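(* Let $\alpha\in(0,1)$, $\beta\in[-1,1]$, and let $f_k,g_k$ be an admissible system with $f=\sum_kf_k$, $g=\sum_kg_k$. Define $h_k:=\left(\frac{1+\beta}{2}\right)^{1/\alpha}f_k-\left(\frac{1-\beta}{2}\right)^{1/\alpha}g_k$ and $h:=\left(\frac{1+\beta}{2}\right)^{1/\alpha}f-\left(\frac{1-\beta}{2}\right)^{1/\alpha}g=\sum_k h_k$. Then $\mathbb W_n(h)$ converges in distribution in $(D[0,1],J_1)$ to an $S_\alpha\big((\ln 2)^{1/\alpha},\beta,0\big)$ Lévy motion.
   Context: $(\mathcal X,\mathcal B,m,T)$ is an ergodic, aperiodic probability preserving system. $S_n(h):=\sum_{j=0}^{n-1}h\circ T^j$, and $\mathbb W_n(h)(t):=n^{-1/\alpha}S_{\lfloor nt\rfloor}(h)$, $t\in[0,1]$, a random element of $D[0,1]$ (càdlàg functions) with the Skorokhod $J_1$ topology. $S_\alpha(\sigma,\beta,\mu)$ denotes the stable law with characteristic function $\exp\{-\sigma^\alpha|\theta|^\alpha(1-i\beta\,\mathrm{sign}(\theta)\tan(\pi\alpha/2))+i\mu\theta\}$ ($\alpha\neq1$). An $S_\alpha(\sigma,\beta,0)$ Lévy motion is a process on $[0,1]$ with càdlàg paths, $\mathbb W_0=0$, independent increments and $\mathbb W_t-\mathbb W_s\sim S_\alpha(\sigma(t-s)^{1/\alpha},\beta,0)$ for $s<t$. Triangular array: on $(\Omega,\mathcal F,\mathbb P)$ let $\{X_k(m):k,m\in\mathbb N\}$ be independent with $X_k(m)\sim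 S_\alpha(k^{-1/\alpha},1,0)$; $Y_k(m):=X_k(m)\mathbf 1_{[2^k\le X_k(m)\le4^k]}$; $Z_k(m):=\sum_{j=8^k}^{16^k}\frac{j}{4^k}\mathbf 1_{[j/4^k\le Y_k(m)<(j+1)/4^k]}$. Let $d_k:=4^{k^2}$. An admissible system is a sequence of measurable $f_k:\mathcal X\to\mathbb R$ such that the family $\{f_k\circ T^j:k\in\mathbb N,0\le j<2d_k\}$ has under $m$ the same joint distribution as $\{Z_k(j+1):k\in\mathbb N,0\le j<2d_k\}$, together with $g_k:=f_k\circ T^{d_k}$; the sums $\sum_kf_k$, $\sum_kg_k$ have a.e. finitely many nonzero terms. *)

theory Defs
  imports "HOL-Probability.Probability"
begin

text \<open>M is the stable law S_alpha(sigma, beta, mu) (alpha \<noteq> 1).\<close>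
definition stable_law :: "real measure \<Rightarrow> real \<Rightarrow> real \<Rightarrow> real \<Rightarrow> real \<Rightarrow> bool" where
  "stable_law M \<alpha> \<sigma> \<beta> \<mu> \<longleftrightarrow> real_distribution M \<and>
     (\<forall>\<theta>::real. char M \<theta> =
        exp (- complex_of_real (\<sigma> powr \<alpha> * \<bar>\<theta>\<bar> powr \<alpha>)
               * (1 - \<i> * complex_of_real (\<beta> * sgn \<theta> * tan (pi * \<alpha> / 2)))
             + \<i> * complex_of_real (\<mu> * \<theta>)))"

definition prob_preserving :: "'a measure \<Rightarrow> ('a \<Rightarrow> 'a) \<Rightarrow> bool" where
  "prob_preserving m T \<longleftrightarrow> prob_space m \<and> T \<in> measurable m m \<and> distr m m T = m"

definition ergodic :: "'a measure \<Rightarrow> ('a \<Rightarrow> 'a) \<Rightarrow> bool" where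
  "ergodic m T \<longleftrightarrow> (\<forall>A\<in>sets m. T -` A \<inter> space m = A \<longrightarrow> measure m A = 0 \<or> measure m A = 1)"

definition aperiodic :: "'a measure \<Rightarrow> ('a \<Rightarrow> 'a) \<Rightarrow> bool" where
  "aperiodic m T \<longleftrightarrow> (AE x in m. \<forall>n::nat. n \<ge> 1 \<longrightarrow> (T ^^ n) x \<noteq> x)"

definition birkhoff_sum :: "('a \<Rightarrow> 'a) \<Rightarrow> nat \<Rightarrow> ('a \<Rightarrow> real) \<Rightarrow> 'a \<Rightarrow> real" where
  "birkhoff_sum T n h x = (\<Sum>j<n. h ((T ^^ j) x))"

text \<open>W_n(h)(t) = n^(-1/alpha) S_{floor(n t)}(h), as a path real => real (only [0,1] matters).\<close>
definition Wn :: "('a \<Rightarrow> 'a) \<Rightarrow> real \<Rightarrow> ('a \<Rightarrow> real) \<Rightarrow> nat \<Rightarrow> 'a \<Rightarrow> real \<Rightarrow> real" where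
  "Wn T \<alpha> h n x = (\<lambda>t. real n powr (-1/\<alpha>) * birkhoff_sum T (nat \<lfloor>real n * t\<rfloor>) h x)"

definition dk :: "nat \<Rightarrow> nat" where
  "dk k = 4 ^ (k^2)"

text \<open>Z_k as a function of X_k: first truncate (Y_k), then discretise.\<close>
definition Ytrunc :: "nat \<Rightarrow> real \<Rightarrow> real" where
  "Ytrunc k x = x * indicator {2 ^ k .. 4 ^ k} x"

definition Zmap :: "nat \<Rightarrow> real \<Rightarrow> real" where
  "Zmap k x = (\<Sum>j\<in>{8^k..16^k::nat}. (real j / 4 ^ k) *
                 indicator {real j / 4 ^ k ..< (real j + 1) / 4 ^ k} (Ytrunc k x))"

definition adm_index :: "(nat \<times> nat) set" where
  "adm_index = {(k, j). 1 \<le> k \<and> j < 2 * dk k}"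

text \<open>Admissible system (indices k \<ge> 1; f 0 is irrelevant). The joint law of the independent
  triangular array {Z_k(j+1)} is the product of the laws of Z_k(m), X_k(m) ~ mu k.\<close>
definition admissible :: "'a measure \<Rightarrow> ('a \<Rightarrow> 'a) \<Rightarrow> real \<Rightarrow> (nat \<Rightarrow> 'a \<Rightarrow> real) \<Rightarrow> bool" where
  "admissible m T \<alpha> f \<longleftrightarrow>
     (\<forall>k. f k \<in> borel_measurable m) \<and>
     (\<exists>\<mu>::nat \<Rightarrow> real measure.
        (\<forall>k\<ge>1. stable_law (\<mu> k) \<alpha> (real k powr (-1/\<alpha>)) 1 0) \<and>
        distr m (PiM adm_index (\<lambda>_. borel)) (\<lambda>x. \<lambda>i\<in>adm_index. f (fst i) ((T ^^ snd i) x))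
          = PiM adm_index (\<lambda>i. distr (\<mu> (fst i)) borel (Zmap (fst i)))) \<and>
     (AE x in m. finite {k. 1 \<le> k \<and> f k x \<noteq> 0}) \<and>
     (AE x in m. finite {k. 1 \<le> k \<and> f k ((T ^^ dk k) x) \<noteq> 0})"

definition cadlag :: "(real \<Rightarrow> real) \<Rightarrow> bool" where
  "cadlag x \<longleftrightarrow> (\<forall>t\<in>{0..<1}. (x \<longlongrightarrow> x t) (at_right t)) \<and>
                 (\<forall>t\<in>{0<..1}. \<exists>l. (x \<longlongrightarrow> l) (at_left t))"

definition time_changes :: "(real \<Rightarrow> real) set" where
  "time_changes = {r. strict_mono_on {0..1} r \<and> continuous_on {0..1} r \<and> r 0 = 0 \<and> r 1 = 1}"

definition J1_dist :: "(real \<Rightarrow> real) \<Rightarrow> (real \<Rightarrow> real) \<Rightarrow> real" where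
  "J1_dist x y = (INF r\<in>time_changes.
      max (SUP t\<in>{0..1}. \<bar>r t - t\<bar>) (SUP t\<in>{0..1}. \<bar>x t - y (r t)\<bar>))"

definition J1_bcont :: "((real \<Rightarrow> real) \<Rightarrow> real) \<Rightarrow> bool" where
  "J1_bcont F \<longleftrightarrow> (\<exists>B. \<forall>x. cadlag x \<longrightarrow> \<bar>F x\<bar> \<le> B) \<and>
     (\<forall>x. cadlag x \<longrightarrow> (\<forall>\<epsilon>>0. \<exists>\<delta>>0. \<forall>y. cadlag y \<longrightarrow> J1_dist x y < \<delta> \<longrightarrow> \<bar>F y - F x\<bar> < \<epsilon>))"

definition stable_levy_motion ::
  "'b measure \<Rightarrow> (real \<Rightarrow> 'b \<Rightarrow> real) \<Rightarrow> real \<Rightarrow> real \<Rightarrow> real \<Rightarrow> bool" where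
  "stable_levy_motion Q W \<alpha> \<sigma> \<beta> \<longleftrightarrow> prob_space Q \<and>
     (\<forall>t. W t \<in> borel_measurable Q) \<and>
     (\<forall>\<omega>\<in>space Q. cadlag (\<lambda>t. W t \<omega>) \<and> W 0 \<omega> = 0) \<and>
     (\<forall>(ts::nat \<Rightarrow> real) n. 0 \<le> ts 0 \<and> ts n \<le> 1 \<and> (\<forall>i<n. ts i < ts (Suc i)) \<longrightarrow>
        prob_space.indep_vars Q (\<lambda>_. borel) (\<lambda>i \<omega>. W (ts (Suc i)) \<omega> - W (ts i) \<omega>) {..<n}) \<and>
     (\<forall>s t. 0 \<le> s \<and> s < t \<and> t \<le> 1 \<longrightarrow>
        stable_law (distr Q borel (\<lambda>\<omega>. W t \<omega> - W s \<omega>)) \<alpha> (\<sigma> * (t - s) powr (1/\<alpha>)) \<beta> 0)"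

definition converges_to_stable_levy ::
  "'a measure \<Rightarrow> (nat \<Rightarrow> 'a \<Rightarrow> real \<Rightarrow> real) \<Rightarrow> real \<Rightarrow> real \<Rightarrow> real \<Rightarrow> bool" where
  "converges_to_stable_levy m X \<alpha> \<sigma> \<beta> \<longleftrightarrow>
     (\<exists>(Q::(real \<Rightarrow> real) measure) W. stable_levy_motion Q W \<alpha> \<sigma> \<beta> \<and>
        (\<forall>F. J1_bcont F \<longrightarrow>
           (\<lambda>n. \<integral>x. F (X n x) \<partial>m) \<longlonglongrightarrow> (\<integral>\<omega>. F (\<lambda>t. W t \<omega>) \<partial>Q)))"

end

theory Submission
  imports Defs "HOL-Real_Asymp.Real_Asymp"
begin

text \<open>
  For fixed n only the indices k with k \<le> n \<le> d_k matter: smaller ones contribute a bounded, negligible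
  amount, larger ones vanish with high probability. The remaining indices give n independent blocks, and
  since \<alpha> < 1 the sum over a block is close to its maximum. The tail of the maximum is the sum of the tails
  of the Z_k; a level y > 0 is seen by those k with 2^k \<le> y \<le> 4^k, and the sum of 1/k over this
  range tends to ln 2, which is the scale of the limit. Hence the block maxima are coupled, by
  their quantiles, to totally asymmetric stable variables with an error o(1/n) per block. The copies
  f_k and f_k o T^(d_k) are independent over a time span of length n \<le> d_k, so the increments of the path become
  differences of independent stable variables, that is, increments of the limiting motion. Finally a
  cadlag path is J1-close to its discretisation on the grid of mesh 1/n, so comparing increments suffices. The
  Levy motion itself is a series of compound Poisson processes.
\<close>

subsection \<open>The Skorokhod topology\<close>

text \<open>The stable laws involved have infinite mean, so increments cannot be compared in
  expectation; every comparison uses the minimum of 1 and the difference. The sum of these truncated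
  differences over the n blocks controls each bounded Lipschitz functional of the two paths, so an
  error o(1/n) per block replaces both a tightness argument and the convergence of
  finite-dimensional laws. Paths carry no sigma-algebra here: functionals are evaluated at step
  paths, where they are continuous functions of the increments, and at W through its
  discretisations. The tail constant of a one-sided stable law comes from a Poisson series over
  cells of width w: the law does not depend on w, and an upper and a lower tail bound meet as w
  tends to 0. The numbers d_k = 4^(k^2) serve twice. They outgrow every power of 4^k, so if d_k < n
  then 4^k is at most n^(1/k), and even n such values are negligible against n^(1/\<alpha>) when
  summed. And d_k is at least 4^(2k) for k \<ge> 2, so every k that sees the level n^(1/\<alpha>) x
  satisfies n \<le> d_k once n is large.\<close>

lemma cadlag_partition:
  assumes x: "cadlag x" and e: "0 < (e::real)"
  obtains P where "finite P" "0 \<in> P" "1 \<in> P" "P \<subseteq> {0..1}"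
    "\<And>s t. s \<in> {0..1} \<Longrightarrow> t \<in> {0..1} \<Longrightarrow> s < t \<Longrightarrow> P \<inter> {s<..t} = {} \<Longrightarrow> \<bar>x s - x t\<bar> < e"
proof -
  have "\<exists>d>0. (\<forall>s\<in>{t..<t+d} \<inter> {0..1}. \<bar>x s - x t\<bar> < e/2) \<and>
        (\<exists>l. \<forall>s\<in>{t-d<..<t} \<inter> {0..1}. \<bar>x s - l\<bar> < e/2)" if t: "t \<in> {0..1}" for t
  proof -
    have "\<exists>d>0. \<forall>s\<in>{t..<t+d} \<inter> {0..1}. \<bar>x s - x t\<bar> < e/2"
    proof (cases "t < 1")
      case True
      then have "(x \<longlongrightarrow> x t) (at_right t)" using x t by (auto simp: cadlag_def)
      then have "eventually (\<lambda>s. dist (x s) (x t) < e/2) (at_right t)"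
        using e by (intro tendstoD) auto
      then obtain b where b: "b > t" "\<forall>y>t. y < b \<longrightarrow> \<bar>x y - x t\<bar> < e/2"
        unfolding eventually_at_right_field dist_real_def by auto
      show ?thesis
      proof (intro exI[of _ "b - t"] conjI ballI)
        fix s assume "s \<in> {t..<t + (b-t)} \<inter> {0..1}"
        then show "\<bar>x s - x t\<bar> < e/2" using b e by (cases "s = t") auto
      qed (use b in auto)
    next
      case False
      then have "t = 1" using t by auto
      then show ?thesis using e by (intro exI[of _ 1]) auto
    qed
    then obtain d1 where d1: "d1 > 0" "\<forall>s\<in>{t..<t+d1} \<inter> {0..1}. \<bar>x s - x t\<bar> < e/2" by auto
    have "\<exists>d>0. \<exists>l. \<forall>s\<in>{t-d<..<t} \<inter> {0..1}. \<bar>x s - l\<bar> < e/2"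
    proof (cases "t > 0")
      case True
      then obtain l where "(x \<longlongrightarrow> l) (at_left t)" using x t by (force simp: cadlag_def)
      then have "eventually (\<lambda>s. dist (x s) l < e/2) (at_left t)"
        using e by (intro tendstoD) auto
      then obtain b where b: "b < t" "\<forall>y>b. y < t \<longrightarrow> \<bar>x y - l\<bar> < e/2"
        unfolding eventually_at_left_field dist_real_def by auto
      then show ?thesis by (intro exI[of _ "t - b"] conjI exI[of _ l]) auto
    next
      case False
      then have "t = 0" using t by auto
      then show ?thesis by (intro exI[of _ 1]) auto
    qed
    then obtain d2 l where d2: "d2 > 0" "\<forall>s\<in>{t-d2<..<t} \<inter> {0..1}. \<bar>x s - l\<bar> < e/2" by auto
    show ?thesis
      by (rule exI[of _ "min d1 d2"]) (use d1 d2 in \<open>auto intro!: exI[of _ l]\<close>)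
  qed
  then obtain d where d: "\<And>t. t \<in> {0..1} \<Longrightarrow> d t > 0 \<and> (\<forall>s\<in>{t..<t+d t} \<inter> {0..1}. \<bar>x s - x t\<bar> < e/2) \<and>
        (\<exists>l. \<forall>s\<in>{t-d t<..<t} \<inter> {0..1}. \<bar>x s - l\<bar> < e/2)" by metis
  have "compact {0..1::real}" by simp
  moreover have "open {c - d c<..<c + d c}" for c by simp
  moreover have "{0..1} \<subseteq> (\<Union>c\<in>{0..1}. {c - d c<..<c + d c})"
  proof
    fix c :: real assume c: "c \<in> {0..1}"
    then have "c \<in> {c - d c<..<c + d c}" using d[OF c] by simp
    with c show "c \<in> (\<Union>c\<in>{0..1}. {c - d c<..<c + d c})" by blast
  qed
  ultimately obtain C where C: "C \<subseteq> {0..1}" "finite C" "{0..1} \<subseteq> (\<Union>c\<in>C. {c - d c<..<c + d c})"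
    by (rule compactE_image)
  \<comment> \<open>Centres and right ends of the covering intervals suffice: if (s, t] avoids them
    and s lies in the interval around c, then t lies in it as well, on the same side of c.\<close>
  define P where "P = (C \<union> (\<lambda>c. c + d c) ` C \<union> {0,1}) \<inter> {0..1}"
  show thesis
  proof (rule that[of P])
    show "finite P" using C by (auto simp: P_def)
    show "0 \<in> P" "1 \<in> P" "P \<subseteq> {0..1}" by (auto simp: P_def)
    fix s t :: real assume st: "s \<in> {0..1}" "t \<in> {0..1}" "s < t" "P \<inter> {s<..t} = {}"
    from C(3) st obtain c where c: "c \<in> C" "s \<in> {c - d c<..<c + d c}" by blast
    have c01: "c \<in> {0..1}" using c C by auto
    have no: "p \<notin> {s<..t}" if "p \<in> C \<union> (\<lambda>c. c + d c) ` C" for p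
    proof
      assume p: "p \<in> {s<..t}"
      then have "p \<in> {0..1}" using st by auto
      then have "p \<in> P" using that by (auto simp: P_def)
      then show False using p st by auto
    qed
    have 1: "t < c + d c" using no[of "c + d c"] c by auto
    have 2: "c \<notin> {s<..t}" using no[of c] c by auto
    show "\<bar>x s - x t\<bar> < e"
    proof (cases "c \<le> s")
      case True
      then have "\<bar>x s - x c\<bar> < e/2" "\<bar>x t - x c\<bar> < e/2" using d[OF c01] st c 1 by auto
      then show ?thesis by linarith
    next
      case False
      then have "t < c" using 2 by auto
      moreover obtain l where "\<forall>s\<in>{c-d c<..<c} \<inter> {0..1}. \<bar>x s - l\<bar> < e/2" using d[OF c01] by blast
      moreover have "s \<in> {c-d c<..<c} \<inter> {0..1}" "t \<in> {c-d c<..<c} \<inter> {0..1}"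
        using st c False \<open>t < c\<close> by auto
      ultimately have "\<bar>x s - l\<bar> < e/2" "\<bar>x t - l\<bar> < e/2" by blast+
      then show ?thesis by linarith
    qed
  qed
qed

text \<open>The suprema in \<open>J1_dist\<close> are suprema of reals and carry information only
  for sets bounded above; this supplies the bound. The value at t is within 1 of the value at the
  last partition point that is not after t.\<close>

lemma cadlag_bounded:
  assumes "cadlag x"
  obtains B where "\<And>t. t \<in> {0..1} \<Longrightarrow> \<bar>x t\<bar> \<le> (B::real)"
proof -
  obtain P where P: "finite P" "0 \<in> P" "1 \<in> P" "P \<subseteq> {0..1}"
    "\<And>s t. s \<in> {0..1} \<Longrightarrow> t \<in> {0..1} \<Longrightarrow> s < t \<Longrightarrow> P \<inter> {s<..t} = {} \<Longrightarrow> \<bar>x s - x t\<bar> < 1"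
    using cadlag_partition[OF assms, of 1] by auto
  show thesis
  proof (rule that)
    fix t :: real assume t: "t \<in> {0..1}"
    define p where "p = Max {p\<in>P. p \<le> t}"
    have ne: "finite {p\<in>P. p \<le> t}" "{p\<in>P. p \<le> t} \<noteq> {}" using P t by auto
    have p: "p \<in> P" "p \<le> t" using Max_in[OF ne] by (auto simp: p_def)
    have "P \<inter> {p<..t} = {}" using Max_ge[OF ne(1)] by (force simp: p_def)
    then have "\<bar>x p - x t\<bar> \<le> 1" using P(5)[of p t] p P(4) t by (cases "p = t") force+
    moreover have "\<bar>x p\<bar> \<le> (\<Sum>p\<in>P. \<bar>x p\<bar>)" using p P(1) by (intro member_le_sum) auto
    ultimately show "\<bar>x t\<bar> \<le> (\<Sum>p\<in>P. \<bar>x p\<bar>) + 1" by linarith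
  qed
qed

section \<open>Time changes and the J1 distance\<close>

lemma time_changesD:
  assumes "r \<in> time_changes"
  shows "strict_mono_on {0..1} r" "continuous_on {0..1} r" "r 0 = 0" "r 1 = 1"
    and "t \<in> {0..1} \<Longrightarrow> r t \<in> {0..1}"
proof -
  show *: "strict_mono_on {0..1} r" "continuous_on {0..1} r" "r 0 = 0" "r 1 = 1"
    using assms by (auto simp: time_changes_def)
  show "r t \<in> {0..1}" if "t \<in> {0..1}"
    using strict_mono_on_leD[OF *(1), of 0 t] strict_mono_on_leD[OF *(1), of t 1] * that by auto
qed

lemma id_time_change: "(\<lambda>t. t) \<in> time_changes"
  by (auto simp: time_changes_def strict_mono_on_def)

lemma time_change_comp:
  assumes "r \<in> time_changes" "r' \<in> time_changes"
  shows "(\<lambda>t. r' (r t)) \<in> time_changes"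
  unfolding time_changes_def
proof (safe intro!: strict_mono_onI)
  fix s t :: real assume "s \<in> {0..1}" "t \<in> {0..1}" "s < t"
  then show "r' (r s) < r' (r t)"
    using time_changesD[OF assms(1)] time_changesD[OF assms(2)] by (meson strict_mono_onD)
next
  show "continuous_on {0..1} (\<lambda>t. r' (r t))"
    using time_changesD(5)[OF assms(1)]
    by (intro continuous_on_compose2[OF time_changesD(2)[OF assms(2)] time_changesD(2)[OF assms(1)]]) auto
qed (use assms in \<open>auto simp: time_changesD\<close>)

text \<open>Needed for the symmetry of the J1 distance. Surjectivity onto [0,1] is the intermediate
  value theorem, and continuity of the inverse comes from compactness of [0,1].\<close>

lemma time_change_inv:
  assumes "r \<in> time_changes"
  obtains r' where "r' \<in> time_changes" "\<And>t. t \<in> {0..1} \<Longrightarrow> r' (r t) = t"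
    "\<And>t. t \<in> {0..1} \<Longrightarrow> r (r' t) = t"
proof -
  note r = time_changesD[OF assms]
  have inj: "inj_on r {0..1}" using r(1) by (rule strict_mono_on_imp_inj_on)
  have im: "r ` {0..1} = {0..1}"
  proof
    show "r ` {0..1} \<subseteq> {0..1}" using r(5) by auto
    show "{0..1} \<subseteq> r ` {0..1}"
    proof
      fix y :: real assume "y \<in> {0..1}"
      then show "y \<in> r ` {0..1}" using IVT'[of r 0 y 1] r by force
    qed
  qed
  define r' where "r' = the_inv_into {0..1} r"
  have 1: "r' (r t) = t" if "t \<in> {0..1}" for t using the_inv_into_f_f[OF inj that] by (simp add: r'_def)
  have 2: "r (r' t) = t" if "t \<in> {0..1}" for t
    using f_the_inv_into_f[OF inj, of t] that im by (simp add: r'_def)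
  have 3: "r' t \<in> {0..1}" if "t \<in> {0..1}" for t
    using the_inv_into_into[OF inj, of t "{0..1}"] that im by (auto simp: r'_def)
  have "r' \<in> time_changes"
    unfolding time_changes_def
  proof (safe intro!: strict_mono_onI)
    fix s t :: real assume st: "s \<in> {0..1}" "t \<in> {0..1}" "s < t"
    show "r' s < r' t"
    proof (rule ccontr)
      assume "\<not> r' s < r' t"
      then have "r (r' t) \<le> r (r' s)" using strict_mono_on_leD[OF r(1), of "r' t" "r' s"] 3 st by auto
      then show False using 2 st by auto
    qed
  next
    have "continuous_on (r ` {0..1}) r'" using 1 by (intro continuous_on_inv[OF r(2)]) auto
    then show "continuous_on {0..1} r'" by (simp add: im)
  next
    show "r' 0 = 0" using 1[of 0] r by auto
    show "r' 1 = 1" using 1[of 1] r by auto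
  qed
  then show thesis using 1 2 that by blast
qed

text \<open>The distance bound with an explicit time change and pointwise estimates. Unlike an
  infimum of suprema it can be composed and inverted without any boundedness condition.\<close>

definition J1_close :: "real \<Rightarrow> (real \<Rightarrow> real) \<Rightarrow> (real \<Rightarrow> real) \<Rightarrow> bool" where
  "J1_close d x y \<longleftrightarrow> (\<exists>r\<in>time_changes. \<forall>t\<in>{0..1}. \<bar>r t - t\<bar> \<le> d \<and> \<bar>x t - y (r t)\<bar> \<le> d)"

lemma time_change_SUP_nonneg:
  assumes "r \<in> time_changes"
  shows "0 \<le> (SUP t\<in>{0..1}. \<bar>r t - t\<bar>)"
proof -
  have "bdd_above ((\<lambda>t. \<bar>r t - t\<bar>) ` {0..1})"
    using time_changesD(5)[OF assms] by (intro bdd_aboveI2[of _ _ 1]) (force simp: abs_le_iff)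
  then have "\<bar>r 0 - 0\<bar> \<le> (SUP t\<in>{0..1}. \<bar>r t - t\<bar>)" by (intro cSUP_upper) auto
  then show ?thesis by linarith
qed

lemma J1_dist_bdd: "bdd_below ((\<lambda>r. max (SUP t\<in>{0..1}. \<bar>r t - t\<bar>) (SUP t\<in>{0..1}. \<bar>x t - y (r t)\<bar>)) ` time_changes)"
  using time_change_SUP_nonneg by (intro bdd_belowI2[of _ 0]) (auto simp: le_max_iff_disj)

lemma J1_dist_nonneg: "0 \<le> J1_dist x y"
  unfolding J1_dist_def using time_change_SUP_nonneg id_time_change
  by (intro cINF_greatest) (auto simp: le_max_iff_disj)

lemma J1_dist_leI: "J1_close d x y \<Longrightarrow> J1_dist x y \<le> d"
proof -
  assume "J1_close d x y"
  then obtain r where r: "r \<in> time_changes" "\<And>t. t \<in> {0..1} \<Longrightarrow> \<bar>r t - t\<bar> \<le> d"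
    "\<And>t. t \<in> {0..1} \<Longrightarrow> \<bar>x t - y (r t)\<bar> \<le> d" by (auto simp: J1_close_def)
  have "max (SUP t\<in>{0..1}. \<bar>r t - t\<bar>) (SUP t\<in>{0..1}. \<bar>x t - y (r t)\<bar>) \<le> d"
    using r by (intro max.boundedI cSUP_least) auto
  then show ?thesis unfolding J1_dist_def by (intro cINF_lower2[OF J1_dist_bdd r(1)])
qed

lemma J1_dist_lessD:
  assumes "cadlag x" "cadlag y" "J1_dist x y < d"
  shows "J1_close d x y"
proof -
  obtain B where B: "\<And>t. t \<in> {0..1} \<Longrightarrow> \<bar>x t\<bar> \<le> B" using cadlag_bounded[OF assms(1)] by blast
  obtain B' where B': "\<And>t. t \<in> {0..1} \<Longrightarrow> \<bar>y t\<bar> \<le> B'" using cadlag_bounded[OF assms(2)] by blast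
  have ne: "time_changes \<noteq> {}" using id_time_change by blast
  from assms(3) obtain r where r: "r \<in> time_changes"
      "max (SUP t\<in>{0..1}. \<bar>r t - t\<bar>) (SUP t\<in>{0..1}. \<bar>x t - y (r t)\<bar>) < d"
    unfolding J1_dist_def cINF_less_iff[OF ne J1_dist_bdd] by blast
  have 1: "bdd_above ((\<lambda>t. \<bar>r t - t\<bar>) ` {0..1})"
    using time_changesD(5)[OF r(1)] by (intro bdd_aboveI2[of _ _ 1]) (force simp: abs_le_iff)
  have 2: "bdd_above ((\<lambda>t. \<bar>x t - y (r t)\<bar>) ` {0..1})"
  proof (intro bdd_aboveI2[of _ _ "B + B'"])
    fix t :: real assume "t \<in> {0..1}"
    then show "\<bar>x t - y (r t)\<bar> \<le> B + B'" using B[of t] B'[of "r t"] time_changesD(5)[OF r(1)] by fastforce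
  qed
  show ?thesis unfolding J1_close_def
  proof (intro bexI[OF _ r(1)] ballI conjI)
    fix t :: real assume t: "t \<in> {0..1}"
    show "\<bar>r t - t\<bar> \<le> d" using cSUP_upper[OF t 1] r(2) by auto
    show "\<bar>x t - y (r t)\<bar> \<le> d" using cSUP_upper[OF t 2] r(2) by auto
  qed
qed

lemma J1_close_sym: "J1_close d x y \<Longrightarrow> J1_close d y x"
proof -
  assume "J1_close d x y"
  then obtain r where r: "r \<in> time_changes" "\<And>t. t \<in> {0..1} \<Longrightarrow> \<bar>r t - t\<bar> \<le> d"
    "\<And>t. t \<in> {0..1} \<Longrightarrow> \<bar>x t - y (r t)\<bar> \<le> d" by (auto simp: J1_close_def)
  obtain r' where r': "r' \<in> time_changes" "\<And>t. t \<in> {0..1} \<Longrightarrow> r (r' t) = t"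
    using time_change_inv[OF r(1)] by metis
  show ?thesis unfolding J1_close_def
  proof (intro bexI[OF _ r'(1)] ballI conjI)
    fix t :: real assume t: "t \<in> {0..1}"
    note t' = time_changesD(5)[OF r'(1) t]
    show "\<bar>r' t - t\<bar> \<le> d" using r(2)[OF t'] r'(2)[OF t] by (simp add: abs_minus_commute)
    show "\<bar>y t - x (r' t)\<bar> \<le> d" using r(3)[OF t'] r'(2)[OF t] by (simp add: abs_minus_commute)
  qed
qed

lemma J1_close_trans: "J1_close d x y \<Longrightarrow> J1_close d' y z \<Longrightarrow> J1_close (d + d') x z"
proof -
  assume "J1_close d x y" "J1_close d' y z"
  then obtain r r' where r: "r \<in> time_changes" "\<And>t. t \<in> {0..1} \<Longrightarrow> \<bar>r t - t\<bar> \<le> d"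
    "\<And>t. t \<in> {0..1} \<Longrightarrow> \<bar>x t - y (r t)\<bar> \<le> d"
    and r': "r' \<in> time_changes" "\<And>t. t \<in> {0..1} \<Longrightarrow> \<bar>r' t - t\<bar> \<le> d'"
    "\<And>t. t \<in> {0..1} \<Longrightarrow> \<bar>y t - z (r' t)\<bar> \<le> d'" by (auto simp: J1_close_def)
  show ?thesis unfolding J1_close_def
  proof (intro bexI[OF _ time_change_comp[OF r(1) r'(1)]] ballI conjI)
    fix t :: real assume t: "t \<in> {0..1}"
    note t' = time_changesD(5)[OF r(1) t]
    show "\<bar>r' (r t) - t\<bar> \<le> d + d'" using r(2)[OF t] r'(2)[OF t'] by linarith
    show "\<bar>x t - z (r' (r t))\<bar> \<le> d + d'" using r(3)[OF t] r'(3)[OF t'] by linarith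
  qed
qed

text \<open>The infimum in \<open>J1_dist\<close> need not be attained; the slack e is split between
  the two time changes that are composed.\<close>

lemma J1_dist_triangle:
  assumes "cadlag x" "cadlag y" "cadlag z"
  shows "J1_dist x z \<le> J1_dist x y + J1_dist y z"
proof (rule field_le_epsilon)
  fix e :: real assume e: "0 < e"
  have "J1_close (J1_dist x y + e/2) x y" "J1_close (J1_dist y z + e/2) y z"
    using e assms by (auto intro!: J1_dist_lessD)
  from J1_dist_leI[OF J1_close_trans[OF this]]
  show "J1_dist x z \<le> J1_dist x y + J1_dist y z + e" by simp
qed

lemma J1_dist_commute:
  assumes "cadlag x" "cadlag y"
  shows "J1_dist x y = J1_dist y x"
proof -
  have "J1_dist y x \<le> J1_dist x y" if "cadlag x" "cadlag y" for x y
  proof (rule field_le_epsilon)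
    fix e :: real assume e: "0 < e"
    show "J1_dist y x \<le> J1_dist x y + e"
      by (rule J1_dist_leI[OF J1_close_sym[OF J1_dist_lessD[OF that]]]) (use e in auto)
  qed
  then show ?thesis using assms by (simp add: antisym)
qed

lemma J1_close_uniform: "(\<And>t. t \<in> {0..1} \<Longrightarrow> \<bar>x t - y t\<bar> \<le> d) \<Longrightarrow> J1_close d x y"
  unfolding J1_close_def by (intro bexI[OF _ id_time_change]) force

text \<open>The time change moves every partition point p to the next grid point by adding a small tent at p.\<close>
lemma J1_discretisation:
  assumes x: "cadlag x" and e: "0 < (e::real)"
  shows "eventually (\<lambda>n. \<forall>y. (\<forall>t\<in>{0..1}. y t = x (real_of_int \<lfloor>real n * t\<rfloor> / real n)) \<longrightarrow> J1_close e x y) sequentially"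
proof -
  obtain P where P: "finite P" "0 \<in> P" "1 \<in> P" "P \<subseteq> {0..1}"
    "\<And>s t. s \<in> {0..1} \<Longrightarrow> t \<in> {0..1} \<Longrightarrow> s < t \<Longrightarrow> P \<inter> {s<..t} = {} \<Longrightarrow> \<bar>x s - x t\<bar> < e"
    by (rule cadlag_partition[OF assms]) blast
  define D where "D = (\<lambda>(p,q). \<bar>p - q\<bar>) ` ({(p,q)\<in>P\<times>P. p \<noteq> q})"
  have "(0, 1) \<in> {(p,q)\<in>P\<times>P. p \<noteq> q}" using P by simp
  then have "(\<lambda>(p,q). \<bar>p - q\<bar>) (0, 1) \<in> D" unfolding D_def by (rule imageI)
  then have D: "finite D" "1 \<in> D"
    using finite_subset[OF _ finite_cartesian_product[OF P(1) P(1)], of "{(p,q)\<in>P\<times>P. p \<noteq> q}"]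
    by (auto simp: D_def)
  \<comment> \<open>The smallest gap between partition points: a tent of half-width \<gamma> at one
    point vanishes at all the others. \<open>D\<close> is nonempty because 0 and 1 belong to
    \<open>P\<close>.\<close>
  define \<gamma> where "\<gamma> = Min D"
  have "\<gamma> \<in> D" unfolding \<gamma>_def using D by (intro Min_in) auto
  then have \<gamma>0: "\<gamma> > 0" by (auto simp: D_def)
  have \<gamma>: "\<gamma> \<le> \<bar>p - q\<bar>" if "p \<in> P" "q \<in> P" "p \<noteq> q" for p q
    unfolding \<gamma>_def using that D by (intro Min_le) (force simp: D_def)+
  have "(\<lambda>n. real (card P) / (real n * \<gamma>)) \<longlonglongrightarrow> 0" "(\<lambda>n. real (card P) / real n) \<longlonglongrightarrow> 0"
    using \<gamma>0 by real_asymp+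
  then have "eventually (\<lambda>n. real (card P) / (real n * \<gamma>) < 1) sequentially"
    "eventually (\<lambda>n. real (card P) / real n < e) sequentially"
    using e by (auto intro!: order_tendstoD(2))
  then show ?thesis
    using eventually_gt_at_top[of 0]
  proof eventually_elim
    case (elim n)
    have n: "real n > 0" using elim by simp
    define \<delta> where "\<delta> p = real_of_int \<lceil>real n * p\<rceil> / real n - p" for p
    define hat where "hat p t = max 0 (1 - \<bar>t - p\<bar> / \<gamma>)" for p t :: real
    define r where "r t = t + (\<Sum>p\<in>P. \<delta> p * hat p t)" for t
    have \<delta>0: "0 \<le> \<delta> p" for p
      using n le_of_int_ceiling[of "real n * p"] by (simp add: \<delta>_def field_simps)
    have \<delta>1: "\<delta> p \<le> 1 / real n" for p
    proof -
      have "real_of_int \<lceil>real n * p\<rceil> / real n \<le> (real n * p + 1) / real n"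
        using n of_int_ceiling_le_add_one[of "real n * p"] by (intro divide_right_mono) auto
      also have "\<dots> = p + 1 / real n" using n by (simp add: field_simps)
      finally show ?thesis by (simp add: \<delta>_def)
    qed
    have hat: "0 \<le> hat p t" "hat p t \<le> 1" for p t using \<gamma>0 by (auto simp: hat_def)
    have hatL: "\<bar>hat p t - hat p s\<bar> \<le> \<bar>t - s\<bar> / \<gamma>" for p s t
    proof -
      have "\<bar>hat p t - hat p s\<bar> \<le> \<bar>\<bar>t - p\<bar> / \<gamma> - \<bar>s - p\<bar> / \<gamma>\<bar>"
        unfolding hat_def by linarith
      also have "\<dots> = \<bar>\<bar>t - p\<bar> - \<bar>s - p\<bar>\<bar> / \<gamma>" using \<gamma>0 by (simp flip: diff_divide_distrib)
      also have "\<dots> \<le> \<bar>t - s\<bar> / \<gamma>" using \<gamma>0 by (intro divide_right_mono) auto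
      finally show ?thesis .
    qed
    have rP: "r p = real_of_int \<lceil>real n * p\<rceil> / real n" if p: "p \<in> P" for p
    proof -
      have "(\<Sum>q\<in>P. \<delta> q * hat q p) = (\<Sum>q\<in>P. if q = p then \<delta> p else 0)"
      proof (intro sum.cong refl)
        fix q assume q: "q \<in> P"
        show "\<delta> q * hat q p = (if q = p then \<delta> p else 0)"
          using \<gamma>[OF p q] \<gamma>0 by (auto simp: hat_def max_def field_simps)
      qed
      also have "\<dots> = \<delta> p" using P p by simp
      finally show ?thesis by (simp add: r_def \<delta>_def)
    qed
    \<comment> \<open>Each tent has slope at most 1/(n \<gamma>), so all of them together change the
      slope of the identity by less than 1 as soon as \<open>card P\<close> is below n
      \<gamma>.\<close>
    have mono: "r s < r t" if st: "s < t" for s t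
    proof -
      have "(\<Sum>p\<in>P. \<delta> p * hat p s) - (\<Sum>p\<in>P. \<delta> p * hat p t) = (\<Sum>p\<in>P. \<delta> p * (hat p s - hat p t))"
        by (simp add: sum_subtractf right_diff_distrib)
      also have "\<dots> \<le> (\<Sum>p\<in>P. 1 / real n * (\<bar>t - s\<bar> / \<gamma>))"
      proof (intro sum_mono)
        fix p
        have "\<delta> p * (hat p s - hat p t) \<le> \<delta> p * (\<bar>t - s\<bar> / \<gamma>)"
          using hatL[of p t s] \<delta>0[of p] by (intro mult_left_mono) auto
        also have "\<dots> \<le> 1 / real n * (\<bar>t - s\<bar> / \<gamma>)"
          using \<delta>1[of p] \<gamma>0 by (intro mult_right_mono) auto
        finally show "\<delta> p * (hat p s - hat p t) \<le> 1 / real n * (\<bar>t - s\<bar> / \<gamma>)" .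
      qed
      also have "\<dots> = real (card P) / (real n * \<gamma>) * (t - s)" using st by simp
      also have "\<dots> < 1 * (t - s)" using elim st by (intro mult_strict_right_mono) auto
      finally show ?thesis by (simp add: r_def)
    qed
    have rt: "r \<in> time_changes"
      unfolding time_changes_def
    proof (safe intro!: strict_mono_onI)
      show "continuous_on {0..1} r"
        unfolding r_def hat_def using \<gamma>0 by (intro continuous_intros) auto
      show "r 0 = 0" "r 1 = 1" using rP P n by auto
    qed (use mono in auto)
    have rd: "\<bar>r t - t\<bar> \<le> e" for t
    proof -
      have "0 \<le> (\<Sum>p\<in>P. \<delta> p * hat p t)" using \<delta>0 hat by (intro sum_nonneg mult_nonneg_nonneg) auto
      moreover have "(\<Sum>p\<in>P. \<delta> p * hat p t) \<le> (\<Sum>p\<in>P. 1 / real n * 1)"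
        using \<delta>0 \<delta>1 hat n by (intro sum_mono mult_mono) auto
      ultimately show ?thesis using elim by (simp add: r_def)
    qed
    show ?case
    proof (intro allI impI)
      fix y assume y: "\<forall>t\<in>{0..1}. y t = x (real_of_int \<lfloor>real n * t\<rfloor> / real n)"
      show "J1_close e x y" unfolding J1_close_def
      proof (intro bexI[OF _ rt] ballI conjI rd)
        fix t :: real assume t: "t \<in> {0..1}"
        note rt01 = time_changesD(5)[OF rt t]
        \<comment> \<open>As \<open>r p\<close> is the ceiling of n p divided by n, the floor in u
          makes p \<le> t equivalent to p \<le> u for every partition point p. So no partition point
          separates t from u, and the partition bounds the difference of \<open>x t\<close> and
          \<open>x u\<close>.\<close>
        define u where "u = real_of_int \<lfloor>real n * r t\<rfloor> / real n"
        have u01: "u \<in> {0..1}"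
        proof -
          have "0 \<le> real n * r t" "real n * r t \<le> real n" using rt01 n by auto
          then have "0 \<le> \<lfloor>real n * r t\<rfloor>" "\<lfloor>real n * r t\<rfloor> \<le> int n" by linarith+
          then show ?thesis using n by (auto simp: u_def)
        qed
        have A: False if p: "p \<in> P" "t < p" "p \<le> u" for p
        proof -
          have "r t < real_of_int \<lceil>real n * p\<rceil> / real n" using mono[OF p(2)] rP[OF p(1)] by simp
          then have "real n * r t < real_of_int \<lceil>real n * p\<rceil>" using n by (simp add: field_simps)
          then have "\<lfloor>real n * r t\<rfloor> < \<lceil>real n * p\<rceil>" by (simp add: floor_less_iff)
          then have "real_of_int \<lfloor>real n * r t\<rfloor> < real n * p" by (simp add: less_ceiling_iff)
          then show False using p n by (simp add: u_def field_simps)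
        qed
        have B: False if p: "p \<in> P" "u < p" "p \<le> t" for p
        proof -
          have "r p \<le> r t" using mono[of p t] p by (cases "p = t") auto
          then have "real_of_int \<lceil>real n * p\<rceil> / real n \<le> r t" using rP[OF p(1)] by simp
          then have "real_of_int \<lceil>real n * p\<rceil> \<le> real n * r t" using n by (simp add: field_simps)
          then have "\<lceil>real n * p\<rceil> \<le> \<lfloor>real n * r t\<rfloor>" by (simp add: le_floor_iff)
          then have "real n * p \<le> real_of_int \<lfloor>real n * r t\<rfloor>" by (simp add: ceiling_le_iff)
          then show False using p n by (simp add: u_def field_simps)
        qed
        have "\<bar>x t - x u\<bar> \<le> e"
        proof (cases t u rule: linorder_cases)
          case less
          then show ?thesis using P(5)[OF t u01] A by force
        next
          case greater
          then show ?thesis using P(5)[OF u01 t] B by force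
        qed (use e in auto)
        then show "\<bar>x t - y (r t)\<bar> \<le> e" using y rt01 by (simp add: u_def)
      qed
    qed
  qed
qed

section \<open>Bounded Lipschitz test functions and their envelopes\<close>

definition J1_Lip :: "((real \<Rightarrow> real) \<Rightarrow> real) \<Rightarrow> real \<Rightarrow> real \<Rightarrow> bool" where
  "J1_Lip F B L \<longleftrightarrow> 0 \<le> L \<and> (\<forall>x. cadlag x \<longrightarrow> \<bar>F x\<bar> \<le> B) \<and>
     (\<forall>x y. cadlag x \<longrightarrow> cadlag y \<longrightarrow> \<bar>F x - F y\<bar> \<le> L * J1_dist x y)"

lemma cadlag_const: "cadlag (\<lambda>_. c)"
  by (auto simp: cadlag_def)

text \<open>The inf-convolution of F with p times the distance: for bounded F it is the largest
  p-Lipschitz function below F on the cadlag paths.\<close>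

definition Lip_envelope :: "((real \<Rightarrow> real) \<Rightarrow> real) \<Rightarrow> real \<Rightarrow> (real \<Rightarrow> real) \<Rightarrow> real" where
  "Lip_envelope F p x = (INF y\<in>Collect cadlag. F y + p * J1_dist x y)"

context
  fixes F :: "(real \<Rightarrow> real) \<Rightarrow> real" and B :: real
  assumes FB: "\<And>x. cadlag x \<Longrightarrow> \<bar>F x\<bar> \<le> B"
begin

lemma Lip_envelope_bdd:
  assumes "0 \<le> p"
  shows "bdd_below ((\<lambda>y. F y + p * J1_dist x y) ` Collect cadlag)"
  using FB assms by (intro bdd_belowI2[of _ "-B"]) (smt (verit) J1_dist_nonneg mem_Collect_eq mult_nonneg_nonneg)

lemma Lip_envelope_le: "cadlag y \<Longrightarrow> 0 \<le> p \<Longrightarrow> Lip_envelope F p x \<le> F y + p * J1_dist x y"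
  unfolding Lip_envelope_def by (intro cINF_lower Lip_envelope_bdd) auto

lemma J1_dist_self: "J1_dist x x = 0"
  using J1_dist_leI[OF J1_close_uniform, of x x 0] J1_dist_nonneg[of x x] by simp

lemma Lip_envelope_le_self: "cadlag x \<Longrightarrow> 0 \<le> p \<Longrightarrow> Lip_envelope F p x \<le> F x"
  using Lip_envelope_le[of x p x] by (simp add: J1_dist_self)

lemma J1_Lip_envelope:
  assumes p: "0 \<le> p"
  shows "J1_Lip (Lip_envelope F p) B p"
  unfolding J1_Lip_def
proof (safe intro!: p)
  have ne: "Collect cadlag \<noteq> {}" using cadlag_const by blast
  fix x :: "real \<Rightarrow> real" assume x: "cadlag x"
  have "- B \<le> Lip_envelope F p x"
    unfolding Lip_envelope_def
  proof (intro cINF_greatest ne)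
    fix y :: "real \<Rightarrow> real" assume "y \<in> Collect cadlag"
    then show "- B \<le> F y + p * J1_dist x y"
      using FB[of y] mult_nonneg_nonneg[OF p J1_dist_nonneg[of x y]] by auto
  qed
  then show "\<bar>Lip_envelope F p x\<bar> \<le> B"
    using Lip_envelope_le_self[OF x p] FB[OF x] by linarith
  fix x' :: "real \<Rightarrow> real" assume x': "cadlag x'"
  have *: "Lip_envelope F p x \<le> Lip_envelope F p x' + p * J1_dist x x'" if "cadlag x" "cadlag x'" for x x'
  proof -
    have "Lip_envelope F p x - p * J1_dist x x' \<le> Lip_envelope F p x'"
      unfolding Lip_envelope_def[of F p x']
    proof (intro cINF_greatest ne)
      fix y :: "real \<Rightarrow> real" assume y: "y \<in> Collect cadlag"
      then have "Lip_envelope F p x \<le> F y + p * J1_dist x y" by (intro Lip_envelope_le p) auto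
      also have "\<dots> \<le> F y + p * (J1_dist x x' + J1_dist x' y)"
        using y that p by (intro add_left_mono mult_left_mono J1_dist_triangle) auto
      finally show "Lip_envelope F p x - p * J1_dist x x' \<le> F y + p * J1_dist x' y"
        by (simp add: algebra_simps)
    qed
    then show ?thesis by simp
  qed
  show "\<bar>Lip_envelope F p x - Lip_envelope F p x'\<bar> \<le> p * J1_dist x x'"
    using *[OF x x'] *[OF x' x] J1_dist_commute[OF x x'] by (simp add: abs_le_iff)
qed

text \<open>Paths closer than \<delta> to x are handled by continuity of F at x; all others are too
  expensive in the infimum once p \<delta> exceeds 2 B. Continuity at the single path x is
  enough.\<close>

lemma Lip_envelope_tendsto:
  assumes x: "cadlag x"
    and cont: "\<And>\<epsilon>. \<epsilon> > 0 \<Longrightarrow> \<exists>\<delta>>0. \<forall>y. cadlag y \<longrightarrow> J1_dist x y < \<delta> \<longrightarrow> \<bar>F y - F x\<bar> < \<epsilon>"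
  shows "(\<lambda>p. Lip_envelope F (real p) x) \<longlonglongrightarrow> F x"
proof (rule LIMSEQ_I)
  fix e :: real assume e: "0 < e"
  obtain \<delta> where d: "\<delta> > 0" "\<And>y. cadlag y \<Longrightarrow> J1_dist x y < \<delta> \<Longrightarrow> \<bar>F y - F x\<bar> < e/2"
    using cont[of "e/2"] e by auto
  obtain N where N: "real N > 2 * B / \<delta>" using reals_Archimedean2 by blast
  have B0: "0 \<le> B" using FB[OF x] by linarith
  show "\<exists>no. \<forall>n\<ge>no. norm (Lip_envelope F (real n) x - F x) < e"
  proof (intro exI[of _ N] allI impI)
    fix n assume "N \<le> n"
    then have "2 * B / \<delta> < real n" using N by linarith
    then have n: "2 * B < real n * \<delta>" using d by (simp add: field_simps)
    have "F x - e/2 \<le> Lip_envelope F (real n) x"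
      unfolding Lip_envelope_def
    proof (intro cINF_greatest)
      show "Collect cadlag \<noteq> {}" using x by auto
      fix y :: "real \<Rightarrow> real" assume y: "y \<in> Collect cadlag"
      show "F x - e/2 \<le> F y + real n * J1_dist x y"
      proof (cases "J1_dist x y < \<delta>")
        case True
        then have "\<bar>F y - F x\<bar> < e/2" using d y by auto
        moreover have "0 \<le> real n * J1_dist x y" by (simp add: J1_dist_nonneg)
        ultimately show ?thesis by linarith
      next
        case False
        then have "real n * \<delta> \<le> real n * J1_dist x y" by (intro mult_left_mono) auto
        then show ?thesis using n FB[OF x] FB[of y] y e by auto
      qed
    qed
    then show "norm (Lip_envelope F (real n) x - F x) < e"
      using Lip_envelope_le_self[OF x, of "real n"] e by simp
  qed
qed

end

subsection \<open>Step paths\<close>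

definition step_path :: "nat \<Rightarrow> (nat \<Rightarrow> real) \<Rightarrow> real \<Rightarrow> real" where
  "step_path n v t = (\<Sum>j<nat \<lfloor>real n * t\<rfloor>. v j)"

lemma Wn_eq_step_path: "Wn T \<alpha> h n x = step_path n (\<lambda>j. real n powr (-1/\<alpha>) * h ((T ^^ j) x))"
  by (simp add: Wn_def birkhoff_sum_def step_path_def sum_distrib_left fun_eq_iff)

lemma cadlag_step_path: "cadlag (step_path n v)"
proof (cases "n = 0")
  case True
  then have "step_path n v = (\<lambda>_. 0)" by (simp add: step_path_def fun_eq_iff)
  then show ?thesis by (simp add: cadlag_const)
next
  case False
  then have n: "real n > 0" by simp
  show ?thesis unfolding cadlag_def
  proof safe
    fix t :: real
    define b where "b = (real_of_int \<lfloor>real n * t\<rfloor> + 1) / real n"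
    have "real n * t < real_of_int \<lfloor>real n * t\<rfloor> + 1" by linarith
    then have b: "t < b" using n by (simp add: b_def field_simps)
    have "eventually (\<lambda>s. step_path n v t = step_path n v s) (at_right t)"
      unfolding eventually_at_right_field
    proof (intro exI[of _ b] conjI b allI impI)
      fix s assume s: "t < s" "s < b"
      have "real n * s < real_of_int \<lfloor>real n * t\<rfloor> + 1" using s n by (simp add: b_def field_simps)
      moreover have "real n * t \<le> real n * s" using s n by simp
      ultimately have "\<lfloor>real n * s\<rfloor> = \<lfloor>real n * t\<rfloor>" by linarith
      then show "step_path n v t = step_path n v s" by (simp add: step_path_def)
    qed
    then show "(step_path n v \<longlongrightarrow> step_path n v t) (at_right t)"
      by (rule Lim_transform_eventually[OF tendsto_const])
  next
    fix t :: real
    define b where "b = (real_of_int \<lceil>real n * t\<rceil> - 1) / real n"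
    define c where "c = (\<Sum>j<nat (\<lceil>real n * t\<rceil> - 1). v j)"
    have "real_of_int \<lceil>real n * t\<rceil> - 1 < real n * t" by linarith
    then have b: "b < t" using n by (simp add: b_def field_simps)
    have "eventually (\<lambda>s. c = step_path n v s) (at_left t)"
      unfolding eventually_at_left_field
    proof (intro exI[of _ b] conjI b allI impI)
      fix s assume s: "b < s" "s < t"
      have "real_of_int \<lceil>real n * t\<rceil> - 1 < real n * s" using s n by (simp add: b_def field_simps)
      moreover have "real n * s < real n * t" using s n by simp
      ultimately have "\<lfloor>real n * s\<rfloor> = \<lceil>real n * t\<rceil> - 1" by linarith
      then show "c = step_path n v s" by (simp add: step_path_def c_def)
    qed
    then have "(step_path n v \<longlongrightarrow> c) (at_left t)"
      by (rule Lim_transform_eventually[OF tendsto_const])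
    then show "\<exists>l. (step_path n v \<longlongrightarrow> l) (at_left t)" by blast
  qed
qed

lemma step_path_diff_le:
  assumes "t \<in> {0..1}"
  shows "\<bar>step_path n v t - step_path n w t\<bar> \<le> (\<Sum>j<n. \<bar>v j - w j\<bar>)"
proof -
  have "\<bar>step_path n v t - step_path n w t\<bar> = \<bar>\<Sum>j<nat \<lfloor>real n * t\<rfloor>. v j - w j\<bar>"
    by (simp add: step_path_def sum_subtractf)
  also have "\<dots> \<le> (\<Sum>j<nat \<lfloor>real n * t\<rfloor>. \<bar>v j - w j\<bar>)" by (rule sum_abs)
  also have "\<dots> \<le> (\<Sum>j<n. \<bar>v j - w j\<bar>)"
  proof (intro sum_mono2)
    have "real n * t \<le> real n" using assms by (simp add: mult_left_le)
    then have "nat \<lfloor>real n * t\<rfloor> \<le> n" by linarith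
    then show "{..<nat \<lfloor>real n * t\<rfloor>} \<subseteq> {..<n}" by auto
  qed auto
  finally show ?thesis .
qed

text \<open>Both paths jump at the same grid times, so the identity is a good enough time
  change.\<close>

lemma J1_dist_step_path_le: "J1_dist (step_path n v) (step_path n w) \<le> (\<Sum>j<n. \<bar>v j - w j\<bar>)"
  by (intro J1_dist_leI J1_close_uniform step_path_diff_le)

text \<open>The truncation at 1 is what permits increments without a mean. A single difference of
  size at least 1 is paid for by the crude bound 2 B; if there is none, the truncation is inactive
  and the Lipschitz estimate applies.\<close>

lemma J1_Lip_step_path_le:
  assumes "J1_Lip F B L"
  shows "\<bar>F (step_path n v) - F (step_path n w)\<bar> \<le> (2 * B + L) * (\<Sum>j<n. min 1 \<bar>v j - w j\<bar>)"
proof -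
  have L: "0 \<le> L" and FB: "\<And>x. cadlag x \<Longrightarrow> \<bar>F x\<bar> \<le> B"
    and FL: "\<And>x y. cadlag x \<Longrightarrow> cadlag y \<Longrightarrow> \<bar>F x - F y\<bar> \<le> L * J1_dist x y"
    using assms by (auto simp: J1_Lip_def)
  have B0: "0 \<le> B" using FB[OF cadlag_const] by (meson abs_ge_zero order_trans)
  show ?thesis
  proof (cases "\<exists>j<n. 1 \<le> \<bar>v j - w j\<bar>")
    case True
    then obtain j where j: "j < n" "1 \<le> \<bar>v j - w j\<bar>" by auto
    have "1 = min 1 \<bar>v j - w j\<bar>" using j by simp
    also have "\<dots> \<le> (\<Sum>j<n. min 1 \<bar>v j - w j\<bar>)" using j by (intro member_le_sum) auto
    finally have 1: "1 \<le> (\<Sum>j<n. min 1 \<bar>v j - w j\<bar>)" .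
    have "\<bar>F (step_path n v) - F (step_path n w)\<bar> \<le> 2 * B"
      using FB[OF cadlag_step_path[of n v]] FB[OF cadlag_step_path[of n w]] by linarith
    also have "\<dots> \<le> (2 * B + L) * 1" using L by simp
    also have "\<dots> \<le> (2 * B + L) * (\<Sum>j<n. min 1 \<bar>v j - w j\<bar>)"
      using 1 L B0 by (intro mult_left_mono) auto
    finally show ?thesis .
  next
    case False
    then have eq: "(\<Sum>j<n. min 1 \<bar>v j - w j\<bar>) = (\<Sum>j<n. \<bar>v j - w j\<bar>)" by (intro sum.cong) auto
    have "\<bar>F (step_path n v) - F (step_path n w)\<bar> \<le> L * (\<Sum>j<n. \<bar>v j - w j\<bar>)"
      using FL[OF cadlag_step_path[of n v] cadlag_step_path[of n w]] J1_dist_step_path_le[of n v w] L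
      by (meson mult_left_mono order_trans)
    also have "\<dots> \<le> (2 * B + L) * (\<Sum>j<n. \<bar>v j - w j\<bar>)"
      using B0 by (intro mult_right_mono sum_nonneg) auto
    finally show ?thesis by (simp add: eq)
  qed
qed

text \<open>On [0,1] a step path is determined by its first n coordinates, and the J1 distance is at
  most their l1 distance. Hence F becomes continuous for the product topology on sequences, whose
  Borel sets are at hand, although paths have no sigma-algebra.\<close>

lemma borel_measurable_J1_step_path:
  assumes "J1_bcont F"
  shows "(\<lambda>v. F (step_path n v)) \<in> borel_measurable (borel :: (nat \<Rightarrow> real) measure)"
proof (rule borel_measurable_continuous_onI)
  show "continuous_on UNIV (\<lambda>v. F (step_path n v))"
  proof (rule continuous_on_sequentiallyI)
    fix u :: "nat \<Rightarrow> nat \<Rightarrow> real" and v assume uv: "u \<longlonglongrightarrow> v"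
    have lim: "(\<lambda>k. \<Sum>j<n. \<bar>v j - u k j\<bar>) \<longlonglongrightarrow> (\<Sum>j<n. \<bar>v j - v j\<bar>)"
    proof (intro tendsto_sum tendsto_rabs tendsto_diff tendsto_const)
      fix j
      have "continuous_on UNIV (\<lambda>x :: nat \<Rightarrow> real. x j)"
        by (rule continuous_on_product_coordinates)
      then have "isCont (\<lambda>x :: nat \<Rightarrow> real. x j) v"
        using continuous_on_eq_continuous_at[OF open_UNIV] by blast
      then show "(\<lambda>k. u k j) \<longlonglongrightarrow> v j" using uv by (rule isCont_tendsto_compose)
    qed
    show "(\<lambda>k. F (step_path n (u k))) \<longlonglongrightarrow> F (step_path n v)"
    proof (rule LIMSEQ_I)
      fix e :: real assume "0 < e"
      then obtain \<delta> where d: "\<delta> > 0" "\<And>y. cadlag y \<Longrightarrow> J1_dist (step_path n v) y < \<delta> \<Longrightarrow> \<bar>F y - F (step_path n v)\<bar> < e"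
        using assms cadlag_step_path[of n v] unfolding J1_bcont_def by metis
      have "eventually (\<lambda>k. (\<Sum>j<n. \<bar>v j - u k j\<bar>) < \<delta>) sequentially"
        using lim d(1) by (intro order_tendstoD(2)[OF lim]) auto
      then have "eventually (\<lambda>k. norm (F (step_path n (u k)) - F (step_path n v)) < e) sequentially"
      proof eventually_elim
        case (elim k)
        then have "J1_dist (step_path n v) (step_path n (u k)) < \<delta>"
          using J1_dist_step_path_le[of n v "u k"] by linarith
        then show ?case using d(2)[OF cadlag_step_path] by simp
      qed
      then show "\<exists>no. \<forall>k\<ge>no. norm (F (step_path n (u k)) - F (step_path n v)) < e"
        by (simp add: eventually_sequentially)
    qed
  qed
qed

lemma J1_Lip_imp_bcont: "J1_Lip F B L \<Longrightarrow> J1_bcont F"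
  unfolding J1_Lip_def J1_bcont_def
proof (safe, goal_cases)
  case (2 x e)
  show ?case
  proof (intro exI[of _ "e / (L + 1)"] conjI allI impI)
    show "0 < e / (L + 1)" using 2 by auto
    fix y assume y: "cadlag y" "J1_dist x y < e / (L + 1)"
    have "\<bar>F y - F x\<bar> \<le> L * J1_dist x y" using 2 y J1_dist_commute by metis
    also have "\<dots> \<le> (L + 1) * J1_dist x y" by (simp add: J1_dist_nonneg distrib_right)
    also have "\<dots> < e" using y 2 by (simp add: field_simps)
    finally show "\<bar>F y - F x\<bar> < e" .
  qed
qed auto

definition grid_increments :: "nat \<Rightarrow> (real \<Rightarrow> real) \<Rightarrow> nat \<Rightarrow> real" where
  "grid_increments n x j = x (real (Suc j) / real n) - x (real j / real n)"

lemma step_path_grid_increments: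
  assumes "x 0 = 0" "t \<in> {0..1}"
  shows "step_path n (grid_increments n x) t = x (real_of_int \<lfloor>real n * t\<rfloor> / real n)"
proof -
  have "step_path n (grid_increments n x) t = x (real (nat \<lfloor>real n * t\<rfloor>) / real n) - x (real 0 / real n)"
    unfolding step_path_def grid_increments_def by (rule sum_lessThan_telescope)
  then show ?thesis using assms by simp
qed

text \<open>The step path built from the grid increments samples x on the grid; starting at 0 is
  what makes the telescoping sum return x itself. Then \<open>J1_discretisation\<close>
  applies.\<close>

lemma J1_Lip_grid_tendsto:
  assumes F: "J1_bcont F" and x: "cadlag x" "x 0 = 0"
  shows "(\<lambda>n. F (step_path n (grid_increments n x))) \<longlonglongrightarrow> F x"
proof (rule LIMSEQ_I)
  fix e :: real assume "0 < e"
  then obtain \<delta> where d: "\<delta> > 0" "\<And>y. cadlag y \<Longrightarrow> J1_dist x y < \<delta> \<Longrightarrow> \<bar>F y - F x\<bar> < e"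
    using F x unfolding J1_bcont_def by metis
  have "eventually (\<lambda>n. J1_close (\<delta>/2) x (step_path n (grid_increments n x))) sequentially"
    using J1_discretisation[OF x(1), of "\<delta>/2"] d(1)
    by (auto elim!: eventually_mono simp: step_path_grid_increments[where x=x, OF x(2)])
  then have "eventually (\<lambda>n. norm (F (step_path n (grid_increments n x)) - F x) < e) sequentially"
  proof eventually_elim
    case (elim n)
    have "J1_dist x (step_path n (grid_increments n x)) < \<delta>" using J1_dist_leI[OF elim] d(1) by linarith
    then show ?case using d(2)[OF cadlag_step_path] by simp
  qed
  then show "\<exists>no. \<forall>n\<ge>no. norm (F (step_path n (grid_increments n x)) - F x) < e"
    by (simp add: eventually_sequentially)
qed

section \<open>Expectations of functionals of a cadlag process\<close>

locale cadlag_process = prob_space Q for Q :: "'b measure" +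
  fixes W :: "real \<Rightarrow> 'b \<Rightarrow> real"
  assumes W_measurable [measurable]: "\<And>t. W t \<in> borel_measurable Q"
    and W_cadlag: "\<And>\<omega>. \<omega> \<in> space Q \<Longrightarrow> cadlag (\<lambda>t. W t \<omega>)"
    and W_0: "\<And>\<omega>. \<omega> \<in> space Q \<Longrightarrow> W 0 \<omega> = 0"
begin

lemma grid_increments_measurable [measurable]:
  "(\<lambda>\<omega>. grid_increments n (\<lambda>t. W t \<omega>)) \<in> Q \<rightarrow>\<^sub>M (borel :: (nat \<Rightarrow> real) measure)"
  by (rule measurable_coordinatewise_then_product) (simp add: grid_increments_def)

text \<open>Measurability of a functional of the whole path, as a pointwise limit of functions of
  the grid increments.\<close>

lemma J1_measurable:
  assumes "J1_bcont F"
  shows "(\<lambda>\<omega>. F (\<lambda>t. W t \<omega>)) \<in> borel_measurable Q"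
proof (rule borel_measurable_LIMSEQ_real)
  show "(\<lambda>n. F (step_path n (grid_increments n (\<lambda>t. W t \<omega>)))) \<longlonglongrightarrow> F (\<lambda>t. W t \<omega>)" if "\<omega> \<in> space Q" for \<omega>
    using that by (intro J1_Lip_grid_tendsto assms W_cadlag W_0)
  show "(\<lambda>\<omega>. F (step_path n (grid_increments n (\<lambda>t. W t \<omega>)))) \<in> borel_measurable Q" for n
    by (rule measurable_compose[OF grid_increments_measurable borel_measurable_J1_step_path[OF assms]])
qed

lemma expectation_grid_tendsto:
  assumes F: "J1_bcont F"
  shows "(\<lambda>n. \<integral>\<omega>. F (step_path n (grid_increments n (\<lambda>t. W t \<omega>))) \<partial>Q) \<longlonglongrightarrow> (\<integral>\<omega>. F (\<lambda>t. W t \<omega>) \<partial>Q)"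
proof -
  obtain B where B: "\<And>x. cadlag x \<Longrightarrow> \<bar>F x\<bar> \<le> B" using F by (auto simp: J1_bcont_def)
  show ?thesis
  proof (rule integral_dominated_convergence[where w="\<lambda>_. B"])
    show "(\<lambda>\<omega>. F (\<lambda>t. W t \<omega>)) \<in> borel_measurable Q" by (rule J1_measurable[OF F])
    show "(\<lambda>\<omega>. F (step_path n (grid_increments n (\<lambda>t. W t \<omega>)))) \<in> borel_measurable Q" for n
      by (rule measurable_compose[OF grid_increments_measurable borel_measurable_J1_step_path[OF F]])
    show "AE \<omega> in Q. (\<lambda>n. F (step_path n (grid_increments n (\<lambda>t. W t \<omega>)))) \<longlonglongrightarrow> F (\<lambda>t. W t \<omega>)"
      by (intro AE_I2 J1_Lip_grid_tendsto F W_cadlag W_0)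
  qed (auto intro!: B cadlag_step_path)
qed

text \<open>Only Lipschitz test functions have to be considered: a bounded continuous F is the increasing
  limit of its Lipschitz envelopes, which gives lim inf E F(X_n) \<ge> E F(W); the same is applied to -F.\<close>
lemma J1_convergence_Lipschitz:
  fixes \<xi> :: "nat \<Rightarrow> 'c \<Rightarrow> nat \<Rightarrow> real"
  assumes "prob_space m"
    and \<xi>: "\<And>n. \<xi> n \<in> m \<rightarrow>\<^sub>M borel"
    and Lip: "\<And>F B L. J1_Lip F B L \<Longrightarrow>
      (\<lambda>n. (\<integral>x. F (step_path n (\<xi> n x)) \<partial>m) - (\<integral>\<omega>. F (step_path n (grid_increments n (\<lambda>t. W t \<omega>))) \<partial>Q)) \<longlonglongrightarrow> 0"
    and F: "J1_bcont F"
  shows "(\<lambda>n. \<integral>x. F (step_path n (\<xi> n x)) \<partial>m) \<longlonglongrightarrow> (\<integral>\<omega>. F (\<lambda>t. W t \<omega>) \<partial>Q)"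
proof -
  interpret m: prob_space m by fact
  have int_m: "integrable m (\<lambda>x. F (step_path n (\<xi> n x)))" if F: "J1_bcont F" for F n
  proof -
    obtain B where B: "\<And>x. cadlag x \<Longrightarrow> \<bar>F x\<bar> \<le> B" using F by (auto simp: J1_bcont_def)
    show ?thesis
      by (intro m.integrable_const_bound[where B=B] measurable_compose[OF \<xi> borel_measurable_J1_step_path[OF F]])
        (auto intro!: B cadlag_step_path)
  qed
  have lower: "eventually (\<lambda>n. (\<integral>\<omega>. F (\<lambda>t. W t \<omega>) \<partial>Q) - e < (\<integral>x. F (step_path n (\<xi> n x)) \<partial>m)) sequentially"
    if F: "J1_bcont F" and e: "e > 0" for F and e :: real
  proof -
    obtain B where B: "\<And>x. cadlag x \<Longrightarrow> \<bar>F x\<bar> \<le> B" using F by (auto simp: J1_bcont_def)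
    have Lp: "J1_Lip (Lip_envelope F (real p)) B (real p)" for p
      by (rule J1_Lip_envelope) (use B in auto)
    note cp = J1_Lip_imp_bcont[OF Lp]
    have "(\<lambda>p. \<integral>\<omega>. Lip_envelope F (real p) (\<lambda>t. W t \<omega>) \<partial>Q) \<longlonglongrightarrow> (\<integral>\<omega>. F (\<lambda>t. W t \<omega>) \<partial>Q)"
    proof (rule integral_dominated_convergence[where w="\<lambda>_. B"])
      show "AE \<omega> in Q. (\<lambda>p. Lip_envelope F (real p) (\<lambda>t. W t \<omega>)) \<longlonglongrightarrow> F (\<lambda>t. W t \<omega>)"
      proof (rule AE_I2)
        fix \<omega> assume "\<omega> \<in> space Q"
        then have c: "cadlag (\<lambda>t. W t \<omega>)" by (rule W_cadlag)
        show "(\<lambda>p. Lip_envelope F (real p) (\<lambda>t. W t \<omega>)) \<longlonglongrightarrow> F (\<lambda>t. W t \<omega>)"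
          by (rule Lip_envelope_tendsto[OF B c]) (use F c in \<open>auto simp: J1_bcont_def\<close>)
      qed
      show "AE \<omega> in Q. norm (Lip_envelope F (real p) (\<lambda>t. W t \<omega>)) \<le> B" for p
        using Lp[of p] W_cadlag by (intro AE_I2) (auto simp: J1_Lip_def)
    qed (auto intro!: J1_measurable cp F)
    then have "eventually (\<lambda>p. (\<integral>\<omega>. F (\<lambda>t. W t \<omega>) \<partial>Q) - e/2 < (\<integral>\<omega>. Lip_envelope F (real p) (\<lambda>t. W t \<omega>) \<partial>Q)) sequentially"
      using e by (intro order_tendstoD(1)) auto
    then obtain p where p: "(\<integral>\<omega>. F (\<lambda>t. W t \<omega>) \<partial>Q) - e/2 < (\<integral>\<omega>. Lip_envelope F (real p) (\<lambda>t. W t \<omega>) \<partial>Q)"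
      by (auto simp: eventually_sequentially)
    have "(\<lambda>n. \<integral>x. Lip_envelope F (real p) (step_path n (\<xi> n x)) \<partial>m) \<longlonglongrightarrow> (\<integral>\<omega>. Lip_envelope F (real p) (\<lambda>t. W t \<omega>) \<partial>Q)"
      using tendsto_add[OF Lip[OF Lp[of p]] expectation_grid_tendsto[OF cp[of p]]] by simp
    then have "eventually (\<lambda>n. (\<integral>\<omega>. Lip_envelope F (real p) (\<lambda>t. W t \<omega>) \<partial>Q) - e/2 <
        (\<integral>x. Lip_envelope F (real p) (step_path n (\<xi> n x)) \<partial>m)) sequentially"
      using e by (intro order_tendstoD(1)) auto
    then show ?thesis
    proof eventually_elim
      case (elim n)
      have "(\<integral>x. Lip_envelope F (real p) (step_path n (\<xi> n x)) \<partial>m) \<le> (\<integral>x. F (step_path n (\<xi> n x)) \<partial>m)"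
        by (intro integral_mono int_m cp F Lip_envelope_le_self[OF B] cadlag_step_path) auto
      then show ?case using p elim by linarith
    qed
  qed
  show ?thesis
  proof (rule tendstoI)
    fix e :: real assume e: "0 < e"
    have F': "J1_bcont (\<lambda>x. - F x)" using F unfolding J1_bcont_def
      by (simp add: abs_minus_commute)
    from lower[OF F e] lower[OF F' e]
    show "eventually (\<lambda>n. dist (\<integral>x. F (step_path n (\<xi> n x)) \<partial>m) (\<integral>\<omega>. F (\<lambda>t. W t \<omega>) \<partial>Q) < e) sequentially"
      by eventually_elim (auto simp: dist_real_def)
  qed
qed

end

subsection \<open>Independence and characteristic functions\<close>

text \<open>Under the measure with density D / k the variable X has the same characteristic function
  as under M, hence the same law, so the weight D factors out of every event of X. If k = 0, the
  weight vanishes almost everywhere and no normalisation is possible or necessary.\<close>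

lemma (in prob_space) char_weighted_unique:
  fixes D X :: "'a \<Rightarrow> real"
  assumes [measurable]: "D \<in> borel_measurable M" "X \<in> borel_measurable M"
    and D: "integrable M D" "\<And>x. 0 \<le> D x"
    and eq: "\<And>s. (\<integral>x. complex_of_real (D x) * iexp (s * X x) \<partial>M) = of_real k * (\<integral>x. iexp (s * X x) \<partial>M)"
    and A [measurable]: "A \<in> sets borel"
  shows "(\<integral>x. D x * indicator A (X x) \<partial>M) = k * prob (X -` A \<inter> space M)"
proof -
  have k: "k = (\<integral>x. D x \<partial>M)"
    using eq[of 0] integral_complex_of_real[of M D] by (simp add: prob_space)
  have k0: "0 \<le> k" unfolding k using D by simp
  show ?thesis
  proof (cases "k = 0")
    case True
    then have "AE x in M. D x = 0" using k integral_nonneg_eq_0_iff_AE[OF D(1)] D(2) by simp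
    then have "(\<integral>x. D x * indicator A (X x) \<partial>M) = (\<integral>x. 0 \<partial>M)" by (intro integral_cong_AE) auto
    then show ?thesis using True by simp
  next
    case False
    then have k0: "0 < k" using k0 by simp
    define N where "N = density M (\<lambda>x. ennreal (D x / k))"
    have "emeasure N (space N) = (\<integral>\<^sup>+x. ennreal (D x / k) \<partial>M)"
      by (simp add: N_def emeasure_density)
    also have "\<dots> = ennreal (\<integral>x. D x / k \<partial>M)" using D k0 by (intro nn_integral_eq_integral) auto
    also have "\<dots> = 1" using k k0 by simp
    finally have N: "prob_space N" by (rule prob_spaceI)
    have [measurable]: "X \<in> borel_measurable N" by (simp add: N_def)
    have rd: "real_distribution (distr N borel X)" "real_distribution (distr M borel X)"
      using prob_space.prob_space_distr[OF N, of X borel] prob_space_distr[of X borel]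
      by (auto simp: real_distribution_def real_distribution_axioms_def)
    have "char (distr N borel X) s = char (distr M borel X) s" for s
    proof -
      have "char (distr N borel X) s = (\<integral>x. iexp (s * X x) \<partial>N)" by (simp add: char_def integral_distr)
      also have "\<dots> = (\<integral>x. (D x / k) *\<^sub>R iexp (s * X x) \<partial>M)"
        unfolding N_def using D k0 by (intro integral_density) auto
      also have "\<dots> = (\<integral>x. complex_of_real (D x) * iexp (s * X x) / of_real k \<partial>M)"
        by (intro Bochner_Integration.integral_cong) (simp_all add: scaleR_conv_of_real)
      also have "\<dots> = (\<integral>x. complex_of_real (D x) * iexp (s * X x) \<partial>M) / of_real k"
        by simp
      also have "\<dots> = char (distr M borel X) s" using k0 by (simp only: eq) (simp add: char_def integral_distr)
      finally show ?thesis .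
    qed
    then have "distr N borel X = distr M borel X" by (intro Levy_uniqueness rd) auto
    then have "measure (distr N borel X) A = measure (distr M borel X) A" by simp
    then have "measure N (X -` A \<inter> space M) = prob (X -` A \<inter> space M)"
      by (simp add: measure_distr N_def)
    moreover have "measure N (X -` A \<inter> space M) = (\<integral>x. indicator A (X x) \<partial>N)"
    proof -
      have "(\<integral>x. indicator A (X x) \<partial>N) = (\<integral>x. indicator (X -` A \<inter> space N) x \<partial>N)"
        by (intro Bochner_Integration.integral_cong) (auto simp: indicator_def)
      also have "\<dots> = measure N (X -` A \<inter> space N)" by (simp add: Int_absorb2)
      finally show ?thesis by (simp add: N_def)
    qed
    moreover have "(\<integral>x. indicator A (X x) \<partial>N) = (\<integral>x. (D x / k) *\<^sub>R (indicator A (X x) :: real) \<partial>M)"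
      unfolding N_def using D k0 by (intro integral_density) auto
    moreover have "\<dots> = (\<integral>x. D x * indicator A (X x) / k \<partial>M)"
      by (intro Bochner_Integration.integral_cong) simp_all
    moreover have "\<dots> = (\<integral>x. D x * indicator A (X x) \<partial>M) / k" by simp
    ultimately show ?thesis using k0 by (simp add: field_simps)
  qed
qed

lemma (in prob_space) expectation_iexp_minus:
  "(\<integral>x. iexp (- X x) \<partial>M) = cnj (\<integral>x. iexp (X x) \<partial>M)"
proof -
  have "(\<integral>x. iexp (- X x) \<partial>M) = (\<integral>x. cnj (iexp (X x)) \<partial>M)" by (simp add: exp_cnj)
  also have "\<dots> = cnj (\<integral>x. iexp (X x) \<partial>M)" by simp
  finally show ?thesis .
qed

lemma iexp_add: "iexp (a + b) = iexp a * iexp b"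
  by (simp add: distrib_left exp_add)

text \<open>The weight 1 + cos y turns one exponential into three, with phases shifted by 0, y and
  -y. A weighted integral thus becomes a combination of joint characteristic functions that are
  already known; the sine weight behaves alike.\<close>

lemma cos_weight_iexp:
  "complex_of_real (g * (1 + cos y)) * iexp a =
     of_real g * iexp a + (of_real g * iexp (a + y) + of_real g * iexp (a - y)) / 2"
proof -
  have c: "complex_of_real (cos y) = (iexp y + iexp (-y)) / 2"
    by (simp add: cos_of_real[symmetric] cos_exp_eq)
  have d: "iexp (a - y) = iexp a * iexp (-y)" using iexp_add[of a "-y"] by simp
  have "g * (1 + (u + v) / 2) * e = g * e + (g * (e * u) + g * (e * v)) / 2" for g u v e :: complex
    by (simp add: field_simps)
  then show ?thesis unfolding iexp_add[of a y] d of_real_mult[of g] of_real_add[of 1] of_real_1 c by blast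
qed

lemma sin_weight_iexp:
  "complex_of_real (g * (1 + sin y)) * iexp a =
     of_real g * iexp a + (of_real g * iexp (a + y) - of_real g * iexp (a - y)) / (2 * \<i>)"
proof -
  have c: "complex_of_real (sin y) = (iexp y - iexp (-y)) / (2 * \<i>)"
    by (simp add: sin_of_real[symmetric] sin_exp_eq)
  have d: "iexp (a - y) = iexp a * iexp (-y)" using iexp_add[of a "-y"] by simp
  have "g * (1 + (u - v) / (2 * \<i>)) * e = g * e + (g * (e * u) - g * (e * v)) / (2 * \<i>)" for g u v e :: complex
    by (simp add: field_simps)
  then show ?thesis unfolding iexp_add[of a y] d of_real_mult[of g] of_real_add[of 1] of_real_1 c by blast
qed

text \<open>The exponentials are replaced by indicators one variable at a time: multiplying by the
  nonnegative weights 1 + cos Y and 1 + sin Y, with Y the combination of the remaining variables,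
  reduces each step to uniqueness in dimension one.\<close>
lemma (in prob_space) indep_vars_char:
  fixes X :: "nat \<Rightarrow> 'a \<Rightarrow> real"
  assumes rv [measurable]: "\<And>i. X i \<in> borel_measurable M"
    and joint: "\<And>\<theta>. (\<integral>x. iexp (\<Sum>i<n. \<theta> i * X i x) \<partial>M) = (\<Prod>i<n. \<integral>x. iexp (\<theta> i * X i x) \<partial>M)"
  shows "indep_vars (\<lambda>_. borel) X {..<n}"
proof -
  define \<phi> where "\<phi> i s = (\<integral>x. iexp (s * X i x) \<partial>M)" for i s
  \<comment> \<open>Induction on p: variables below p already appear as indicators, the others still
    as exponentials. At p = n only the product formula for events is left.\<close>
  have claim: "p \<le> n \<Longrightarrow> (\<And>i. A i \<in> sets borel) \<Longrightarrow>
     (\<integral>x. complex_of_real (\<Prod>i<p. indicator (A i) (X i x)) * iexp (\<Sum>i\<in>{p..<n}. \<theta> i * X i x) \<partial>M) =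
       of_real (\<Prod>i<p. prob (X i -` A i \<inter> space M)) * (\<Prod>i\<in>{p..<n}. \<phi> i (\<theta> i))"
    for p and A :: "nat \<Rightarrow> real set" and \<theta> :: "nat \<Rightarrow> real"
  proof (induction p arbitrary: \<theta>)
    case 0
    then show ?case using joint[of \<theta>] by (simp add: \<phi>_def lessThan_atLeast0)
  next
    case (Suc p)
    note A [measurable] = Suc.prems(2)
    define G where "G x = (\<Prod>i<p. indicator (A i) (X i x) :: real)" for x
    define Y where "Y x = (\<Sum>i\<in>{Suc p..<n}. \<theta> i * X i x)" for x
    define R where "R = (\<Prod>i<p. prob (X i -` A i \<inter> space M))"
    define c where "c = (\<Prod>i\<in>{Suc p..<n}. \<phi> i (\<theta> i))"
    have [measurable]: "G \<in> borel_measurable M" "Y \<in> borel_measurable M"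
      unfolding G_def Y_def by measurable
    have G01: "0 \<le> G x" "G x \<le> 1" for x
      unfolding G_def by (auto intro!: prod_nonneg prod_le_1)
    have split: "{p..<n} = insert p {Suc p..<n}" using Suc.prems by auto
    \<comment> \<open>The exponent s at variable p and those at the later variables are free. The
      choices 0, \<theta> and -\<theta> for the later ones yield the three integrals
      \<open>e0\<close>, \<open>e1\<close>, \<open>e2\<close> that the two weights require.\<close>
    have IH: "(\<integral>x. complex_of_real (G x) * iexp (s * X p x + (\<Sum>i\<in>{Suc p..<n}. \<theta>' i * X i x)) \<partial>M) =
       of_real R * (\<phi> p s * (\<Prod>i\<in>{Suc p..<n}. \<phi> i (\<theta>' i)))" for s \<theta>'
      using Suc.IH[of "\<theta>'(p := s)"] Suc.prems unfolding split G_def[symmetric] R_def[symmetric]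
      by (simp add: fun_upd_def)
    have e0: "(\<integral>x. complex_of_real (G x) * iexp (s * X p x) \<partial>M) = of_real R * \<phi> p s" for s
      using IH[of s "\<lambda>_. 0"] by (simp add: \<phi>_def prob_space)
    have e1: "(\<integral>x. complex_of_real (G x) * iexp (s * X p x + Y x) \<partial>M) = of_real R * \<phi> p s * c" for s
      using IH[of s \<theta>] by (simp add: Y_def c_def)
    have e2: "(\<integral>x. complex_of_real (G x) * iexp (s * X p x - Y x) \<partial>M) = of_real R * \<phi> p s * cnj c" for s
    proof -
      have "\<phi> i (- \<theta> i) = cnj (\<phi> i (\<theta> i))" for i
        unfolding \<phi>_def using expectation_iexp_minus[of "\<lambda>x. \<theta> i * X i x"] by simp
      then show ?thesis using IH[of s "\<lambda>i. - \<theta> i"] by (simp add: Y_def c_def sum_negf)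
    qed
    have int: "integrable M (\<lambda>x. complex_of_real (G x) * iexp (Z x))"
      if [measurable]: "Z \<in> borel_measurable M" for Z
      by (rule integrable_const_bound[where B=1]) (auto simp: norm_mult G01 abs_of_nonneg)
    have intr: "integrable M (\<lambda>x. G x * Z x)" if [measurable]: "Z \<in> borel_measurable M" and "\<And>x. \<bar>Z x\<bar> \<le> 2" for Z
      using G01 that(2) by (intro integrable_const_bound[where B="1 * 2"])
        (auto simp: abs_mult intro!: AE_I2 order_trans[OF mult_mono[of "G _" 1 "\<bar>Z _\<bar>" 2]])
    note weighted = char_weighted_unique[where X="X p" and A="A p", folded \<phi>_def]
    have w0: "(\<integral>x. G x * indicator (A p) (X p x) \<partial>M) = R * prob (X p -` A p \<inter> space M)"
    proof (rule weighted)
      show "integrable M G" using intr[of "\<lambda>_. 1"] by simp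
    qed (simp_all add: G01 e0 del: of_real_mult)
    have w1: "(\<integral>x. (G x * (1 + cos (Y x))) * indicator (A p) (X p x) \<partial>M) = R * (1 + Re c) * prob (X p -` A p \<inter> space M)"
    proof (intro weighted)
      show "integrable M (\<lambda>x. G x * (1 + cos (Y x)))"
        by (intro intr) (auto intro: order_trans[OF abs_triangle_ineq] simp: add_mono[of 1 1 "\<bar>cos (Y _)\<bar>" 1, simplified])
      show "0 \<le> G x * (1 + cos (Y x))" for x
        using G01[of x] cos_ge_minus_one[of "Y x"] by (intro mult_nonneg_nonneg) linarith+
      fix s
      have "(\<integral>x. complex_of_real (G x * (1 + cos (Y x))) * iexp (s * X p x) \<partial>M) =
        (\<integral>x. complex_of_real (G x) * iexp (s * X p x) + (complex_of_real (G x) * iexp (s * X p x + Y x)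
            + complex_of_real (G x) * iexp (s * X p x - Y x)) / 2 \<partial>M)"
        by (intro Bochner_Integration.integral_cong refl cos_weight_iexp)
      also have "\<dots> = of_real R * \<phi> p s + (of_real R * \<phi> p s * c + of_real R * \<phi> p s * cnj c) / 2"
        using int[of "\<lambda>x. s * X p x"] int[of "\<lambda>x. s * X p x + Y x"] int[of "\<lambda>x. s * X p x - Y x"]
        by (simp add: e0 e1 e2 del: of_real_mult of_real_add of_real_diff)
      also have "\<dots> = of_real R * \<phi> p s * (1 + (c + cnj c) / 2)" by (simp add: field_simps)
      also have "\<dots> = of_real (R * (1 + Re c)) * \<phi> p s" by (simp add: complex_add_cnj)
      finally show "(\<integral>x. complex_of_real (G x * (1 + cos (Y x))) * iexp (s * X p x) \<partial>M) = of_real (R * (1 + Re c)) * \<phi> p s" .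
    qed auto
    have w2: "(\<integral>x. (G x * (1 + sin (Y x))) * indicator (A p) (X p x) \<partial>M) = R * (1 + Im c) * prob (X p -` A p \<inter> space M)"
    proof (intro weighted)
      show "integrable M (\<lambda>x. G x * (1 + sin (Y x)))"
        by (intro intr) (auto intro: order_trans[OF abs_triangle_ineq] simp: add_mono[of 1 1 "\<bar>sin (Y _)\<bar>" 1, simplified])
      show "0 \<le> G x * (1 + sin (Y x))" for x
        using G01[of x] sin_ge_minus_one[of "Y x"] by (intro mult_nonneg_nonneg) linarith+
      fix s
      have "(\<integral>x. complex_of_real (G x * (1 + sin (Y x))) * iexp (s * X p x) \<partial>M) =
        (\<integral>x. complex_of_real (G x) * iexp (s * X p x) + (complex_of_real (G x) * iexp (s * X p x + Y x)
            - complex_of_real (G x) * iexp (s * X p x - Y x)) / (2 * \<i>) \<partial>M)"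
        by (intro Bochner_Integration.integral_cong refl sin_weight_iexp)
      also have "\<dots> = of_real R * \<phi> p s + (of_real R * \<phi> p s * c - of_real R * \<phi> p s * cnj c) / (2 * \<i>)"
        using int[of "\<lambda>x. s * X p x"] int[of "\<lambda>x. s * X p x + Y x"] int[of "\<lambda>x. s * X p x - Y x"]
        by (simp add: e0 e1 e2 del: of_real_mult of_real_add of_real_diff)
      also have "\<dots> = of_real R * \<phi> p s * (1 + (c - cnj c) / (2 * \<i>))" by (simp add: field_simps)
      also have "\<dots> = of_real (R * (1 + Im c)) * \<phi> p s" by (simp add: complex_diff_cnj field_simps)
      finally show "(\<integral>x. complex_of_real (G x * (1 + sin (Y x))) * iexp (s * X p x) \<partial>M) = of_real (R * (1 + Im c)) * \<phi> p s" .
    qed auto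
    let ?I = "\<lambda>x. indicator (A p) (X p x) :: real"
    let ?P = "prob (X p -` A p \<inter> space M)"
    have i0: "integrable M (\<lambda>x. complex_of_real (G x * ?I x))"
      by (rule integrable_const_bound[where B=1]) (use G01 in \<open>auto simp: norm_mult abs_of_nonneg indicator_def\<close>)
    have i1: "integrable M (\<lambda>x. complex_of_real (G x * (1 + cos (Y x)) * ?I x))"
    proof (rule integrable_const_bound[where B=2])
      have "\<bar>1 + cos y\<bar> \<le> 2" for y :: real using abs_cos_le_one[of y] by linarith
      then have "\<bar>G x * (1 + cos (Y x))\<bar> \<le> 1 * 2" for x using G01[of x] unfolding abs_mult by (intro mult_mono) auto
      then show "AE x in M. cmod (complex_of_real (G x * (1 + cos (Y x)) * ?I x)) \<le> 2"
        by (auto simp: indicator_def simp del: of_real_mult of_real_add)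
    qed auto
    have i2: "integrable M (\<lambda>x. complex_of_real (G x * (1 + sin (Y x)) * ?I x))"
    proof (rule integrable_const_bound[where B=2])
      have "\<bar>1 + sin y\<bar> \<le> 2" for y :: real using abs_sin_le_one[of y] by linarith
      then have "\<bar>G x * (1 + sin (Y x))\<bar> \<le> 1 * 2" for x using G01[of x] unfolding abs_mult by (intro mult_mono) auto
      then show "AE x in M. cmod (complex_of_real (G x * (1 + sin (Y x)) * ?I x)) \<le> 2"
        by (auto simp: indicator_def simp del: of_real_mult of_real_add)
    qed auto
    \<comment> \<open>Recombination: \<open>iexp (Y x)\<close> is ((1 + cos Y) - 1) + i ((1 + sin Y)
      - 1), and each of the weights 1, 1 + cos Y, 1 + sin Y has been treated above.\<close>
    have "(\<integral>x. complex_of_real (\<Prod>i<Suc p. indicator (A i) (X i x)) * iexp (Y x) \<partial>M) =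
      (\<integral>x. (complex_of_real (G x * (1 + cos (Y x)) * ?I x) - complex_of_real (G x * ?I x)) +
        \<i> * (complex_of_real (G x * (1 + sin (Y x)) * ?I x) - complex_of_real (G x * ?I x)) \<partial>M)"
      by (intro Bochner_Integration.integral_cong refl)
        (simp add: G_def[symmetric] exp_Euler cos_of_real sin_of_real algebra_simps)
    also have "\<dots> = (of_real (R * (1 + Re c) * ?P) - of_real (R * ?P)) + \<i> * (of_real (R * (1 + Im c) * ?P) - of_real (R * ?P))"
      using i0 i1 i2 unfolding w0[symmetric] w1[symmetric] w2[symmetric] integral_complex_of_real[symmetric]
      by simp
    also have "\<dots> = of_real (R * ?P) * (of_real (Re c) + \<i> * of_real (Im c))"
      by (simp add: algebra_simps)
    also have "\<dots> = of_real (\<Prod>i<Suc p. prob (X i -` A i \<inter> space M)) * c"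
      by (simp add: R_def complex_eq[symmetric])
    finally show ?case by (simp add: Y_def c_def)
  qed
  show ?thesis
  proof (cases "n = 0")
    case True
    then show ?thesis by (simp add: indep_vars_def2 indep_sets_def)
  next
    case False
    have "indep_sets (\<lambda>i. {X i -` A \<inter> space M |A. A \<in> sets borel}) {..<n}"
    proof (rule indep_sets_finite[THEN iffD2])
      show "\<forall>A\<in>\<Pi> i\<in>{..<n}. {X i -` A \<inter> space M |A. A \<in> sets borel}. prob (\<Inter> (A ` {..<n})) = (\<Prod>j<n. prob (A j))"
      proof
        fix A assume "A \<in> (\<Pi> i\<in>{..<n}. {X i -` A \<inter> space M |A. A \<in> sets borel})"
        then have "\<forall>i\<in>{..<n}. \<exists>B. B \<in> sets borel \<and> A i = X i -` B \<inter> space M" by (auto simp: Pi_iff) blast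
        from bchoice[OF this] obtain B0 where B0: "\<And>i. i < n \<Longrightarrow> B0 i \<in> sets borel" "\<And>i. i < n \<Longrightarrow> A i = X i -` B0 i \<inter> space M"
          by auto
        \<comment> \<open>\<open>claim\<close> asks for Borel sets at all indices, so those from n
          on receive the whole line.\<close>
        define B where "B i = (if i < n then B0 i else UNIV)" for i
        have B: "B i \<in> sets borel" "i < n \<Longrightarrow> A i = X i -` B i \<inter> space M" for i using B0 by (auto simp: B_def)
        note [measurable] = B(1)
        have "(\<integral>x. complex_of_real (\<Prod>i<n. indicator (B i) (X i x)) \<partial>M) = of_real (\<Prod>i<n. prob (X i -` B i \<inter> space M))"
          using claim[of n B "\<lambda>_. 0"] B by simp
        then have "(\<integral>x. (\<Prod>i<n. indicator (B i) (X i x)) \<partial>M) = (\<Prod>i<n. prob (X i -` B i \<inter> space M))"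
          unfolding integral_complex_of_real of_real_eq_iff .
        moreover have "(\<integral>x. (\<Prod>i<n. indicator (B i) (X i x) :: real) \<partial>M) = (\<integral>x. indicator (\<Inter>i\<in>{..<n}. A i) x \<partial>M)"
        proof (intro Bochner_Integration.integral_cong refl)
          fix x assume x: "x \<in> space M"
          show "(\<Prod>i<n. indicator (B i) (X i x)) = (indicator (\<Inter>i\<in>{..<n}. A i) x :: real)"
          proof (cases "\<forall>i<n. X i x \<in> B i")
            case True
            then show ?thesis using x by (auto simp: B(2) indicator_def intro!: prod.neutral)
          next
            case False
            then obtain i where i: "i < n" "X i x \<notin> B i" by auto
            then have "(\<Prod>i<n. indicator (B i) (X i x) :: real) = 0" by (intro prod_zero bexI[of _ i]) auto
            moreover have "x \<notin> (\<Inter>i\<in>{..<n}. A i)" using i B(2)[of i] by auto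
            ultimately show ?thesis by simp
          qed
        qed
        moreover have "(\<Inter>i\<in>{..<n}. A i) \<in> events" using False by (intro sets.finite_INT) (auto simp: B(2))
        ultimately show "prob (\<Inter> (A ` {..<n})) = (\<Prod>j<n. prob (A j))"
          by (simp add: B(2) Int_absorb2 sets.sets_into_space)
      qed
    next
      show "space M \<in> {X i -` A \<inter> space M |A. A \<in> sets borel}" for i by (intro CollectI exI[of _ UNIV]) auto
    qed (use False in auto)
    then show ?thesis unfolding indep_vars_def2 using rv by blast
  qed
qed

lemma product_coordinates_indep:
  assumes M: "\<And>i. i \<in> I \<Longrightarrow> prob_space (M i)"
  shows "prob_space.indep_vars (PiM I M) M (\<lambda>i x. x i) I"
proof -
  interpret P: prob_space "PiM I M" using M by (rule prob_space_PiM)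
  show ?thesis
  proof (cases "I = {}")
    case True
    then show ?thesis unfolding True P.indep_vars_def2[unfolded True] P.indep_sets_def[unfolded True] by auto
  next
    case False
    have "distr (PiM I M) (PiM I M) (\<lambda>x. \<lambda>i\<in>I. x i) = distr (PiM I M) (PiM I M) (\<lambda>x. x)"
      by (intro distr_cong refl) (auto simp: space_PiM extensional_restrict PiE_def)
    also have "\<dots> = PiM I M" by (rule distr_id)
    also have "\<dots> = PiM I (\<lambda>i. distr (PiM I M) (M i) (\<lambda>x. x i))"
    proof (intro PiM_cong refl)
      fix i assume i: "i \<in> I"
      \<comment> \<open>The interpretation demands a probability measure at every index, whereas M
        is controlled only on I. A point mass is put elsewhere; the product over I is the
        same.\<close>
      interpret M': product_prob_space "\<lambda>i. if i \<in> I then M i else count_space {undefined}" I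
        by (rule product_prob_spaceI) (use M in \<open>auto intro!: prob_spaceI simp: prob_space.emeasure_space_1\<close>)
      have "PiM I (\<lambda>i. if i \<in> I then M i else count_space {undefined}) = PiM I M" by (intro PiM_cong) auto
      then show "M i = distr (PiM I M) (M i) (\<lambda>x. x i)"
        using M'.PiM_component[OF i] i by simp
    qed
    finally show ?thesis
      by (subst P.indep_vars_iff_distr_eq_PiM'[OF False]) auto
  qed
qed

subsection \<open>Compound Poisson sums\<close>

lemma poisson_integral:
  fixes f :: "nat \<Rightarrow> 'b::{banach, second_countable_topology}"
  assumes "0 < w" and f: "\<And>n. norm (f n) \<le> B"
  shows "(\<lambda>n. (w ^ n / fact n * exp (-w)) *\<^sub>R f n) sums (\<integral>n. f n \<partial>measure_pmf (poisson_pmf w))"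
proof -
  have e: "(\<integral>n. f n \<partial>measure_pmf (poisson_pmf w)) = (\<integral>n. pmf (poisson_pmf w) n *\<^sub>R f n \<partial>count_space UNIV)"
    unfolding measure_pmf_eq_density by (intro integral_density) auto
  have i: "integrable (count_space UNIV) (\<lambda>n. pmf (poisson_pmf w) n *\<^sub>R f n)"
  proof -
    have "integrable (measure_pmf (poisson_pmf w)) f"
      using f by (intro measure_pmf.integrable_const_bound[where B=B]) auto
    then show ?thesis unfolding measure_pmf_eq_density by (subst (asm) integrable_density) auto
  qed
  show ?thesis using sums_integral_count_space_nat[OF i] assms(1) unfolding e by simp
qed

lemma poisson_generating_function:
  assumes "0 < w" "norm (z::complex) \<le> 1"
  shows "(\<integral>n. z ^ n \<partial>measure_pmf (poisson_pmf w)) = exp (of_real w * (z - 1))"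
proof -
  have "(\<lambda>n. (w ^ n / fact n * exp (-w)) *\<^sub>R z ^ n) sums (\<integral>n. z ^ n \<partial>measure_pmf (poisson_pmf w))"
    using assms by (intro poisson_integral[where B=1]) (auto simp: norm_power power_le_one)
  moreover have "(\<lambda>n. ((of_real w * z) ^ n /\<^sub>R fact n) * exp (of_real (-w))) sums (exp (of_real w * z) * exp (of_real (-w)))"
    by (intro sums_mult2 exp_converges)
  moreover have "((of_real w * z) ^ n /\<^sub>R fact n) * exp (of_real (-w)) = (w ^ n / fact n * exp (-w)) *\<^sub>R z ^ n" for n
    unfolding exp_of_real by (simp add: scaleR_conv_of_real power_mult_distrib field_simps)
  ultimately have "(\<integral>n. z ^ n \<partial>measure_pmf (poisson_pmf w)) = exp (of_real w * z) * exp (of_real (-w))"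
    using sums_unique2 by (simp only:) blast
  then show ?thesis by (simp add: exp_add[symmetric] right_diff_distrib exp_diff exp_minus field_simps)
qed

text \<open>A Poisson point process of total mass \<open>w\<close> with marks distributed as
  \<open>M\<close>, coded as a count and an infinite sequence of candidate marks.
  \<open>cell_sum\<close> reads only as many candidates as the count says, so the count and the
  marks are simply independent factors of a product.\<close>

definition poisson_cell :: "real \<Rightarrow> 'b measure \<Rightarrow> (nat \<times> (nat \<Rightarrow> 'b)) measure" where
  "poisson_cell w M = measure_pmf (poisson_pmf w) \<Otimes>\<^sub>M PiM UNIV (\<lambda>_. M)"

definition cell_sum :: "('b \<Rightarrow> 'c) \<Rightarrow> nat \<times> (nat \<Rightarrow> 'b) \<Rightarrow> 'c::comm_monoid_add" where
  "cell_sum g x = (\<Sum>l<fst x. g (snd x l))"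

lemma prob_space_poisson_cell: "prob_space M \<Longrightarrow> prob_space (poisson_cell w M)"
  unfolding poisson_cell_def
  by (intro prob_space_pair prob_space_PiM measure_pmf.prob_space_axioms)

lemma cell_sum_measurable [measurable]:
  fixes g :: "'b \<Rightarrow> 'c::{second_countable_topology, topological_comm_monoid_add}"
  assumes [measurable]: "g \<in> borel_measurable M"
  shows "cell_sum g \<in> borel_measurable (poisson_cell w M)"
proof -
  have eq: "cell_sum g = (\<lambda>x. (\<lambda>n y. \<Sum>l<n. g (y l)) (fst x) (snd x))" by (simp add: cell_sum_def fun_eq_iff)
  show ?thesis unfolding eq poisson_cell_def
    by (rule measurable_compose_countable[where g=fst]) measurable
qed

text \<open>Given the count n, the characteristic function is the n-th power of that of one mark;
  the generating function of the Poisson law turns these powers into an exponential.\<close>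

lemma poisson_cell_char:
  assumes "0 < w" "prob_space M" and [measurable]: "g \<in> borel_measurable M"
  shows "(\<integral>x. iexp (cell_sum g x) \<partial>poisson_cell w M) = exp (of_real w * ((\<integral>y. iexp (g y) \<partial>M) - 1))"
proof -
  interpret M: prob_space M by fact
  interpret PP: prob_space "PiM (UNIV :: nat set) (\<lambda>_. M)" by (rule prob_space_PiM) (rule assms(2))
  interpret P: product_prob_space "\<lambda>_. M" "UNIV :: nat set" ..
  interpret C: pair_prob_space "measure_pmf (poisson_pmf w)" "PiM (UNIV :: nat set) (\<lambda>_. M)" ..
  have pow: "(\<integral>y. iexp (\<Sum>l<n. g (y l)) \<partial>PiM (UNIV :: nat set) (\<lambda>_. M)) = (\<integral>y. iexp (g y) \<partial>M) ^ n" for n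
  proof -
    have "PP.indep_vars (\<lambda>_. M) (\<lambda>i x. x i) UNIV" by (rule product_coordinates_indep) (rule assms(2))
    then have "PP.indep_vars (\<lambda>_. M) (\<lambda>i x. x i) {..<n}" by (rule PP.indep_vars_subset) auto
    then have ind: "PP.indep_vars (\<lambda>_. borel) (\<lambda>i x. iexp (g (x i))) {..<n}"
      by (rule PP.indep_vars_compose2) measurable
    have "(\<integral>y. iexp (\<Sum>l<n. g (y l)) \<partial>PiM (UNIV :: nat set) (\<lambda>_. M)) =
        (\<integral>y. (\<Prod>l<n. iexp (g (y l))) \<partial>PiM (UNIV :: nat set) (\<lambda>_. M))"
      by (simp add: sum_distrib_left exp_sum)
    also have "\<dots> = (\<Prod>l<n. \<integral>y. iexp (g (y l)) \<partial>PiM (UNIV :: nat set) (\<lambda>_. M))"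
      by (rule PP.indep_vars_lebesgue_integral[OF _ ind]) (auto intro!: PP.integrable_iexp)
    also have "\<dots> = (\<Prod>l<n. \<integral>y. iexp (g y) \<partial>M)"
    proof (intro prod.cong refl)
      fix l
      have "(\<integral>y. iexp (g y) \<partial>M) = (\<integral>y. iexp (g y) \<partial>distr (PiM (UNIV :: nat set) (\<lambda>_. M)) M (\<lambda>x. x l))"
        by (simp add: P.PiM_component)
      also have "\<dots> = (\<integral>y. iexp (g (y l)) \<partial>PiM (UNIV :: nat set) (\<lambda>_. M))"
        by (intro integral_distr) measurable
      finally show "(\<integral>y. iexp (g (y l)) \<partial>PiM (UNIV :: nat set) (\<lambda>_. M)) = (\<integral>y. iexp (g y) \<partial>M)" ..
    qed
    finally show ?thesis by simp
  qed
  have [measurable]: "cell_sum g \<in> borel_measurable (measure_pmf (poisson_pmf w) \<Otimes>\<^sub>M PiM (UNIV :: nat set) (\<lambda>_. M))"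
    using cell_sum_measurable[of g M w] by (simp add: poisson_cell_def)
  have "(\<integral>x. iexp (cell_sum g x) \<partial>poisson_cell w M) =
     (\<integral>n. (\<integral>y. iexp (cell_sum g (n, y)) \<partial>PiM (UNIV :: nat set) (\<lambda>_. M)) \<partial>measure_pmf (poisson_pmf w))"
    unfolding poisson_cell_def by (intro C.integral_fst'[symmetric] C.integrable_iexp) auto
  also have "\<dots> = (\<integral>n. (\<integral>y. iexp (g y) \<partial>M) ^ n \<partial>measure_pmf (poisson_pmf w))"
    by (simp only: cell_sum_def fst_conv snd_conv pow)
  also have "\<dots> = exp (of_real w * ((\<integral>y. iexp (g y) \<partial>M) - 1))"
  proof (intro poisson_generating_function assms)
    have "norm (\<integral>y. iexp (g y) \<partial>M) \<le> (\<integral>y. norm (iexp (g y)) \<partial>M)" by (rule integral_norm_bound)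
    then show "norm (\<integral>y. iexp (g y) \<partial>M) \<le> 1" by (simp add: M.prob_space)
  qed
  finally show ?thesis .
qed

lemma poisson_sums_1:
  assumes "0 < w"
  shows "pmf (poisson_pmf w) sums 1"
proof -
  have "(\<lambda>n. (w ^ n / fact n * exp (-w)) *\<^sub>R (1::real)) = pmf (poisson_pmf w)"
    using assms by (simp add: fun_eq_iff)
  then show ?thesis using poisson_integral[OF assms, of "\<lambda>_. 1 :: real" 1] by simp
qed

lemma pmf_poisson_Suc: "0 < w \<Longrightarrow> pmf (poisson_pmf w) (Suc n) * real (Suc n) = w * pmf (poisson_pmf w) n"
  by (simp add: field_simps del: of_nat_Suc)

lemma poisson_mean:
  assumes "0 < w"
  shows "(\<lambda>n. pmf (poisson_pmf w) n * real n) sums w"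
proof -
  have "(\<lambda>n. pmf (poisson_pmf w) (Suc n) * real (Suc n)) sums (w * 1)"
    unfolding pmf_poisson_Suc[OF assms] by (intro sums_mult poisson_sums_1 assms)
  from sums_Suc[OF this] show ?thesis by simp
qed

text \<open>For the upper tail bound of the one-sided law: a sum of n jumps exceeds z only if one of
  them exceeds z / n, and the union bound then costs at most a factor n squared.\<close>

lemma poisson_second_moment:
  assumes "0 < w"
  shows "(\<lambda>n. pmf (poisson_pmf w) n * (real n)\<^sup>2) sums (w * (w + 1))"
proof -
  have "pmf (poisson_pmf w) (Suc n) * (real (Suc n))\<^sup>2 =
      w * (pmf (poisson_pmf w) n * real n + pmf (poisson_pmf w) n)" for n
    using pmf_poisson_Suc[OF assms, of n] by (simp only: power2_eq_square mult.assoc[symmetric]) (simp add: algebra_simps)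
  moreover have "(\<lambda>n. w * (pmf (poisson_pmf w) n * real n + pmf (poisson_pmf w) n)) sums (w * (w + 1))"
    by (intro sums_mult sums_add poisson_mean poisson_sums_1 assms)
  ultimately have "(\<lambda>n. pmf (poisson_pmf w) (Suc n) * (real (Suc n))\<^sup>2) sums (w * (w + 1))" by simp
  from sums_Suc[OF this] show ?thesis by simp
qed

lemma nn_integral_poisson:
  assumes "(\<lambda>n. pmf (poisson_pmf w) n * f n) sums s" "\<And>n. 0 \<le> f n" "0 < w"
  shows "(\<integral>\<^sup>+n. ennreal (f n) \<partial>measure_pmf (poisson_pmf w)) = ennreal s"
proof -
  have "(\<integral>\<^sup>+n. ennreal (f n) \<partial>measure_pmf (poisson_pmf w)) = (\<Sum>n. ennreal (pmf (poisson_pmf w) n * f n))"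
    by (simp add: nn_integral_measure_pmf nn_integral_count_space_nat ennreal_mult')
  also have "\<dots> = ennreal s" using assms by (intro suminf_ennreal_eq) auto
  finally show ?thesis .
qed

lemma nn_integral_PiM_component:
  assumes "\<And>i. i \<in> I \<Longrightarrow> prob_space (M i)" "i \<in> I" and [measurable]: "f \<in> borel_measurable (M i)"
  shows "(\<integral>\<^sup>+x. f (x i) \<partial>PiM I M) = (\<integral>\<^sup>+x. f x \<partial>M i)"
    and "distr (PiM I M) (M i) (\<lambda>x. x i) = M i"
proof -
  interpret M': product_prob_space "\<lambda>i. if i \<in> I then M i else count_space {undefined}" I
    by (rule product_prob_spaceI) (use assms in \<open>auto intro!: prob_spaceI simp: prob_space.emeasure_space_1\<close>)
  have "PiM I (\<lambda>i. if i \<in> I then M i else count_space {undefined}) = PiM I M" by (intro PiM_cong) auto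
  then show d: "distr (PiM I M) (M i) (\<lambda>x. x i) = M i"
    using M'.PiM_component[OF assms(2)] assms(2) by simp
  have "(\<integral>\<^sup>+x. f (x i) \<partial>PiM I M) = (\<integral>\<^sup>+x. f x \<partial>distr (PiM I M) (M i) (\<lambda>x. x i))"
    using assms(2) by (intro nn_integral_distr[symmetric]) auto
  then show "(\<integral>\<^sup>+x. f (x i) \<partial>PiM I M) = (\<integral>\<^sup>+x. f x \<partial>M i)" by (simp add: d)
qed

text \<open>Campbell's formula: condition on the count and insert its mean.\<close>

lemma nn_integral_cell_sum:
  fixes g :: "'b \<Rightarrow> real"
  assumes "0 < w" "prob_space M" and [measurable]: "g \<in> borel_measurable M" and g: "\<And>y. 0 \<le> g y"
  shows "(\<integral>\<^sup>+x. ennreal (cell_sum g x) \<partial>poisson_cell w M) = ennreal w * (\<integral>\<^sup>+y. ennreal (g y) \<partial>M)"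
proof -
  interpret PP: prob_space "PiM (UNIV :: nat set) (\<lambda>_. M)" by (rule prob_space_PiM) (rule assms(2))
  have [measurable]: "cell_sum g \<in> borel_measurable (measure_pmf (poisson_pmf w) \<Otimes>\<^sub>M PiM (UNIV :: nat set) (\<lambda>_. M))"
    using cell_sum_measurable[of g M w] by (simp add: poisson_cell_def)
  have "(\<integral>\<^sup>+x. ennreal (cell_sum g x) \<partial>poisson_cell w M) =
     (\<integral>\<^sup>+n. (\<integral>\<^sup>+y. ennreal (cell_sum g (n, y)) \<partial>PiM (UNIV :: nat set) (\<lambda>_. M)) \<partial>measure_pmf (poisson_pmf w))"
    unfolding poisson_cell_def by (intro PP.nn_integral_fst[symmetric]) measurable
  also have "\<dots> = (\<integral>\<^sup>+n. (\<integral>\<^sup>+y. ennreal (g y) \<partial>M) * ennreal (real n) \<partial>measure_pmf (poisson_pmf w))"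
  proof (intro nn_integral_cong)
    fix n
    have "(\<integral>\<^sup>+y. ennreal (cell_sum g (n, y)) \<partial>PiM (UNIV :: nat set) (\<lambda>_. M)) =
      (\<Sum>l<n. \<integral>\<^sup>+y. ennreal (g (y l)) \<partial>PiM (UNIV :: nat set) (\<lambda>_. M))"
      using g by (simp add: cell_sum_def sum_ennreal[symmetric] nn_integral_sum del: sum_ennreal)
    also have "\<dots> = (\<Sum>l<n. \<integral>\<^sup>+y. ennreal (g y) \<partial>M)"
      by (intro sum.cong refl nn_integral_PiM_component) (auto intro: assms)
    finally show "(\<integral>\<^sup>+y. ennreal (cell_sum g (n, y)) \<partial>PiM (UNIV :: nat set) (\<lambda>_. M)) = (\<integral>\<^sup>+y. ennreal (g y) \<partial>M) * ennreal (real n)"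
      by (simp add: mult.commute ennreal_of_nat_eq_real_of_nat)
  qed
  also have "\<dots> = (\<integral>\<^sup>+y. ennreal (g y) \<partial>M) * (\<integral>\<^sup>+n. ennreal (real n) \<partial>measure_pmf (poisson_pmf w))"
    by (intro nn_integral_cmult) auto
  also have "(\<integral>\<^sup>+n. ennreal (real n) \<partial>measure_pmf (poisson_pmf w)) = ennreal w"
    using assms(1) by (intro nn_integral_poisson poisson_mean) auto
  finally show ?thesis by (simp add: mult.commute)
qed

lemma increasing_steps_mono:
  fixes ts :: "nat \<Rightarrow> real"
  shows "(\<And>j. j < n \<Longrightarrow> ts j < ts (Suc j)) \<Longrightarrow> i \<le> j \<Longrightarrow> j \<le> n \<Longrightarrow> ts i \<le> ts j"
proof (induction j)
  case (Suc j)
  show ?case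
  proof (cases "i = Suc j")
    case False
    have "ts j < ts (Suc j)" using Suc.prems by simp
    moreover have "ts i \<le> ts j" using Suc False by simp
    ultimately show ?thesis by simp
  qed simp
qed auto

subsection \<open>Processes given by a series of compound Poisson processes\<close>

text \<open>Cell i carries Poisson many jumps with sizes \<open>J i\<close>. Cell 0 holds the large
  jumps, which have no mean for \<alpha> < 1 but are finite in number; the cells
  \<open>Suc i\<close> have summable mean absolute sizes. So the series converges absolutely almost
  surely and no compensation is required.\<close>

locale compound_series = K: prob_space K for K :: "'k measure" +
  fixes w :: real and J :: "nat \<Rightarrow> 'k \<Rightarrow> real"
  assumes w_pos: "0 < w"
    and J_measurable [measurable]: "\<And>i. J i \<in> borel_measurable K"
    and J_integrable: "\<And>i. integrable K (J (Suc i))"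
    and J_summable: "summable (\<lambda>i. \<integral>y. \<bar>J (Suc i) y\<bar> \<partial>K)"
begin

definition unif :: "real measure" where "unif = uniform_measure lborel {0..1}"

definition marks :: "(real \<times> 'k) measure" where "marks = unif \<Otimes>\<^sub>M K"

definition cells :: "(nat \<Rightarrow> nat \<times> (nat \<Rightarrow> real \<times> 'k)) measure" where
  "cells = PiM UNIV (\<lambda>_. poisson_cell w marks)"

text \<open>The condition \<open>0 < fst p\<close> makes the process vanish at time 0 at every
  sample point, not merely almost surely.\<close>

definition jump :: "nat \<Rightarrow> real \<Rightarrow> real \<times> 'k \<Rightarrow> real" where
  "jump i t p = (if 0 < fst p \<and> fst p \<le> t then J i (snd p) else 0)"

definition absj :: "nat \<Rightarrow> real \<times> 'k \<Rightarrow> real" where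
  "absj i p = \<bar>J i (snd p)\<bar>"

definition good :: "(nat \<Rightarrow> nat \<times> (nat \<Rightarrow> real \<times> 'k)) \<Rightarrow> bool" where
  "good x \<longleftrightarrow> (\<Sum>i. ennreal (cell_sum (absj i) (x i))) < top"

text \<open>The value 0 where absolute summability fails makes every path cadlag, as the definition
  of a Levy motion demands of all sample points.\<close>

definition L :: "real \<Rightarrow> (nat \<Rightarrow> nat \<times> (nat \<Rightarrow> real \<times> 'k)) \<Rightarrow> real" where
  "L t x = (if good x then \<Sum>i. cell_sum (jump i t) (x i) else 0)"

lemma sets_unif [measurable_cong]: "sets unif = sets borel"
  by (simp add: unif_def)

lemma space_unif [simp]: "space unif = UNIV"
  by (simp add: unif_def)

sublocale unif: prob_space unif
  unfolding unif_def by (rule prob_space_uniform_measure) auto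

sublocale marks: prob_space marks
  unfolding marks_def by (intro prob_space_pair unif.prob_space_axioms K.prob_space_axioms)

sublocale cell: prob_space "poisson_cell w marks"
  by (rule prob_space_poisson_cell) (rule marks.prob_space_axioms)

sublocale cells: prob_space cells
  unfolding cells_def by (rule prob_space_PiM) (rule cell.prob_space_axioms)

lemma jump_measurable [measurable]: "jump i t \<in> borel_measurable marks"
  unfolding jump_def[abs_def] marks_def by measurable

lemma absj_measurable [measurable]: "absj i \<in> borel_measurable marks"
  unfolding absj_def[abs_def] marks_def by measurable

lemma component_measurable [measurable]: "(\<lambda>x. x i) \<in> cells \<rightarrow>\<^sub>M poisson_cell w marks"
  unfolding cells_def by measurable

lemma good_measurable [measurable]: "Measurable.pred cells good"
  unfolding good_def[abs_def] by measurable

lemma L_measurable [measurable]: "L t \<in> borel_measurable cells"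
  unfolding L_def[abs_def] by measurable

lemma absj_nonneg: "0 \<le> absj i p" "0 \<le> cell_sum (absj i) x"
  by (auto simp: absj_def cell_sum_def intro!: sum_nonneg)

lemma nn_integral_cells_component:
  assumes [measurable]: "f \<in> borel_measurable (poisson_cell w marks)"
  shows "(\<integral>\<^sup>+x. f (x i) \<partial>cells) = (\<integral>\<^sup>+x. f x \<partial>poisson_cell w marks)"
  unfolding cells_def by (rule nn_integral_PiM_component) (auto intro: cell.prob_space_axioms)

lemma nn_integral_absj: "(\<integral>\<^sup>+x. ennreal (cell_sum (absj i) (x i)) \<partial>cells) = ennreal w * (\<integral>\<^sup>+y. ennreal \<bar>J i y\<bar> \<partial>K)"
proof -
  have "(\<integral>\<^sup>+x. ennreal (cell_sum (absj i) (x i)) \<partial>cells) = (\<integral>\<^sup>+x. ennreal (cell_sum (absj i) x) \<partial>poisson_cell w marks)"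
    by (rule nn_integral_cells_component[of "\<lambda>x. ennreal (cell_sum (absj i) x)"]) measurable
  also have "\<dots> = ennreal w * (\<integral>\<^sup>+p. ennreal (absj i p) \<partial>marks)"
    by (rule nn_integral_cell_sum) (auto intro: w_pos marks.prob_space_axioms absj_nonneg)
  also have "(\<integral>\<^sup>+p. ennreal (absj i p) \<partial>marks) = (\<integral>\<^sup>+u. (\<integral>\<^sup>+y. ennreal \<bar>J i y\<bar> \<partial>K) \<partial>unif)"
    unfolding marks_def by (subst K.nn_integral_fst[symmetric]) (auto simp: absj_def)
  also have "\<dots> = (\<integral>\<^sup>+y. ennreal \<bar>J i y\<bar> \<partial>K)" using unif.emeasure_space_1 by simp
  finally show ?thesis .
qed

lemma nn_integral_tail:
  "(\<integral>\<^sup>+x. (\<Sum>i. ennreal (cell_sum (absj (Suc i)) (x (Suc i)))) \<partial>cells) = ennreal (w * (\<Sum>i. \<integral>y. \<bar>J (Suc i) y\<bar> \<partial>K))"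
proof -
  have "(\<integral>\<^sup>+x. (\<Sum>i. ennreal (cell_sum (absj (Suc i)) (x (Suc i)))) \<partial>cells) =
      (\<Sum>i. ennreal w * (\<integral>\<^sup>+y. ennreal \<bar>J (Suc i) y\<bar> \<partial>K))"
    by (subst nn_integral_suminf) (auto simp: nn_integral_absj)
  also have "\<dots> = (\<Sum>i. ennreal (w * (\<integral>y. \<bar>J (Suc i) y\<bar> \<partial>K)))"
    using J_integrable w_pos by (simp add: nn_integral_eq_integral ennreal_mult)
  also have "\<dots> = ennreal (w * (\<Sum>i. \<integral>y. \<bar>J (Suc i) y\<bar> \<partial>K))"
    using w_pos J_summable by (intro suminf_ennreal_eq sums_mult summable_sums) auto
  finally show ?thesis .
qed

lemma good_iff_tail: "good x \<longleftrightarrow> (\<Sum>i. ennreal (cell_sum (absj (Suc i)) (x (Suc i)))) < top"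
  using suminf_offset[of "\<lambda>i. ennreal (cell_sum (absj i) (x i))" 1] by (simp add: good_def)

lemma AE_good: "AE x in cells. good x"
proof -
  have "AE x in cells. (\<Sum>i. ennreal (cell_sum (absj (Suc i)) (x (Suc i)))) \<noteq> \<infinity>"
    by (rule nn_integral_PInf_AE) (auto simp: nn_integral_tail)
  then show ?thesis by eventually_elim (simp add: good_iff_tail less_top)
qed

lemma good_summable:
  assumes "good x"
  shows "summable (\<lambda>i. cell_sum (absj i) (x i))"
  using assms unfolding good_def by (intro summable_suminf_not_top absj_nonneg) auto

lemma cell_sum_jump_le: "\<bar>cell_sum (jump i t) y\<bar> \<le> cell_sum (absj i) y"
  unfolding cell_sum_def by (rule order_trans[OF sum_abs]) (auto intro!: sum_mono simp: jump_def absj_def)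

lemma summable_jump: "good x \<Longrightarrow> summable (\<lambda>i. cell_sum (jump i t) (x i))"
  by (rule summable_comparison_test'[OF good_summable]) (auto intro: cell_sum_jump_le)

lemma L_0: "L 0 x = 0"
proof -
  have "cell_sum (jump i 0) (x i) = 0" for i by (auto simp: cell_sum_def jump_def intro!: sum.neutral)
  then show ?thesis by (simp add: L_def)
qed

text \<open>Tannery's theorem with the majorant \<open>absj\<close>, which does not depend on t,
  carries limits of single jumps through the series. One-sided limits of the paths therefore reduce
  to those of an indicator of the jump time.\<close>

lemma L_limit:
  assumes F: "F \<noteq> bot" and lim: "\<And>i p. ((\<lambda>t. jump i t p) \<longlongrightarrow> l i p) F" and x: "good x"
  shows "((\<lambda>t. L t x) \<longlongrightarrow> (\<Sum>i. cell_sum (l i) (x i))) F"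
proof -
  have "((\<lambda>t. \<Sum>i. cell_sum (jump i t) (x i)) \<longlongrightarrow> (\<Sum>i. cell_sum (l i) (x i))) F"
  proof (rule tannerys_theorem[THEN conjunct2, THEN conjunct2, OF _ _ good_summable[OF x] F])
    show "((\<lambda>t. cell_sum (jump i t) (x i)) \<longlongrightarrow> cell_sum (l i) (x i)) F" for i
      unfolding cell_sum_def by (intro tendsto_sum lim)
    show "\<forall>\<^sub>F (i, t) in at_top \<times>\<^sub>F F. norm (cell_sum (jump i t) (x i)) \<le> cell_sum (absj i) (x i)"
      by (intro always_eventually) (auto intro: cell_sum_jump_le)
  qed
  then show ?thesis using x by (simp add: L_def)
qed

lemma cadlag_L: "cadlag (\<lambda>t. L t x)"
proof (cases "good x")
  case False
  then have "(\<lambda>t. L t x) = (\<lambda>_. 0)" by (simp add: L_def fun_eq_iff)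
  then show ?thesis by (simp add: cadlag_const)
next
  case True
  show ?thesis unfolding cadlag_def
  proof safe
    fix t :: real
    have "((\<lambda>s. jump i s p) \<longlongrightarrow> jump i t p) (at_right t)" for i p
    proof (rule Lim_transform_eventually[OF tendsto_const])
      show "eventually (\<lambda>s. jump i t p = jump i s p) (at_right t)"
        unfolding eventually_at_right_field
        by (rule exI[of _ "if fst p \<le> t then t + 1 else fst p"]) (auto simp: jump_def)
    qed
    from L_limit[OF _ this True] have "((\<lambda>t. L t x) \<longlongrightarrow> (\<Sum>i. cell_sum (jump i t) (x i))) (at_right t)" by simp
    then show "((\<lambda>t. L t x) \<longlongrightarrow> L t x) (at_right t)" using True by (simp add: L_def)
  next
    fix t :: real
    have "((\<lambda>s. jump i s p) \<longlongrightarrow> (if 0 < fst p \<and> fst p < t then J i (snd p) else 0)) (at_left t)" for i p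
    proof (rule Lim_transform_eventually[OF tendsto_const])
      show "eventually (\<lambda>s. (if 0 < fst p \<and> fst p < t then J i (snd p) else 0) = jump i s p) (at_left t)"
        unfolding eventually_at_left_field
        by (rule exI[of _ "if fst p < t then fst p else t - 1"]) (auto simp: jump_def)
    qed
    from L_limit[OF _ this True] show "\<exists>l. ((\<lambda>t. L t x) \<longlongrightarrow> l) (at_left t)" by auto
  qed
qed

text \<open>The Levy-Khintchine exponent at time 1 without compensator, cut into cells of intensity
  \<open>w\<close>. Outside cell 0 its terms are summable because the modulus of
  \<open>iexp x - 1\<close> is at most that of x.\<close>

definition exponent :: "real \<Rightarrow> complex" where
  "exponent \<theta> = of_real w * (\<Sum>i. (\<integral>y. iexp (\<theta> * J i y) \<partial>K) - 1)"

lemma summable_exponent: "summable (\<lambda>i. (\<integral>y. iexp (\<theta> * J i y) \<partial>K) - 1)"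
proof (subst summable_Suc_iff[symmetric], rule summable_comparison_test')
  show "summable (\<lambda>i. \<bar>\<theta>\<bar> * (\<integral>y. \<bar>J (Suc i) y\<bar> \<partial>K))" by (intro summable_mult J_summable)
  fix i
  have "(\<integral>y. iexp (\<theta> * J (Suc i) y) \<partial>K) - 1 = (\<integral>y. iexp (\<theta> * J (Suc i) y) - 1 \<partial>K)"
    by (subst Bochner_Integration.integral_diff) (auto simp: K.prob_space intro!: K.integrable_iexp)
  also have "norm \<dots> \<le> (\<integral>y. norm (iexp (\<theta> * J (Suc i) y) - 1) \<partial>K)" by (rule integral_norm_bound)
  also have "\<dots> \<le> (\<integral>y. \<bar>\<theta>\<bar> * \<bar>J (Suc i) y\<bar> \<partial>K)"
  proof (rule integral_mono)
    show "integrable K (\<lambda>y. norm (iexp (\<theta> * J (Suc i) y) - 1))"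
      by (intro integrable_norm Bochner_Integration.integrable_diff K.integrable_iexp) auto
    show "integrable K (\<lambda>y. \<bar>\<theta>\<bar> * \<bar>J (Suc i) y\<bar>)" using J_integrable by auto
    show "norm (iexp (\<theta> * J (Suc i) y) - 1) \<le> \<bar>\<theta>\<bar> * \<bar>J (Suc i) y\<bar>" for y
      using iexp_approx1[of "\<theta> * J (Suc i) y" 0] by (simp add: abs_mult)
  qed
  finally show "norm ((\<integral>y. iexp (\<theta> * J (Suc i) y) \<partial>K) - 1) \<le> \<bar>\<theta>\<bar> * (\<integral>y. \<bar>J (Suc i) y\<bar> \<partial>K)" by simp
qed

text \<open>A linear combination of increments is again a sum over marks, with mark function
  \<open>g\<close>, so each cell contributes the exponential of \<open>poisson_cell_char\<close>.
  The time of a mark lies in at most one of the intervals, hence \<open>iexp (g i p) - 1\<close>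
  splits into a sum over intervals and the exponents add up: independence of the increments in
  Fourier form.\<close>

lemma L_joint_char:
  fixes ts :: "nat \<Rightarrow> real"
  assumes ts: "0 \<le> ts 0" "ts n \<le> 1" "\<And>j. j < n \<Longrightarrow> ts j < ts (Suc j)"
  shows "(\<integral>x. iexp (\<Sum>j<n. \<theta> j * (L (ts (Suc j)) x - L (ts j) x)) \<partial>cells) =
     exp (\<Sum>j<n. of_real (ts (Suc j) - ts j) * exponent (\<theta> j))"
proof -
  have mono: "i \<le> j \<Longrightarrow> j \<le> n \<Longrightarrow> ts i \<le> ts j" for i j
    by (rule increasing_steps_mono[of n]) (auto intro: ts(3))
  have pos: "0 \<le> ts j" if "j \<le> n" for j using mono[of 0 j] ts(1) that by simp
  define g where "g i p = (\<Sum>j<n. \<theta> j * (jump i (ts (Suc j)) p - jump i (ts j) p))" for i p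
  have g_meas [measurable]: "g i \<in> borel_measurable marks" for i unfolding g_def[abs_def] by measurable
  have g_eq: "g i p = (\<Sum>j<n. indicator {ts j<..ts (Suc j)} (fst p) * (\<theta> j * J i (snd p)))" for i p
    unfolding g_def
  proof (intro sum.cong refl)
    fix j assume j: "j \<in> {..<n}"
    then show "\<theta> j * (jump i (ts (Suc j)) p - jump i (ts j) p) = indicator {ts j<..ts (Suc j)} (fst p) * (\<theta> j * J i (snd p))"
      using pos[of j] ts(3)[of j] by (auto simp: jump_def indicator_def)
  qed
  define Z where "Z m x = (\<Sum>i<m. cell_sum (g i) (x i))" for m and x :: "nat \<Rightarrow> nat \<times> (nat \<Rightarrow> real \<times> 'k)"
  have Z_lim: "(\<lambda>m. Z m x) \<longlonglongrightarrow> (\<Sum>j<n. \<theta> j * (L (ts (Suc j)) x - L (ts j) x))" if x: "good x" for x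
  proof -
    have "(\<lambda>m. \<Sum>j<n. \<theta> j * ((\<Sum>i<m. cell_sum (jump i (ts (Suc j))) (x i)) - (\<Sum>i<m. cell_sum (jump i (ts j)) (x i))))
      \<longlonglongrightarrow> (\<Sum>j<n. \<theta> j * (L (ts (Suc j)) x - L (ts j) x))"
      using x by (intro tendsto_sum tendsto_mult tendsto_const tendsto_diff)
        (auto simp: L_def intro!: summable_LIMSEQ summable_jump)
    moreover have "(\<Sum>j<n. \<theta> j * ((\<Sum>i<m. cell_sum (jump i (ts (Suc j))) (x i)) - (\<Sum>i<m. cell_sum (jump i (ts j)) (x i)))) = Z m x" for m
    proof -
      have "cell_sum (g i) y = (\<Sum>j<n. \<theta> j * (cell_sum (jump i (ts (Suc j))) y - cell_sum (jump i (ts j)) y))" for i y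
        unfolding cell_sum_def g_def
        by (subst sum.swap) (simp add: sum_distrib_left sum_subtractf right_diff_distrib)
      then show ?thesis
        unfolding Z_def sum_subtractf[symmetric] sum_distrib_left by (simp add: sum.swap[of _ "{..<n}"])
    qed
    ultimately show ?thesis by simp
  qed
  have Z_meas [measurable]: "Z m \<in> borel_measurable cells" for m unfolding Z_def[abs_def] by measurable
  have lim1: "(\<lambda>m. \<integral>x. iexp (Z m x) \<partial>cells) \<longlonglongrightarrow> (\<integral>x. iexp (\<Sum>j<n. \<theta> j * (L (ts (Suc j)) x - L (ts j) x)) \<partial>cells)"
  proof (rule integral_dominated_convergence[where w="\<lambda>_. 1"])
    show "AE x in cells. (\<lambda>m. iexp (Z m x)) \<longlonglongrightarrow> iexp (\<Sum>j<n. \<theta> j * (L (ts (Suc j)) x - L (ts j) x))"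
      using AE_good by eventually_elim (intro tendsto_exp tendsto_mult tendsto_const tendsto_of_real Z_lim)
  qed auto
  have ind: "cells.indep_vars (\<lambda>_. poisson_cell w marks) (\<lambda>i x. x i) UNIV"
    unfolding cells_def by (rule product_coordinates_indep) (rule cell.prob_space_axioms)
  have cell_char: "(\<integral>x. iexp (cell_sum (g i) (x i)) \<partial>cells) =
     exp (of_real w * (\<Sum>j<n. of_real (ts (Suc j) - ts j) * ((\<integral>y. iexp (\<theta> j * J i y) \<partial>K) - 1)))" for i
  proof -
    have "(\<integral>x. iexp (cell_sum (g i) (x i)) \<partial>cells) = (\<integral>x. iexp (cell_sum (g i) x) \<partial>distr cells (poisson_cell w marks) (\<lambda>x. x i))"
      by (intro integral_distr[symmetric]) measurable
    also have "distr cells (poisson_cell w marks) (\<lambda>x. x i) = poisson_cell w marks"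
      unfolding cells_def by (rule nn_integral_PiM_component(2)[where f="\<lambda>_. 0"]) (auto intro: cell.prob_space_axioms)
    also have "(\<integral>x. iexp (cell_sum (g i) x) \<partial>poisson_cell w marks) = exp (of_real w * ((\<integral>p. iexp (g i p) \<partial>marks) - 1))"
      by (intro poisson_cell_char w_pos marks.prob_space_axioms g_meas)
    also have "(\<integral>p. iexp (g i p) \<partial>marks) - 1 = (\<integral>p. iexp (g i p) - 1 \<partial>marks)"
      by (subst Bochner_Integration.integral_diff) (auto simp: marks.prob_space intro!: marks.integrable_iexp)
    also have "\<dots> = (\<integral>p. (\<Sum>j<n. indicator {ts j<..ts (Suc j)} (fst p) *\<^sub>R (iexp (\<theta> j * J i (snd p)) - 1)) \<partial>marks)"
    proof (intro Bochner_Integration.integral_cong refl)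
      fix p :: "real \<times> 'k"
      show "iexp (g i p) - 1 = (\<Sum>j<n. indicator {ts j<..ts (Suc j)} (fst p) *\<^sub>R (iexp (\<theta> j * J i (snd p)) - 1))"
      proof (cases "\<exists>j<n. fst p \<in> {ts j<..ts (Suc j)}")
        case True
        then obtain j where j: "j < n" "fst p \<in> {ts j<..ts (Suc j)}" by auto
        have other: "indicator {ts k<..ts (Suc k)} (fst p) = (0::real)" if "k < n" "k \<noteq> j" for k
        proof (cases "k < j")
          case True
          then have "ts (Suc k) \<le> ts j" using mono[of "Suc k" j] j by simp
          then show ?thesis using j by auto
        next
          case False
          then have "ts (Suc j) \<le> ts k" using mono[of "Suc j" k] that by simp
          then show ?thesis using j by auto
        qed
        have split: "(\<Sum>k<n. indicator {ts k<..ts (Suc k)} (fst p) *\<^sub>R f k) = f j" for f :: "nat \<Rightarrow> 'v::real_vector"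
        proof -
          have "(\<Sum>k<n. indicator {ts k<..ts (Suc k)} (fst p) *\<^sub>R f k) = (\<Sum>k<n. if k = j then f j else 0)"
            using j other by (intro sum.cong refl) auto
          then show ?thesis using j by simp
        qed
        show ?thesis unfolding g_eq split using split[of "\<lambda>k. \<theta> k * J i (snd p)"] by simp
      next
        case False
        then have "indicator {ts k<..ts (Suc k)} (fst p) = (0::real)" if "k < n" for k using that by auto
        then show ?thesis unfolding g_eq by simp
      qed
    qed
    also have "\<dots> = (\<Sum>j<n. \<integral>p. indicator {ts j<..ts (Suc j)} (fst p) *\<^sub>R (iexp (\<theta> j * J i (snd p)) - 1) \<partial>marks)"
    proof (intro Bochner_Integration.integral_sum)
      fix j
      have "norm (iexp r - 1) \<le> 2" for r using norm_triangle_ineq4[of "iexp r" 1] by simp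
      then show "integrable marks (\<lambda>p. indicator {ts j<..ts (Suc j)} (fst p) *\<^sub>R (iexp (\<theta> j * J i (snd p)) - 1))"
        unfolding marks_def
        by (intro finite_measure.integrable_const_bound[where B=2] marks.finite_measure_axioms[unfolded marks_def])
          (auto simp: indicator_def simp del: of_real_mult)
    qed
    also have "\<dots> = (\<Sum>j<n. of_real (ts (Suc j) - ts j) * ((\<integral>y. iexp (\<theta> j * J i y) \<partial>K) - 1))"
    proof (intro sum.cong refl)
      fix j assume j: "j \<in> {..<n}"
      interpret MM: pair_prob_space unif K ..
      have b: "norm (iexp r - 1) \<le> 2" for r using norm_triangle_ineq4[of "iexp r" 1] by simp
      have "(\<integral>p. indicator {ts j<..ts (Suc j)} (fst p) *\<^sub>R (iexp (\<theta> j * J i (snd p)) - 1) \<partial>marks) =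
        (\<integral>u. (\<integral>y. indicator {ts j<..ts (Suc j)} u *\<^sub>R (iexp (\<theta> j * J i y) - 1) \<partial>K) \<partial>unif)"
        unfolding marks_def
        by (subst MM.integral_fst'[symmetric], rule MM.integrable_const_bound[where B=2])
          (auto simp: indicator_def b simp del: of_real_mult)
      also have "\<dots> = (\<integral>u. indicator {ts j<..ts (Suc j)} u *\<^sub>R ((\<integral>y. iexp (\<theta> j * J i y) \<partial>K) - 1) \<partial>unif)"
        by (subst Bochner_Integration.integral_scaleR_right, subst Bochner_Integration.integral_diff)
          (auto simp: K.prob_space intro!: K.integrable_iexp)
      also have "\<dots> = measure unif {ts j<..ts (Suc j)} *\<^sub>R ((\<integral>y. iexp (\<theta> j * J i y) \<partial>K) - 1)"
        by (subst Bochner_Integration.integral_scaleR_left)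
          (auto intro!: integrable_real_indicator simp: unif.emeasure_eq_measure)
      also have "measure unif {ts j<..ts (Suc j)} = ts (Suc j) - ts j"
      proof -
        have "{0..1} \<inter> {ts j<..ts (Suc j)} = {ts j<..ts (Suc j)}"
          using pos[of j] mono[of "Suc j" n] j ts(2) by auto
        then have "emeasure unif {ts j<..ts (Suc j)} = ennreal (ts (Suc j) - ts j)"
          using ts(3)[of j] j divide_ennreal[of "ts (Suc j) - ts j" 1]
          unfolding unif_def by (subst emeasure_uniform_measure) auto
        then show ?thesis using ts(3)[of j] j by (simp add: measure_def)
      qed
      finally show "(\<integral>p. indicator {ts j<..ts (Suc j)} (fst p) *\<^sub>R (iexp (\<theta> j * J i (snd p)) - 1) \<partial>marks) =
         of_real (ts (Suc j) - ts j) * ((\<integral>y. iexp (\<theta> j * J i y) \<partial>K) - 1)"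
        by (simp add: scaleR_conv_of_real)
    qed
    finally show ?thesis .
  qed
  have "(\<integral>x. iexp (Z m x) \<partial>cells) =
     exp (\<Sum>i<m. of_real w * (\<Sum>j<n. of_real (ts (Suc j) - ts j) * ((\<integral>y. iexp (\<theta> j * J i y) \<partial>K) - 1)))" for m
  proof -
    have "cells.indep_vars (\<lambda>_. poisson_cell w marks) (\<lambda>i x. x i) {..<m}"
      by (rule cells.indep_vars_subset[OF ind]) auto
    then have ind: "cells.indep_vars (\<lambda>_. borel) (\<lambda>i x. iexp (cell_sum (g i) (x i))) {..<m}"
      by (rule cells.indep_vars_compose2) measurable
    have "(\<integral>x. iexp (Z m x) \<partial>cells) = (\<integral>x. (\<Prod>i<m. iexp (cell_sum (g i) (x i))) \<partial>cells)"
      by (simp add: Z_def sum_distrib_left exp_sum)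
    also have "\<dots> = (\<Prod>i<m. \<integral>x. iexp (cell_sum (g i) (x i)) \<partial>cells)"
      by (rule cells.indep_vars_lebesgue_integral[OF _ ind]) (auto intro!: cells.integrable_iexp)
    finally show ?thesis by (simp add: cell_char exp_sum)
  qed
  moreover have "(\<lambda>m. exp (\<Sum>i<m. of_real w * (\<Sum>j<n. of_real (ts (Suc j) - ts j) * ((\<integral>y. iexp (\<theta> j * J i y) \<partial>K) - 1))))
     \<longlonglongrightarrow> exp (\<Sum>j<n. of_real (ts (Suc j) - ts j) * exponent (\<theta> j))"
  proof (rule tendsto_exp)
    have "(\<lambda>m. \<Sum>j<n. of_real (ts (Suc j) - ts j) * (of_real w * (\<Sum>i<m. (\<integral>y. iexp (\<theta> j * J i y) \<partial>K) - 1)))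
      \<longlonglongrightarrow> (\<Sum>j<n. of_real (ts (Suc j) - ts j) * exponent (\<theta> j))"
      unfolding exponent_def
      by (intro tendsto_sum tendsto_mult tendsto_const summable_LIMSEQ summable_exponent)
    moreover have "(\<Sum>j<n. of_real (ts (Suc j) - ts j) * (of_real w * (\<Sum>i<m. (\<integral>y. iexp (\<theta> j * J i y) \<partial>K) - 1))) =
      (\<Sum>i<m. of_real w * (\<Sum>j<n. of_real (ts (Suc j) - ts j) * ((\<integral>y. iexp (\<theta> j * J i y) \<partial>K) - 1)))" for m
      unfolding sum_distrib_left by (subst sum.swap) (simp add: ac_simps)
    ultimately show "(\<lambda>m. \<Sum>i<m. of_real w * (\<Sum>j<n. of_real (ts (Suc j) - ts j) * ((\<integral>y. iexp (\<theta> j * J i y) \<partial>K) - 1)))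
      \<longlonglongrightarrow> (\<Sum>j<n. of_real (ts (Suc j) - ts j) * exponent (\<theta> j))" by simp
  qed
  ultimately have "(\<lambda>m. \<integral>x. iexp (Z m x) \<partial>cells) \<longlonglongrightarrow> exp (\<Sum>j<n. of_real (ts (Suc j) - ts j) * exponent (\<theta> j))"
    by simp
  with lim1 show ?thesis by (rule LIMSEQ_unique)
qed

end

text \<open>The limit in the statement lives on a fixed type of sample points, so the process is transported
  along its path map.\<close>
lemma stable_levy_motionI:
  fixes L :: "real \<Rightarrow> 'b \<Rightarrow> real"
  assumes "cadlag_process M L"
    and char: "\<And>(ts :: nat \<Rightarrow> real) n \<theta>. 0 \<le> ts 0 \<Longrightarrow> ts n \<le> 1 \<Longrightarrow> (\<And>j. j < n \<Longrightarrow> ts j < ts (Suc j)) \<Longrightarrow>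
      (\<integral>x. iexp (\<Sum>j<n. \<theta> j * (L (ts (Suc j)) x - L (ts j) x)) \<partial>M) =
      exp (\<Sum>j<n. of_real (ts (Suc j) - ts j) * \<psi> (\<theta> j))"
    and \<psi>: "\<And>\<theta>. \<psi> \<theta> = - complex_of_real (\<sigma> powr \<alpha> * \<bar>\<theta>\<bar> powr \<alpha>)
               * (1 - \<i> * complex_of_real (\<beta> * sgn \<theta> * tan (pi * \<alpha> / 2)))"
    and "0 < \<alpha>" "0 \<le> \<sigma>"
  obtains Q :: "(real \<Rightarrow> real) measure" and W where "stable_levy_motion Q W \<alpha> \<sigma> \<beta>"
proof -
  interpret cadlag_process M L by fact
  \<comment> \<open>The product sigma-algebra restricted to cadlag functions vanishing at 0: the
    required path properties then hold at every point of the space, and evaluation at a time remains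
    measurable.\<close>
  define P where "P = restrict_space (PiM UNIV (\<lambda>_::real. borel :: real measure)) {x. cadlag x \<and> x 0 = 0}"
  define Q where "Q = distr M P (\<lambda>\<omega> t. L t \<omega>)"
  define W where "W t x = x t" for t :: real and x :: "real \<Rightarrow> real"
  have path [measurable]: "(\<lambda>\<omega> t. L t \<omega>) \<in> M \<rightarrow>\<^sub>M P"
    unfolding P_def by (intro measurable_restrict_space2 measurable_PiM_single') (auto simp: W_cadlag W_0)
  have Wm [measurable]: "W t \<in> borel_measurable P" for t
    unfolding P_def W_def[abs_def] by (intro measurable_restrict_space1 measurable_component_singleton) auto
  interpret Q: prob_space Q unfolding Q_def by (rule prob_space_distr) (rule path)
  have WQ [measurable]: "W t \<in> borel_measurable Q" for t by (simp add: Q_def)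
  have spQ: "space Q = {x. cadlag x \<and> x 0 = 0}" by (auto simp: Q_def P_def space_restrict_space space_PiM)
  have charQ: "(\<integral>x. iexp (\<Sum>j<n. \<theta> j * (W (ts (Suc j)) x - W (ts j) x)) \<partial>Q) = exp (\<Sum>j<n. of_real (ts (Suc j) - ts j) * \<psi> (\<theta> j))"
    if "0 \<le> ts 0" "ts n \<le> 1" "\<And>j. j < n \<Longrightarrow> ts j < ts (Suc j)" for ts :: "nat \<Rightarrow> real" and n \<theta>
  proof -
    have "(\<integral>x. iexp (\<Sum>j<n. \<theta> j * (W (ts (Suc j)) x - W (ts j) x)) \<partial>Q) =
        (\<integral>x. iexp (\<Sum>j<n. \<theta> j * (W (ts (Suc j)) (\<lambda>t. L t x) - W (ts j) (\<lambda>t. L t x))) \<partial>M)"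
      unfolding Q_def by (intro integral_distr) measurable
    then show ?thesis using char[OF that, of \<theta>] by (simp only: W_def)
  qed
  have charW: "(\<integral>x. iexp (\<theta> * (W t x - W s x)) \<partial>Q) = exp (of_real (t - s) * \<psi> \<theta>)"
    if "0 \<le> s" "s < t" "t \<le> 1" for s t \<theta>
    using charQ[of "\<lambda>j. if j = 0 then s else t" 1 "\<lambda>_. \<theta>"] that by simp
  have "stable_levy_motion Q W \<alpha> \<sigma> \<beta>"
    unfolding stable_levy_motion_def
  proof (intro conjI allI ballI impI)
    fix ts :: "nat \<Rightarrow> real" and n
    assume ts: "0 \<le> ts 0 \<and> ts n \<le> 1 \<and> (\<forall>i<n. ts i < ts (Suc i))"
    have mono: "i \<le> j \<Longrightarrow> j \<le> n \<Longrightarrow> ts i \<le> ts j" for i j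
      by (rule increasing_steps_mono[of n]) (use ts in auto)
    show "Q.indep_vars (\<lambda>_. borel) (\<lambda>i \<omega>. W (ts (Suc i)) \<omega> - W (ts i) \<omega>) {..<n}"
    proof (rule Q.indep_vars_char)
      fix \<theta> :: "nat \<Rightarrow> real"
      have "(\<integral>x. iexp (\<theta> i * (W (ts (Suc i)) x - W (ts i) x)) \<partial>Q) = exp (of_real (ts (Suc i) - ts i) * \<psi> (\<theta> i))" if "i < n" for i
        using ts that mono[of 0 i] mono[of "Suc i" n] by (intro charW) auto
      then show "(\<integral>x. iexp (\<Sum>i<n. \<theta> i * (W (ts (Suc i)) x - W (ts i) x)) \<partial>Q) =
          (\<Prod>i<n. \<integral>x. iexp (\<theta> i * (W (ts (Suc i)) x - W (ts i) x)) \<partial>Q)"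
        using ts by (subst charQ) (auto simp: exp_sum)
    qed measurable
  next
    fix s t :: real assume st: "0 \<le> s \<and> s < t \<and> t \<le> 1"
    have 1: "(\<sigma> * (t - s) powr (1 / \<alpha>)) powr \<alpha> = \<sigma> powr \<alpha> * (t - s)"
      using assms(4,5) st by (simp add: powr_mult powr_powr)
    have "char (distr Q borel (\<lambda>\<omega>. W t \<omega> - W s \<omega>)) \<theta> = exp (of_real (t - s) * \<psi> \<theta>)" for \<theta>
      using charW[of s t \<theta>] st by (simp add: char_def integral_distr)
    moreover have "real_distribution (distr Q borel (\<lambda>\<omega>. W t \<omega> - W s \<omega>))"
      using Q.prob_space_distr[of "\<lambda>\<omega>. W t \<omega> - W s \<omega>" borel]
      by (simp add: real_distribution_def real_distribution_axioms_def)
    ultimately show "stable_law (distr Q borel (\<lambda>\<omega>. W t \<omega> - W s \<omega>)) \<alpha> (\<sigma> * (t - s) powr (1 / \<alpha>)) \<beta> 0"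
      unfolding stable_law_def \<psi> 1 by (simp add: algebra_simps)
  qed (auto simp: spQ W_def Q.prob_space_axioms WQ[unfolded W_def])
  then show thesis by (rule that)
qed

subsection \<open>The exponent of a stable law\<close>

lemma Gamma_scaled_integral:
  assumes "0 < a" "0 < (c::real)"
  shows "has_bochner_integral lborel (\<lambda>x. indicator {0..} x * x powr (a - 1) * exp (- (c * x))) (Gamma a * c powr (-a))"
proof (rule has_bochner_integral_nn_integral)
  let ?g = "\<lambda>t. ennreal (indicator {0..} t * t powr (a - 1) / exp t)"
  have "(\<integral>\<^sup>+x. ennreal (indicator {0..} x * x powr (a - 1) * exp (- (c * x))) \<partial>lborel) =
      ennreal \<bar>1 / c\<bar> * (\<integral>\<^sup>+x. ennreal (indicator {0..} (0 + 1 / c * x) * (0 + 1 / c * x) powr (a - 1) * exp (- (c * (0 + 1 / c * x)))) \<partial>lborel)"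
    using assms by (intro nn_integral_real_affine) auto
  also have "\<dots> = ennreal \<bar>1 / c\<bar> * (\<integral>\<^sup>+x. ennreal (c powr (1 - a)) * ?g x \<partial>lborel)"
  proof (intro arg_cong2[where f="(*)"] refl nn_integral_cong)
    fix x :: real
    show "ennreal (indicator {0..} (0 + 1 / c * x) * (0 + 1 / c * x) powr (a - 1) * exp (- (c * (0 + 1 / c * x)))) = ennreal (c powr (1 - a)) * ?g x"
    proof (cases "0 \<le> x")
      case True
      then have "(x / c) powr (a - 1) = c powr (1 - a) * x powr (a - 1)"
        using assms by (simp add: powr_divide powr_diff field_simps)
      then show ?thesis using assms True
        by (simp add: ennreal_mult'[symmetric] exp_minus field_simps)
    next
      case False
      then show ?thesis using assms by (simp add: indicator_def zero_le_divide_iff)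
    qed
  qed
  also have "\<dots> = ennreal (1 / c) * (ennreal (c powr (1 - a)) * ennreal (Gamma a))"
    using assms by (simp add: nn_integral_cmult Gamma_conv_nn_integral_real)
  also have "\<dots> = ennreal (Gamma a * c powr (-a))"
    using assms Gamma_real_pos[of a]
    by (simp add: ennreal_mult'[symmetric] powr_diff powr_minus field_simps)
  finally show "(\<integral>\<^sup>+x. ennreal (indicator {0..} x * x powr (a - 1) * exp (- (c * x))) \<partial>lborel) = ennreal (Gamma a * c powr (-a))" .
qed (use assms Gamma_real_pos[of a] in auto)

text \<open>Expand exp (-z x) around a large real centre c, so that the binomial series converges.\<close>
lemma Gamma_scaled_integral_complex:
  fixes z :: complex
  assumes a: "0 < a" and z: "0 < Re z"
  shows "(\<integral>x. of_real (indicator {0..} x * x powr (a - 1)) * exp (- (z * of_real x)) \<partial>lborel) = of_real (Gamma a) * z powr (- of_real a)"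
proof -
  \<comment> \<open>The disc of radius c around c contains z exactly when 2 c Re z exceeds the
    square of the norm of z; the summand 1 makes the inequality strict.\<close>
  define c where "c = (norm z)\<^sup>2 / (2 * Re z) + 1"
  have c0: "c > 0" using z by (auto simp: c_def intro!: add_nonneg_pos)
  have cz: "norm (of_real c - z) < c"
  proof (rule power2_less_imp_less)
    have "(norm (of_real c - z))\<^sup>2 = c\<^sup>2 - 2 * c * Re z + (norm z)\<^sup>2"
      unfolding cmod_power2 by (simp add: power2_eq_square algebra_simps)
    moreover have "2 * c * Re z = (norm z)\<^sup>2 + 2 * Re z" using z by (simp add: c_def field_simps)
    ultimately show "(norm (of_real c - z))\<^sup>2 < c\<^sup>2" using z by simp
  qed (use c0 in simp)
  define \<rho> where "\<rho> = norm (of_real c - z)"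
  define g where "g b x = indicator {0..} x * x powr (b - 1) * exp (- (c * x))" for b x :: real
  have g: "has_bochner_integral lborel (g b) (Gamma b * c powr (-b))" if "0 < b" for b
    unfolding g_def by (rule Gamma_scaled_integral[OF that c0])
  define f where "f n x = of_real (g (a + real n) x) * ((of_real c - z) ^ n / fact n)" for n x
  have int_f: "integrable lborel (f n)" for n
    unfolding f_def using g[of "a + real n"] a by (intro integrable_mult_left integrable_of_real) (auto simp: has_bochner_integral_iff)
  have f_val: "(\<integral>x. f n x \<partial>lborel) = of_real (Gamma (a + real n) * c powr (-(a + real n))) * ((of_real c - z) ^ n / fact n)" for n
    unfolding f_def using g[of "a + real n"] a
    by (subst integral_mult_left_zero) (auto simp: has_bochner_integral_iff)
  have g_nonneg: "0 \<le> g b x" for b x by (simp add: g_def indicator_def)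
  have f_norm: "norm (f n x) = g (a + real n) x * (\<rho> ^ n / fact n)" for n x
    using g_nonneg by (simp add: f_def \<rho>_def norm_mult norm_divide norm_power)
  have g_pow: "g (a + real n) x = g a x * x ^ n" for n x
  proof (cases "0 < x")
    case True
    then have "x powr (a + real n - 1) = x powr (a - 1) * x ^ n"
      by (simp add: powr_add[symmetric] powr_realpow[symmetric] algebra_simps)
    then show ?thesis using True by (simp add: g_def)
  next
    case False
    then show ?thesis by (cases "x = 0") (auto simp: g_def)
  qed
  have Gam: "Gamma (a + real n) = Gamma a * pochhammer a n" for n
  proof -
    have "pochhammer a n = Gamma (a + real n) / Gamma a"
      using a by (intro pochhammer_Gamma) (auto elim!: nonpos_Ints_cases)
    moreover have "0 < Gamma a" using a by (rule Gamma_real_pos)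
    ultimately show ?thesis by (simp add: field_simps)
  qed
  have cpow: "c powr (-(a + real n)) = c powr (-a) / c ^ n" for n
    using c0 by (simp add: powr_diff powr_realpow)
  have "(\<lambda>n. \<integral>x. f n x \<partial>lborel) sums (\<integral>x. (\<Sum>n. f n x) \<partial>lborel)"
  proof (rule sums_integral[OF int_f])
    show "AE x in lborel. summable (\<lambda>n. norm (f n x))"
    proof (rule AE_I2)
      fix x
      have "(\<lambda>n. norm (f n x)) = (\<lambda>n. g a x * ((\<rho> * x) ^ n /\<^sub>R fact n))"
        by (simp add: fun_eq_iff f_norm g_pow power_mult_distrib divide_inverse)
      moreover have "summable (\<lambda>n. g a x * ((\<rho> * x) ^ n /\<^sub>R fact n))"
        by (intro summable_mult summable_exp_generic)
      ultimately show "summable (\<lambda>n. norm (f n x))" by (simp only:)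
    qed
    \<comment> \<open>The integrals of the norms again form a binomial series, now at -\<rho>/c, and
      \<rho> < c. This justifies integrating term by term.\<close>
    have "(\<integral>x. norm (f n x) \<partial>lborel) = Gamma a * c powr (-a) * (((-a) gchoose n) * (- (\<rho> / c)) ^ n)" for n
    proof -
      have "(\<integral>x. norm (f n x) \<partial>lborel) = Gamma (a + real n) * c powr (-(a + real n)) * (\<rho> ^ n / fact n)"
        unfolding f_norm using g[of "a + real n"] a by (subst integral_mult_left_zero) (auto simp: has_bochner_integral_iff)
      also have "\<dots> = Gamma a * c powr (-a) * (((-a) gchoose n) * (- (\<rho> / c)) ^ n)"
        unfolding Gam cpow gbinomial_pochhammer power_minus[of "\<rho> / c"] by (simp add: power_divide field_simps flip: power_mult_distrib)
      finally show ?thesis .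
    qed
    moreover have "summable (\<lambda>n. ((-a) gchoose n) * (- (\<rho> / c)) ^ n)"
      using gen_binomial_real[of "- (\<rho> / c)" "-a"] cz c0 by (auto simp: \<rho>_def sums_iff abs_of_nonneg)
    ultimately show "summable (\<lambda>n. \<integral>x. norm (f n x) \<partial>lborel)" by (simp add: summable_mult)
  qed
  moreover have "(\<Sum>n. f n x) = of_real (indicator {0..} x * x powr (a - 1)) * exp (- (z * of_real x))" for x
  proof -
    have "(\<lambda>n. of_real (g a x) * (((of_real c - z) * of_real x) ^ n /\<^sub>R fact n)) sums (of_real (g a x) * exp ((of_real c - z) * of_real x))"
      by (intro sums_mult exp_converges)
    moreover have "of_real (g a x) * (((of_real c - z) * of_real x) ^ n /\<^sub>R fact n) = f n x" for n
      by (simp add: f_def g_pow power_mult_distrib scaleR_conv_of_real divide_inverse ac_simps)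
    ultimately have "(\<Sum>n. f n x) = of_real (g a x) * exp ((of_real c - z) * of_real x)" by (simp add: sums_iff)
    also have "\<dots> = of_real (indicator {0..} x * x powr (a - 1)) * (exp (of_real (- (c * x))) * exp ((of_real c - z) * of_real x))"
      unfolding g_def of_real_mult exp_of_real[symmetric] by (simp add: mult.assoc)
    also have "exp (of_real (- (c * x))) * exp ((of_real c - z) * of_real x) = exp (- (z * of_real x))"
      unfolding exp_add[symmetric] by (simp add: algebra_simps)
    finally show ?thesis .
  qed
  ultimately have 1: "(\<lambda>n. \<integral>x. f n x \<partial>lborel) sums (\<integral>x. of_real (indicator {0..} x * x powr (a - 1)) * exp (- (z * of_real x)) \<partial>lborel)"
    by simp
  define \<zeta> where "\<zeta> = (of_real c - z) / of_real c"
  have \<zeta>: "norm (- \<zeta>) < 1" using cz c0 by (simp add: \<zeta>_def norm_divide)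
  have "(\<lambda>n. of_real (Gamma a * c powr (-a)) * (((- of_real a) gchoose n) * (- \<zeta>) ^ n)) sums
      (of_real (Gamma a * c powr (-a)) * (1 + - \<zeta>) powr (- of_real a))"
    by (intro sums_mult gen_binomial_complex \<zeta>)
  moreover have "of_real (Gamma a * c powr (-a)) * (((- of_real a) gchoose n) * (- \<zeta>) ^ n) = (\<integral>x. f n x \<partial>lborel)" for n
  proof -
    have "((- of_real a) gchoose n) * (- \<zeta>) ^ n = of_real (pochhammer a n) / fact n * \<zeta> ^ n"
      unfolding gbinomial_pochhammer power_minus[of \<zeta>] by (simp add: pochhammer_of_real)
    moreover have "\<zeta> ^ n = (of_real c - z) ^ n / of_real (c ^ n)"
      by (simp add: \<zeta>_def power_divide)
    ultimately show ?thesis unfolding f_val Gam cpow by (simp add: ac_simps)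
  qed
  ultimately have 2: "(\<lambda>n. \<integral>x. f n x \<partial>lborel) sums (of_real (Gamma a * c powr (-a)) * (1 + - \<zeta>) powr (- of_real a))"
    by simp
  have zc: "z = of_real c * (1 + - \<zeta>)" using c0 by (simp add: \<zeta>_def field_simps)
  have nz: "(1 + - \<zeta>) \<noteq> 0" using \<zeta> by auto
  have "z \<noteq> 0" using z by auto
  then have "z powr (- of_real a) = exp (- of_real a * Ln z)" by (simp add: powr_def)
  \<comment> \<open>As c is a positive real, the principal logarithm splits without a multiple of 2
    pi i.\<close>
  also have "Ln z = of_real (ln c) + Ln (1 + - \<zeta>)" 
    using Ln_times_of_real[OF c0 nz] c0 by (subst zc) (simp add: Ln_of_real)
  also have "exp (- of_real a * (of_real (ln c) + Ln (1 + - \<zeta>))) = exp (of_real (- a * ln c)) * exp (- of_real a * Ln (1 + - \<zeta>))"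
    unfolding exp_add[symmetric] by (simp add: algebra_simps)
  also have "\<dots> = of_real (c powr (-a)) * (1 + - \<zeta>) powr (- of_real a)"
    using c0 nz unfolding exp_of_real by (simp add: powr_def)
  finally have "z powr (- of_real a) = of_real (c powr (-a)) * (1 + - \<zeta>) powr (- of_real a)" .
  with sums_unique2[OF 1 2] show ?thesis by simp
qed

text \<open>The inverse of the tail x^(-\<alpha>): it maps Lebesgue measure on the positive
  half-line to the Levy measure with that tail, so integrals over jump sizes become integrals over
  \<open>lborel\<close>. The value 0 elsewhere makes the integrands vanish on the negative
  half-line.\<close>

definition stable_jump :: "real \<Rightarrow> real \<Rightarrow> real" where
  "stable_jump \<alpha> s = (if 0 < s then s powr (-1/\<alpha>) else 0)"

lemma stable_jump_measurable [measurable]: "stable_jump \<alpha> \<in> borel_measurable borel"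
  unfolding stable_jump_def[abs_def] by measurable

lemma stable_jump_nonneg: "0 \<le> stable_jump \<alpha> s"
  by (simp add: stable_jump_def)

lemma norm_one_minus_exp_le:
  assumes "0 \<le> Re w"
  shows "norm (1 - exp (- w)) \<le> norm w"
proof -
  have "norm (exp (- 0) - exp (- w)) \<le> 1 * norm (0 - w)"
  proof (rule field_differentiable_bound[where S="{w. 0 \<le> Re w}" and f'="\<lambda>w. - exp (- w)"])
    show "convex {w. 0 \<le> Re w}" by (rule convex_halfspace_Re_ge)
    show "((\<lambda>w. exp (- w)) has_field_derivative - exp (- z)) (at z within {w. 0 \<le> Re w})" for z
      by (auto intro!: derivative_eq_intros)
  qed (use assms in auto)
  then show ?thesis by simp
qed

section \<open>Evaluation of the one-sided stable exponent\<close>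

context
  fixes \<alpha> :: real
  assumes \<alpha>: "0 < \<alpha>" "\<alpha> < 1"
begin

lemma stable_jump_le_iff: "0 < s \<Longrightarrow> 0 < x \<Longrightarrow> x \<le> stable_jump \<alpha> s \<longleftrightarrow> s \<le> x powr (-\<alpha>)"
proof -
  assume s: "0 < s" "0 < x"
  have "x \<le> s powr (-1/\<alpha>) \<longleftrightarrow> (s powr (-1/\<alpha>)) powr (-\<alpha>) \<le> x powr (-\<alpha>)"
    using s \<alpha> powr_le_cancel_iff by (simp add: powr_mono2' powr_less_mono2_neg flip: not_le) 
      (smt (verit) powr_less_mono2_neg powr_mono2' powr_gt_zero)
  also have "(s powr (-1/\<alpha>)) powr (-\<alpha>) = s" using s \<alpha> by (simp add: powr_powr)
  finally show ?thesis using s by (simp add: stable_jump_def)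
qed

lemma stable_jump_scale: "0 < c \<Longrightarrow> stable_jump \<alpha> (c powr \<alpha> * s) = stable_jump \<alpha> s / c"
  using \<alpha> by (auto simp: stable_jump_def powr_mult powr_powr powr_minus zero_less_mult_iff field_simps)

text \<open>Integrability of min(1, x) against the Levy measure. Here \<alpha> < 1 enters, as
  1/\<alpha> > 1 makes the small jumps integrable. The same function later dominates the difference
  of rescaled quantiles.\<close>

lemma integrable_stable_jump_min: "integrable lborel (\<lambda>s. min 1 (stable_jump \<alpha> s))"
proof -
  have e: "-1/\<alpha> < -1" using \<alpha> by (simp add: field_simps)
  define F where "F s = s powr (-1/\<alpha> + 1) / (-1/\<alpha> + 1)" for s :: real
  have "(\<integral>\<^sup>+s. ennreal (s powr (-1/\<alpha>)) * indicator {1..} s \<partial>lborel) = ennreal (0 - F 1)"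
  proof (rule nn_integral_FTC_atLeast)
    show "DERIV F s :> s powr (-1/\<alpha>)" if "1 \<le> s" for s
      unfolding F_def using that e by (auto intro!: derivative_eq_intros)
    show "(F \<longlongrightarrow> 0) at_top"
      unfolding F_def using e by (intro tendsto_divide_zero tendsto_neg_powr filterlim_ident) auto
  qed auto
  moreover have "(\<integral>\<^sup>+s. ennreal (min 1 (stable_jump \<alpha> s)) \<partial>lborel) \<le>
      (\<integral>\<^sup>+s. indicator {0..1} s + ennreal (s powr (-1/\<alpha>)) * indicator {1..} s \<partial>lborel)"
    by (intro nn_integral_mono) (auto simp: indicator_def stable_jump_def min_def intro!: ennreal_leI)
  moreover have "(\<integral>\<^sup>+s. indicator {0..1} s + ennreal (s powr (-1/\<alpha>)) * indicator {1..} s \<partial>lborel) =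
      1 + (\<integral>\<^sup>+s. ennreal (s powr (-1/\<alpha>)) * indicator {1..} s \<partial>lborel)"
    by (subst nn_integral_add) auto
  ultimately have "(\<integral>\<^sup>+s. ennreal (min 1 (stable_jump \<alpha> s)) \<partial>lborel) \<le> 1 + ennreal (0 - F 1)" by simp
  also have "\<dots> < \<infinity>" by (simp add: less_top[symmetric])
  finally have "(\<integral>\<^sup>+s. ennreal (min 1 (stable_jump \<alpha> s)) \<partial>lborel) < \<infinity>" .
  then show ?thesis
    by (intro integrableI_bounded) (auto simp: stable_jump_nonneg)
qed

lemma norm_one_minus_exp_jump_le:
  assumes "0 \<le> Re z"
  shows "norm (1 - exp (- (z * of_real (stable_jump \<alpha> s)))) \<le> (2 + norm z) * min 1 (stable_jump \<alpha> s)"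
proof (cases "stable_jump \<alpha> s \<le> 1")
  case True
  have "norm (1 - exp (- (z * of_real (stable_jump \<alpha> s)))) \<le> norm (z * of_real (stable_jump \<alpha> s))"
    using assms stable_jump_nonneg by (intro norm_one_minus_exp_le) auto
  also have "\<dots> \<le> (2 + norm z) * stable_jump \<alpha> s"
    using stable_jump_nonneg[of \<alpha> s] by (simp add: norm_mult mult_right_mono)
  finally show ?thesis using True by simp
next
  case False
  have "norm (1 - exp (- (z * of_real (stable_jump \<alpha> s)))) \<le> norm (1::complex) + norm (exp (- (z * of_real (stable_jump \<alpha> s))))"
    by (rule norm_triangle_ineq4)
  also have "\<dots> \<le> 1 + 1" using assms stable_jump_nonneg[of \<alpha> s] by (intro add_mono) (auto)
  also have "\<dots> \<le> 2 + norm z" by simp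
  finally show ?thesis using False by simp
qed

lemma integrable_exp_jump:
  assumes "0 \<le> Re z"
  shows "integrable lborel (\<lambda>s. 1 - exp (- (z * of_real (stable_jump \<alpha> s))))"
  using norm_one_minus_exp_jump_le[OF assms] stable_jump_nonneg
  by (intro Bochner_Integration.integrable_bound[OF integrable_mult_right[OF integrable_stable_jump_min, of "2 + norm z"]])
    (auto simp: abs_mult abs_of_nonneg)

text \<open>Write 1 - exp(-zY) as the integral of z exp(-zx) over x from 0 to Y and exchange the
  integrals: the set of s with x \<le> \<open>stable_jump \<alpha> s\<close> has length
  x^(-\<alpha>), which leaves a Gamma integral. The exchange needs Re z > 0.\<close>

lemma exp_jump_integral:
  assumes z: "0 < Re z"
  shows "(\<integral>s. 1 - exp (- (z * of_real (stable_jump \<alpha> s))) \<partial>lborel) = of_real (Gamma (1 - \<alpha>)) * z powr of_real \<alpha>"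
proof -
  have z0: "z \<noteq> 0" using z by auto
  define E where "E x = z * exp (- (z * of_real x))" for x
  define h where "h x s = (indicator {0<..stable_jump \<alpha> s} x :: real) *\<^sub>R E x" for x s
  have h_alt: "h x s = (if 0 < x then indicator {0<..x powr (-\<alpha>)} s *\<^sub>R E x else 0)" for x s
    using stable_jump_le_iff[of s x] by (auto simp: h_def indicator_def stable_jump_def)
  have [measurable]: "E \<in> borel_measurable borel" unfolding E_def[abs_def] by measurable
  have h_meas [measurable]: "case_prod h \<in> borel_measurable (lborel \<Otimes>\<^sub>M lborel)"
    unfolding h_def[abs_def] split_beta' by (simp add: indicator_def) measurable
  have E_norm: "norm (E x) = norm z * exp (- (Re z * x))" for x by (simp add: E_def norm_mult)
  have int_s: "(\<integral>s. h x s \<partial>lborel) = of_real (indicator {0..} x * x powr (1 - \<alpha> - 1)) * E x" if "x \<noteq> 0" for x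
    using that by (auto simp: h_alt indicator_def[of "{0..}"] scaleR_conv_of_real)
  have int_norm: "(\<integral>s. norm (h x s) \<partial>lborel) = norm z * (indicator {0..} x * x powr (1 - \<alpha> - 1) * exp (- (Re z * x)))" if "x \<noteq> 0" for x
    using that by (auto simp: h_alt indicator_def[of "{0..}"] E_norm)
  have ne0: "AE x in lborel. x \<noteq> (0::real)" by (rule AE_lborel_singleton)
  have int_h: "integrable (lborel \<Otimes>\<^sub>M lborel) (case_prod h)"
  proof (rule lborel_pair.Fubini_integrable[OF h_meas])
    have "integrable lborel (\<lambda>x. norm z * (indicator {0..} x * x powr (1 - \<alpha> - 1) * exp (- (Re z * x))))"
      using Gamma_scaled_integral[of "1 - \<alpha>" "Re z"] \<alpha> z by (intro integrable_mult_right) (simp add: has_bochner_integral_iff)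
    then show "integrable lborel (\<lambda>x. \<integral>y. norm (case (x, y) of (x, y) \<Rightarrow> h x y) \<partial>lborel)"
      by (rule integrable_cong_AE_imp) (use ne0 in \<open>auto simp: int_norm elim!: eventually_mono\<close>)
    show "AE x in lborel. integrable lborel (\<lambda>y. case (x, y) of (x, y) \<Rightarrow> h x y)"
    proof (rule AE_I2)
      fix x
      have "integrable lborel (\<lambda>y. indicator {0<..x powr (-\<alpha>)} y *\<^sub>R E x)"
        by (intro integrable_scaleR_left integrable_real_indicator) (auto simp: emeasure_lborel_Ioc)
      then show "integrable lborel (\<lambda>y. case (x, y) of (x, y) \<Rightarrow> h x y)"
        by (cases "0 < x") (auto simp: h_alt)
    qed
  qed
  have int_x: "(\<integral>x. h x s \<partial>lborel) = 1 - exp (- (z * of_real (stable_jump \<alpha> s)))" for s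
  proof -
    let ?Y = "stable_jump \<alpha> s"
    have "(\<integral>x. h x s \<partial>lborel) = (\<integral>x. indicator {0..?Y} x *\<^sub>R E x \<partial>lborel)"
      by (intro integral_cong_AE) (use ne0 in \<open>auto simp: h_def indicator_def elim!: eventually_mono\<close>)
    also have "\<dots> = - exp (- (z * of_real ?Y)) - (- exp (- (z * of_real 0)))"
    proof (rule integral_FTC_Icc)
      fix x :: real
      have "((\<lambda>x. - exp (- (z * of_real x))) has_vector_derivative E x) (at x)"
        unfolding E_def by (rule has_vector_derivative_real_field) (auto intro!: derivative_eq_intros)
      then show "((\<lambda>x. - exp (- (z * of_real x))) has_vector_derivative E x) (at x within {0..?Y})"
        by (rule has_vector_derivative_at_within)
      show "continuous_on {0..?Y} E" unfolding E_def[abs_def] by (intro continuous_intros)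
    qed (rule stable_jump_nonneg)
    finally show ?thesis by simp
  qed
  have "(\<integral>s. 1 - exp (- (z * of_real (stable_jump \<alpha> s))) \<partial>lborel) = (\<integral>s. (\<integral>x. h x s \<partial>lborel) \<partial>lborel)"
    by (simp add: int_x)
  also have "\<dots> = (\<integral>x. (\<integral>s. h x s \<partial>lborel) \<partial>lborel)"
    by (rule lborel_pair.Fubini_integral[OF int_h])
  also have "\<dots> = (\<integral>x. of_real (indicator {0..} x * x powr (1 - \<alpha> - 1)) * E x \<partial>lborel)"
  proof (rule integral_cong_AE)
    show "AE x in lborel. (\<integral>s. h x s \<partial>lborel) = of_real (indicator {0..} x * x powr (1 - \<alpha> - 1)) * E x"
      using ne0 by eventually_elim (rule int_s)
  qed measurable
  also have "\<dots> = (\<integral>x. z * (of_real (indicator {0..} x * x powr (1 - \<alpha> - 1)) * exp (- (z * of_real x))) \<partial>lborel)"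
    by (simp add: E_def ac_simps)
  also have "\<dots> = z * (of_real (Gamma (1 - \<alpha>)) * z powr (- of_real (1 - \<alpha>)))"
    using Gamma_scaled_integral_complex[of "1 - \<alpha>" z] \<alpha> z by (simp only: integral_mult_right_zero)
  also have "z * (of_real (Gamma (1 - \<alpha>)) * z powr (- of_real (1 - \<alpha>))) = of_real (Gamma (1 - \<alpha>)) * (z powr 1 * z powr (- of_real (1 - \<alpha>)))"
    using z0 by simp
  also have "z powr 1 * z powr (- of_real (1 - \<alpha>)) = z powr of_real \<alpha>"
    unfolding powr_add[symmetric] by simp
  finally show ?thesis .
qed

text \<open>The \<alpha>-th power of the scale of the stable law whose Levy measure has tail
  x^(-\<alpha>). It converts scales into tail constants.\<close>

definition stable_const :: real where
  "stable_const = Gamma (1 - \<alpha>) * cos (pi * \<alpha> / 2)"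

lemma stable_const_pos: "0 < stable_const"
proof -
  have "pi * \<alpha> < pi * 1" using \<alpha> by (intro mult_strict_left_mono) auto
  then show ?thesis unfolding stable_const_def
    using \<alpha> by (intro mult_pos_pos Gamma_real_pos cos_gt_zero) auto
qed

definition stable_exponent :: "real \<Rightarrow> complex" where
  "stable_exponent \<theta> = (\<integral>s. iexp (\<theta> * stable_jump \<alpha> s) - 1 \<partial>lborel)"

text \<open>The point -i lies on the boundary of the half-plane covered by
  \<open>exp_jump_integral\<close>. It is approached by 1/(n+1) - i, with a dominating function
  uniform in norm z \<le> 2; the power is continuous there since -i is off the cut.\<close>

lemma stable_exponent_1:
  "stable_exponent 1 = - of_real stable_const * (1 - \<i> * of_real (tan (pi * \<alpha> / 2)))"
proof -
  define z where "z n = of_real (1 / real (Suc n)) - \<i>" for n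
  have zlim: "z \<longlonglongrightarrow> - \<i>"
  proof -
    have "(\<lambda>n. of_real (1 / real (Suc n)) - \<i>) \<longlonglongrightarrow> of_real 0 - \<i>"
      by (intro tendsto_diff tendsto_of_real tendsto_const LIMSEQ_Suc[OF lim_1_over_n])
    then show ?thesis by (simp add: z_def[abs_def])
  qed
  have znorm: "norm (z n) \<le> 2" for n
  proof -
    have "norm (z n) \<le> norm (complex_of_real (1 / real (Suc n))) + norm \<i>" unfolding z_def by (rule norm_triangle_ineq4)
    also have "\<dots> \<le> 1 + 1" by (intro add_mono) (auto simp: norm_divide simp del: of_nat_Suc)
    finally show ?thesis by simp
  qed
  have "(\<lambda>n. \<integral>s. 1 - exp (- (z n * of_real (stable_jump \<alpha> s))) \<partial>lborel) \<longlonglongrightarrow> (\<integral>s. 1 - exp (- (- \<i> * of_real (stable_jump \<alpha> s))) \<partial>lborel)"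
  proof (rule integral_dominated_convergence[where w="\<lambda>s. 4 * min 1 (stable_jump \<alpha> s)"])
    show "integrable lborel (\<lambda>s. 4 * min 1 (stable_jump \<alpha> s))" by (intro integrable_mult_right integrable_stable_jump_min)
    show "AE s in lborel. norm (1 - exp (- (z n * of_real (stable_jump \<alpha> s)))) \<le> 4 * min 1 (stable_jump \<alpha> s)" for n
    proof (rule AE_I2)
      fix s
      have "norm (1 - exp (- (z n * of_real (stable_jump \<alpha> s)))) \<le> (2 + norm (z n)) * min 1 (stable_jump \<alpha> s)"
        by (rule norm_one_minus_exp_jump_le) (simp add: z_def)
      also have "\<dots> \<le> 4 * min 1 (stable_jump \<alpha> s)"
        using znorm[of n] stable_jump_nonneg by (intro mult_right_mono) auto
      finally show "norm (1 - exp (- (z n * of_real (stable_jump \<alpha> s)))) \<le> 4 * min 1 (stable_jump \<alpha> s)" .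
    qed
    show "AE s in lborel. (\<lambda>n. 1 - exp (- (z n * of_real (stable_jump \<alpha> s)))) \<longlonglongrightarrow> 1 - exp (- (- \<i> * of_real (stable_jump \<alpha> s)))"
      by (intro AE_I2 tendsto_diff tendsto_const tendsto_exp tendsto_minus tendsto_mult zlim)
  qed measurable
  moreover have "(\<integral>s. 1 - exp (- (z n * of_real (stable_jump \<alpha> s))) \<partial>lborel) = of_real (Gamma (1 - \<alpha>)) * z n powr of_real \<alpha>" for n
    by (rule exp_jump_integral) (simp add: z_def)
  moreover have "(\<lambda>n. of_real (Gamma (1 - \<alpha>)) * z n powr of_real \<alpha>) \<longlonglongrightarrow> of_real (Gamma (1 - \<alpha>)) * (- \<i>) powr of_real \<alpha>"
    by (intro tendsto_mult tendsto_const tendsto_powr_complex zlim) (auto simp: complex_nonpos_Reals_iff)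
  ultimately have "(\<integral>s. 1 - exp (- (- \<i> * of_real (stable_jump \<alpha> s))) \<partial>lborel) = of_real (Gamma (1 - \<alpha>)) * (- \<i>) powr of_real \<alpha>"
    using LIMSEQ_unique by simp
  moreover have "stable_exponent 1 = (\<integral>s. - (1 - exp (- (- \<i> * of_real (stable_jump \<alpha> s)))) \<partial>lborel)"
    by (simp add: stable_exponent_def)
  moreover have "(- \<i>) powr of_real \<alpha> = cis (- (pi * \<alpha> / 2))"
    by (simp add: powr_def cis_conv_exp algebra_simps)
  moreover have "of_real (Gamma (1 - \<alpha>)) * cis (- (pi * \<alpha> / 2)) = of_real stable_const * (1 - \<i> * of_real (tan (pi * \<alpha> / 2)))"
  proof -
    have "cos (pi * \<alpha> / 2) \<noteq> 0" using stable_const_pos by (auto simp: stable_const_def)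
    then show ?thesis by (simp add: stable_const_def complex_eq_iff tan_def)
  qed
  ultimately show ?thesis by (simp only: integral_minus) simp
qed

text \<open>For positive \<theta> the substitution s to \<theta>^\<alpha> s reduces to \<theta> = 1;
  negative \<theta> follow by complex conjugation.\<close>

lemma stable_exponent_eq:
  "stable_exponent \<theta> = - of_real (stable_const * \<bar>\<theta>\<bar> powr \<alpha>) * (1 - \<i> * of_real (sgn \<theta> * tan (pi * \<alpha> / 2)))"
proof -
  have pos: "stable_exponent \<theta> = of_real (\<theta> powr \<alpha>) * stable_exponent 1" if "0 < \<theta>" for \<theta>
  proof -
    have c: "\<theta> powr \<alpha> \<noteq> 0" using that by simp
    have "stable_exponent \<theta> = \<bar>\<theta> powr \<alpha>\<bar> *\<^sub>R (\<integral>s. iexp (\<theta> * stable_jump \<alpha> (0 + \<theta> powr \<alpha> * s)) - 1 \<partial>lborel)"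
      unfolding stable_exponent_def by (rule lborel_integral_real_affine[OF c])
    also have "(\<lambda>s. iexp (\<theta> * stable_jump \<alpha> (0 + \<theta> powr \<alpha> * s)) - 1) = (\<lambda>s. iexp (1 * stable_jump \<alpha> s) - 1)"
      using that by (simp add: stable_jump_scale)
    finally show ?thesis by (simp add: stable_exponent_def scaleR_conv_of_real)
  qed
  have neg: "stable_exponent (- \<theta>) = cnj (stable_exponent \<theta>)" for \<theta>
  proof -
    have "stable_exponent (- \<theta>) = (\<integral>s. cnj (iexp (\<theta> * stable_jump \<alpha> s) - 1) \<partial>lborel)"
      by (simp add: stable_exponent_def exp_cnj)
    then show ?thesis by (simp only: Bochner_Integration.integral_cnj stable_exponent_def)
  qed
  consider "\<theta> = 0" | "0 < \<theta>" | "0 < - \<theta>" by linarith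
  then show ?thesis
  proof cases
    case 1
    then show ?thesis by (simp add: stable_exponent_def)
  next
    case 2
    then show ?thesis by (simp add: pos stable_exponent_1)
  next
    case 3
    have "stable_exponent \<theta> = cnj (stable_exponent (- \<theta>))" using neg[of "-\<theta>"] by simp
    also have "\<dots> = - of_real (stable_const * \<bar>\<theta>\<bar> powr \<alpha>) * (1 + \<i> * of_real (tan (pi * \<alpha> / 2)))"
      using 3 pos[of "- \<theta>"] by (simp add: stable_exponent_1)
    finally show ?thesis using 3 by simp
  qed
qed

end

section \<open>Series representation and existence of stable Levy motions\<close>

lemma (in compound_series) cadlag_process_L: "cadlag_process cells L"
  by (intro cadlag_process.intro cadlag_process_axioms.intro cells.prob_space_axioms L_measurable cadlag_L L_0)

text \<open>Half-open, so that the cells from w i to w (i + 1) tile the half-line without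
  overlap.\<close>

abbreviation unif01 :: "real measure" where
  "unif01 \<equiv> uniform_measure lborel {0..<1}"

lemma prob_space_unif01: "prob_space unif01"
  by (rule prob_space_uniform_measure) auto

lemma AE_unif01: "AE v in unif01. v \<in> {0..<1}"
  by (rule AE_uniform_measureI) auto

lemma AE_unif01_pos: "AE v in unif01. 0 < v \<and> v < 1"
proof (rule AE_uniform_measureI)
  show "AE x in lborel. x \<in> {0..<1} \<longrightarrow> 0 < x \<and> x < (1::real)"
    using AE_lborel_singleton[of "0::real"] by eventually_elim auto
qed auto

lemma unif01_density: "unif01 = density lborel (\<lambda>x. ennreal (indicator {0..<1} x))"
  unfolding uniform_measure_def by (intro density_cong) (auto simp: indicator_def)

text \<open>The half-line is cut into cells of width w, and a uniform point of cell i is w (i + v).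
  This identifies the exponent of a compound series with the exponent as a \<open>lborel\<close>
  integral, for every width.\<close>

lemma unif01_cells_sums:
  fixes g :: "real \<Rightarrow> complex"
  assumes w: "0 < w" and g: "integrable lborel g" and neg: "\<And>s. s < 0 \<Longrightarrow> g s = 0"
  shows "(\<lambda>i. of_real w * (\<integral>v. g (w * (real i + v)) \<partial>unif01)) sums (\<integral>s. g s \<partial>lborel)"
proof -
  have [measurable]: "g \<in> borel_measurable borel" using g by auto
  have cell: "of_real w * (\<integral>v. g (w * (real i + v)) \<partial>unif01) =
      (\<integral>s. indicator {w * real i..<w * (real i + 1)} s *\<^sub>R g s \<partial>lborel)" for i
  proof -
    have "(\<integral>s. indicator {w * real i..<w * (real i + 1)} s *\<^sub>R g s \<partial>lborel) =
      \<bar>w\<bar> *\<^sub>R (\<integral>v. indicator {w * real i..<w * (real i + 1)} (w * real i + w * v) *\<^sub>R g (w * real i + w * v) \<partial>lborel)"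
      using w by (intro lborel_integral_real_affine) auto
    also have "(\<integral>v. indicator {w * real i..<w * (real i + 1)} (w * real i + w * v) *\<^sub>R g (w * real i + w * v) \<partial>lborel) =
      (\<integral>v. (indicator {0..<1} v :: real) *\<^sub>R g (w * (real i + v)) \<partial>lborel)"
    proof (intro Bochner_Integration.integral_cong refl)
      fix v
      have "w * real i + w * v < w * (real i + 1) \<longleftrightarrow> v < 1" using w by (simp add: distrib_left)
      moreover have "w * real i \<le> w * real i + w * v \<longleftrightarrow> 0 \<le> v" using w by (simp add: zero_le_mult_iff)
      ultimately show "indicator {w * real i..<w * (real i + 1)} (w * real i + w * v) *\<^sub>R g (w * real i + w * v) =
        (indicator {0..<1} v :: real) *\<^sub>R g (w * (real i + v))"
        by (auto simp: indicator_def distrib_left)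
    qed
    also have "\<dots> = (\<integral>v. g (w * (real i + v)) \<partial>unif01)"
      unfolding unif01_density by (intro integral_density[symmetric]) auto
    finally show ?thesis using w by (simp add: scaleR_conv_of_real)
  qed
  have part: "(\<Sum>i<m. \<integral>s. indicator {w * real i..<w * (real i + 1)} s *\<^sub>R g s \<partial>lborel) =
      (\<integral>s. indicator {0..<w * real m} s *\<^sub>R g s \<partial>lborel)" for m
  proof (induction m)
    case (Suc m)
    have "(\<Sum>i<Suc m. \<integral>s. indicator {w * real i..<w * (real i + 1)} s *\<^sub>R g s \<partial>lborel) =
      (\<integral>s. indicator {0..<w * real m} s *\<^sub>R g s + indicator {w * real m..<w * (real m + 1)} s *\<^sub>R g s \<partial>lborel)"
      using Suc g by (subst Bochner_Integration.integral_add) (auto intro!: integrable_mult_indicator)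
    also have "\<dots> = (\<integral>s. indicator {0..<w * real (Suc m)} s *\<^sub>R g s \<partial>lborel)"
    proof (intro Bochner_Integration.integral_cong refl)
      fix s
      have "w * real m \<le> w * (real m + 1)" "0 \<le> w * real m" using w by auto
      then show "indicator {0..<w * real m} s *\<^sub>R g s + indicator {w * real m..<w * (real m + 1)} s *\<^sub>R g s = indicator {0..<w * real (Suc m)} s *\<^sub>R g s"
        by (auto simp: indicator_def add.commute)
    qed
    finally show ?case .
  qed simp
  have "(\<lambda>m. \<integral>s. indicator {0..<w * real m} s *\<^sub>R g s \<partial>lborel) \<longlonglongrightarrow> (\<integral>s. g s \<partial>lborel)"
  proof (rule integral_dominated_convergence[where w="\<lambda>s. norm (g s)"])
    show "AE s in lborel. (\<lambda>m. indicator {0..<w * real m} s *\<^sub>R g s) \<longlonglongrightarrow> g s"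
    proof (rule AE_I2)
      fix s
      obtain N where N: "real N > s / w" using reals_Archimedean2 by blast
      have "indicator {0..<w * real m} s *\<^sub>R g s = g s" if "N \<le> m" for m
      proof -
        have "s / w < real m" using N that by linarith
        then show ?thesis using w neg[of s] by (auto simp: indicator_def field_simps)
      qed
      then show "(\<lambda>m. indicator {0..<w * real m} s *\<^sub>R g s) \<longlonglongrightarrow> g s"
        by (intro tendsto_eventually) (auto simp: eventually_sequentially)
    qed
  qed (use g in \<open>auto simp: indicator_def\<close>)
  then show ?thesis unfolding sums_def cell part .
qed

context
  fixes \<alpha> :: real
  assumes \<alpha>: "0 < \<alpha>" "\<alpha> < 1"
begin

lemma stable_jump_antimono: "0 < s \<Longrightarrow> s \<le> t \<Longrightarrow> stable_jump \<alpha> t \<le> stable_jump \<alpha> s"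
  using \<alpha> by (simp add: stable_jump_def powr_mono2')

lemma stable_jump_cell_le:
  assumes "0 < w" "0 \<le> v"
  shows "stable_jump \<alpha> (w * (real (Suc i) + v)) \<le> stable_jump \<alpha> (w * real (Suc i))"
  using assms by (intro stable_jump_antimono mult_left_mono mult_pos_pos) auto

lemma summable_stable_jump: "0 < w \<Longrightarrow> summable (\<lambda>i. stable_jump \<alpha> (w * real (Suc i)))"
proof -
  assume w: "0 < w"
  have "-1/\<alpha> < -1" using \<alpha> by (simp add: field_simps)
  then have "summable (\<lambda>i. real (Suc i) powr (-1/\<alpha>))"
    by (subst summable_Suc_iff) (simp only: summable_real_powr_iff)
  then have "summable (\<lambda>i. w powr (-1/\<alpha>) * real (Suc i) powr (-1/\<alpha>))" by (rule summable_mult)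
  then show ?thesis using w by (simp add: stable_jump_def powr_mult del: of_nat_Suc)
qed

lemma exponent_one_sided_sums:
  assumes "0 < w"
  shows "(\<lambda>i. of_real w * ((\<integral>v. iexp (\<theta> * stable_jump \<alpha> (w * (real i + v))) \<partial>unif01) - 1)) sums stable_exponent \<alpha> \<theta>"
proof -
  interpret U: prob_space unif01 by (rule prob_space_unif01)
  have "integrable lborel (\<lambda>s. - (1 - exp (- ((- \<i> * of_real \<theta>) * of_real (stable_jump \<alpha> s)))))"
    by (intro integrable_minus integrable_exp_jump \<alpha>) auto
  then have "integrable lborel (\<lambda>s. iexp (\<theta> * stable_jump \<alpha> s) - 1)" by (simp add: mult.assoc)
  from unif01_cells_sums[OF assms this]
  have "(\<lambda>i. of_real w * (\<integral>v. iexp (\<theta> * stable_jump \<alpha> (w * (real i + v))) - 1 \<partial>unif01)) sums stable_exponent \<alpha> \<theta>"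
    by (simp add: stable_exponent_def[OF \<alpha>] stable_jump_def)
  moreover have "(\<integral>v. iexp (\<theta> * stable_jump \<alpha> (w * (real i + v))) - 1 \<partial>unif01) =
      (\<integral>v. iexp (\<theta> * stable_jump \<alpha> (w * (real i + v))) \<partial>unif01) - 1" for i
    by (subst Bochner_Integration.integral_diff) (auto intro!: U.integrable_iexp simp: U.prob_space)
  ultimately show ?thesis by simp
qed

text \<open>The width w stays free because the tail bounds below let it tend to 0. Summability is
  that of i^(-1/\<alpha>), obtained by bounding a jump by the left end of its cell.\<close>

lemma compound_series_one_sided:
  assumes w: "0 < w"
  shows "compound_series unif01 w (\<lambda>i v. stable_jump \<alpha> (w * (real i + v)))"
proof -
  interpret U: prob_space unif01 by (rule prob_space_unif01)
  have int: "integrable unif01 (\<lambda>v. stable_jump \<alpha> (w * (real (Suc i) + v)))" for i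
    by (rule U.integrable_const_bound[where B="stable_jump \<alpha> (w * real (Suc i))"])
      (use AE_unif01 in \<open>auto elim!: eventually_mono simp: stable_jump_nonneg abs_of_nonneg intro!: stable_jump_cell_le[OF w, simplified]\<close>)
  show ?thesis
  proof (unfold_locales)
    show "summable (\<lambda>i. \<integral>v. \<bar>stable_jump \<alpha> (w * (real (Suc i) + v))\<bar> \<partial>unif01)"
    proof (rule summable_comparison_test'[OF summable_stable_jump[OF w]])
      fix i
      have "(\<integral>v. \<bar>stable_jump \<alpha> (w * (real (Suc i) + v))\<bar> \<partial>unif01) \<le> (\<integral>v. stable_jump \<alpha> (w * real (Suc i)) \<partial>unif01)"
        by (intro integral_mono_AE integrable_abs int)
          (use AE_unif01 in \<open>auto elim!: eventually_mono simp: stable_jump_nonneg abs_of_nonneg intro!: stable_jump_cell_le[OF w, simplified]\<close>)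
      then show "norm (\<integral>v. \<bar>stable_jump \<alpha> (w * (real (Suc i) + v))\<bar> \<partial>unif01) \<le> stable_jump \<alpha> (w * real (Suc i))"
        by (simp add: U.prob_space)
    qed
  qed (use w int in auto)
qed

definition sgnb :: "bool \<Rightarrow> real" where "sgnb b = (if b then 1 else -1)"

text \<open>Each jump receives an independent sign, positive with probability p, which splits the
  Levy measure in the proportion p to 1 - p.\<close>

lemma compound_series_two_sided:
  shows "compound_series (unif01 \<Otimes>\<^sub>M measure_pmf (bernoulli_pmf p)) 1 (\<lambda>i vb. \<gamma> * sgnb (snd vb) * stable_jump \<alpha> (real i + fst vb))"
    (is "compound_series ?K 1 ?J")
proof -
  interpret U: prob_space unif01 by (rule prob_space_unif01)
  interpret UB: pair_prob_space unif01 "measure_pmf (bernoulli_pmf p)" ..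
  have AE: "AE vb in ?K. 0 \<le> fst vb"
    using UB.AE_pair_measure[of "\<lambda>vb. 0 \<le> fst vb"] AE_unif01 by (auto elim!: eventually_mono)
  have bound: "AE vb in ?K. \<bar>?J (Suc i) vb\<bar> \<le> \<bar>\<gamma>\<bar> * stable_jump \<alpha> (real (Suc i))" for i
    using AE
  proof eventually_elim
    case (elim vb)
    have "\<bar>?J (Suc i) vb\<bar> = \<bar>\<gamma>\<bar> * stable_jump \<alpha> (real (Suc i) + fst vb)"
      by (simp add: abs_mult sgnb_def stable_jump_nonneg)
    then show ?case using stable_jump_cell_le[of 1 "fst vb" i] elim by (simp add: mult_left_mono)
  qed
  have int: "integrable ?K (?J (Suc i))" for i
    using bound[of i] by (intro UB.integrable_const_bound) auto
  show ?thesis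
  proof (unfold_locales)
    show "summable (\<lambda>i. \<integral>vb. \<bar>?J (Suc i) vb\<bar> \<partial>?K)"
    proof (rule summable_comparison_test'[OF summable_mult[OF summable_stable_jump[of 1], of "\<bar>\<gamma>\<bar>"]])
      fix i
      have "(\<integral>vb. \<bar>?J (Suc i) vb\<bar> \<partial>?K) \<le> (\<integral>vb. \<bar>\<gamma>\<bar> * stable_jump \<alpha> (real (Suc i)) \<partial>?K)"
        by (intro integral_mono_AE integrable_abs int bound) auto
      then show "norm (\<integral>vb. \<bar>?J (Suc i) vb\<bar> \<partial>?K) \<le> \<bar>\<gamma>\<bar> * stable_jump \<alpha> (1 * real (Suc i))"
        by (simp add: UB.prob_space)
    qed simp
  qed (use int in auto)
qed

lemma ex_stable_levy_motion:
  assumes "0 < \<sigma>" "-1 \<le> \<beta>" "\<beta> \<le> 1"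
  obtains Q :: "(real \<Rightarrow> real) measure" and W where "stable_levy_motion Q W \<alpha> \<sigma> \<beta>"
proof -
  \<comment> \<open>The skewness is the difference p - (1 - p) of the weights of the two
    signs.\<close>
  define p where "p = (1 + \<beta>) / 2"
  have p: "0 \<le> p" "p \<le> 1" using assms by (auto simp: p_def)
  define \<kappa> where "\<kappa> = stable_const \<alpha>"
  have \<kappa>: "0 < \<kappa>" using stable_const_pos[OF \<alpha>] by (simp add: \<kappa>_def)
  \<comment> \<open>Unit jumps produce \<sigma>^\<alpha> = \<kappa>; jumps scaled by \<gamma>
    produce \<kappa> \<gamma>^\<alpha>, which this choice makes equal to the prescribed power of
    \<sigma>.\<close>
  define \<gamma> where "\<gamma> = \<sigma> * \<kappa> powr (-1/\<alpha>)"
  have \<gamma>: "0 < \<gamma>" using assms \<kappa> by (simp add: \<gamma>_def)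
  have \<gamma>\<alpha>: "\<kappa> * \<gamma> powr \<alpha> = \<sigma> powr \<alpha>"
  proof -
    have "(\<kappa> powr (-1/\<alpha>)) powr \<alpha> = \<kappa> powr (-1)" using \<alpha> by (simp add: powr_powr del: powr_minus)
    also have "\<dots> = 1 / \<kappa>" using \<kappa> by (simp add: powr_minus divide_inverse)
    finally show ?thesis using assms \<kappa> unfolding \<gamma>_def by (simp add: powr_mult)
  qed
  let ?K = "unif01 \<Otimes>\<^sub>M measure_pmf (bernoulli_pmf p)"
  let ?J = "\<lambda>i vb. \<gamma> * sgnb (snd vb) * stable_jump \<alpha> (real i + fst vb)"
  interpret U: prob_space unif01 by (rule prob_space_unif01)
  interpret UB: pair_prob_space unif01 "measure_pmf (bernoulli_pmf p)" ..
  interpret C: compound_series ?K 1 ?J by (rule compound_series_two_sided)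
  have char: "(\<integral>vb. iexp (\<theta> * ?J i vb) \<partial>?K) - 1 =
     of_real p * (of_real 1 * ((\<integral>v. iexp (\<gamma> * \<theta> * stable_jump \<alpha> (1 * (real i + v))) \<partial>unif01) - 1)) +
     of_real (1 - p) * (of_real 1 * ((\<integral>v. iexp (- \<gamma> * \<theta> * stable_jump \<alpha> (1 * (real i + v))) \<partial>unif01) - 1))" for \<theta> i
  proof -
    have "(\<integral>vb. iexp (\<theta> * ?J i vb) \<partial>?K) =
       (\<integral>v. (\<integral>b. iexp (\<theta> * ?J i (v, b)) \<partial>measure_pmf (bernoulli_pmf p)) \<partial>unif01)"
      by (intro UB.integral_fst'[symmetric] UB.integrable_iexp) auto
    also have "\<dots> = (\<integral>v. of_real p * iexp (\<gamma> * \<theta> * stable_jump \<alpha> (1 * (real i + v))) +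
        of_real (1 - p) * iexp (- \<gamma> * \<theta> * stable_jump \<alpha> (1 * (real i + v))) \<partial>unif01)"
      using p by (intro Bochner_Integration.integral_cong refl)
        (simp add: integral_measure_pmf[of UNIV] UNIV_bool sgnb_def scaleR_conv_of_real ac_simps)
    also have "\<dots> = of_real p * (\<integral>v. iexp (\<gamma> * \<theta> * stable_jump \<alpha> (1 * (real i + v))) \<partial>unif01) +
        of_real (1 - p) * (\<integral>v. iexp (- \<gamma> * \<theta> * stable_jump \<alpha> (1 * (real i + v))) \<partial>unif01)"
      by (subst Bochner_Integration.integral_add)
        (auto intro!: integrable_mult_right U.integrable_iexp simp del: of_real_mult of_real_minus)
    finally show ?thesis by (simp add: algebra_simps)
  qed
  have expo: "C.exponent \<theta> = - complex_of_real (\<sigma> powr \<alpha> * \<bar>\<theta>\<bar> powr \<alpha>)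
               * (1 - \<i> * complex_of_real (\<beta> * sgn \<theta> * tan (pi * \<alpha> / 2)))" for \<theta>
  proof -
    have "(\<lambda>i. (\<integral>vb. iexp (\<theta> * ?J i vb) \<partial>?K) - 1) sums
       (of_real p * stable_exponent \<alpha> (\<gamma> * \<theta>) + of_real (1 - p) * stable_exponent \<alpha> (- \<gamma> * \<theta>))"
      unfolding char by (intro sums_add sums_mult exponent_one_sided_sums) auto
    then have "C.exponent \<theta> = of_real p * stable_exponent \<alpha> (\<gamma> * \<theta>) + of_real (1 - p) * stable_exponent \<alpha> (- \<gamma> * \<theta>)"
      by (simp add: C.exponent_def sums_iff)
    moreover have "stable_exponent \<alpha> (\<gamma> * \<theta>) = - of_real (\<sigma> powr \<alpha> * \<bar>\<theta>\<bar> powr \<alpha>) * (1 - \<i> * of_real (sgn \<theta> * tan (pi * \<alpha> / 2)))"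
      unfolding stable_exponent_eq[OF \<alpha>] \<kappa>_def[symmetric] \<gamma>\<alpha>[symmetric]
      using \<gamma> by (simp add: abs_mult powr_mult sgn_mult)
    moreover have "stable_exponent \<alpha> (- \<gamma> * \<theta>) = - of_real (\<sigma> powr \<alpha> * \<bar>\<theta>\<bar> powr \<alpha>) * (1 + \<i> * of_real (sgn \<theta> * tan (pi * \<alpha> / 2)))"
      unfolding stable_exponent_eq[OF \<alpha>] \<kappa>_def[symmetric] \<gamma>\<alpha>[symmetric]
      using \<gamma> by (simp add: abs_mult powr_mult sgn_mult)
    moreover have "of_real p * (- A * (1 - \<i> * T)) + of_real (1 - p) * (- A * (1 + \<i> * T)) = - A * (1 - \<i> * (of_real \<beta> * T))" for A T :: complex
      by (simp add: p_def field_simps)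
    ultimately show ?thesis by (simp only:) (simp add: mult.assoc)
  qed
  show thesis
  proof (rule stable_levy_motionI[where M=C.cells and L=C.L and \<psi>=C.exponent and \<alpha>=\<alpha> and \<sigma>=\<sigma> and \<beta>=\<beta>])
    fix ts :: "nat \<Rightarrow> real" and n \<theta>
    assume "0 \<le> ts 0" "ts n \<le> 1" "\<And>j. j < n \<Longrightarrow> ts j < ts (Suc j)"
    then show "(\<integral>x. iexp (\<Sum>j<n. \<theta> j * (C.L (ts (Suc j)) x - C.L (ts j) x)) \<partial>C.cells) =
        exp (\<Sum>j<n. of_real (ts (Suc j) - ts j) * C.exponent (\<theta> j))"
      by (rule C.L_joint_char)
  next
    show "thesis" if "stable_levy_motion Q W \<alpha> \<sigma> \<beta>" for Q :: "(real \<Rightarrow> real) measure" and W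
      using that by (rule \<open>\<And>Q W. stable_levy_motion Q W \<alpha> \<sigma> \<beta> \<Longrightarrow> thesis\<close>)
  qed (use C.cadlag_process_L expo assms \<alpha> in auto)
qed


lemma stable_jump_less_iff: "0 < s \<Longrightarrow> 0 < y \<Longrightarrow> y < stable_jump \<alpha> s \<longleftrightarrow> s < y powr (-\<alpha>)"
proof -
  assume s: "0 < s" "0 < y"
  have 1: "stable_jump \<alpha> s powr (-\<alpha>) = s" using s \<alpha> by (simp add: stable_jump_def powr_powr)
  have 2: "0 < stable_jump \<alpha> s" using s by (simp add: stable_jump_def)
  show ?thesis
  proof
    assume "y < stable_jump \<alpha> s"
    then show "s < y powr (-\<alpha>)" using powr_less_mono2_neg[of "-\<alpha>" y "stable_jump \<alpha> s"] s \<alpha> 1 by simp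
  next
    assume "s < y powr (-\<alpha>)"
    then show "y < stable_jump \<alpha> s" using powr_mono2'[of "-\<alpha>" "stable_jump \<alpha> s" y] 2 s \<alpha> 1 by (force simp: not_less)
  qed
qed

lemma emeasure_unif01_jump_tail:
  assumes "0 < w" "0 < y"
  shows "emeasure unif01 {v. y < stable_jump \<alpha> (w * v)} = ennreal (min 1 (y powr (-\<alpha>) / w))"
proof -
  have "{0..<1} \<inter> {v. y < stable_jump \<alpha> (w * v)} = {0<..<min 1 (y powr (-\<alpha>) / w)}"
  proof (intro set_eqI)
    fix v
    have "v \<le> 0 \<Longrightarrow> \<not> y < stable_jump \<alpha> (w * v)" using assms by (auto simp: stable_jump_def zero_less_mult_iff)
    moreover have "0 < v \<Longrightarrow> y < stable_jump \<alpha> (w * v) \<longleftrightarrow> v < y powr (-\<alpha>) / w"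
      using stable_jump_less_iff[of "w * v" y] assms by (simp add: field_simps)
    ultimately show "v \<in> {0..<1} \<inter> {v. y < stable_jump \<alpha> (w * v)} \<longleftrightarrow> v \<in> {0<..<min 1 (y powr (-\<alpha>) / w)}"
      by (cases "0 < v") auto
  qed
  moreover have "0 \<le> y powr (-\<alpha>) / w" using assms by simp
  moreover have "{v. y < stable_jump \<alpha> (w * v)} \<in> sets lborel" by measurable
  ultimately show ?thesis
    using divide_ennreal[of "min 1 (y powr (-\<alpha>) / w)" 1] by (subst emeasure_uniform_measure) auto
qed

section \<open>The tail of the one-sided stable law\<close>

context
  fixes w :: real
  assumes w: "0 < w"
begin

interpretation S: compound_series unif01 w "\<lambda>i v. stable_jump \<alpha> (w * (real i + v))"
  by (rule compound_series_one_sided[OF w])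

lemma one_sided_char: "char (distr S.cells borel (S.L 1)) \<theta> = exp (stable_exponent \<alpha> \<theta>)"
proof -
  have "S.exponent \<theta> = stable_exponent \<alpha> \<theta>"
  proof -
    have "S.exponent \<theta> = (\<Sum>i. of_real w * ((\<integral>v. iexp (\<theta> * stable_jump \<alpha> (w * (real i + v))) \<partial>unif01) - 1))"
      unfolding S.exponent_def by (rule suminf_mult[symmetric]) (rule S.summable_exponent)
    also have "\<dots> = stable_exponent \<alpha> \<theta>"
      using exponent_one_sided_sums[OF w] by (rule sums_unique[symmetric])
    finally show ?thesis .
  qed
  then show ?thesis
    using S.L_joint_char[of "\<lambda>j. if j = 0 then 0 else 1" 1 "\<lambda>_. \<theta>"]
    unfolding char_def by (subst integral_distr) (simp_all add: S.L_0)
qed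

lemma jump_nonneg: "0 \<le> S.jump i t p" "0 \<le> cell_sum (S.jump i t) x"
  by (auto simp: S.jump_def cell_sum_def stable_jump_nonneg intro!: sum_nonneg)

lemma one_sided_nonneg: "0 \<le> S.L t x"
  by (auto simp: S.L_def intro!: suminf_nonneg S.summable_jump jump_nonneg)

lemma emeasure_marks_tail:
  assumes y: "0 < y"
  shows "emeasure S.marks {p\<in>space S.marks. y < S.jump 0 1 p} = ennreal (min 1 (y powr (-\<alpha>) / w))"
proof -
  have sp: "space S.marks = UNIV" by (simp add: S.marks_def space_pair_measure)
  have "{p\<in>space S.marks. y < S.jump 0 1 p} \<in> sets S.marks" by measurable
  then have "emeasure S.marks {p\<in>space S.marks. y < S.jump 0 1 p} =
      (\<integral>\<^sup>+u. emeasure unif01 (Pair u -` {p. y < S.jump 0 1 p}) \<partial>S.unif)"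
    unfolding sp unfolding S.marks_def by (subst S.K.emeasure_pair_measure_alt) auto
  also have "\<dots> = (\<integral>\<^sup>+u. ennreal (min 1 (y powr (-\<alpha>) / w)) \<partial>S.unif)"
  proof (rule nn_integral_cong_AE)
    have "AE u in S.unif. u \<in> {0<..1}" unfolding S.unif_def
    proof (rule AE_uniform_measureI)
      show "AE x in lborel. x \<in> {0..1} \<longrightarrow> x \<in> {0<..1::real}"
        using AE_lborel_singleton[of "0::real"] by eventually_elim auto
    qed auto
    then show "AE u in S.unif. emeasure unif01 (Pair u -` {p. y < S.jump 0 1 p}) = ennreal (min 1 (y powr (-\<alpha>) / w))"
    proof eventually_elim
      case (elim u)
      have "Pair u -` {p. y < S.jump 0 1 p} = {v. y < stable_jump \<alpha> (w * v)}"
        using elim by (auto simp: S.jump_def)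
      then show ?case using emeasure_unif01_jump_tail[OF w y] by simp
    qed
  qed
  also have "\<dots> = ennreal (min 1 (y powr (-\<alpha>) / w))"
    using S.unif.emeasure_space_1 by simp
  finally show ?thesis .
qed

interpretation PP: prob_space "PiM (UNIV :: nat set) (\<lambda>_. S.marks)"
  by (rule prob_space_PiM) (rule S.marks.prob_space_axioms)

lemma emeasure_marks_component:
  assumes y: "0 < y"
  shows "emeasure (PiM (UNIV :: nat set) (\<lambda>_. S.marks)) {z\<in>space (PiM UNIV (\<lambda>_. S.marks)). y < S.jump 0 1 (z l)} = ennreal (min 1 (y powr (-\<alpha>) / w))"
proof -
  have "emeasure (distr (PiM (UNIV :: nat set) (\<lambda>_. S.marks)) S.marks (\<lambda>z. z l)) {p\<in>space S.marks. y < S.jump 0 1 p} =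
     emeasure (PiM (UNIV :: nat set) (\<lambda>_. S.marks)) {z\<in>space (PiM UNIV (\<lambda>_. S.marks)). y < S.jump 0 1 (z l)}"
    by (subst emeasure_distr) (auto intro!: arg_cong2[where f=emeasure] simp: space_PiM)
  moreover have "distr (PiM (UNIV :: nat set) (\<lambda>_. S.marks)) S.marks (\<lambda>z. z l) = S.marks"
    by (rule nn_integral_PiM_component(2)[where f="\<lambda>_. 0"]) (auto intro: S.marks.prob_space_axioms)
  ultimately show ?thesis using emeasure_marks_tail[OF y] by simp
qed

lemma emeasure_first_cell:
  assumes [measurable]: "Measurable.pred (poisson_cell w S.marks) P"
  shows "emeasure S.cells {x\<in>space S.cells. P (x 0)} = (\<integral>\<^sup>+n. emeasure (PiM (UNIV :: nat set) (\<lambda>_. S.marks)) {z\<in>space (PiM UNIV (\<lambda>_. S.marks)). P (n, z)} \<partial>measure_pmf (poisson_pmf w))"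
proof -
  let ?C = "poisson_cell w S.marks"
  have A: "{y\<in>space ?C. P y} \<in> sets ?C" by measurable
  have "emeasure S.cells {x\<in>space S.cells. P (x 0)} = (\<integral>\<^sup>+x. indicator {y\<in>space ?C. P y} (x 0) \<partial>S.cells)"
  proof -
    have "{x\<in>space S.cells. P (x 0)} \<in> sets S.cells" by measurable
    moreover have "indicator {y\<in>space ?C. P y} (x 0) = (indicator {x\<in>space S.cells. P (x 0)} x :: ennreal)" if "x \<in> space S.cells" for x
      using measurable_space[OF S.component_measurable that, of 0] that by (auto simp: indicator_def)
    ultimately show ?thesis by (simp cong: nn_integral_cong)
  qed
  also have "\<dots> = emeasure ?C {y\<in>space ?C. P y}"
    using A by (subst S.nn_integral_cells_component) auto
  also have "\<dots> = (\<integral>\<^sup>+n. emeasure (PiM (UNIV :: nat set) (\<lambda>_. S.marks)) (Pair n -` {y\<in>space ?C. P y}) \<partial>measure_pmf (poisson_pmf w))"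
    using A unfolding poisson_cell_def by (subst PP.emeasure_pair_measure_alt) auto
  also have "(\<lambda>n. Pair n -` {y\<in>space ?C. P y}) = (\<lambda>n. {z\<in>space (PiM UNIV (\<lambda>_. S.marks)). P (n, z)})"
    by (auto simp: poisson_cell_def space_pair_measure fun_eq_iff)
  finally show ?thesis .
qed

text \<open>All jumps are nonnegative, so it suffices that cell 0 is nonempty and its first jump
  exceeds y. The condition on y makes the minimum in the tail of one jump inactive, and the
  coefficient tends to 1 with w.\<close>

lemma one_sided_tail_lower:
  assumes y: "0 < y" "y powr (-\<alpha>) \<le> w"
  shows "(1 - exp (-w)) / w * y powr (-\<alpha>) \<le> measure (distr S.cells borel (S.L 1)) {y<..}"
proof -
  define P where "P = (\<lambda>x :: nat \<times> (nat \<Rightarrow> real \<times> real). 1 \<le> fst x \<and> y < S.jump 0 1 (snd x 0))"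
  have [measurable]: "Measurable.pred (poisson_cell w S.marks) P"
    unfolding P_def poisson_cell_def by measurable
  have "ennreal ((1 - exp (-w)) / w * y powr (-\<alpha>)) = ennreal (y powr (-\<alpha>) / w) * ennreal (1 - exp (-w))"
    using w by (simp add: ennreal_mult'[symmetric] mult.commute)
  also have "ennreal (1 - exp (-w)) = emeasure (measure_pmf (poisson_pmf w)) (UNIV - {0})"
    using measure_pmf.prob_compl[of "{0}" "poisson_pmf w"] w by (simp add: measure_pmf.emeasure_eq_measure measure_pmf_single)
  also have "ennreal (y powr (-\<alpha>) / w) * emeasure (measure_pmf (poisson_pmf w)) (UNIV - {0}) =
      (\<integral>\<^sup>+n. ennreal (y powr (-\<alpha>) / w) * indicator (UNIV - {0}) n \<partial>measure_pmf (poisson_pmf w))"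
    by (subst nn_integral_cmult_indicator) auto
  also have "\<dots> = (\<integral>\<^sup>+n. emeasure (PiM (UNIV :: nat set) (\<lambda>_. S.marks)) {z\<in>space (PiM UNIV (\<lambda>_. S.marks)). P (n, z)} \<partial>measure_pmf (poisson_pmf w))"
  proof (rule nn_integral_cong)
    fix n :: nat
    show "ennreal (y powr (-\<alpha>) / w) * indicator (UNIV - {0}) n = emeasure (PiM (UNIV :: nat set) (\<lambda>_. S.marks)) {z\<in>space (PiM UNIV (\<lambda>_. S.marks)). P (n, z)}"
      using emeasure_marks_component[OF y(1), of 0] y w by (cases "n = 0") (auto simp: P_def min_def field_simps)
  qed
  also have "\<dots> = emeasure S.cells {x\<in>space S.cells. P (x 0)}"
    by (rule emeasure_first_cell[symmetric]) measurable
  also have "\<dots> \<le> emeasure S.cells {x\<in>space S.cells. y < S.L 1 x}"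
  proof (rule emeasure_mono_AE)
    show "AE x in S.cells. x \<in> {x\<in>space S.cells. P (x 0)} \<longrightarrow> x \<in> {x\<in>space S.cells. y < S.L 1 x}"
      using S.AE_good
    proof eventually_elim
      case (elim x)
      show ?case
      proof
        assume x: "x \<in> {x\<in>space S.cells. P (x 0)}"
        have "y < S.jump 0 1 (snd (x 0) 0)" using x by (simp add: P_def)
        also have "\<dots> \<le> cell_sum (S.jump 0 1) (x 0)"
          unfolding cell_sum_def using x by (intro member_le_sum jump_nonneg) (auto simp: P_def)
        also have "\<dots> = (\<Sum>i<1. cell_sum (S.jump i 1) (x i))" by simp
        also have "\<dots> \<le> S.L 1 x"
          unfolding S.L_def using elim by (simp only: if_True) (intro sum_le_suminf S.summable_jump jump_nonneg, auto)
        finally show "x \<in> {x\<in>space S.cells. y < S.L 1 x}" using x by simp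
      qed
    qed
  qed measurable
  also have "\<dots> = emeasure (distr S.cells borel (S.L 1)) {y<..}"
    by (subst emeasure_distr) (auto intro!: arg_cong2[where f=emeasure])
  finally show ?thesis
    using finite_measure.emeasure_eq_measure[OF prob_space.finite_measure[OF S.cells.prob_space_distr[OF S.L_measurable]]]
    by (simp add: measure_nonneg)
qed

text \<open>Either cell 0 exceeds (1 - e) y or the other cells exceed e y. The first event costs the
  factor 1 + w, the second Poisson moment w (w + 1) divided by w; the second event is handled by
  Markov's inequality and is of order 1/y, smaller than y^(-\<alpha>).\<close>

lemma one_sided_tail_upper:
  assumes y: "0 < y" and e: "0 < e" "e < 1"
  shows "measure (distr S.cells borel (S.L 1)) {y<..} \<le>
    (1 + w) * ((1 - e) * y) powr (-\<alpha>) + w * (\<Sum>i. \<integral>v. \<bar>stable_jump \<alpha> (w * (real (Suc i) + v))\<bar> \<partial>unif01) / (e * y)"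
proof -
  define z where "z = (1 - e) * y"
  have z: "0 < z" using y e by (simp add: z_def)
  define c where "c = w * (\<Sum>i. \<integral>v. \<bar>stable_jump \<alpha> (w * (real (Suc i) + v))\<bar> \<partial>unif01)"
  have c: "0 \<le> c" unfolding c_def using w S.J_summable by (intro mult_nonneg_nonneg suminf_nonneg) auto
  define R where "R x = (\<Sum>i. ennreal (cell_sum (S.absj (Suc i)) (x (Suc i))))" for x
  have [measurable]: "R \<in> borel_measurable S.cells" unfolding R_def[abs_def] by measurable
  let ?P = "\<lambda>x. z < cell_sum (S.jump 0 1) x"
  have "emeasure (distr S.cells borel (S.L 1)) {y<..} = emeasure S.cells {x\<in>space S.cells. y < S.L 1 x}"
    by (subst emeasure_distr) (auto intro!: arg_cong2[where f=emeasure])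
  also have "\<dots> \<le> emeasure S.cells ({x\<in>space S.cells. ?P (x 0)} \<union> {x\<in>space S.cells. 1 \<le> ennreal (1 / (e * y)) * R x})"
  proof (rule emeasure_mono, rule subsetI)
    fix x assume x: "x \<in> {x\<in>space S.cells. y < S.L 1 x}"
    show "x \<in> {x\<in>space S.cells. ?P (x 0)} \<union> {x\<in>space S.cells. 1 \<le> ennreal (1 / (e * y)) * R x}"
    proof (rule ccontr)
      assume n: "\<not> ?thesis"
      then have 1: "cell_sum (S.jump 0 1) (x 0) \<le> z" and 2: "ennreal (1 / (e * y)) * R x < 1" using x by (auto simp: not_less not_le)
      have good: "S.good x" using x y by (auto simp: S.L_def split: if_splits)
      have su: "summable (\<lambda>i. cell_sum (S.absj (Suc i)) (x (Suc i)))"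
        using S.good_summable[OF good] by (subst summable_Suc_iff)
      have "S.L 1 x = cell_sum (S.jump 0 1) (x 0) + (\<Sum>i. cell_sum (S.jump (Suc i) 1) (x (Suc i)))"
        using good suminf_split_head[OF S.summable_jump[OF good, of 1]] by (simp add: S.L_def)
      also have "(\<Sum>i. cell_sum (S.jump (Suc i) 1) (x (Suc i))) \<le> (\<Sum>i. cell_sum (S.absj (Suc i)) (x (Suc i)))"
      proof (intro suminf_le su)
        show "summable (\<lambda>i. cell_sum (S.jump (Suc i) 1) (x (Suc i)))"
          using S.summable_jump[OF good, of 1] by (subst summable_Suc_iff)
        show "cell_sum (S.jump (Suc i) 1) (x (Suc i)) \<le> cell_sum (S.absj (Suc i)) (x (Suc i))" for i
          using S.cell_sum_jump_le[of "Suc i" 1 "x (Suc i)"] by linarith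
      qed
      finally have "y - z < (\<Sum>i. cell_sum (S.absj (Suc i)) (x (Suc i)))" using 1 x by simp
      then have "e * y < (\<Sum>i. cell_sum (S.absj (Suc i)) (x (Suc i)))" by (simp add: z_def algebra_simps)
      moreover have "R x = ennreal (\<Sum>i. cell_sum (S.absj (Suc i)) (x (Suc i)))"
        unfolding R_def by (intro suminf_ennreal2 su S.absj_nonneg)
      moreover have "0 \<le> (\<Sum>i. cell_sum (S.absj (Suc i)) (x (Suc i)))" by (intro suminf_nonneg su S.absj_nonneg)
      ultimately have "1 \<le> ennreal (1 / (e * y)) * R x"
        using e y by (simp add: ennreal_mult'[symmetric] divide_simps)
      then show False using 2 by simp
    qed
  qed measurable
  also have "\<dots> \<le> emeasure S.cells {x\<in>space S.cells. ?P (x 0)} + emeasure S.cells {x\<in>space S.cells. 1 \<le> ennreal (1 / (e * y)) * R x}"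
    by (intro emeasure_subadditive) measurable
  also have "emeasure S.cells {x\<in>space S.cells. 1 \<le> ennreal (1 / (e * y)) * R x} \<le> ennreal (1 / (e * y)) * (\<integral>\<^sup>+x. R x * indicator (space S.cells) x \<partial>S.cells)"
    by (rule nn_integral_Markov_inequality) auto
  also have "(\<integral>\<^sup>+x. R x * indicator (space S.cells) x \<partial>S.cells) = ennreal c"
    using S.nn_integral_tail by (simp add: R_def c_def cong: nn_integral_cong)
  also have "ennreal (1 / (e * y)) * ennreal c = ennreal (c / (e * y))"
    using e y c by (simp add: ennreal_mult'[symmetric])
  also have "emeasure S.cells {x\<in>space S.cells. ?P (x 0)} \<le> ennreal ((1 + w) * z powr (-\<alpha>))"
  proof -
    have "emeasure S.cells {x\<in>space S.cells. ?P (x 0)} = (\<integral>\<^sup>+n. emeasure (PiM (UNIV :: nat set) (\<lambda>_. S.marks)) {v\<in>space (PiM UNIV (\<lambda>_. S.marks)). ?P (n, v)} \<partial>measure_pmf (poisson_pmf w))"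
      by (rule emeasure_first_cell) measurable
    also have "\<dots> \<le> (\<integral>\<^sup>+n. ennreal (z powr (-\<alpha>) / w) * ennreal ((real n)\<^sup>2) \<partial>measure_pmf (poisson_pmf w))"
    proof (rule nn_integral_mono)
      fix n :: nat
      show "emeasure (PiM (UNIV :: nat set) (\<lambda>_. S.marks)) {v\<in>space (PiM UNIV (\<lambda>_. S.marks)). ?P (n, v)} \<le> ennreal (z powr (-\<alpha>) / w) * ennreal ((real n)\<^sup>2)"
      proof (cases "n = 0")
        case True
        then show ?thesis using z by (simp add: cell_sum_def)
      next
        case False
        then have n: "0 < real n" by simp
        have "emeasure (PiM (UNIV :: nat set) (\<lambda>_. S.marks)) {v\<in>space (PiM UNIV (\<lambda>_. S.marks)). ?P (n, v)} \<le>
          emeasure (PiM (UNIV :: nat set) (\<lambda>_. S.marks)) (\<Union>l<n. {v\<in>space (PiM UNIV (\<lambda>_. S.marks)). z / real n < S.jump 0 1 (v l)})"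
        proof (rule emeasure_mono, rule subsetI)
          fix v assume v: "v \<in> {v\<in>space (PiM UNIV (\<lambda>_. S.marks)). ?P (n, v)}"
          have "\<exists>l<n. z / real n < S.jump 0 1 (v l)"
          proof (rule ccontr)
            assume "\<not> ?thesis"
            then have "(\<Sum>l<n. S.jump 0 1 (v l)) \<le> (\<Sum>l<n. z / real n)" by (intro sum_mono) (meson lessThan_iff not_less)
            then show False using v n by (simp add: cell_sum_def)
          qed
          then show "v \<in> (\<Union>l<n. {v\<in>space (PiM UNIV (\<lambda>_. S.marks)). z / real n < S.jump 0 1 (v l)})" using v by auto
        qed measurable
        also have "\<dots> \<le> (\<Sum>l<n. emeasure (PiM (UNIV :: nat set) (\<lambda>_. S.marks)) {v\<in>space (PiM UNIV (\<lambda>_. S.marks)). z / real n < S.jump 0 1 (v l)})"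
          by (intro emeasure_subadditive_finite) auto
        also have "\<dots> \<le> (\<Sum>l<n. ennreal (real n * (z powr (-\<alpha>) / w)))"
        proof (rule sum_mono)
          fix l
          have "(z / real n) powr (-\<alpha>) = real n powr \<alpha> * z powr (-\<alpha>)" using n z by (simp add: powr_divide powr_minus field_simps)
          also have "\<dots> \<le> real n powr 1 * z powr (-\<alpha>)" using n \<alpha> False by (intro mult_right_mono powr_mono) auto
          finally have "(z / real n) powr (-\<alpha>) / w \<le> real n * (z powr (-\<alpha>) / w)" using w n by (simp add: divide_right_mono)
          then show "emeasure (PiM (UNIV :: nat set) (\<lambda>_. S.marks)) {v\<in>space (PiM UNIV (\<lambda>_. S.marks)). z / real n < S.jump 0 1 (v l)} \<le> ennreal (real n * (z powr (-\<alpha>) / w))"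
            using z n by (subst emeasure_marks_component) (auto intro!: ennreal_leI)
        qed
        also have "\<dots> = ennreal (z powr (-\<alpha>) / w) * ennreal ((real n)\<^sup>2)"
          using w n by (simp add: ennreal_of_nat_eq_real_of_nat ennreal_mult'[symmetric] power2_eq_square field_simps)
        finally show ?thesis .
      qed
    qed
    also have "\<dots> = ennreal (z powr (-\<alpha>) / w) * (\<integral>\<^sup>+n. ennreal ((real n)\<^sup>2) \<partial>measure_pmf (poisson_pmf w))"
      by (intro nn_integral_cmult) auto
    also have "(\<integral>\<^sup>+n. ennreal ((real n)\<^sup>2) \<partial>measure_pmf (poisson_pmf w)) = ennreal (w * (w + 1))"
      using w by (intro nn_integral_poisson poisson_second_moment) auto
    also have "ennreal (z powr (-\<alpha>) / w) * ennreal (w * (w + 1)) = ennreal ((1 + w) * z powr (-\<alpha>))"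
      using w by (simp add: ennreal_mult'[symmetric] field_simps)
    finally show ?thesis .
  qed
  finally have "emeasure (distr S.cells borel (S.L 1)) {y<..} \<le> ennreal ((1 + w) * z powr (-\<alpha>)) + ennreal (c / (e * y))"
    by (simp add: add_mono)
  also have "\<dots> = ennreal ((1 + w) * z powr (-\<alpha>) + c / (e * y))" using w c e y by (intro ennreal_plus[symmetric]) auto
  finally have "ennreal (measure (distr S.cells borel (S.L 1)) {y<..}) \<le> ennreal ((1 + w) * z powr (-\<alpha>) + c / (e * y))"
    using finite_measure.emeasure_eq_measure[OF prob_space.finite_measure[OF S.cells.prob_space_distr[OF S.L_measurable]]] by simp
  then show ?thesis using w c e y unfolding c_def[symmetric] z_def[symmetric] by (subst (asm) ennreal_le_iff) auto
qed

definition one_sided_law :: "real measure" where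
  "one_sided_law = distr S.cells borel (S.L 1)"

lemma one_sided_law_facts:
  "real_distribution one_sided_law" "char one_sided_law \<theta> = exp (stable_exponent \<alpha> \<theta>)" "measure one_sided_law {..<0} = 0"
proof -
  show "real_distribution one_sided_law"
    using S.cells.prob_space_distr[OF S.L_measurable]
    by (simp add: one_sided_law_def real_distribution_def real_distribution_axioms_def)
  show "char one_sided_law \<theta> = exp (stable_exponent \<alpha> \<theta>)"
    unfolding one_sided_law_def by (rule one_sided_char)
  have "S.L 1 -` {..<0} \<inter> space S.cells = {}" using one_sided_nonneg by (auto simp: not_less[symmetric])
  then show "measure one_sided_law {..<0} = 0"
    unfolding one_sided_law_def by (subst measure_distr) auto
qed

end

text \<open>The characteristic functions do not see how the half-line is cut into cells. This makes
  it legitimate to choose w after the law has been fixed.\<close>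

lemma one_sided_law_unique: "0 < w \<Longrightarrow> 0 < w' \<Longrightarrow> one_sided_law w = one_sided_law w'"
  using one_sided_law_facts by (intro Levy_uniqueness) auto

lemma one_sided_law_tail:
  "((\<lambda>y. y powr \<alpha> * measure (one_sided_law 1) {y<..}) \<longlongrightarrow> 1) at_top"
proof (rule tendstoI)
  fix e :: real assume e: "0 < e"
  \<comment> \<open>The coefficient of the upper bound when its splitting parameter e is also taken
    to be w. It tends to 1, like the coefficient (1 - exp(-w))/w of the lower bound.\<close>
  have "((\<lambda>w. (1 + w) * (1 - w) powr (-\<alpha>)) \<longlongrightarrow> (1 + 0) * (1 - 0) powr (-\<alpha>)) (at_right 0)"
    by (intro tendsto_intros) auto
  then have "eventually (\<lambda>w. (1 + w) * (1 - w) powr (-\<alpha>) < 1 + e / 2) (at_right 0)"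
    using e by (intro order_tendstoD(2)) auto
  moreover have "((\<lambda>w::real. (1 - exp (-w)) / w) \<longlongrightarrow> 1) (at_right 0)" by real_asymp
  then have "eventually (\<lambda>w::real. 1 - e < (1 - exp (-w)) / w) (at_right 0)"
    using e by (intro order_tendstoD(1)) auto
  moreover have "eventually (\<lambda>w::real. 0 < w \<and> w < 1) (at_right 0)"
    by (auto simp: eventually_at_right_field intro: exI[of _ 1])
  ultimately have "eventually (\<lambda>w. (1 + w) * (1 - w) powr (-\<alpha>) < 1 + e / 2 \<and> 1 - e < (1 - exp (-w)) / w \<and> 0 < w \<and> w < 1) (at_right 0)"
    by eventually_elim auto
  then obtain w where w: "(1 + w) * (1 - w) powr (-\<alpha>) < 1 + e / 2" "1 - e < (1 - exp (-w)) / w" "0 < w" "w < 1"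
    using eventually_happens'[of "at_right (0::real)"] by (auto simp: trivial_limit_at_right_real)
  define p where "p y = measure (one_sided_law 1) {y<..}" for y
  have p_w: "p y = measure (one_sided_law w) {y<..}" for y
    using one_sided_law_unique[of 1 w] w by (simp add: p_def)
  define c where "c = w * (\<Sum>i. \<integral>v. \<bar>stable_jump \<alpha> (w * (real (Suc i) + v))\<bar> \<partial>unif01)"
  have "((\<lambda>y. c / w * y powr (\<alpha> - 1)) \<longlongrightarrow> c / w * 0) at_top"
    using \<alpha> by (intro tendsto_mult tendsto_const tendsto_neg_powr filterlim_ident) auto
  then have "eventually (\<lambda>y. c / w * y powr (\<alpha> - 1) < e / 2) at_top"
    using e by (intro order_tendstoD(2)) auto
  moreover have "((\<lambda>y. y powr (-\<alpha>)) \<longlongrightarrow> 0) at_top"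
    using \<alpha> by (intro tendsto_neg_powr filterlim_ident) auto
  then have "eventually (\<lambda>y. y powr (-\<alpha>) < w) at_top" using w by (intro order_tendstoD(2)) auto
  ultimately show "eventually (\<lambda>y. dist (y powr \<alpha> * measure (one_sided_law 1) {y<..}) 1 < e) at_top"
    using eventually_gt_at_top[of 0]
  proof eventually_elim
    case (elim y)
    have yy: "y powr \<alpha> * y powr (-\<alpha>) = 1" using elim by (simp add: powr_add[symmetric])
    have "(1 - exp (-w)) / w * y powr (-\<alpha>) \<le> p y"
      unfolding p_w one_sided_law_def[OF w(3)] using elim by (intro one_sided_tail_lower[OF w(3)]) auto
    then have "y powr \<alpha> * ((1 - exp (-w)) / w * y powr (-\<alpha>)) \<le> y powr \<alpha> * p y" by (intro mult_left_mono) auto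
    moreover have "y powr \<alpha> * ((1 - exp (-w)) / w * y powr (-\<alpha>)) = (1 - exp (-w)) / w"
      using yy by (metis mult.left_commute mult.right_neutral)
    ultimately have lower: "1 - e < y powr \<alpha> * p y" using w by linarith
    have "p y \<le> (1 + w) * ((1 - w) * y) powr (-\<alpha>) + c / (w * y)"
      unfolding p_w one_sided_law_def[OF w(3)] c_def using elim w by (intro one_sided_tail_upper[OF w(3)]) auto
    then have "y powr \<alpha> * p y \<le> y powr \<alpha> * ((1 + w) * ((1 - w) * y) powr (-\<alpha>) + c / (w * y))" by (intro mult_left_mono) auto
    also have "\<dots> = (1 + w) * (1 - w) powr (-\<alpha>) * (y powr \<alpha> * y powr (-\<alpha>)) + c / w * y powr (\<alpha> - 1)"
    proof -
      have "((1 - w) * y) powr (-\<alpha>) = (1 - w) powr (-\<alpha>) * y powr (-\<alpha>)" by (rule powr_mult)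
      moreover have "y powr \<alpha> * (c / (w * y)) = c / w * y powr (\<alpha> - 1)" using elim by (simp add: powr_diff)
      moreover have "Y * ((1 + w) * (A * B) + D) = (1 + w) * A * (Y * B) + Y * D" for Y A B D :: real
        by (simp add: algebra_simps)
      ultimately show ?thesis by simp
    qed
    also have "\<dots> < 1 + e" unfolding yy mult_1_right using w(1) elim(1) by linarith
    finally show ?case using lower e by (simp add: dist_real_def p_def abs_less_iff)
  qed
qed

text \<open>By uniqueness of characteristic functions, the law is the image of the series law under
  multiplication by \<gamma>, so nonnegativity and the tail asymptotics are inherited;
  \<gamma>^\<alpha> becomes the tail constant.\<close>

lemma stable_law_one_sided:
  assumes "stable_law \<mu> \<alpha> \<sigma> 1 0" "0 < \<sigma>"
  shows "measure \<mu> {..<0} = 0"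
    and "((\<lambda>y. y powr \<alpha> * measure \<mu> {y<..}) \<longlongrightarrow> \<sigma> powr \<alpha> / stable_const \<alpha>) at_top"
proof -
  define \<kappa> where "\<kappa> = stable_const \<alpha>"
  have \<kappa>: "0 < \<kappa>" using stable_const_pos[OF \<alpha>] by (simp add: \<kappa>_def)
  define \<gamma> where "\<gamma> = \<sigma> * \<kappa> powr (-1/\<alpha>)"
  have \<gamma>: "0 < \<gamma>" using assms \<kappa> by (simp add: \<gamma>_def)
  have \<gamma>\<alpha>: "\<gamma> powr \<alpha> = \<sigma> powr \<alpha> / \<kappa>"
  proof -
    have "(\<kappa> powr (-1/\<alpha>)) powr \<alpha> = \<kappa> powr (-1)" using \<alpha> by (simp add: powr_powr del: powr_minus)
    also have "\<dots> = 1 / \<kappa>" using \<kappa> by (simp add: powr_minus divide_inverse)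
    finally show ?thesis using assms \<kappa> unfolding \<gamma>_def by (simp add: powr_mult)
  qed
  define \<nu> where "\<nu> = one_sided_law 1"
  interpret \<nu>: real_distribution \<nu> unfolding \<nu>_def by (rule one_sided_law_facts) simp
  have "\<mu> = distr \<nu> borel (\<lambda>x. \<gamma> * x)"
  proof (rule Levy_uniqueness)
    show "real_distribution \<mu>" using assms by (simp add: stable_law_def)
    show "real_distribution (distr \<nu> borel (\<lambda>x. \<gamma> * x))"
      using \<nu>.prob_space_distr[of "\<lambda>x. \<gamma> * x" borel] by (simp add: real_distribution_def real_distribution_axioms_def)
    show "char \<mu> = char (distr \<nu> borel (\<lambda>x. \<gamma> * x))"
    proof
      fix \<theta>
      have "char (distr \<nu> borel (\<lambda>x. \<gamma> * x)) \<theta> = char \<nu> (\<gamma> * \<theta>)"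
        unfolding char_def by (subst integral_distr) (simp_all add: ac_simps)
      also have "\<dots> = exp (stable_exponent \<alpha> (\<gamma> * \<theta>))" unfolding \<nu>_def by (rule one_sided_law_facts) simp
      also have "stable_exponent \<alpha> (\<gamma> * \<theta>) = - complex_of_real (\<sigma> powr \<alpha> * \<bar>\<theta>\<bar> powr \<alpha>) * (1 - \<i> * complex_of_real (1 * sgn \<theta> * tan (pi * \<alpha> / 2)))"
        unfolding stable_exponent_eq[OF \<alpha>] \<kappa>_def[symmetric]
        using \<gamma> \<gamma>\<alpha> \<kappa> by (simp add: abs_mult powr_mult sgn_mult)
      finally show "char \<mu> \<theta> = char (distr \<nu> borel (\<lambda>x. \<gamma> * x)) \<theta>"
        using assms by (simp add: stable_law_def)
    qed
  qed
  then have m: "measure \<mu> A = measure \<nu> ((\<lambda>x. \<gamma> * x) -` A)" if "A \<in> sets borel" for A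
    using that by (simp add: measure_distr)
  have "(\<lambda>x. \<gamma> * x) -` {..<0} = {..<0}" using \<gamma> by (auto simp: mult_less_0_iff)
  then show "measure \<mu> {..<0} = 0" using one_sided_law_facts(3)[of 1] by (simp add: m \<nu>_def)
  have "((\<lambda>y. \<gamma> powr \<alpha> * ((y / \<gamma>) powr \<alpha> * measure \<nu> {y / \<gamma><..})) \<longlongrightarrow> \<gamma> powr \<alpha> * 1) at_top"
  proof (intro tendsto_mult tendsto_const)
    have "filterlim (\<lambda>y. y / \<gamma>) at_top at_top" using \<gamma> by real_asymp
    from filterlim_compose[OF one_sided_law_tail this]
    show "((\<lambda>y. (y / \<gamma>) powr \<alpha> * measure \<nu> {y / \<gamma><..}) \<longlongrightarrow> 1) at_top" by (simp add: \<nu>_def)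
  qed
  moreover have "eventually (\<lambda>y. \<gamma> powr \<alpha> * ((y / \<gamma>) powr \<alpha> * measure \<nu> {y / \<gamma><..}) = y powr \<alpha> * measure \<mu> {y<..}) at_top"
    using eventually_gt_at_top[of 0]
  proof eventually_elim
    case (elim y)
    have "(\<lambda>x. \<gamma> * x) -` {y<..} = {y / \<gamma><..}" using \<gamma> by (auto simp: field_simps)
    then have "measure \<mu> {y<..} = measure \<nu> {y / \<gamma><..}" using m[of "{y<..}"] by simp
    moreover have "\<gamma> powr \<alpha> * (y / \<gamma>) powr \<alpha> = y powr \<alpha>" using \<gamma> elim by (simp add: powr_divide)
    ultimately show ?case by (simp add: mult.assoc[symmetric])
  qed
  ultimately show "((\<lambda>y. y powr \<alpha> * measure \<mu> {y<..}) \<longlongrightarrow> \<sigma> powr \<alpha> / stable_const \<alpha>) at_top"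
    using \<gamma>\<alpha> by (simp add: \<kappa>_def Lim_transform_eventually)
qed

end

subsection \<open>The truncated and discretised variables\<close>

lemma Ytrunc_measurable [measurable]: "Ytrunc k \<in> borel_measurable borel"
  unfolding Ytrunc_def[abs_def] by measurable

lemma Zmap_measurable [measurable]: "Zmap k \<in> borel_measurable borel"
  unfolding Zmap_def[abs_def] by measurable

text \<open>Multiplication by 4^k maps the truncation range onto 8^k to 16^k, so exactly one index
  of the sum fires, the floor of 4^k x; the end point x = 4^k is caught by the last index. A
  truncated value 0 fires none, as all indices are positive.\<close>

lemma Zmap_eq:
  "Zmap k x = (if 2 ^ k \<le> x \<and> x \<le> 4 ^ k then real_of_int \<lfloor>4 ^ k * x\<rfloor> / 4 ^ k else 0)"
proof (cases "2 ^ k \<le> x \<and> x \<le> 4 ^ k")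
  case True
  have p4: "(0::real) < 4 ^ k" by simp
  have e: "(8::real) ^ k = 4 ^ k * 2 ^ k" "(16::real) ^ k = 4 ^ k * 4 ^ k" by (simp_all flip: power_mult_distrib)
  define j where "j = nat \<lfloor>4 ^ k * x\<rfloor>"
  have x0: "0 \<le> x" using True by (meson order_trans zero_le_numeral zero_le_power)
  have jr: "real j = real_of_int \<lfloor>4 ^ k * x\<rfloor>" using x0 by (simp add: j_def)
  have lo: "(8::real) ^ k \<le> 4 ^ k * x" and hi: "4 ^ k * x \<le> (16::real) ^ k" using True unfolding e by auto
  have "real (8 ^ k) \<le> 4 ^ k * x" using lo by simp
  then have "real (8 ^ k) \<le> real j" unfolding jr by (metis le_floor_iff of_int_of_nat_eq of_int_le_iff)
  then have j1: "8 ^ k \<le> j" by (simp only: of_nat_le_iff)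
  have "real j \<le> 16 ^ k" unfolding jr using order_trans[OF of_int_floor_le hi] .
  then have "real j \<le> real (16 ^ k)" by simp
  then have j2: "j \<le> 16 ^ k" by (simp only: of_nat_le_iff)
  have ind: "indicator {real i / 4 ^ k ..< (real i + 1) / 4 ^ k} x = (if i = j then 1 else (0::real))" for i
  proof -
    have "x \<in> {real i / 4 ^ k ..< (real i + 1) / 4 ^ k} \<longleftrightarrow> real i \<le> 4 ^ k * x \<and> 4 ^ k * x < real i + 1"
      by (simp add: field_simps)
    also have "\<dots> \<longleftrightarrow> \<lfloor>4 ^ k * x\<rfloor> = int i" by (auto simp: floor_eq_iff)
    also have "\<dots> \<longleftrightarrow> i = j" using x0 by (auto simp: j_def)
    finally show ?thesis by (simp add: indicator_def)
  qed
  have "Zmap k x = (\<Sum>i\<in>{8^k..16^k}. if i = j then real j / 4 ^ k else 0)"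
    using True unfolding Zmap_def Ytrunc_def by (intro sum.cong refl) (simp add: ind)
  then show ?thesis using True j1 j2 by (simp add: jr)
next
  case False
  then have "Ytrunc k x = 0" by (simp add: Ytrunc_def)
  moreover have "(0::real) \<notin> {real i / 4 ^ k ..< (real i + 1) / 4 ^ k}" if "i \<in> {8^k..16^k}" for i
  proof -
    have "0 < (8::nat) ^ k" by simp
    also have "\<dots> \<le> i" using that by simp
    finally have "0 < real i / 4 ^ k" by simp
    then show ?thesis by simp
  qed
  ultimately have "Zmap k x = 0" unfolding Zmap_def by (intro sum.neutral) simp
  then show ?thesis unfolding if_not_P[OF False] .
qed

lemma Zmap_bounds:
  shows "0 \<le> Zmap k x" and "Zmap k x \<le> 4 ^ k" and "Zmap k x \<noteq> 0 \<Longrightarrow> 2 ^ k \<le> x"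
    and "0 \<le> x \<Longrightarrow> Zmap k x \<le> x" and "2 ^ k \<le> x \<Longrightarrow> x \<le> 4 ^ k \<Longrightarrow> x - 1 < Zmap k x"
proof -
  have A: "0 \<le> Zmap k x \<and> Zmap k x \<le> x \<and> x - 1 < Zmap k x" if x: "2 ^ k \<le> x" "x \<le> 4 ^ k"
  proof -
    have x0: "0 \<le> x" using x(1) by (meson order_trans zero_le_numeral zero_le_power)
    have "real_of_int \<lfloor>4 ^ k * x\<rfloor> / 4 ^ k \<le> 4 ^ k * x / 4 ^ k" by (intro divide_right_mono) auto
    moreover have "4 ^ k * x - 1 < real_of_int \<lfloor>4 ^ k * x\<rfloor>" by linarith
    then have "(4 ^ k * x - 1) / 4 ^ k < real_of_int \<lfloor>4 ^ k * x\<rfloor> / 4 ^ k" by (intro divide_strict_right_mono) auto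
    moreover have "(4 ^ k * x - 1) / 4 ^ k = x - 1 / 4 ^ k" by (simp add: field_simps)
    moreover have "x - 1 \<le> x - 1 / 4 ^ k" by simp
    ultimately have "real_of_int \<lfloor>4 ^ k * x\<rfloor> / 4 ^ k \<le> x" "x - 1 < real_of_int \<lfloor>4 ^ k * x\<rfloor> / 4 ^ k"
      by (simp, linarith)
    then show ?thesis using x x0 unfolding Zmap_eq by simp
  qed
  show "0 \<le> Zmap k x" using A by (cases "2 ^ k \<le> x \<and> x \<le> 4 ^ k") (auto simp: Zmap_eq)
  show "Zmap k x \<le> 4 ^ k" using A by (cases "2 ^ k \<le> x \<and> x \<le> 4 ^ k") (force simp: Zmap_eq)+
  show "Zmap k x \<noteq> 0 \<Longrightarrow> 2 ^ k \<le> x" by (auto simp: Zmap_eq split: if_splits)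
  show "0 \<le> x \<Longrightarrow> Zmap k x \<le> x" using A by (cases "2 ^ k \<le> x \<and> x \<le> 4 ^ k") (auto simp: Zmap_eq)
  show "2 ^ k \<le> x \<Longrightarrow> x \<le> 4 ^ k \<Longrightarrow> x - 1 < Zmap k x" using A by auto
qed

lemma sum_power_tail_le:
  fixes r :: real
  assumes r: "0 \<le> r" "r < 1" and F: "finite F" "\<And>k. k \<in> F \<Longrightarrow> m \<le> k"
  shows "(\<Sum>k\<in>F. r ^ k) \<le> r ^ m / (1 - r)"
proof -
  have "(\<Sum>k\<in>F. r ^ k) = (\<Sum>k\<in>F. r ^ m * r ^ (k - m))"
    using F by (intro sum.cong refl) (simp flip: power_add)
  also have "\<dots> = (\<Sum>j\<in>(\<lambda>k. k - m) ` F. r ^ m * r ^ j)"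
    using F by (subst sum.reindex) (auto intro!: inj_on_diff_nat)
  also have "\<dots> \<le> (\<Sum>j. r ^ m * r ^ j)"
    using r F by (intro sum_le_suminf summable_mult summable_geometric) auto
  also have "\<dots> = r ^ m / (1 - r)" using r by (simp add: suminf_mult suminf_geometric summable_geometric)
  finally show ?thesis .
qed

lemma le_dk: "k \<le> dk k"
proof -
  have "k \<le> k^2" by (simp add: power2_eq_square)
  also have "k^2 < 2 ^ (k^2)" by (rule less_exp)
  also have "(2::nat) ^ (k^2) \<le> 4 ^ (k^2)" by (simp add: power_mono)
  finally show ?thesis by (simp add: dk_def)
qed

text \<open>The limit controls large y; for the remaining y the probability is at most 1. A bound
  valid for all levels is what domination and summation over k require.\<close>

lemma (in real_distribution) tail_powr_bound:
  assumes \<alpha>: "0 < \<alpha>" and lim: "((\<lambda>y. y powr \<alpha> * measure M {y<..}) \<longlongrightarrow> c) at_top"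
  shows "\<exists>C>0. \<forall>y>0. measure M {y<..} \<le> C * y powr (-\<alpha>)"
proof -
  have "eventually (\<lambda>y. y powr \<alpha> * measure M {y<..} < c + 1) at_top" using lim by (rule order_tendstoD) simp
  then obtain y0 where y0: "\<And>y. y0 \<le> y \<Longrightarrow> y powr \<alpha> * measure M {y<..} < c + 1" by (auto simp: eventually_at_top_linorder)
  define y1 where "y1 = max 1 y0"
  define C where "C = max (c + 1) (y1 powr \<alpha>)"
  have "measure M {y<..} \<le> C * y powr (-\<alpha>)" if y: "0 < y" for y
  proof (cases "y1 \<le> y")
    case True
    then have "y powr \<alpha> * measure M {y<..} \<le> C" using y0[of y] by (simp add: y1_def C_def)
    then show ?thesis using y by (simp add: powr_minus field_simps)
  next
    case False
    have "y powr \<alpha> * measure M {y<..} \<le> y1 powr \<alpha> * 1"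
      using False y \<alpha> by (intro mult_mono powr_mono2) auto
    also have "\<dots> \<le> C" by (simp add: C_def)
    finally show ?thesis using y by (simp add: powr_minus field_simps)
  qed
  moreover have "0 < C" by (auto simp: C_def y1_def less_max_iff_disj)
  ultimately show ?thesis by blast
qed

section \<open>Tails of the triangular array\<close>

locale stable_array =
  fixes \<alpha> :: real and \<mu> :: "nat \<Rightarrow> real measure"
  assumes \<alpha>: "0 < \<alpha>" "\<alpha> < 1"
    and \<mu>: "\<And>k. 1 \<le> k \<Longrightarrow> stable_law (\<mu> k) \<alpha> (real k powr (-1/\<alpha>)) 1 0"
begin

definition c :: real where "c = 1 / stable_const \<alpha>"

text \<open>Only the tail of X_1 is named: X_k is distributed as k^(-1/\<alpha>) X_1, so one
  function serves all k.\<close>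

definition p :: "real \<Rightarrow> real" where "p y = measure (\<mu> (Suc 0)) {y<..}"

definition z :: "nat \<Rightarrow> real \<Rightarrow> real" where "z k t = measure (distr (\<mu> k) borel (Zmap k)) {t<..}"

lemma real_distribution_\<mu>: "1 \<le> k \<Longrightarrow> real_distribution (\<mu> k)"
  using \<mu> by (simp add: stable_law_def)

lemma p_tendsto: "((\<lambda>y. y powr \<alpha> * p y) \<longlongrightarrow> c) at_top"
  using stable_law_one_sided(2)[OF \<alpha> \<mu>[of "Suc 0"]] by (simp add: p_def c_def)

lemma \<mu>_tail:
  assumes k: "1 \<le> k"
  shows "measure (\<mu> k) {y<..} = p (real k powr (1/\<alpha>) * y)"
proof -
  interpret \<mu>1: real_distribution "\<mu> (Suc 0)" by (rule real_distribution_\<mu>) simp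
  define \<gamma> where "\<gamma> = real k powr (-1/\<alpha>)"
  have \<gamma>: "0 < \<gamma>" using k by (simp add: \<gamma>_def)
  have "\<mu> k = distr (\<mu> (Suc 0)) borel (\<lambda>x. \<gamma> * x)"
  proof (rule Levy_uniqueness)
    show "real_distribution (\<mu> k)" using k by (rule real_distribution_\<mu>)
    show "real_distribution (distr (\<mu> (Suc 0)) borel (\<lambda>x. \<gamma> * x))"
      using \<mu>1.prob_space_distr[of "\<lambda>x. \<gamma> * x" borel] by (simp add: real_distribution_def real_distribution_axioms_def)
    show "char (\<mu> k) = char (distr (\<mu> (Suc 0)) borel (\<lambda>x. \<gamma> * x))"
    proof
      fix \<theta>
      have "char (distr (\<mu> (Suc 0)) borel (\<lambda>x. \<gamma> * x)) \<theta> = char (\<mu> (Suc 0)) (\<gamma> * \<theta>)"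
        unfolding char_def by (subst integral_distr) (simp_all add: ac_simps)
      also have "\<dots> = char (\<mu> k) \<theta>"
        using \<mu>[of "Suc 0"] \<mu>[OF k] \<gamma> unfolding stable_law_def \<gamma>_def[symmetric]
        by (simp add: abs_mult powr_mult sgn_mult)
      finally show "char (\<mu> k) \<theta> = char (distr (\<mu> (Suc 0)) borel (\<lambda>x. \<gamma> * x)) \<theta>" ..
    qed
  qed
  then have "measure (\<mu> k) {y<..} = measure (\<mu> (Suc 0)) ((\<lambda>x. \<gamma> * x) -` {y<..})"
    by (simp add: measure_distr)
  also have "(\<lambda>x. \<gamma> * x) -` {y<..} = {real k powr (1/\<alpha>) * y<..}"
    using k by (auto simp: \<gamma>_def powr_minus field_simps)
  finally show ?thesis by (simp add: p_def)
qed

lemma p_bound: "\<exists>C>0. \<forall>y>0. p y \<le> C * y powr (-\<alpha>)"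
  unfolding p_def
  by (rule real_distribution.tail_powr_bound[OF real_distribution_\<mu> \<alpha>(1) p_tendsto[unfolded p_def]]) simp

definition C :: real where "C = (SOME C. C > 0 \<and> (\<forall>y>0. p y \<le> C * y powr (-\<alpha>)))"

lemma C: "0 < C" "0 < y \<Longrightarrow> p y \<le> C * y powr (-\<alpha>)"
  using someI_ex[OF p_bound] unfolding C_def[symmetric] by auto

lemma pk_le:
  assumes "1 \<le> k" "0 < y"
  shows "p (real k powr (1/\<alpha>) * y) \<le> C / real k * y powr (-\<alpha>)"
proof -
  have "p (real k powr (1/\<alpha>) * y) \<le> C * (real k powr (1/\<alpha>) * y) powr (-\<alpha>)" using assms by (intro C) auto
  also have "(real k powr (1/\<alpha>) * y) powr (-\<alpha>) = y powr (-\<alpha>) / real k"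
    using assms \<alpha> by (simp add: powr_mult powr_powr powr_minus_divide)
  finally show ?thesis by simp
qed

lemma z_eq: "1 \<le> k \<Longrightarrow> z k t = measure (\<mu> k) {x. t < Zmap k x}"
proof -
  assume k: "1 \<le> k"
  interpret real_distribution "\<mu> k" using k by (rule real_distribution_\<mu>)
  show ?thesis unfolding z_def by (subst measure_distr) (auto intro!: arg_cong2[where f=measure])
qed

lemma z_nonneg: "0 \<le> z k t" by (simp add: z_def)

lemma z_le_p:
  assumes k: "1 \<le> k" and t: "0 \<le> t"
  shows "z k t \<le> p (real k powr (1/\<alpha>) * t)"
proof -
  interpret real_distribution "\<mu> k" using k by (rule real_distribution_\<mu>)
  have "t < x" if "t < Zmap k x" for x
  proof -
    have "2 ^ k \<le> x" using that t Zmap_bounds(3)[of k x] by auto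
    then have "0 \<le> x" by (meson order_trans zero_le_numeral zero_le_power)
    then show ?thesis using that Zmap_bounds(4)[of x k] by linarith
  qed
  then have "z k t \<le> measure (\<mu> k) {t<..}"
    unfolding z_eq[OF k] by (intro finite_measure_mono) auto
  then show ?thesis by (simp add: \<mu>_tail[OF k])
qed

text \<open>X_k reaches 2^k with probability of order r^k / k, which makes sums over large k
  geometric.\<close>

definition r :: real where "r = 2 powr (-\<alpha>)"

lemma r: "0 < r" "r < 1"
  using \<alpha> powr_less_mono[of "-\<alpha>" 0 "2::real"] by (auto simp: r_def)

lemma power2_powr: "(2 ^ k) powr (-\<alpha>) = r ^ k"
proof -
  have "(2 ^ k) powr (-\<alpha>) = (2 powr real k) powr (-\<alpha>)" by (simp add: powr_realpow)
  also have "\<dots> = (2 powr (-\<alpha>)) powr real k" by (simp only: powr_powr mult.commute)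
  also have "\<dots> = r ^ k" unfolding r_def by (rule powr_realpow) simp
  finally show ?thesis .
qed

text \<open>A nonzero Z_k is at least 2^k, so the bound holds at every level t, however low. The
  factor 1/k is kept because it later provides a gain of 1/log y.\<close>

lemma z_le_geometric:
  assumes k: "1 \<le> k" and t: "0 \<le> t"
  shows "z k t \<le> C / (real k * r) * r ^ k"
proof -
  interpret real_distribution "\<mu> k" using k by (rule real_distribution_\<mu>)
  \<comment> \<open>Half of 2^k turns the weak inequality into a strict one; this is the origin of
    the extra r in the denominator.\<close>
  have "2 ^ k / 2 < x" if "t < Zmap k x" for x
  proof -
    have "2 ^ k \<le> x" using that t Zmap_bounds(3)[of k x] by auto
    moreover have "(0::real) < 2 ^ k" by simp
    ultimately show ?thesis by linarith
  qed
  then have "z k t \<le> measure (\<mu> k) {2 ^ k / 2<..}"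
    unfolding z_eq[OF k] by (intro finite_measure_mono) auto
  also have "\<dots> \<le> C / real k * (2 ^ k / 2) powr (-\<alpha>)"
    using k by (subst \<mu>_tail[OF k]) (intro pk_le, auto)
  also have "(2 ^ k / 2) powr (-\<alpha>) = r ^ k / r" using power2_powr[of k] by (simp add: powr_divide r_def)
  finally show ?thesis by (simp add: divide_divide_eq_left)
qed

lemma z_zero:
  assumes "1 \<le> k" "4 ^ k \<le> t"
  shows "z k t = 0"
proof -
  have "{x. t < Zmap k x} = {}" using order_trans[OF Zmap_bounds(2) assms(2)] by (simp add: not_less)
  then show ?thesis unfolding z_eq[OF assms(1)] by simp
qed

text \<open>The shift by 1 absorbs the rounding, whose error is at most 4^(-k); the subtracted tail
  at 4^k is the truncation.\<close>

lemma z_ge: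
  assumes k: "1 \<le> k" and t: "2 ^ k \<le> t"
  shows "p (real k powr (1/\<alpha>) * (t + 1)) - p (real k powr (1/\<alpha>) * 4 ^ k) \<le> z k t"
proof -
  interpret real_distribution "\<mu> k" using k by (rule real_distribution_\<mu>)
  have "{t + 1<..} \<subseteq> {x. t < Zmap k x} \<union> {4 ^ k<..}"
  proof
    fix x assume x: "x \<in> {t + 1<..}"
    show "x \<in> {x. t < Zmap k x} \<union> {4 ^ k<..}"
      using Zmap_bounds(5)[of k x] x t by (cases "x \<le> 4 ^ k") auto
  qed
  moreover have "{x. t < Zmap k x} \<in> events" by (simp add: events_eq_borel)
  ultimately have "measure (\<mu> k) {t + 1<..} \<le> measure (\<mu> k) ({x. t < Zmap k x} \<union> {4 ^ k<..})"
    by (intro finite_measure_mono) auto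
  also have "\<dots> \<le> z k t + measure (\<mu> k) {4 ^ k<..}"
    unfolding z_eq[OF k] by (intro measure_Un_le) auto
  finally show ?thesis by (simp add: \<mu>_tail[OF k])
qed

text \<open>The sum starts no earlier than the first m with t < 2^m, and there r^m is the power 2^m
  to -\<alpha>, at most t^(-\<alpha>).\<close>

lemma sum_geometric_above:
  assumes "finite F" "\<And>k. k \<in> F \<Longrightarrow> t < 2 ^ k" "0 < t"
  shows "(\<Sum>k\<in>F. r ^ k) \<le> t powr (-\<alpha>) / (1 - r)"
proof -
  obtain k1 where "t < 2 ^ k1" using real_arch_pow[of 2 t] by auto
  define m where "m = (LEAST k. t < 2 ^ k)"
  have m: "t < 2 ^ m" unfolding m_def by (rule LeastI) fact
  have "(\<Sum>k\<in>F. r ^ k) \<le> r ^ m / (1 - r)"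
    using r assms by (intro sum_power_tail_le) (auto simp: m_def intro: Least_le)
  also have "r ^ m \<le> t powr (-\<alpha>)"
    unfolding power2_powr[symmetric] using m assms(3) \<alpha> by (intro powr_mono2') auto
  finally show ?thesis using r by (simp add: divide_right_mono)
qed

lemma log_bounds:
  assumes "0 < y"
  shows "2 ^ k \<le> y \<longleftrightarrow> real k \<le> log 2 y" "y < 4 ^ k \<longleftrightarrow> log 2 y / 2 < real k"
proof -
  have "(2::real) ^ k \<le> y \<longleftrightarrow> 2 powr real k \<le> y" by (simp add: powr_realpow)
  also have "\<dots> \<longleftrightarrow> real k \<le> log 2 y" using assms by (subst le_log_iff) auto
  finally show "2 ^ k \<le> y \<longleftrightarrow> real k \<le> log 2 y" .
  have e: "(4::real) ^ k = 2 powr (2 * real k)" by (simp add: powr_powr[symmetric] powr_realpow)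
  have "y < 4 ^ k \<longleftrightarrow> log 2 y < 2 * real k" unfolding e using assms by (subst log_less_iff) auto
  then show "y < 4 ^ k \<longleftrightarrow> log 2 y / 2 < real k" by auto
qed

text \<open>The k whose truncation range contains the level y, that is, k between half of log2 y and
  log2 y. For smaller k the level cannot be exceeded, for larger ones it lies below the whole
  range.\<close>

definition window :: "real \<Rightarrow> nat set" where
  "window y = {k. 1 \<le> k \<and> 2 ^ k \<le> y \<and> y < 4 ^ k}"

lemma finite_window: "0 < y \<Longrightarrow> finite (window y)"
proof -
  assume y: "0 < y"
  have "window y \<subseteq> {..nat \<lceil>log 2 y\<rceil>}" using log_bounds[OF y] by (auto simp: window_def) linarith
  then show ?thesis by (rule finite_subset) simp
qed

text \<open>With l = log2 y there are at most l indices, each above l/2.\<close>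

lemma sum_window_inverse_le: "0 < y \<Longrightarrow> (\<Sum>k\<in>window y. 1 / real k) \<le> 2"
proof -
  assume y: "0 < y"
  let ?l = "log 2 y"
  show ?thesis
  proof (cases "window y = {}")
    case False
    then obtain k where "k \<in> window y" by auto
    then have l: "1 \<le> ?l" using log_bounds(1)[OF y, of k] by (auto simp: window_def)
    have "(\<Sum>k\<in>window y. 1 / real k) \<le> (\<Sum>k\<in>window y. 2 / ?l)"
      using l log_bounds[OF y] by (intro sum_mono) (auto simp: window_def field_simps)
    also have "\<dots> = real (card (window y)) * (2 / ?l)" by simp
    also have "\<dots> \<le> ?l * (2 / ?l)"
    proof (intro mult_right_mono)
      have "window y \<subseteq> {1..nat \<lfloor>?l\<rfloor>}" using log_bounds[OF y] l by (auto simp: window_def le_nat_iff le_floor_iff)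
      then have "card (window y) \<le> nat \<lfloor>?l\<rfloor>" using card_mono[of "{1..nat \<lfloor>?l\<rfloor>}" "window y"] by simp
      then show "real (card (window y)) \<le> ?l" using l by linarith
    qed (use l in auto)
    finally show ?thesis using l by simp
  qed simp
qed

text \<open>The term 2 C pays for the indices in the window, the other one for the geometric sum
  over those with t < 2^k.\<close>

definition H :: real where "H = 2 * C + C / (r * (1 - r))"

lemma H_pos: "0 < H"
  using C r by (auto simp: H_def intro!: add_pos_pos divide_pos_pos)

text \<open>Indices fall into three groups: 4^k \<le> t contributes nothing, the window contributes
  the bounded sum of 1/k, and t < 2^k a geometric sum. All are of order t^(-\<alpha>), uniformly in
  the finite index set.\<close>

lemma sum_z_le:
  assumes F: "finite F" "\<And>k. k \<in> F \<Longrightarrow> 1 \<le> k" and t: "0 < t"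
  shows "(\<Sum>k\<in>F. z k t) \<le> H * t powr (-\<alpha>)"
proof -
  let ?A = "{k\<in>F. t < 2 ^ k}" and ?B = "{k\<in>F. k \<in> window t}"
  have "(\<Sum>k\<in>F. z k t) = (\<Sum>k\<in>?A \<union> ?B. z k t)"
    using F by (intro sum.mono_neutral_right) (auto simp: window_def not_less intro!: z_zero)
  also have "\<dots> = (\<Sum>k\<in>?A. z k t) + (\<Sum>k\<in>?B. z k t)"
    using F by (intro sum.union_disjoint) (auto simp: window_def)
  also have "(\<Sum>k\<in>?A. z k t) \<le> (\<Sum>k\<in>?A. C / r * r ^ k)"
  proof (rule sum_mono)
    fix k assume k: "k \<in> ?A"
    have "z k t \<le> C / (real k * r) * r ^ k" using k F t by (intro z_le_geometric) auto
    also have "\<dots> \<le> C / r * r ^ k"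
      using k F(2)[of k] r C(1) by (intro mult_right_mono divide_left_mono) auto
    finally show "z k t \<le> C / r * r ^ k" .
  qed
  also have "\<dots> = C / r * (\<Sum>k\<in>?A. r ^ k)" by (simp add: sum_distrib_left)
  also have "\<dots> \<le> C / r * (t powr (-\<alpha>) / (1 - r))"
    using F t C(1) r by (intro mult_left_mono sum_geometric_above) auto
  also have "(\<Sum>k\<in>?B. z k t) \<le> (\<Sum>k\<in>?B. C * t powr (-\<alpha>) * (1 / real k))"
  proof (rule sum_mono)
    fix k assume k: "k \<in> ?B"
    have "z k t \<le> p (real k powr (1/\<alpha>) * t)" using k F t by (intro z_le_p) auto
    also have "\<dots> \<le> C / real k * t powr (-\<alpha>)" using k F t by (intro pk_le) auto
    finally show "z k t \<le> C * t powr (-\<alpha>) * (1 / real k)" by (simp add: field_simps)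
  qed
  also have "\<dots> \<le> (\<Sum>k\<in>window t. C * t powr (-\<alpha>) * (1 / real k))"
    using finite_window[OF t] C(1) by (intro sum_mono2) auto
  also have "\<dots> = C * t powr (-\<alpha>) * (\<Sum>k\<in>window t. 1 / real k)" by (simp add: sum_distrib_left)
  also have "\<dots> \<le> C * t powr (-\<alpha>) * 2" using C(1) by (intro mult_left_mono sum_window_inverse_le t) auto
  also have "C / r * (t powr (-\<alpha>) / (1 - r)) + C * t powr (-\<alpha>) * 2 = H * t powr (-\<alpha>)"
    by (simp add: H_def field_simps)
  finally show ?thesis by simp
qed

end

section \<open>The constant ln 2 and the sums over active indices\<close>

context stable_array
begin

text \<open>The sum is a difference of harmonic numbers at l and l/2 with l = log2 y. Euler's
  constant cancels, and the quotient of the integer parts tends to 2.\<close>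

lemma harm_window_tendsto: "((\<lambda>y. \<Sum>k\<in>window y. 1 / real k) \<longlongrightarrow> ln 2) at_top"
proof -
  define N where "N l = nat \<lfloor>l\<rfloor>" for l :: real
  have N_top: "filterlim N at_top at_top"
    unfolding N_def by (intro filterlim_compose[OF filterlim_nat_sequentially filterlim_floor_sequentially])
  have half: "filterlim (\<lambda>l. l / 2) at_top (at_top :: real filter)" by real_asymp
  define g where "g n = (harm n :: real) - ln (real n)" for n
  have g: "g \<longlonglongrightarrow> euler_mascheroni" using euler_mascheroni_LIMSEQ by (simp add: g_def[abs_def])
  have 1: "((\<lambda>l. g (N l) - g (N (l/2))) \<longlongrightarrow> euler_mascheroni - euler_mascheroni) at_top"
    by (intro tendsto_diff filterlim_compose[OF g] N_top filterlim_compose[OF N_top half])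
  have ratio: "((\<lambda>l. real (N l) / l) \<longlongrightarrow> 1) at_top"
  proof (rule tendsto_sandwich[of "\<lambda>l. (l - 1) / l" _ _ "\<lambda>l. 1"])
    show "eventually (\<lambda>l. (l - 1) / l \<le> real (N l) / l) at_top"
      using eventually_gt_at_top[of 0] by eventually_elim (intro divide_right_mono; simp add: N_def; linarith)
    show "eventually (\<lambda>l. real (N l) / l \<le> 1) at_top"
      using eventually_gt_at_top[of 0] by eventually_elim (auto simp: N_def)
    show "((\<lambda>l::real. (l - 1) / l) \<longlongrightarrow> 1) at_top" by real_asymp
  qed auto
  have "((\<lambda>l. 2 * ((real (N l) / l) / (real (N (l/2)) / (l/2)))) \<longlongrightarrow> 2 * (1 / 1)) at_top"
    by (intro tendsto_mult tendsto_divide tendsto_const ratio filterlim_compose[OF ratio half]) auto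
  then have "((\<lambda>l. ln (2 * ((real (N l) / l) / (real (N (l/2)) / (l/2))))) \<longlongrightarrow> ln (2 * (1 / 1))) at_top"
    by (intro tendsto_ln) auto
  with 1 have "((\<lambda>l. (g (N l) - g (N (l/2))) + ln (2 * ((real (N l) / l) / (real (N (l/2)) / (l/2))))) \<longlongrightarrow> ln 2) at_top"
    using tendsto_add by fastforce
  moreover have "eventually (\<lambda>l. (g (N l) - g (N (l/2))) + ln (2 * ((real (N l) / l) / (real (N (l/2)) / (l/2)))) = (\<Sum>k\<in>{N (l/2)<..N l}. 1 / real k)) at_top"
    using eventually_ge_at_top[of 2]
  proof eventually_elim
    case (elim l)
    have pos: "0 < N l" "0 < N (l/2)" using elim by (auto simp: N_def)
    have le: "N (l/2) \<le> N l" using elim by (auto simp: N_def intro!: nat_mono floor_mono)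
    have "2 * ((real (N l) / l) / (real (N (l/2)) / (l/2))) = real (N l) / real (N (l/2))"
      using elim by (simp add: field_simps)
    then have "ln (2 * ((real (N l) / l) / (real (N (l/2)) / (l/2)))) = ln (real (N l)) - ln (real (N (l/2)))"
      using pos by (simp add: ln_div)
    moreover have "{1..N l} = {1..N (l/2)} \<union> {N (l/2)<..N l}" using le pos by auto
    then have "harm (N l) = harm (N (l/2)) + (\<Sum>k\<in>{N (l/2)<..N l}. inverse (real k))"
      unfolding harm_def by (simp only:) (subst sum.union_disjoint, auto)
    ultimately show ?case by (simp add: g_def inverse_eq_divide)
  qed
  ultimately have 2: "((\<lambda>l. \<Sum>k\<in>{N (l/2)<..N l}. 1 / real k) \<longlongrightarrow> ln 2) at_top"
    by (rule Lim_transform_eventually)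
  have "filterlim (log 2) at_top at_top" by real_asymp
  from filterlim_compose[OF 2 this] have "((\<lambda>y. \<Sum>k\<in>{N (log 2 y/2)<..N (log 2 y)}. 1 / real k) \<longlongrightarrow> ln 2) at_top" .
  moreover have "eventually (\<lambda>y. (\<Sum>k\<in>{N (log 2 y/2)<..N (log 2 y)}. 1 / real k) = (\<Sum>k\<in>window y. 1 / real k)) at_top"
    using eventually_ge_at_top[of 1]
  proof eventually_elim
    case (elim y)
    then have l: "0 \<le> log 2 y" "0 < y" by auto
    have "window y = {N (log 2 y/2)<..N (log 2 y)}"
    proof (intro set_eqI)
      fix k
      have "real k \<le> log 2 y \<longleftrightarrow> k \<le> N (log 2 y)" using l by (simp add: N_def le_nat_iff le_floor_iff)
      moreover have "log 2 y / 2 < real k \<longleftrightarrow> N (log 2 y / 2) < k" using l by (simp add: N_def nat_less_iff floor_less_iff)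
      ultimately show "k \<in> window y \<longleftrightarrow> k \<in> {N (log 2 y/2)<..N (log 2 y)}"
        using log_bounds[OF l(2), of k] by (auto simp: window_def)
    qed
    then show ?case by simp
  qed
  ultimately show ?thesis by (rule Lim_transform_eventually)
qed

lemma c_pos: "0 < c"
  using stable_const_pos[OF \<alpha>] by (simp add: c_def)

text \<open>The limit is uniform over all finite sets that contain the window, since indices outside
  it contribute only O(1/log y) after normalisation. Uniformity is needed because the set of active
  indices varies with n.\<close>

lemma sum_z_limit:
  assumes e: "0 < e"
  shows "eventually (\<lambda>y. \<forall>A. finite A \<longrightarrow> (\<forall>k\<in>A. 1 \<le> k) \<longrightarrow> window y \<subseteq> A \<longrightarrow>
      \<bar>y powr \<alpha> * (\<Sum>k\<in>A. z k y) - c * ln 2\<bar> < e) at_top"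
proof -
  define h where "h y = (\<Sum>k\<in>window y. 1 / real k)" for y
  have h: "(h \<longlongrightarrow> ln 2) at_top" using harm_window_tendsto by (simp add: h_def[abs_def])
  \<comment> \<open>The window sum tends to ln 2, so an error \<delta> in the tail constant becomes
    \<delta> ln 2; half of e is reserved for it. The bound c / 2 keeps c - \<delta>
    positive.\<close>
  define \<delta> where "\<delta> = min (c / 2) (e / (2 * ln 2))"
  have \<delta>: "0 < \<delta>" "\<delta> < c" "\<delta> * ln 2 \<le> e / 2"
  proof -
    have "\<delta> * ln 2 \<le> e / (2 * ln 2) * ln 2" by (intro mult_right_mono) (auto simp: \<delta>_def)
    then show "\<delta> * ln 2 \<le> e / 2" by simp
  qed (use c_pos e in \<open>auto simp: \<delta>_def\<close>)
  define upper where "upper y = (c + \<delta>) * h y + C / (r * (1 - r)) * (1 / log 2 y)" for y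
  define lower where "lower y = (y / (y + 1)) powr \<alpha> * (c - \<delta>) * h y - 2 * C / (1 - r) * (1 / log 2 y)" for y
  have l0: "((\<lambda>y. 1 / log 2 y) \<longlongrightarrow> 0) at_top" by real_asymp
  have "(upper \<longlongrightarrow> (c + \<delta>) * ln 2 + C / (r * (1 - r)) * 0) at_top"
    unfolding upper_def by (intro tendsto_intros h l0)
  moreover have "(c + \<delta>) * ln 2 + C / (r * (1 - r)) * 0 < c * ln 2 + e"
    using \<delta>(3) e by (simp add: distrib_right)
  ultimately have ev_upper: "eventually (\<lambda>y. upper y < c * ln 2 + e) at_top" by (rule order_tendstoD)
  have y1: "((\<lambda>y. y / (y + 1)) \<longlongrightarrow> (1::real)) at_top" by real_asymp
  have "(lower \<longlongrightarrow> 1 powr \<alpha> * (c - \<delta>) * ln 2 - 2 * C / (1 - r) * 0) at_top"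
    unfolding lower_def by (intro tendsto_intros h l0 y1) auto
  moreover have "c * ln 2 - e < 1 powr \<alpha> * (c - \<delta>) * ln 2 - 2 * C / (1 - r) * 0"
    using \<delta>(3) e by (simp add: left_diff_distrib)
  ultimately have ev_lower: "eventually (\<lambda>y. c * ln 2 - e < lower y) at_top" by (rule order_tendstoD)
  have "eventually (\<lambda>y. c - \<delta> < y powr \<alpha> * p y) at_top" "eventually (\<lambda>y. y powr \<alpha> * p y < c + \<delta>) at_top"
    using p_tendsto \<delta> by (auto intro!: order_tendstoD)
  then have "eventually (\<lambda>y. c - \<delta> < y powr \<alpha> * p y \<and> y powr \<alpha> * p y < c + \<delta>) at_top" by eventually_elim auto
  then obtain y0 where y0: "\<And>y. y0 \<le> y \<Longrightarrow> c - \<delta> < y powr \<alpha> * p y \<and> y powr \<alpha> * p y < c + \<delta>"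
    by (auto simp: eventually_at_top_linorder)
  have "eventually (\<lambda>y. 2 \<le> y \<and> y0 \<le> y) at_top" by (intro eventually_conj eventually_ge_at_top)
  then show ?thesis using ev_upper ev_lower
  proof eventually_elim
    case (elim y)
    have y: "0 < y" "2 \<le> y" "y0 \<le> y" using elim by auto
    let ?l = "log 2 y"
    have l: "1 \<le> ?l" using y by simp
    have yy: "y powr \<alpha> * y powr (-\<alpha>) = 1" using y by (simp add: powr_add[symmetric])
    have pk: "s powr \<alpha> * p (real k powr (1/\<alpha>) * s) = 1 / real k * ((real k powr (1/\<alpha>) * s) powr \<alpha> * p (real k powr (1/\<alpha>) * s))"
      if "1 \<le> k" "0 < s" for k s
      using that \<alpha> by (simp add: powr_mult powr_powr)
    have ks: "s \<le> real k powr (1/\<alpha>) * s" if "1 \<le> k" "0 < s" for k s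
    proof -
      have "1 \<le> real k powr (1/\<alpha>)" using that \<alpha> by (intro ge_one_powr_ge_zero) auto
      then show ?thesis using that by simp
    qed
    show ?case
    proof (intro allI impI)
      fix A assume A: "finite A" "\<forall>k\<in>A. 1 \<le> k" "window y \<subseteq> A"
      let ?A = "{k\<in>A. y < 2 ^ k}"
      have fw: "finite (window y)" using finite_window[OF y(1)] .
      have "(\<Sum>k\<in>A. z k y) = (\<Sum>k\<in>?A \<union> window y. z k y)"
        using A by (intro sum.mono_neutral_right) (auto simp: window_def not_less intro!: z_zero)
      also have "\<dots> = (\<Sum>k\<in>?A. z k y) + (\<Sum>k\<in>window y. z k y)"
        using A fw by (intro sum.union_disjoint) (auto simp: window_def)
      finally have split: "(\<Sum>k\<in>A. z k y) = (\<Sum>k\<in>?A. z k y) + (\<Sum>k\<in>window y. z k y)" .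
      \<comment> \<open>Here k is at least log2 y, so the factor 1/k of the geometric bound gains
        1/log2 y over the order y^(-\<alpha>).\<close>
      have "(\<Sum>k\<in>?A. z k y) \<le> (\<Sum>k\<in>?A. C / (?l * r) * r ^ k)"
      proof (rule sum_mono)
        fix k assume k: "k \<in> ?A"
        then have kl: "?l \<le> real k" using log_bounds(1)[OF y(1), of k] by auto
        have "z k y \<le> C / (real k * r) * r ^ k" using k A y by (intro z_le_geometric) auto
        also have "\<dots> \<le> C / (?l * r) * r ^ k"
          using kl l r C(1) by (intro mult_right_mono divide_left_mono) auto
        finally show "z k y \<le> C / (?l * r) * r ^ k" .
      qed
      also have "\<dots> = C / (?l * r) * (\<Sum>k\<in>?A. r ^ k)" by (simp add: sum_distrib_left)
      also have "\<dots> \<le> C / (?l * r) * (y powr (-\<alpha>) / (1 - r))"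
        using A y C(1) r l by (intro mult_left_mono sum_geometric_above) auto
      finally have "y powr \<alpha> * (\<Sum>k\<in>?A. z k y) \<le> y powr \<alpha> * (C / (?l * r) * (y powr (-\<alpha>) / (1 - r)))"
        by (intro mult_left_mono) auto
      also have "\<dots> = C / (r * (1 - r)) * (1 / ?l)"
      proof -
        have "Y * (C / (l * r) * (Y' / (1 - r))) = C / (r * (1 - r)) * (1 / l) * (Y * Y')" for Y Y' l
          by (simp add: divide_inverse ac_simps)
        then show ?thesis using yy by simp
      qed
      finally have up1: "y powr \<alpha> * (\<Sum>k\<in>?A. z k y) \<le> C / (r * (1 - r)) * (1 / ?l)" .
      have "y powr \<alpha> * (\<Sum>k\<in>window y. z k y) \<le> (\<Sum>k\<in>window y. (c + \<delta>) * (1 / real k))"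
        unfolding sum_distrib_left
      proof (rule sum_mono)
        fix k assume "k \<in> window y"
        then have k: "1 \<le> k" by (simp add: window_def)
        have "y powr \<alpha> * z k y \<le> y powr \<alpha> * p (real k powr (1/\<alpha>) * y)"
          using k y by (intro mult_left_mono z_le_p) auto
        also have "\<dots> \<le> 1 / real k * (c + \<delta>)"
          unfolding pk[OF k y(1)] using y0[of "real k powr (1/\<alpha>) * y"] ks[OF k y(1)] y by (intro mult_left_mono) auto
        finally show "y powr \<alpha> * z k y \<le> (c + \<delta>) * (1 / real k)" by (simp add: mult.commute)
      qed
      then have up2: "y powr \<alpha> * (\<Sum>k\<in>window y. z k y) \<le> (c + \<delta>) * h y" by (simp add: h_def sum_distrib_left)
      have up: "y powr \<alpha> * (\<Sum>k\<in>A. z k y) < c * ln 2 + e"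
        using up1 up2 elim unfolding split upper_def by (simp add: distrib_left)
      have lo1: "0 \<le> y powr \<alpha> * (\<Sum>k\<in>?A. z k y)" by (intro mult_nonneg_nonneg sum_nonneg z_nonneg) auto
      \<comment> \<open>The loss from truncating at 4^k is of order r^(2k)/k. In the window 1/k is
        below 2/log2 y, and 4^k > y makes the sum of r^(2k) of order y^(-\<alpha>), so the loss
        again disappears like 1/log2 y.\<close>
      have "(\<Sum>k\<in>window y. (y / (y + 1)) powr \<alpha> * (c - \<delta>) * (1 / real k) - 2 * C / ?l * y powr \<alpha> * r ^ (2 * k)) \<le> y powr \<alpha> * (\<Sum>k\<in>window y. z k y)"
        unfolding sum_distrib_left
      proof (rule sum_mono)
        fix k assume kw: "k \<in> window y"
        then have k: "1 \<le> k" "2 ^ k \<le> y" "?l / 2 < real k" using log_bounds(2)[OF y(1), of k] by (auto simp: window_def)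
        have y1: "0 < y + 1" "y \<le> y + 1" using y by auto
        have "1 / real k * (c - \<delta>) \<le> (y + 1) powr \<alpha> * p (real k powr (1/\<alpha>) * (y + 1))"
          unfolding pk[OF k(1) y1(1)]
          using y0[of "real k powr (1/\<alpha>) * (y + 1)"] ks[OF k(1) y1(1)] y1 y by (intro mult_left_mono) auto
        then have "(y / (y + 1)) powr \<alpha> * (1 / real k * (c - \<delta>)) \<le> (y / (y + 1)) powr \<alpha> * ((y + 1) powr \<alpha> * p (real k powr (1/\<alpha>) * (y + 1)))"
          by (intro mult_left_mono) auto
        also have "\<dots> = y powr \<alpha> * p (real k powr (1/\<alpha>) * (y + 1))" using y by (simp add: powr_divide)
        finally have 1: "(y / (y + 1)) powr \<alpha> * (c - \<delta>) * (1 / real k) \<le> y powr \<alpha> * p (real k powr (1/\<alpha>) * (y + 1))"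
          by (simp only: ac_simps)
        have "p (real k powr (1/\<alpha>) * 4 ^ k) \<le> C / real k * (4 ^ k) powr (-\<alpha>)" using k by (intro pk_le) auto
        also have "(4 ^ k :: real) powr (-\<alpha>) = r ^ (2 * k)" using power2_powr[of "2 * k"] by (simp add: power_mult)
        also have "C / real k * r ^ (2 * k) \<le> 2 * C / ?l * r ^ (2 * k)"
          using k l r C(1) by (intro mult_right_mono) (auto simp: field_simps)
        finally have "y powr \<alpha> * p (real k powr (1/\<alpha>) * 4 ^ k) \<le> y powr \<alpha> * (2 * C / ?l * r ^ (2 * k))" by (intro mult_left_mono) auto
        moreover have "y powr \<alpha> * (p (real k powr (1/\<alpha>) * (y + 1)) - p (real k powr (1/\<alpha>) * 4 ^ k)) \<le> y powr \<alpha> * z k y"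
          using k by (intro mult_left_mono z_ge) auto
        ultimately show "(y / (y + 1)) powr \<alpha> * (c - \<delta>) * (1 / real k) - 2 * C / ?l * y powr \<alpha> * r ^ (2 * k) \<le> y powr \<alpha> * z k y"
          using 1 by (simp add: right_diff_distrib ac_simps)
      qed
      moreover have "(\<Sum>k\<in>window y. (y / (y + 1)) powr \<alpha> * (c - \<delta>) * (1 / real k) - 2 * C / ?l * y powr \<alpha> * r ^ (2 * k)) =
        (y / (y + 1)) powr \<alpha> * (c - \<delta>) * h y - 2 * C / ?l * y powr \<alpha> * (\<Sum>k\<in>window y. r ^ (2 * k))"
        by (simp add: h_def sum_subtractf sum_distrib_left)
      moreover have "2 * C / ?l * y powr \<alpha> * (\<Sum>k\<in>window y. r ^ (2 * k)) \<le> 2 * C / (1 - r) * (1 / ?l)"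
      proof -
        have "(\<Sum>k\<in>window y. r ^ (2 * k)) = (\<Sum>j\<in>(\<lambda>k. 2 * k) ` window y. r ^ j)"
          by (subst sum.reindex) (auto simp: inj_on_def)
        also have "\<dots> \<le> y powr (-\<alpha>) / (1 - r)"
          using fw y by (intro sum_geometric_above) (auto simp: window_def power_mult)
        finally have "2 * C / ?l * y powr \<alpha> * (\<Sum>k\<in>window y. r ^ (2 * k)) \<le> 2 * C / ?l * y powr \<alpha> * (y powr (-\<alpha>) / (1 - r))"
          using C(1) l by (intro mult_left_mono) auto
        also have "\<dots> = 2 * C / (1 - r) * (1 / ?l)"
        proof -
          have "2 * C / l * Y * (Y' / (1 - r)) = 2 * C / (1 - r) * (1 / l) * (Y * Y')" for Y Y' l
            by (simp add: divide_inverse ac_simps)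
          then show ?thesis using yy by simp
        qed
        finally show ?thesis .
      qed
      ultimately have "lower y \<le> y powr \<alpha> * (\<Sum>k\<in>window y. z k y)" unfolding lower_def by linarith
      then have "c * ln 2 - e < y powr \<alpha> * (\<Sum>k\<in>A. z k y)"
        using lo1 elim unfolding split by (simp add: distrib_left)
      then show "\<bar>y powr \<alpha> * (\<Sum>k\<in>A. z k y) - c * ln 2\<bar> < e" using up by (simp add: abs_less_iff)
    qed
  qed
qed

definition active :: "nat \<Rightarrow> nat set" where
  "active n = {k. 1 \<le> k \<and> k \<le> n \<and> n \<le> dk k}"

lemma finite_active: "finite (active n)"
  by (rule finite_subset[of _ "{..n}"]) (auto simp: active_def)

text \<open>With y = n^(1/\<alpha>) x it remains to see that the window of y is active for large n:
  k \<le> log2 y \<le> n, and n \<le> y^2 < 4^(2k) \<le> 4^(k^2). The last inequality needs k \<ge>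
  2, which y \<ge> 4 enforces inside the window.\<close>

lemma array_limit:
  assumes x: "0 < x"
  shows "(\<lambda>n. real n * (\<Sum>k\<in>active n. z k (real n powr (1/\<alpha>) * x))) \<longlonglongrightarrow> c * ln 2 * x powr (-\<alpha>)"
proof -
  define y where "y n = real n powr (1/\<alpha>) * x" for n
  have y_top: "filterlim y at_top sequentially"
    unfolding y_def using x \<alpha> by real_asymp
  have y_pow: "y n powr \<alpha> = real n * x powr \<alpha>" for n
    using x \<alpha> by (cases "n = 0") (auto simp: y_def powr_mult powr_powr)
  have "(\<lambda>n. y n powr \<alpha> * (\<Sum>k\<in>active n. z k (y n))) \<longlonglongrightarrow> c * ln 2"
  proof (rule tendstoI)
    fix e :: real assume e: "0 < e"
    have ev1: "eventually (\<lambda>n. \<forall>A. finite A \<longrightarrow> (\<forall>k\<in>A. 1 \<le> k) \<longrightarrow> window (y n) \<subseteq> A \<longrightarrow>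
      \<bar>y n powr \<alpha> * (\<Sum>k\<in>A. z k (y n)) - c * ln 2\<bar> < e) sequentially"
      using filterlim_iff[THEN iffD1, OF y_top] sum_z_limit[OF e] by blast
    have ev2: "eventually (\<lambda>n. 4 \<le> y n) sequentially" using y_top by (simp add: filterlim_at_top)
    have ev3: "eventually (\<lambda>n. log 2 (y n) \<le> real n) sequentially"
      unfolding y_def using x \<alpha> by real_asymp
    have ev4: "eventually (\<lambda>n. real n \<le> y n ^ 2) sequentially"
    proof -
      have "1 - 2 / \<alpha> < 0" using \<alpha> by (simp add: field_simps)
      then have "(\<lambda>n. real n powr (1 - 2 / \<alpha>)) \<longlonglongrightarrow> 0"
        by (intro tendsto_neg_powr filterlim_real_sequentially)
      then have "eventually (\<lambda>n. real n powr (1 - 2 / \<alpha>) < x\<^sup>2) sequentially"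
        using x by (intro order_tendstoD(2)) auto
      then show ?thesis using eventually_gt_at_top[of 0]
      proof eventually_elim
        case (elim n)
        have "real n = real n powr (1 - 2 / \<alpha>) * real n powr (2 / \<alpha>)"
          using elim by (simp flip: powr_add)
        also have "\<dots> \<le> x\<^sup>2 * real n powr (2 / \<alpha>)" using elim by (intro mult_right_mono) auto
        also have "\<dots> = y n ^ 2" using elim
          by (simp add: y_def power_mult_distrib power2_eq_square powr_add[symmetric])
        finally show ?case .
      qed
    qed
    show "eventually (\<lambda>n. dist (y n powr \<alpha> * (\<Sum>k\<in>active n. z k (y n))) (c * ln 2) < e) sequentially"
      using ev1 ev2 ev3 ev4
    proof eventually_elim
      case (elim n)
      have y0: "0 < y n" using elim by simp
      have "window (y n) \<subseteq> active n"
      proof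
        fix k assume k: "k \<in> window (y n)"
        then have "real k \<le> log 2 (y n)" using log_bounds(1)[OF y0] by (simp add: window_def)
        then have kn: "k \<le> n" using elim by linarith
        have k4: "y n < 4 ^ k" using k by (simp add: window_def)
        have "2 \<le> k"
        proof (rule ccontr)
          assume "\<not> 2 \<le> k"
          then have "k = 1" using k by (simp add: window_def)
          then show False using k4 elim by simp
        qed
        have "real n \<le> y n ^ 2" using elim by simp
        also have "\<dots> \<le> (4 ^ k) ^ 2" using k4 y0 by (intro power_mono) auto
        also have "\<dots> \<le> (4 ^ k) ^ k" using \<open>2 \<le> k\<close> by (intro power_increasing) auto
        also have "\<dots> = real (dk k)" by (simp add: dk_def power_mult[symmetric] power2_eq_square)
        finally have "n \<le> dk k" by simp
        then show "k \<in> active n" using k kn by (simp add: active_def window_def)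
      qed
      then show ?case using elim(1) finite_active by (simp add: active_def dist_real_def)
    qed
  qed
  then have "(\<lambda>n. x powr (-\<alpha>) * (y n powr \<alpha> * (\<Sum>k\<in>active n. z k (y n)))) \<longlonglongrightarrow> x powr (-\<alpha>) * (c * ln 2)"
    by (rule tendsto_mult_left)
  moreover have "x powr (-\<alpha>) * (y n powr \<alpha> * S) = real n * S" for n S
  proof -
    have "x powr (-\<alpha>) * x powr \<alpha> = 1" using x by (simp add: powr_add[symmetric])
    moreover have "x powr (-\<alpha>) * (real n * x powr \<alpha> * S) = (x powr (-\<alpha>) * x powr \<alpha>) * (real n * S)" by (simp only: ac_simps)
    ultimately show ?thesis unfolding y_pow by simp
  qed
  ultimately have "(\<lambda>n. real n * (\<Sum>k\<in>active n. z k (y n))) \<longlonglongrightarrow> x powr (-\<alpha>) * (c * ln 2)" by (simp only:)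
  then show ?thesis by (simp only: y_def mult.commute)
qed

lemma sum_power4_le: "(\<Sum>k\<le>K. 4 ^ k :: real) \<le> 2 * 4 ^ K"
proof (induction K)
  case (Suc K)
  have "(0::real) \<le> 4 ^ K" by simp
  then have "(\<Sum>k\<le>K. 4 ^ k :: real) + 4 * 4 ^ K \<le> 2 * (4 * 4 ^ K)" using Suc by linarith
  then show ?case by simp
qed simp

text \<open>The prefactor is n summands divided by n^(1/\<alpha>). Fix R with 1/R < 1/\<alpha> - 1.
  For the largest index K with d_K < n, either K \<le> R or 4^(K R) \<le> 4^(K^2) < n, so 4^K is at
  most 4^R + n^(1/R), and the resulting power of n is negative.\<close>

lemma small_index_negligible:
  "(\<lambda>n. real n powr (1 - 1/\<alpha>) * (\<Sum>k | 1 \<le> k \<and> dk k < n. 4 ^ k)) \<longlonglongrightarrow> 0"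
proof -
  have \<alpha>1: "0 < 1/\<alpha> - 1" using \<alpha> by simp
  obtain R where R: "R > 0" "1 / real R < 1/\<alpha> - 1"
    using reals_Archimedean[OF \<alpha>1] by (metis inverse_eq_divide zero_less_Suc)
  have bound: "(\<Sum>k | 1 \<le> k \<and> dk k < n. 4 ^ k :: real) \<le> 2 * (4 ^ R + real n powr (1 / real R))" for n
  proof -
    let ?S = "{k. 1 \<le> k \<and> dk k < n}"
    have "k \<le> n" if "dk k < n" for k using that le_dk[of k] by (meson le_less_trans less_imp_le)
    then have "?S \<subseteq> {..n}" by auto
    then have fin: "finite ?S" by (rule finite_subset) simp
    show ?thesis
    proof (cases "?S = {}")
      case True
      then show ?thesis by (simp only: sum.empty) simp
    next
      case False
      define K where "K = Max ?S"
      have K: "K \<in> ?S" unfolding K_def using fin False by (rule Max_in)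
      have "?S \<subseteq> {..K}" using fin by (auto simp: K_def)
      then have "(\<Sum>k\<in>?S. 4 ^ k :: real) \<le> (\<Sum>k\<le>K. 4 ^ k)" by (intro sum_mono2) auto
      also have "\<dots> \<le> 2 * 4 ^ K" by (rule sum_power4_le)
      also have "4 ^ K \<le> 4 ^ R + real n powr (1 / real R)"
      proof (cases "K \<le> R")
        case True
        then have "(4::real) ^ K \<le> 4 ^ R" by (intro power_increasing) auto
        then show ?thesis by (simp add: add_increasing2)
      next
        case False
        have "(4 ^ K) ^ R \<le> (4 ^ K :: real) ^ K" using False by (intro power_increasing) auto
        also have "\<dots> = real (dk K)" by (simp add: dk_def power_mult[symmetric] power2_eq_square)
        also have "\<dots> \<le> real n" using K by simp
        finally have "((4 ^ K :: real) ^ R) powr (1 / real R) \<le> real n powr (1 / real R)" by (intro powr_mono2) auto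
        moreover have "((4 ^ K :: real) ^ R) powr (1 / real R) = 4 ^ K"
          using R by (simp add: powr_realpow[symmetric] powr_powr)
        ultimately show ?thesis by (simp add: add_increasing)
      qed
      finally show ?thesis by simp
    qed
  qed
  have lim: "(\<lambda>n. real n powr (1 - 1/\<alpha>) * (2 * (4 ^ R + real n powr (1 / real R)))) \<longlonglongrightarrow> 0"
  proof -
    have 1: "(\<lambda>n. real n powr (1 - 1/\<alpha>)) \<longlonglongrightarrow> 0"
      using \<alpha>1 by (intro tendsto_neg_powr filterlim_real_sequentially) auto
    have 2: "(\<lambda>n. real n powr (1 - 1/\<alpha> + 1 / real R)) \<longlonglongrightarrow> 0"
      using R by (intro tendsto_neg_powr filterlim_real_sequentially) auto
    have "(\<lambda>n. 2 * 4 ^ R * real n powr (1 - 1/\<alpha>) + 2 * real n powr (1 - 1/\<alpha> + 1 / real R)) \<longlonglongrightarrow> 2 * 4 ^ R * 0 + 2 * 0"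
      by (intro tendsto_add tendsto_mult tendsto_const 1 2)
    moreover have "2 * 4 ^ R * real n powr a + 2 * real n powr (a + b) = real n powr a * (2 * (4 ^ R + real n powr b))" for n a b
      by (simp add: powr_add distrib_left)
    ultimately show ?thesis by simp
  qed
  show ?thesis
  proof (rule tendsto_sandwich[OF _ _ tendsto_const lim])
    show "eventually (\<lambda>n. 0 \<le> real n powr (1 - 1/\<alpha>) * (\<Sum>k | 1 \<le> k \<and> dk k < n. 4 ^ k)) sequentially"
      by (intro always_eventually allI mult_nonneg_nonneg sum_nonneg) auto
    show "eventually (\<lambda>n. real n powr (1 - 1/\<alpha>) * (\<Sum>k | 1 \<le> k \<and> dk k < n. 4 ^ k) \<le> real n powr (1 - 1/\<alpha>) * (2 * (4 ^ R + real n powr (1 / real R)))) sequentially"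
      by (intro always_eventually allI mult_left_mono bound) auto
  qed
qed

lemma sum_z_beyond_le:
  assumes "finite F" "\<And>k. k \<in> F \<Longrightarrow> n < k"
  shows "(\<Sum>k\<in>F. z k 0) \<le> C / (r * (1 - r)) * r ^ n"
proof -
  have "(\<Sum>k\<in>F. z k 0) \<le> (\<Sum>k\<in>F. C / r * r ^ k)"
  proof (rule sum_mono)
    fix k assume "k \<in> F"
    then have k: "1 \<le> k" using assms(2)[of k] by simp
    have "z k 0 \<le> C / (real k * r) * r ^ k" using k by (intro z_le_geometric) auto
    also have "\<dots> \<le> C / r * r ^ k"
      using k r C(1) by (intro mult_right_mono divide_left_mono) auto
    finally show "z k 0 \<le> C / r * r ^ k" .
  qed
  also have "\<dots> = C / r * (\<Sum>k\<in>F. r ^ k)" by (simp add: sum_distrib_left)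
  also have "\<dots> \<le> C / r * (r ^ n / (1 - r))"
    using r C(1) assms by (intro mult_left_mono sum_power_tail_le) (auto intro: less_imp_le)
  finally show ?thesis by simp
qed

lemma beyond_negligible: "(\<lambda>n. real n * (C / (r * (1 - r)) * r ^ n)) \<longlonglongrightarrow> 0"
proof -
  have "(\<lambda>n. C / (r * (1 - r)) * (real n * r ^ n)) \<longlonglongrightarrow> C / (r * (1 - r)) * 0"
    using r by (intro tendsto_mult tendsto_const powser_times_n_limit_0) auto
  then show ?thesis by (simp add: ac_simps)
qed

end

subsection \<open>Quantile coupling\<close>

text \<open>Inverting the tail rather than the distribution function puts the large values at small u, so
  that two laws with equivalent tails are compared by substituting u = s / n.\<close>
definition upper_quantile :: "real measure \<Rightarrow> real \<Rightarrow> real" where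
  "upper_quantile \<rho> u = (if 0 < u then Inf {x. 0 \<le> x \<and> measure \<rho> {x<..} \<le> u} else 0)"

lemma (in real_distribution) tail_eq_cdf: "measure M {x<..} = 1 - cdf M x"
proof -
  have "{x<..} = space M - {..x}" by auto
  then show ?thesis using prob_compl[of "{..x}"] by (simp add: cdf_def)
qed

lemma (in real_distribution) tail_small:
  assumes "0 < u"
  shows "\<exists>x\<ge>0. measure M {x<..} \<le> u"
proof -
  have "((\<lambda>x. 1 - cdf M x) \<longlongrightarrow> 1 - 1) at_top" by (intro tendsto_diff tendsto_const cdf_lim_at_top_prob)
  then have "eventually (\<lambda>x. 1 - cdf M x < u) at_top" using assms by (intro order_tendstoD(2)) auto
  then obtain x0 where "\<And>x. x0 \<le> x \<Longrightarrow> 1 - cdf M x < u" by (auto simp: eventually_at_top_linorder)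
  then show ?thesis by (intro exI[of _ "max 0 x0"]) (auto simp: tail_eq_cdf less_imp_le)
qed

text \<open>The infimum is attained because the tail is continuous from the right. The equivalence
  replaces an inverse of the tail, which may have jumps and flat pieces.\<close>

lemma (in real_distribution) upper_quantile_le_iff:
  assumes u: "0 < u" and x: "0 \<le> x"
  shows "upper_quantile M u \<le> x \<longleftrightarrow> measure M {x<..} \<le> u"
proof -
  let ?S = "{x. 0 \<le> x \<and> measure M {x<..} \<le> u}"
  let ?q = "Inf ?S"
  have ne: "?S \<noteq> {}" using tail_small[OF u] by auto
  have bdd: "bdd_below ?S" by (rule bdd_belowI[of _ 0]) auto
  have q: "upper_quantile M u = ?q" using u by (simp add: upper_quantile_def)
  have "measure M {x<..} \<le> u" if "?q \<le> x"
  proof -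
    have above: "measure M {y<..} \<le> u" if "?q < y" for y
    proof -
      obtain s where "s \<in> ?S" "s < y" using cInf_lessD[OF ne \<open>?q < y\<close>] by auto
      then show ?thesis using finite_measure_mono[of "{y<..}" "{s<..}"] by force
    qed
    have "((\<lambda>y. 1 - cdf M y) \<longlongrightarrow> 1 - cdf M x) (at_right x)"
      using cdf_is_right_cont[of x] by (intro tendsto_diff tendsto_const) (simp add: continuous_within)
    moreover have "eventually (\<lambda>y. 1 - cdf M y \<le> u) (at_right x)"
      unfolding eventually_at_right_field using above \<open>?q \<le> x\<close>
      by (intro exI[of _ "x + 1"]) (auto simp: tail_eq_cdf)
    ultimately have "1 - cdf M x \<le> u" by (intro tendsto_upperbound) auto
    then show ?thesis by (simp add: tail_eq_cdf)
  qed
  moreover have "?q \<le> x" if "measure M {x<..} \<le> u" using that x by (intro cInf_lower bdd) auto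
  ultimately show ?thesis unfolding q by blast
qed

lemma (in real_distribution) upper_quantile_nonneg: "0 \<le> upper_quantile M u"
  using tail_small[of u] unfolding upper_quantile_def by (auto intro!: cInf_greatest)

lemma (in real_distribution) upper_quantile_measurable [measurable]: "upper_quantile M \<in> borel_measurable borel"
proof (subst borel_measurable_iff_le, intro allI)
  fix x
  show "{u \<in> space borel. upper_quantile M u \<le> x} \<in> sets borel"
  proof (cases "0 \<le> x")
    case True
    have "{u \<in> space borel. upper_quantile M u \<le> x} = {..0} \<union> ({0<..} \<inter> {measure M {x<..}..})"
      using upper_quantile_le_iff[OF _ True] True by (auto simp: upper_quantile_def not_less)
    then show ?thesis by simp
  next
    case False
    then have "{u \<in> space borel. upper_quantile M u \<le> x} = {}"
      using upper_quantile_nonneg by (auto dest: order_trans)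
    then show ?thesis by simp
  qed
qed

text \<open>The quantile is nonnegative by construction, so it can represent only laws without mass
  on the negative axis. For x \<ge> 0 the event that it is at most x is that u is at least the tail
  at x.\<close>

lemma (in real_distribution) distr_upper_quantile:
  assumes neg: "measure M {..<0} = 0"
  shows "distr unif01 borel (upper_quantile M) = M"
proof (rule cdf_unique)
  interpret U: prob_space unif01 by (rule prob_space_unif01)
  show "real_distribution (distr unif01 borel (upper_quantile M))"
    using U.prob_space_distr[of "upper_quantile M" borel] by (simp add: real_distribution_def real_distribution_axioms_def)
  show "real_distribution M" by (rule real_distribution_axioms)
  show "cdf (distr unif01 borel (upper_quantile M)) = cdf M"
  proof
    fix x
    have e: "cdf (distr unif01 borel (upper_quantile M)) x = U.prob {u. upper_quantile M u \<le> x}"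
      by (simp add: cdf_def measure_distr vimage_def)
    show "cdf (distr unif01 borel (upper_quantile M)) x = cdf M x"
    proof (cases "0 \<le> x")
      case False
      then have "{u. upper_quantile M u \<le> x} = {}" using upper_quantile_nonneg by (auto dest: order_trans)
      moreover have "measure M {..x} \<le> measure M {..<0}" using False by (intro finite_measure_mono) auto
      ultimately show ?thesis using e neg by (simp add: cdf_def measure_le_0_iff)
    next
      case True
      let ?g = "measure M {x<..}"
      have g: "0 \<le> ?g" "?g \<le> 1" by auto
      have "U.prob {u. upper_quantile M u \<le> x} = U.prob {?g..}"
      proof (rule U.finite_measure_eq_AE)
        show "AE u in unif01. u \<in> {u. upper_quantile M u \<le> x} \<longleftrightarrow> u \<in> {?g..}"
          using AE_unif01_pos by eventually_elim (use upper_quantile_le_iff[OF _ True] in auto)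
      qed measurable
      also have "emeasure unif01 {?g..} = ennreal (1 - ?g)"
      proof -
        have "{0..<1} \<inter> {?g..} = {?g..<1}" by (auto intro: order_trans[OF g(1)])
        then show ?thesis using g divide_ennreal[of "1 - ?g" 1] by (subst emeasure_uniform_measure) auto
      qed
      then have "U.prob {?g..} = 1 - ?g" using g by (simp add: measure_def)
      finally show ?thesis using e by (simp add: tail_eq_cdf)
    qed
  qed
qed

text \<open>The limiting tail \<kappa> x^(-\<alpha>) is strictly decreasing, so at the solution x of
  \<kappa> x^(-\<alpha>) = s the levels x - e and x + e have limits strictly on either side of s; by
  the equivalence for quantiles they enclose the rescaled quantile eventually.\<close>

lemma upper_quantile_scaled:
  fixes \<rho> :: "nat \<Rightarrow> real measure" and N :: "nat \<Rightarrow> real"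
  assumes \<alpha>: "0 < \<alpha>" and \<rho>: "\<And>n. real_distribution (\<rho> n)" and N: "\<And>n. 0 < n \<Longrightarrow> 0 < N n"
    and \<kappa>: "0 < \<kappa>"
    and lim: "\<And>x. 0 < x \<Longrightarrow> (\<lambda>n. real n * measure (\<rho> n) {N n * x<..}) \<longlonglongrightarrow> \<kappa> * x powr (-\<alpha>)"
    and s: "0 < s"
  shows "(\<lambda>n. upper_quantile (\<rho> n) (s / real n) / N n) \<longlonglongrightarrow> (\<kappa> / s) powr (1/\<alpha>)"
proof (rule LIMSEQ_I)
  fix e0 :: real assume "0 < e0"
  define x where "x = (\<kappa> / s) powr (1/\<alpha>)"
  have x: "0 < x" using \<kappa> s by (simp add: x_def)
  have xs: "\<kappa> * x powr (-\<alpha>) = s" using \<kappa> s \<alpha> by (simp add: x_def powr_powr powr_minus divide_simps)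
  define e where "e = min (e0 / 2) (x / 2)"
  have e: "0 < e" "e < x" "e < e0" using \<open>0 < e0\<close> x by (auto simp: e_def)
  have "\<kappa> * (x + e) powr (-\<alpha>) < s" unfolding xs[symmetric]
    using x e \<alpha> \<kappa> by (intro mult_strict_left_mono powr_less_mono2_neg) auto
  then have 1: "eventually (\<lambda>n. real n * measure (\<rho> n) {N n * (x + e)<..} < s) sequentially"
    using lim[of "x + e"] x e by (intro order_tendstoD(2)) auto
  have "s < \<kappa> * (x - e) powr (-\<alpha>)" unfolding xs[symmetric]
    using x e \<alpha> \<kappa> by (intro mult_strict_left_mono powr_less_mono2_neg) auto
  then have 2: "eventually (\<lambda>n. s < real n * measure (\<rho> n) {N n * (x - e)<..}) sequentially"
    using lim[of "x - e"] e by (intro order_tendstoD(1)) auto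
  have "eventually (\<lambda>n. norm (upper_quantile (\<rho> n) (s / real n) / N n - x) < e0) sequentially"
    using 1 2 eventually_gt_at_top[of 0]
  proof eventually_elim
    case (elim n)
    interpret real_distribution "\<rho> n" by (rule \<rho>)
    have n: "0 < real n" "0 < N n" using elim N by auto
    have "measure (\<rho> n) {N n * (x + e)<..} \<le> s / real n" using elim n by (simp add: field_simps)
    then have "upper_quantile (\<rho> n) (s / real n) \<le> N n * (x + e)"
      using n s x e by (subst upper_quantile_le_iff) auto
    then have "upper_quantile (\<rho> n) (s / real n) / N n \<le> x + e" using n by (simp add: field_simps)
    moreover have "\<not> measure (\<rho> n) {N n * (x - e)<..} \<le> s / real n" using elim n by (simp add: field_simps)
    then have "\<not> upper_quantile (\<rho> n) (s / real n) \<le> N n * (x - e)"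
      using n s e by (subst upper_quantile_le_iff) auto
    then have "x - e < upper_quantile (\<rho> n) (s / real n) / N n" using n by (simp add: field_simps not_le)
    ultimately show ?case using e by (simp add: abs_less_iff)
  qed
  then show "\<exists>no. \<forall>n\<ge>no. norm (upper_quantile (\<rho> n) (s / real n) / N n - (\<kappa> / s) powr (1/\<alpha>)) < e0"
    by (simp add: eventually_sequentially x_def)
qed

lemma upper_quantile_scaled_bound:
  assumes \<alpha>: "0 < \<alpha>" and \<rho>: "real_distribution \<rho>" and N: "0 < N" and H: "0 < H" and n: "0 < n"
    and bound: "\<And>x. 0 < x \<Longrightarrow> real n * measure \<rho> {N * x<..} \<le> H * x powr (-\<alpha>)"
    and s: "0 < s"
  shows "upper_quantile \<rho> (s / real n) / N \<le> H powr (1/\<alpha>) * s powr (-1/\<alpha>)"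
proof -
  interpret real_distribution \<rho> by (rule \<rho>)
  define x where "x = (H / s) powr (1/\<alpha>)"
  have x: "0 < x" using H s by (simp add: x_def)
  have "real n * measure \<rho> {N * x<..} \<le> H * x powr (-\<alpha>)" by (rule bound[OF x])
  also have "\<dots> = s" using H s \<alpha> by (simp add: x_def powr_powr powr_minus divide_simps)
  finally have "measure \<rho> {N * x<..} \<le> s / real n" using n by (simp add: field_simps)
  then have "upper_quantile \<rho> (s / real n) \<le> N * x" using n s x N by (subst upper_quantile_le_iff) auto
  then have "upper_quantile \<rho> (s / real n) / N \<le> x" using N by (simp add: field_simps)
  also have "x = H powr (1/\<alpha>) * s powr (-1/\<alpha>)" using H s by (simp add: x_def powr_divide powr_minus field_simps)
  finally show ?thesis .
qed

text \<open>Substituting u = s/n absorbs the factor n and moves the integral to (0, n). There both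
  rescaled quantiles converge to the same power of s, and the uniform tail bound gives a majorant
  proportional to min(1, s^(-1/\<alpha>)), integrable since \<alpha> < 1.\<close>

lemma quantile_coupling:
  fixes \<rho> \<rho>' :: "nat \<Rightarrow> real measure" and N :: "nat \<Rightarrow> real"
  assumes \<alpha>: "0 < \<alpha>" "\<alpha> < 1"
    and \<rho>: "\<And>n. real_distribution (\<rho> n)" "\<And>n. real_distribution (\<rho>' n)" and N: "\<And>n. 0 < n \<Longrightarrow> 0 < N n"
    and \<kappa>: "0 < \<kappa>" and H: "0 < H"
    and lim: "\<And>x. 0 < x \<Longrightarrow> (\<lambda>n. real n * measure (\<rho> n) {N n * x<..}) \<longlonglongrightarrow> \<kappa> * x powr (-\<alpha>)"
      "\<And>x. 0 < x \<Longrightarrow> (\<lambda>n. real n * measure (\<rho>' n) {N n * x<..}) \<longlonglongrightarrow> \<kappa> * x powr (-\<alpha>)"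
    and bound: "\<And>n x. 0 < n \<Longrightarrow> 0 < x \<Longrightarrow> real n * measure (\<rho> n) {N n * x<..} \<le> H * x powr (-\<alpha>)"
      "\<And>n x. 0 < n \<Longrightarrow> 0 < x \<Longrightarrow> real n * measure (\<rho>' n) {N n * x<..} \<le> H * x powr (-\<alpha>)"
  shows "(\<lambda>n. real n * (\<integral>u. min 1 (\<bar>upper_quantile (\<rho> n) u - upper_quantile (\<rho>' n) u\<bar> / N n) \<partial>unif01)) \<longlonglongrightarrow> 0"
proof -
  have [measurable]: "upper_quantile (\<rho> n) \<in> borel_measurable borel" "upper_quantile (\<rho>' n) \<in> borel_measurable borel" for n
    by (rule real_distribution.upper_quantile_measurable[OF \<rho>(1)] real_distribution.upper_quantile_measurable[OF \<rho>(2)])+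
  define g where "g n s = indicator {0<..<real n} s * min 1 (\<bar>upper_quantile (\<rho> n) (s / real n) - upper_quantile (\<rho>' n) (s / real n)\<bar> / N n)" for n s
  \<comment> \<open>The 1 serves small s, where the truncated difference is only known to be at most
    1; the other entry is the sum of the bounds for the two quantiles.\<close>
  define K where "K = max 1 (2 * H powr (1/\<alpha>))"
  have "(\<lambda>n. \<integral>s. g n s \<partial>lborel) \<longlonglongrightarrow> (\<integral>s. 0 \<partial>(lborel :: real measure))"
  proof (rule integral_dominated_convergence[where w="\<lambda>s. K * min 1 (stable_jump \<alpha> s)"])
    show "integrable lborel (\<lambda>s. K * min 1 (stable_jump \<alpha> s))"
      by (intro integrable_mult_right integrable_stable_jump_min \<alpha>)
    show "g n \<in> borel_measurable lborel" for n unfolding g_def[abs_def] by measurable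
    show "AE s in lborel. (\<lambda>n. g n s) \<longlonglongrightarrow> 0"
    proof (rule AE_I2)
      fix s :: real
      show "(\<lambda>n. g n s) \<longlonglongrightarrow> 0"
      proof (cases "0 < s")
        case False
        then show ?thesis by (simp add: g_def)
      next
        case True
        have l: "(\<lambda>n. upper_quantile (\<rho> n) (s / real n) / N n - upper_quantile (\<rho>' n) (s / real n) / N n) \<longlonglongrightarrow> (\<kappa> / s) powr (1/\<alpha>) - (\<kappa> / s) powr (1/\<alpha>)"
          by (intro tendsto_diff upper_quantile_scaled[OF \<alpha>(1) \<rho>(1) N \<kappa> lim(1) True] upper_quantile_scaled[OF \<alpha>(1) \<rho>(2) N \<kappa> lim(2) True])
        then have l: "(\<lambda>n. \<bar>upper_quantile (\<rho> n) (s / real n) / N n - upper_quantile (\<rho>' n) (s / real n) / N n\<bar>) \<longlonglongrightarrow> 0"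
          by (simp add: tendsto_rabs_zero)
        show ?thesis
        proof (rule tendsto_sandwich[OF _ _ tendsto_const l])
          show "eventually (\<lambda>n. 0 \<le> g n s) sequentially"
            using eventually_gt_at_top[of 0] by eventually_elim (use N in \<open>auto simp: g_def less_imp_le\<close>)
          show "eventually (\<lambda>n. g n s \<le> \<bar>upper_quantile (\<rho> n) (s / real n) / N n - upper_quantile (\<rho>' n) (s / real n) / N n\<bar>) sequentially"
            using eventually_gt_at_top[of 0]
          proof eventually_elim
            case (elim n)
            have "\<bar>upper_quantile (\<rho> n) (s / real n) - upper_quantile (\<rho>' n) (s / real n)\<bar> / N n = \<bar>upper_quantile (\<rho> n) (s / real n) / N n - upper_quantile (\<rho>' n) (s / real n) / N n\<bar>"
              using N[OF elim] by (simp add: diff_divide_distrib[symmetric])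
            then show ?case by (auto simp: g_def indicator_def)
          qed
        qed
      qed
    qed
    show "AE s in lborel. norm (g n s) \<le> K * min 1 (stable_jump \<alpha> s)" for n
    proof (rule AE_I2)
      fix s :: real
      show "norm (g n s) \<le> K * min 1 (stable_jump \<alpha> s)"
      proof (cases "0 < s \<and> s < real n")
        case False
        then show ?thesis using stable_jump_nonneg[of \<alpha> s] by (auto simp: g_def K_def)
      next
        case True
        then have n: "0 < n" by (cases n) auto
        let ?q = "upper_quantile (\<rho> n) (s / real n)" and ?q' = "upper_quantile (\<rho>' n) (s / real n)"
        have nn: "0 \<le> ?q" "0 \<le> ?q'"
          using real_distribution.upper_quantile_nonneg[OF \<rho>(1)] real_distribution.upper_quantile_nonneg[OF \<rho>(2)] by auto
        have "?q / N n \<le> H powr (1/\<alpha>) * s powr (-1/\<alpha>)"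
          using True by (intro upper_quantile_scaled_bound[OF \<alpha>(1) \<rho>(1) N[OF n] H n bound(1)[OF n]]) auto
        moreover have "?q' / N n \<le> H powr (1/\<alpha>) * s powr (-1/\<alpha>)"
          using True by (intro upper_quantile_scaled_bound[OF \<alpha>(1) \<rho>(2) N[OF n] H n bound(2)[OF n]]) auto
        moreover have "0 \<le> ?q / N n" "0 \<le> ?q' / N n" using nn N[OF n] by auto
        ultimately have "\<bar>?q / N n - ?q' / N n\<bar> \<le> 2 * (H powr (1/\<alpha>) * s powr (-1/\<alpha>))" by linarith
        then have 1: "\<bar>?q - ?q'\<bar> / N n \<le> 2 * H powr (1/\<alpha>) * stable_jump \<alpha> s"
          using N[OF n] True by (simp add: diff_divide_distrib[symmetric] stable_jump_def)
        have "min 1 (\<bar>?q - ?q'\<bar> / N n) \<le> K * min 1 (stable_jump \<alpha> s)"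
        proof (cases "stable_jump \<alpha> s \<le> 1")
          case True
          have "\<bar>?q - ?q'\<bar> / N n \<le> K * stable_jump \<alpha> s"
            by (rule order_trans[OF 1]) (auto simp: K_def intro!: mult_right_mono stable_jump_nonneg)
          then show ?thesis using True by simp
        qed (simp add: K_def)
        then show ?thesis using N[OF n] True by (simp add: g_def)
      qed
    qed
  qed simp
  moreover have "(\<integral>s. g n s \<partial>lborel) = real n * (\<integral>u. min 1 (\<bar>upper_quantile (\<rho> n) u - upper_quantile (\<rho>' n) u\<bar> / N n) \<partial>unif01)" for n
  proof (cases "n = 0")
    case False
    have "(\<integral>s. g n s \<partial>lborel) = \<bar>real n\<bar> *\<^sub>R (\<integral>u. g n (0 + real n * u) \<partial>lborel)"
      using False by (intro lborel_integral_real_affine) auto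
    also have "(\<integral>u. g n (0 + real n * u) \<partial>lborel) = (\<integral>u. indicator {0..<1} u *\<^sub>R min 1 (\<bar>upper_quantile (\<rho> n) u - upper_quantile (\<rho>' n) u\<bar> / N n) \<partial>lborel)"
    proof (rule integral_cong_AE)
      show "AE u in lborel. g n (0 + real n * u) = indicator {0..<1} u *\<^sub>R min 1 (\<bar>upper_quantile (\<rho> n) u - upper_quantile (\<rho>' n) u\<bar> / N n)"
        using AE_lborel_singleton[of "0::real"]
        by eventually_elim (use False in \<open>auto simp: g_def indicator_def zero_less_mult_iff\<close>)
    qed (auto simp: g_def)
    also have "\<dots> = (\<integral>u. min 1 (\<bar>upper_quantile (\<rho> n) u - upper_quantile (\<rho>' n) u\<bar> / N n) \<partial>unif01)"
      unfolding unif01_density by (rule integral_density[symmetric]) auto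
    finally show ?thesis by simp
  qed (simp add: g_def)
  ultimately show ?thesis by simp
qed

subsection \<open>Sums and maxima over the active indices\<close>

text \<open>The outer maximum with 0 changes nothing for nonnegative values. It makes the result
  nonnegative at every point, although the terms are nonnegative only almost everywhere.\<close>

definition maxS :: "'i set \<Rightarrow> ('i \<Rightarrow> real) \<Rightarrow> real" where
  "maxS S v = max 0 (Max (v ` S))"

lemma maxS_measurable [measurable (raw)]:
  assumes "finite S" "\<And>i. i \<in> S \<Longrightarrow> (\<lambda>x. f x i) \<in> borel_measurable M"
  shows "(\<lambda>x. maxS S (f x)) \<in> borel_measurable M"
  unfolding maxS_def using assms by (intro borel_measurable_max borel_measurable_Max) auto

lemma maxS_le_iff:
  assumes "finite S" "S \<noteq> {}" "0 \<le> y"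
  shows "maxS S v \<le> y \<longleftrightarrow> (\<forall>i\<in>S. v i \<le> y)"
  using assms by (auto simp: maxS_def)

lemma maxS_nonneg: "0 \<le> maxS S v"
  by (simp add: maxS_def)

lemma maxS_reindex: "maxS (h ` S) v = maxS S (\<lambda>i. v (h i))"
  by (simp add: maxS_def image_image)

text \<open>If two terms exceed y, the double sum is at least 1 and covers the truncated left side.
  Otherwise at most one term is large; the maximum removes it, and the remaining terms equal their
  truncations at y.\<close>

lemma sum_minus_maxS_le:
  fixes v :: "'i \<Rightarrow> real"
  assumes S: "finite S" "S \<noteq> {}" and v: "\<And>i. i \<in> S \<Longrightarrow> 0 \<le> v i" and y: "0 \<le> y" and N: "0 < N"
  shows "min 1 (\<bar>(\<Sum>i\<in>S. v i) - maxS S v\<bar> / N) \<le>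
    (\<Sum>i\<in>S. min (v i) y) / N + (\<Sum>i\<in>S. \<Sum>j\<in>S-{i}. indicator {y<..} (v i) * indicator {y<..} (v j))"
proof -
  have le: "v i \<le> maxS S v" if "i \<in> S" for i using S that by (auto simp: maxS_def intro: max.coboundedI2)
  have "maxS S v \<le> (\<Sum>i\<in>S. v i)"
    using S v by (subst maxS_le_iff) (auto intro!: sum_nonneg member_le_sum)
  then have abs: "\<bar>(\<Sum>i\<in>S. v i) - maxS S v\<bar> = (\<Sum>i\<in>S. v i) - maxS S v" by simp
  have s0: "0 \<le> (\<Sum>i\<in>S. min (v i) y) / N" using v y N by (intro divide_nonneg_pos sum_nonneg) auto
  have d0: "0 \<le> (\<Sum>i\<in>S. \<Sum>j\<in>S-{i}. indicator {y<..} (v i) * indicator {y<..} (v j) :: real)"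
    by (intro sum_nonneg) auto
  show ?thesis
  proof (cases "\<exists>i\<in>S. \<exists>j\<in>S-{i}. y < v i \<and> y < v j")
    case True
    then obtain i j where ij: "i \<in> S" "j \<in> S - {i}" "y < v i" "y < v j" by auto
    have "1 = (indicator {y<..} (v i) * indicator {y<..} (v j) :: real)" using ij by simp
    also have "\<dots> \<le> (\<Sum>j\<in>S-{i}. indicator {y<..} (v i) * indicator {y<..} (v j))"
      using ij S by (intro member_le_sum[of j]) auto
    also have "\<dots> \<le> (\<Sum>i\<in>S. \<Sum>j\<in>S-{i}. indicator {y<..} (v i) * indicator {y<..} (v j))"
      using ij S by (intro member_le_sum[of i "S" "\<lambda>i. \<Sum>j\<in>S-{i}. indicator {y<..} (v i) * indicator {y<..} (v j)"] sum_nonneg) auto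
    finally show ?thesis using s0 by linarith
  next
    case False
    have "(\<Sum>i\<in>S. v i) - maxS S v \<le> (\<Sum>i\<in>S. min (v i) y)"
    proof (cases "\<exists>i\<in>S. y < v i")
      case True
      then obtain i where i: "i \<in> S" "y < v i" by auto
      have "(\<Sum>j\<in>S-{i}. v j) = (\<Sum>j\<in>S-{i}. min (v j) y)"
        using False i by (intro sum.cong) (auto simp: min_def)
      moreover note sum.remove[OF S(1) i(1), of v] sum.remove[OF S(1) i(1), of "\<lambda>j. min (v j) y"]
      moreover have "0 \<le> min (v i) y" using i y by simp
      ultimately show ?thesis using le[OF i(1)] by linarith
    next
      case no: False
      then have "(\<Sum>i\<in>S. v i) = (\<Sum>i\<in>S. min (v i) y)" by (intro sum.cong) (auto simp: min_def)
      then show ?thesis using maxS_nonneg[of S v] by linarith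
    qed
    then have "\<bar>(\<Sum>i\<in>S. v i) - maxS S v\<bar> / N \<le> (\<Sum>i\<in>S. min (v i) y) / N"
      unfolding abs using N by (intro divide_right_mono) auto
    then show ?thesis using d0 by linarith
  qed
qed

lemma dk_pos: "0 < dk k"
  by (simp add: dk_def)

section \<open>Blocks of the dynamical array: sums against maxima\<close>

locale stable_system = stable_array \<alpha> \<mu> + prob_space m
  for \<alpha> :: real and \<mu> and m :: "'a measure" +
  fixes T :: "'a \<Rightarrow> 'a" and f :: "nat \<Rightarrow> 'a \<Rightarrow> real"
  assumes T_measurable [measurable]: "T \<in> m \<rightarrow>\<^sub>M m"
    and T_inv: "distr m m T = m"
    and f_measurable [measurable]: "\<And>k. f k \<in> borel_measurable m"
    and f_law: "distr m (PiM adm_index (\<lambda>_. borel)) (\<lambda>x. \<lambda>i\<in>adm_index. f (fst i) ((T ^^ snd i) x))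
          = PiM adm_index (\<lambda>i. distr (\<mu> (fst i)) borel (Zmap (fst i)))"
begin

definition F :: "nat \<times> nat \<Rightarrow> 'a \<Rightarrow> real" where
  "F i x = f (fst i) ((T ^^ snd i) x)"

lemma F_measurable [measurable]: "F i \<in> borel_measurable m"
  unfolding F_def by measurable

lemma T_pow_inv: "distr m m (T ^^ j) = m"
proof (induction j)
  case 0
  show ?case by (simp add: distr_id2)
next
  case (Suc j)
  have "distr m m (T ^^ Suc j) = distr (distr m m (T ^^ j)) m T"
    by (subst distr_distr) (auto simp: comp_def)
  then show ?case by (simp only: Suc T_inv)
qed

lemma integral_T_pow:
  fixes g :: "'a \<Rightarrow> real"
  assumes [measurable]: "g \<in> borel_measurable m"
  shows "(\<integral>x. g ((T ^^ j) x) \<partial>m) = (\<integral>x. g x \<partial>m)"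
proof -
  have "(\<integral>x. g x \<partial>m) = (\<integral>x. g x \<partial>distr m m (T ^^ j))" by (simp add: T_pow_inv)
  also have "\<dots> = (\<integral>x. g ((T ^^ j) x) \<partial>m)" by (rule integral_distr) measurable
  finally show ?thesis ..
qed

lemma adm_indexD: "i \<in> adm_index \<Longrightarrow> 1 \<le> fst i"
  by (auto simp: adm_index_def)

lemma prob_space_\<zeta>: "1 \<le> k \<Longrightarrow> prob_space (distr (\<mu> k) borel (Zmap k))"
proof -
  assume "1 \<le> k"
  then interpret M: real_distribution "\<mu> k" by (rule real_distribution_\<mu>)
  show ?thesis by (rule M.prob_space_distr) simp
qed

lemma F_distr:
  assumes i: "i \<in> adm_index"
  shows "distr m borel (F i) = distr (\<mu> (fst i)) borel (Zmap (fst i))"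
proof -
  let ?\<zeta> = "\<lambda>i::nat \<times> nat. distr (\<mu> (fst i)) borel (Zmap (fst i))"
  have "distr m borel (F i) = distr (distr m (PiM adm_index (\<lambda>_. borel)) (\<lambda>x. \<lambda>i\<in>adm_index. f (fst i) ((T ^^ snd i) x))) borel (\<lambda>v. v i)"
    using i by (subst distr_distr) (auto simp: comp_def F_def intro!: distr_cong)
  also have "\<dots> = distr (PiM adm_index ?\<zeta>) borel (\<lambda>v. v i)" by (simp add: f_law)
  also have "\<dots> = distr (PiM adm_index ?\<zeta>) (?\<zeta> i) (\<lambda>v. v i)" by (intro distr_cong) auto
  also have "\<dots> = ?\<zeta> i"
    by (rule nn_integral_PiM_component(2)[OF _ i, where f="\<lambda>_. 0"]) (auto intro: prob_space_\<zeta> adm_indexD)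
  finally show ?thesis .
qed

lemma F_indep: "indep_vars (\<lambda>_. borel) F adm_index"
proof -
  have "(1, 0) \<in> adm_index" by (simp add: adm_index_def dk_pos)
  then have ne: "adm_index \<noteq> {}" by blast
  show ?thesis
    unfolding indep_vars_iff_distr_eq_PiM[OF ne F_measurable]
    using f_law F_distr by (simp add: F_def cong: PiM_cong)
qed

lemma prob_F: "i \<in> adm_index \<Longrightarrow> prob {x\<in>space m. t < F i x} = z (fst i) t"
proof -
  assume i: "i \<in> adm_index"
  have "prob {x\<in>space m. t < F i x} = measure (distr m borel (F i)) {t<..}"
    by (subst measure_distr) (auto intro!: arg_cong2[where f=measure])
  then show ?thesis by (simp add: F_distr[OF i] z_def)
qed

text \<open>The functions are known only through their joint law, so the pointwise bounds for
  \<open>Zmap\<close> survive as almost sure ones.\<close>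

lemma AE_F:
  assumes i: "i \<in> adm_index"
  shows "AE x in m. 0 \<le> F i x \<and> F i x \<le> 4 ^ fst i"
proof -
  interpret \<mu>: real_distribution "\<mu> (fst i)" using adm_indexD[OF i] by (rule real_distribution_\<mu>)
  have "AE y in distr m borel (F i). 0 \<le> y \<and> y \<le> 4 ^ fst i"
    unfolding F_distr[OF i] by (subst AE_distr_iff) (auto simp: Zmap_bounds)
  then show ?thesis by (rule AE_distrD[rotated]) simp
qed

lemma F_pair:
  assumes "i \<in> adm_index" "j \<in> adm_index" "i \<noteq> j"
  shows "(\<integral>x. indicator {y<..} (F i x) * indicator {y<..} (F j x) \<partial>m) = z (fst i) y * z (fst j) y"
proof -
  have "(\<integral>x. (indicator {y<..} (F i x) :: real) * indicator {y<..} (F j x) \<partial>m) =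
      (\<integral>x. indicator (\<Inter>i\<in>{i, j}. F i -` {y<..} \<inter> space m) x \<partial>m)"
    by (intro Bochner_Integration.integral_cong) (auto simp: indicator_def)
  also have "\<dots> = prob (\<Inter>i\<in>{i, j}. F i -` {y<..} \<inter> space m)"
  proof -
    have "(\<Inter>i\<in>{i, j}. F i -` {y<..} \<inter> space m) \<subseteq> space m" by auto
    then show ?thesis by (simp only: Bochner_Integration.integral_indicator Int_absorb2)
  qed
  also have "\<dots> = (\<Prod>i\<in>{i, j}. prob (F i -` {y<..} \<inter> space m))"
    using assms by (intro indep_varsD[OF F_indep]) auto
  also have "\<dots> = prob {x\<in>space m. y < F i x} * prob {x\<in>space m. y < F j x}"
    using assms by (simp add: vimage_def Int_def conj_commute)
  finally show ?thesis using assms by (simp add: prob_F)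
qed

lemma active_nonempty: "0 < n \<Longrightarrow> active n \<noteq> {}"
  using le_dk[of n] by (auto simp: active_def intro!: exI[of _ n])

lemma prob_maxS_le:
  assumes S: "finite S" "S \<noteq> {}" "S \<subseteq> adm_index" and y: "0 \<le> y"
  shows "prob {x\<in>space m. maxS S (\<lambda>i. F i x) \<le> y} = (\<Prod>i\<in>S. 1 - z (fst i) y)"
proof -
  have "{x\<in>space m. maxS S (\<lambda>i. F i x) \<le> y} = (\<Inter>i\<in>S. F i -` {..y} \<inter> space m)"
    using S by (auto simp: maxS_le_iff[OF S(1,2) y])
  then have "prob {x\<in>space m. maxS S (\<lambda>i. F i x) \<le> y} = (\<Prod>i\<in>S. prob (F i -` {..y} \<inter> space m))"
    using S by (simp only:) (rule indep_varsD[OF F_indep], auto)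
  also have "\<dots> = (\<Prod>i\<in>S. 1 - z (fst i) y)"
  proof (intro prod.cong refl)
    fix i assume "i \<in> S"
    then have i: "i \<in> adm_index" using S by auto
    have "F i -` {..y} \<inter> space m = space m - {x\<in>space m. y < F i x}" by auto
    then show "prob (F i -` {..y} \<inter> space m) = 1 - z (fst i) y"
      using prob_compl[of "{x\<in>space m. y < F i x}"] prob_F[OF i, of y] by simp
  qed
  finally show ?thesis .
qed

lemma nn_integral_powr_Ioo:
  assumes "0 < y"
  shows "(\<integral>\<^sup>+t. ennreal (indicator {0<..<y} t * (H * t powr (-\<alpha>))) \<partial>lborel) = ennreal (H * y powr (1 - \<alpha>) / (1 - \<alpha>))"
proof -
  have "((\<lambda>t. t powr (-\<alpha>)) has_integral (y powr (-\<alpha> + 1) / (-\<alpha> + 1))) {0..y}"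
    using \<alpha> assms by (intro has_integral_powr_from_0) auto
  then have "((\<lambda>t. H * t powr (-\<alpha>)) has_integral (H * (y powr (-\<alpha> + 1) / (-\<alpha> + 1)))) {0..y}"
    by (rule has_integral_mult_right)
  then have "(\<integral>\<^sup>+t. ennreal (indicator {0..y} t * (H * t powr (-\<alpha>))) \<partial>lborel) = ennreal (H * (y powr (-\<alpha> + 1) / (-\<alpha> + 1)))"
    using H_pos by (intro nn_integral_has_integral_lebesgue) auto
  moreover have "(\<integral>\<^sup>+t. ennreal (indicator {0..y} t * (H * t powr (-\<alpha>))) \<partial>lborel) = (\<integral>\<^sup>+t. ennreal (indicator {0<..<y} t * (H * t powr (-\<alpha>))) \<partial>lborel)"
  proof (rule nn_integral_cong_AE)
    show "AE t in lborel. ennreal (indicator {0..y} t * (H * t powr (-\<alpha>))) = ennreal (indicator {0<..<y} t * (H * t powr (-\<alpha>)))"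
      using AE_lborel_singleton[of "0::real"] AE_lborel_singleton[of y]
      by eventually_elim (auto simp: indicator_def)
  qed
  ultimately show ?thesis by (simp add: add.commute)
qed

text \<open>Layer-cake formula: the expectation is the integral over t from 0 to y of the summed
  tails, each bounded by H t^(-\<alpha>). Injectivity of \<open>fst\<close> ensures that every k is
  counted once, as \<open>sum_z_le\<close> requires.\<close>

lemma expectation_small_le:
  assumes S: "finite S" "S \<subseteq> adm_index" "inj_on fst S" and y: "0 < y"
  shows "(\<integral>x. (\<Sum>i\<in>S. min (F i x) y) \<partial>m) \<le> H * y powr (1 - \<alpha>) / (1 - \<alpha>)"
proof -
  interpret P: pair_sigma_finite m lborel by unfold_locales
  let ?g = "\<lambda>x t. ennreal (indicator {0<..<y} t * (\<Sum>i\<in>S. indicator {t<..} (F i x)))"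
  have meas: "(\<lambda>(x, t). ?g x t) \<in> borel_measurable (m \<Otimes>\<^sub>M lborel)"
    by (simp add: indicator_def[of "{_<..}"]) measurable
  have nonneg: "AE x in m. \<forall>i\<in>S. 0 \<le> F i x"
    using S AE_F by (subst AE_finite_all) (auto elim!: eventually_mono dest: subsetD)
  have "(\<integral>\<^sup>+x. ennreal (\<Sum>i\<in>S. min (F i x) y) \<partial>m) = (\<integral>\<^sup>+x. (\<integral>\<^sup>+t. ?g x t \<partial>lborel) \<partial>m)"
  proof (rule nn_integral_cong_AE)
    show "AE x in m. ennreal (\<Sum>i\<in>S. min (F i x) y) = (\<integral>\<^sup>+t. ?g x t \<partial>lborel)"
      using nonneg
    proof eventually_elim
      case (elim x)
      have "(\<integral>\<^sup>+t. ?g x t \<partial>lborel) = (\<integral>\<^sup>+t. (\<Sum>i\<in>S. indicator {0<..<min (F i x) y} t) \<partial>lborel)"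
      proof (intro nn_integral_cong)
        fix t
        have "indicator {0<..<y} t * (\<Sum>i\<in>S. indicator {t<..} (F i x)) = (\<Sum>i\<in>S. indicator {0<..<min (F i x) y} t :: real)"
          unfolding sum_distrib_left by (intro sum.cong) (auto simp: indicator_def)
        then show "?g x t = (\<Sum>i\<in>S. indicator {0<..<min (F i x) y} t)"
          by (simp add: sum_ennreal[symmetric] ennreal_indicator)
      qed
      also have "\<dots> = (\<Sum>i\<in>S. ennreal (min (F i x) y))"
        using elim y by (subst nn_integral_sum) (auto intro!: sum.cong)
      also have "\<dots> = ennreal (\<Sum>i\<in>S. min (F i x) y)" using elim y by (intro sum_ennreal) auto
      finally show ?case ..
    qed
  qed
  also have "\<dots> = (\<integral>\<^sup>+t. (\<integral>\<^sup>+x. ?g x t \<partial>m) \<partial>lborel)"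
    by (rule P.Fubini'[OF meas, symmetric])
  also have "\<dots> \<le> (\<integral>\<^sup>+t. ennreal (indicator {0<..<y} t * (H * t powr (-\<alpha>))) \<partial>lborel)"
  proof (rule nn_integral_mono)
    fix t :: real
    show "(\<integral>\<^sup>+x. ?g x t \<partial>m) \<le> ennreal (indicator {0<..<y} t * (H * t powr (-\<alpha>)))"
    proof (cases "t \<in> {0<..<y}")
      case True
      have "(\<integral>\<^sup>+x. ?g x t \<partial>m) = (\<integral>\<^sup>+x. (\<Sum>i\<in>S. indicator {x\<in>space m. t < F i x} x) \<partial>m)"
        using True by (intro nn_integral_cong) (auto simp: sum_ennreal[symmetric] ennreal_indicator indicator_def intro!: sum.cong simp del: sum_ennreal)
      also have "\<dots> = (\<Sum>i\<in>S. emeasure m {x\<in>space m. t < F i x})"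
        by (subst nn_integral_sum) auto
      also have "\<dots> = (\<Sum>i\<in>S. ennreal (z (fst i) t))"
        using S by (intro sum.cong refl) (auto simp: emeasure_eq_measure prob_F dest: subsetD)
      also have "\<dots> = ennreal (\<Sum>i\<in>S. z (fst i) t)" by (intro sum_ennreal z_nonneg)
      also have "(\<Sum>i\<in>S. z (fst i) t) = (\<Sum>k\<in>fst ` S. z k t)" using S by (simp add: sum.reindex)
      also have "ennreal (\<Sum>k\<in>fst ` S. z k t) \<le> ennreal (H * t powr (-\<alpha>))"
        using S True by (intro ennreal_leI sum_z_le) (auto dest!: subsetD adm_indexD)
      finally show ?thesis using True by simp
    qed simp
  qed
  also have "\<dots> = ennreal (H * y powr (1 - \<alpha>) / (1 - \<alpha>))" by (rule nn_integral_powr_Ioo[OF y])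
  finally have nn: "(\<integral>\<^sup>+x. ennreal (\<Sum>i\<in>S. min (F i x) y) \<partial>m) \<le> ennreal (H * y powr (1 - \<alpha>) / (1 - \<alpha>))" .
  have "(\<integral>x. (\<Sum>i\<in>S. min (F i x) y) \<partial>m) = enn2real (\<integral>\<^sup>+x. ennreal (\<Sum>i\<in>S. min (F i x) y) \<partial>m)"
    using nonneg y by (intro integral_eq_nn_integral) (auto elim!: eventually_mono intro!: sum_nonneg)
  also have "\<dots> \<le> H * y powr (1 - \<alpha>) / (1 - \<alpha>)"
    using nn H_pos \<alpha> by (intro enn2real_leI) auto
  finally show ?thesis .
qed

text \<open>One index (k, d k) for each active k. The offset d is 0 for the positive part and
  \<open>dk\<close> for the negative part, both possibly shifted by a time j.\<close>

definition blk :: "(nat \<Rightarrow> nat) \<Rightarrow> nat \<Rightarrow> (nat \<times> nat) set" where "blk d n = (\<lambda>k. (k, d k)) ` active n"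

context
  fixes d :: "nat \<Rightarrow> nat"
  assumes d: "\<And>k. 1 \<le> k \<Longrightarrow> d k < 2 * dk k"
begin

definition \<phi> :: "nat \<Rightarrow> 'a \<Rightarrow> real" where "\<phi> k = F (k, d k)"

lemma adm_d: "1 \<le> k \<Longrightarrow> (k, d k) \<in> adm_index"
  using d by (auto simp: adm_index_def)

lemma blk: "finite (blk d n)" "blk d n \<subseteq> adm_index" "inj_on fst (blk d n)" "fst ` blk d n = active n"
  using finite_active adm_d by (auto simp: blk_def inj_on_def active_def image_image)

lemma AE_\<phi>: "AE x in m. \<forall>k\<ge>1. 0 \<le> \<phi> k x \<and> \<phi> k x \<le> 4 ^ k"
proof -
  have "AE x in m. 1 \<le> k \<longrightarrow> 0 \<le> \<phi> k x \<and> \<phi> k x \<le> 4 ^ k" for k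
    using AE_F[OF adm_d[of k]] by (cases "1 \<le> k") (auto simp: \<phi>_def elim!: eventually_mono)
  then show ?thesis by (subst AE_all_countable) auto
qed

lemma prob_beyond_le:
  "prob {x\<in>space m. \<exists>k>n. 0 < \<phi> k x} \<le> C / (r * (1 - r)) * r ^ n"
proof -
  let ?b = "C / (r * (1 - r)) * r ^ n"
  have b0: "0 \<le> ?b" using C(1) r by simp
  let ?A = "\<lambda>i. {x\<in>space m. 0 < \<phi> (Suc n + i) x}"
  have [measurable]: "\<phi> k \<in> borel_measurable m" for k unfolding \<phi>_def by measurable
  have "{x\<in>space m. \<exists>k>n. 0 < \<phi> k x} = (\<Union>i. ?A i)"
    by (auto simp: less_iff_Suc_add)
  then have "emeasure m {x\<in>space m. \<exists>k>n. 0 < \<phi> k x} \<le> (\<Sum>i. emeasure m (?A i))"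
    by (simp only:) (rule emeasure_subadditive_countably, auto)
  also have "\<dots> = (SUP K. \<Sum>i<K. emeasure m (?A i))" by (rule suminf_eq_SUP)
  also have "\<dots> \<le> ennreal ?b"
  proof (rule SUP_least)
    fix K
    have "(\<Sum>i<K. emeasure m (?A i)) = (\<Sum>i<K. ennreal (z (Suc n + i) 0))"
      using prob_F[OF adm_d] by (intro sum.cong refl) (simp add: emeasure_eq_measure \<phi>_def)
    also have "\<dots> = ennreal (\<Sum>i<K. z (Suc n + i) 0)" by (intro sum_ennreal z_nonneg)
    also have "(\<Sum>i<K. z (Suc n + i) 0) = (\<Sum>k\<in>(\<lambda>i. Suc n + i) ` {..<K}. z k 0)"
      by (subst sum.reindex) (auto simp: inj_on_def)
    also have "ennreal \<dots> \<le> ennreal ?b" by (intro ennreal_leI sum_z_beyond_le) auto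
    finally show "(\<Sum>i<K. emeasure m (?A i)) \<le> ennreal ?b" .
  qed
  finally show ?thesis using b0 by (simp add: emeasure_eq_measure)
qed

text \<open>Distinct indices are independent, so the expected number of ordered pairs above y is at
  most the square of the expected number of terms above y.\<close>

lemma expectation_two_large_le:
  assumes S: "finite S" "S \<subseteq> adm_index" "inj_on fst S" and y: "0 < y"
  shows "(\<integral>x. (\<Sum>i\<in>S. \<Sum>j\<in>S-{i}. indicator {y<..} (F i x) * indicator {y<..} (F j x)) \<partial>m) \<le> (H * y powr (-\<alpha>))\<^sup>2"
proof -
  have int: "integrable m (\<lambda>x. indicator {y<..} (F i x) * indicator {y<..} (F j x) :: real)" for i j
    by (rule integrable_const_bound[where B=1]) (auto simp: indicator_def)
  have "(\<integral>x. (\<Sum>i\<in>S. \<Sum>j\<in>S-{i}. (indicator {y<..} (F i x) :: real) * indicator {y<..} (F j x)) \<partial>m) =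
     (\<Sum>i\<in>S. \<Sum>j\<in>S-{i}. \<integral>x. indicator {y<..} (F i x) * indicator {y<..} (F j x) \<partial>m)"
    using int by (simp add: Bochner_Integration.integral_sum)
  also have "\<dots> = (\<Sum>i\<in>S. \<Sum>j\<in>S-{i}. z (fst i) y * z (fst j) y)"
    using S by (intro sum.cong refl F_pair) auto
  also have "\<dots> \<le> (\<Sum>i\<in>S. \<Sum>j\<in>S. z (fst i) y * z (fst j) y)"
    using S z_nonneg by (intro sum_mono sum_mono2) auto
  also have "\<dots> = (\<Sum>i\<in>S. z (fst i) y)\<^sup>2" by (simp add: power2_eq_square sum_product)
  also have "(\<Sum>i\<in>S. z (fst i) y) = (\<Sum>k\<in>fst ` S. z k y)" using S by (simp add: sum.reindex)
  also have "\<dots>\<^sup>2 \<le> (H * y powr (-\<alpha>))\<^sup>2"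
    using S y by (intro power_mono sum_z_le sum_nonneg z_nonneg) (auto dest!: subsetD adm_indexD)
  finally show ?thesis .
qed

text \<open>The sum and the maximum differ only through two large terms in one block, which is unlikely, or
  through the terms below \<delta> n^(1/\<alpha>), whose expectation is small because \<alpha> < 1.\<close>
lemma sum_vs_max:
  assumes n: "0 < n" and \<delta>: "0 < \<delta>"
  shows "real n * (\<integral>x. min 1 (\<bar>(\<Sum>k. \<phi> (Suc k) x) - maxS (blk d n) (\<lambda>i. F i x)\<bar> / real n powr (1/\<alpha>)) \<partial>m) \<le>
    real n * (C / (r * (1 - r)) * r ^ n) + real n powr (1 - 1/\<alpha>) * (\<Sum>k | 1 \<le> k \<and> dk k < n. 4 ^ k)
    + H * \<delta> powr (1 - \<alpha>) / (1 - \<alpha>) + H\<^sup>2 * \<delta> powr (- 2 * \<alpha>) / real n"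
proof -
  have [measurable]: "\<phi> k \<in> borel_measurable m" for k unfolding \<phi>_def by measurable
  define N where "N = real n powr (1/\<alpha>)"
  have N: "0 < N" using n by (simp add: N_def)
  define y where "y = \<delta> * N"
  have y: "0 < y" using \<delta> N by (simp add: y_def)
  let ?S = "blk d n"
  have ne: "?S \<noteq> {}" using active_nonempty[OF n] by (simp add: blk_def)
  \<comment> \<open>The exceptional event: outside it all indices beyond n vanish almost everywhere,
    and the series is a sum over the active indices plus those with \<open>dk k < n\<close>, whose
    total is at most \<open>c4\<close>.\<close>
  define E where "E = {x\<in>space m. \<exists>k>n. 0 < \<phi> k x}"
  have E [measurable]: "E \<in> events" unfolding E_def by measurable
  define c4 where "c4 = (\<Sum>k | 1 \<le> k \<and> dk k < n. 4 ^ k :: real)"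
  let ?A = "\<lambda>x. \<Sum>i\<in>?S. min (F i x) y"
  let ?B = "\<lambda>x. \<Sum>i\<in>?S. \<Sum>j\<in>?S-{i}. indicator {y<..} (F i x) * indicator {y<..} (F j x) :: real"
  have small_fin: "finite {k. 1 \<le> k \<and> dk k < n}"
    by (rule finite_subset[of _ "{..n}"]) (use le_dk in \<open>auto intro: le_less_trans less_imp_le\<close>)
  have pointwise: "AE x in m. min 1 (\<bar>(\<Sum>k. \<phi> (Suc k) x) - maxS ?S (\<lambda>i. F i x)\<bar> / N) \<le>
      indicator E x + c4 / N + (?A x / N + ?B x)"
    using AE_\<phi> AE_space
  proof eventually_elim
    case (elim x)
    have F\<phi>: "0 \<le> F i x" if "i \<in> ?S" for i using that elim by (auto simp: blk_def active_def \<phi>_def)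
    have c40: "0 \<le> c4 / N" using N by (auto simp: c4_def intro!: divide_nonneg_pos sum_nonneg)
    have AB0: "0 \<le> ?A x / N + ?B x" using F\<phi> y N by (intro add_nonneg_nonneg divide_nonneg_pos sum_nonneg) auto
    show ?case
    proof (cases "x \<in> E")
      case True
      then show ?thesis using c40 AB0 by simp
    next
      case False
      then have z: "\<phi> k x = 0" if "n < k" for k 
      proof -
        have "\<not> 0 < \<phi> k x" using False elim(2) that by (auto simp: E_def)
        moreover have "0 \<le> \<phi> k x" using elim(1) that by simp
        ultimately show ?thesis by simp
      qed
      have "(\<Sum>k. \<phi> (Suc k) x) = (\<Sum>k<n. \<phi> (Suc k) x)"
        by (rule suminf_finite) (auto simp: z)
      also have "\<dots> = (\<Sum>k\<in>{1..n}. \<phi> k x)"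
        by (rule sum.reindex_bij_witness[of _ "\<lambda>k. k - 1" Suc]) auto
      also have "\<dots> = (\<Sum>k\<in>{k\<in>{1..n}. dk k < n} \<union> active n. \<phi> k x)"
        by (intro sum.cong) (auto simp: active_def)
      also have "\<dots> = (\<Sum>k\<in>{k\<in>{1..n}. dk k < n}. \<phi> k x) + (\<Sum>k\<in>active n. \<phi> k x)"
        using finite_active by (intro sum.union_disjoint) (auto simp: active_def)
      also have "(\<Sum>k\<in>active n. \<phi> k x) = (\<Sum>i\<in>?S. F i x)"
        unfolding blk_def by (subst sum.reindex) (auto simp: inj_on_def \<phi>_def)
      finally have eq: "(\<Sum>k. \<phi> (Suc k) x) = (\<Sum>k\<in>{k\<in>{1..n}. dk k < n}. \<phi> k x) + (\<Sum>i\<in>?S. F i x)" .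
      have sm0: "0 \<le> (\<Sum>k\<in>{k\<in>{1..n}. dk k < n}. \<phi> k x)" using elim by (intro sum_nonneg) auto
      have "(\<Sum>k\<in>{k\<in>{1..n}. dk k < n}. \<phi> k x) \<le> (\<Sum>k\<in>{k\<in>{1..n}. dk k < n}. 4 ^ k)"
        using elim by (intro sum_mono) auto
      also have "\<dots> \<le> c4" unfolding c4_def using small_fin by (intro sum_mono2) auto
      finally have sm: "(\<Sum>k\<in>{k\<in>{1..n}. dk k < n}. \<phi> k x) \<le> c4" .
      have "\<bar>(\<Sum>k. \<phi> (Suc k) x) - maxS ?S (\<lambda>i. F i x)\<bar> \<le> c4 + \<bar>(\<Sum>i\<in>?S. F i x) - maxS ?S (\<lambda>i. F i x)\<bar>"
        unfolding eq using sm sm0 by linarith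
      then have "\<bar>(\<Sum>k. \<phi> (Suc k) x) - maxS ?S (\<lambda>i. F i x)\<bar> / N \<le> c4 / N + \<bar>(\<Sum>i\<in>?S. F i x) - maxS ?S (\<lambda>i. F i x)\<bar> / N"
        using N by (simp add: add_divide_distrib[symmetric] divide_right_mono)
      then have "min 1 (\<bar>(\<Sum>k. \<phi> (Suc k) x) - maxS ?S (\<lambda>i. F i x)\<bar> / N) \<le> c4 / N + min 1 (\<bar>(\<Sum>i\<in>?S. F i x) - maxS ?S (\<lambda>i. F i x)\<bar> / N)"
        using c40 by linarith
      also have "min 1 (\<bar>(\<Sum>i\<in>?S. F i x) - maxS ?S (\<lambda>i. F i x)\<bar> / N) \<le> ?A x / N + ?B x"
        using blk(1) ne F\<phi> y N by (intro sum_minus_maxS_le) auto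
      finally show ?thesis using False by simp
    qed
  qed
  have nonneg: "AE x in m. \<forall>i\<in>?S. 0 \<le> F i x"
    using AE_\<phi> by eventually_elim (auto simp: blk_def active_def \<phi>_def)
  have intA: "integrable m ?A"
    by (intro Bochner_Integration.integrable_sum integrable_const_bound[where B=y])
      (use nonneg y in \<open>auto elim!: eventually_mono\<close>)
  have intB: "integrable m ?B"
    by (intro Bochner_Integration.integrable_sum integrable_const_bound[where B=1]) (auto simp: indicator_def)
  have "(\<integral>x. min 1 (\<bar>(\<Sum>k. \<phi> (Suc k) x) - maxS ?S (\<lambda>i. F i x)\<bar> / N) \<partial>m) \<le> (\<integral>x. indicator E x + c4 / N + (?A x / N + ?B x) \<partial>m)"
  proof (rule integral_mono_AE[OF _ _ pointwise])
    show "integrable m (\<lambda>x. min 1 (\<bar>(\<Sum>k. \<phi> (Suc k) x) - maxS ?S (\<lambda>i. F i x)\<bar> / N))"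
      using N blk(1) by (intro integrable_const_bound[where B=1]) auto
    show "integrable m (\<lambda>x. indicator E x + c4 / N + (?A x / N + ?B x))"
      using intA intB E by (intro Bochner_Integration.integrable_add integrable_divide integrable_real_indicator) (auto simp: emeasure_eq_measure)
  qed
  also have "\<dots> = prob E + c4 / N + ((\<integral>x. ?A x \<partial>m) / N + (\<integral>x. ?B x \<partial>m))"
    using intA intB E by (simp add: prob_space emeasure_eq_measure Int_absorb2 sets.sets_into_space)
  also have "\<dots> \<le> C / (r * (1 - r)) * r ^ n + c4 / N + (H * y powr (1 - \<alpha>) / (1 - \<alpha>) / N + (H * y powr (-\<alpha>))\<^sup>2)"
    using prob_beyond_le[of n] expectation_small_le[OF blk(1-3) y] expectation_two_large_le[OF blk(1-3) y] N
    by (intro add_mono divide_right_mono) (auto simp: E_def)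
  finally have "real n * (\<integral>x. min 1 (\<bar>(\<Sum>k. \<phi> (Suc k) x) - maxS ?S (\<lambda>i. F i x)\<bar> / N) \<partial>m) \<le>
     real n * (C / (r * (1 - r)) * r ^ n + c4 / N + (H * y powr (1 - \<alpha>) / (1 - \<alpha>) / N + (H * y powr (-\<alpha>))\<^sup>2))"
    by (rule mult_left_mono) simp
  also have "\<dots> = real n * (C / (r * (1 - r)) * r ^ n) + real n / N * c4 + H / (1 - \<alpha>) * (real n / N * y powr (1 - \<alpha>)) + H\<^sup>2 * (real n * (y powr (-\<alpha>))\<^sup>2)"
    by (simp add: field_simps power_mult_distrib)
  also have "real n / N = real n powr (1 - 1/\<alpha>)" using n by (simp add: N_def powr_diff)
  \<comment> \<open>The level y = \<delta> n^(1/\<alpha>) is chosen so that the powers of n cancel: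
    what remains is small with \<delta>, independently of n.\<close>
  also have "real n powr (1 - 1/\<alpha>) * y powr (1 - \<alpha>) = \<delta> powr (1 - \<alpha>)"
  proof -
    have "(1 - 1/\<alpha>) + (1/\<alpha>) * (1 - \<alpha>) = 0" using \<alpha> by (simp add: field_simps)
    moreover have "y powr (1 - \<alpha>) = \<delta> powr (1 - \<alpha>) * real n powr ((1/\<alpha>) * (1 - \<alpha>))"
      by (simp only: y_def N_def powr_mult powr_powr)
    moreover have "real n powr (1 - 1/\<alpha>) * (D * real n powr ((1/\<alpha>) * (1 - \<alpha>))) = D * real n powr ((1 - 1/\<alpha>) + (1/\<alpha>) * (1 - \<alpha>))" for D
      by (simp only: powr_add ac_simps)
    ultimately show ?thesis using n by simp
  qed
  also have "real n * (y powr (-\<alpha>))\<^sup>2 = \<delta> powr (- 2 * \<alpha>) / real n"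
  proof -
    have "N powr (-\<alpha>) = real n powr (-1)" using \<alpha> by (simp add: N_def powr_powr del: powr_minus)
    then have "y powr (-\<alpha>) = \<delta> powr (-\<alpha>) / real n" using n by (simp add: y_def powr_mult powr_minus divide_inverse)
    moreover have "(\<delta> powr (-\<alpha>))\<^sup>2 = \<delta> powr (- 2 * \<alpha>)" by (simp add: power2_eq_square powr_add[symmetric])
    ultimately show ?thesis using n by (simp add: power_divide power2_eq_square)
  qed
  finally show ?thesis unfolding N_def c4_def by (simp add: ac_simps)
qed

text \<open>First \<delta> is fixed to make the term of the small values less than e/2; afterwards n
  tends to infinity and the remaining three terms vanish.\<close>

lemma sum_vs_max_tendsto:
  "(\<lambda>n. real n * (\<integral>x. min 1 (\<bar>(\<Sum>k. \<phi> (Suc k) x) - maxS (blk d n) (\<lambda>i. F i x)\<bar> / real n powr (1/\<alpha>)) \<partial>m)) \<longlonglongrightarrow> 0"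
proof (rule tendstoI)
  fix e :: real assume e: "0 < e"
  have "((\<lambda>\<delta>. H * \<delta> powr (1 - \<alpha>) / (1 - \<alpha>)) \<longlongrightarrow> H * 0 / (1 - \<alpha>)) (at_right 0)"
  proof (intro tendsto_intros)
    show "((\<lambda>\<delta>. \<delta> powr (1 - \<alpha>)) \<longlongrightarrow> (0::real)) (at_right 0)"
      using \<alpha> by real_asymp
  qed (use \<alpha> in auto)
  then have "eventually (\<lambda>\<delta>. H * \<delta> powr (1 - \<alpha>) / (1 - \<alpha>) < e / 2) (at_right 0)"
    using e by (intro order_tendstoD(2)) auto
  moreover have "eventually (\<lambda>\<delta>::real. 0 < \<delta>) (at_right 0)" by (auto simp: eventually_at_right_field intro: exI[of _ 1])
  ultimately have "eventually (\<lambda>\<delta>. 0 < \<delta> \<and> H * \<delta> powr (1 - \<alpha>) / (1 - \<alpha>) < e / 2) (at_right 0)" by eventually_elim auto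
  then obtain \<delta> where \<delta>: "0 < \<delta>" "H * \<delta> powr (1 - \<alpha>) / (1 - \<alpha>) < e / 2"
    using eventually_happens'[of "at_right (0::real)"] by (auto simp: trivial_limit_at_right_real)
  have "(\<lambda>n. real n * (C / (r * (1 - r)) * r ^ n) + real n powr (1 - 1/\<alpha>) * (\<Sum>k | 1 \<le> k \<and> dk k < n. 4 ^ k)
      + H\<^sup>2 * \<delta> powr (- 2 * \<alpha>) * (1 / real n)) \<longlonglongrightarrow> 0 + 0 + H\<^sup>2 * \<delta> powr (- 2 * \<alpha>) * 0"
    by (intro tendsto_add beyond_negligible small_index_negligible tendsto_mult_left lim_1_over_n)
  then have "eventually (\<lambda>n. real n * (C / (r * (1 - r)) * r ^ n) + real n powr (1 - 1/\<alpha>) * (\<Sum>k | 1 \<le> k \<and> dk k < n. 4 ^ k)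
      + H\<^sup>2 * \<delta> powr (- 2 * \<alpha>) * (1 / real n) < e / 2) sequentially"
    using e by (intro order_tendstoD(2)) auto
  then show "eventually (\<lambda>n. dist (real n * (\<integral>x. min 1 (\<bar>(\<Sum>k. \<phi> (Suc k) x) - maxS (blk d n) (\<lambda>i. F i x)\<bar> / real n powr (1/\<alpha>)) \<partial>m)) 0 < e) sequentially"
    using eventually_gt_at_top[of 0]
  proof eventually_elim
    case (elim n)
    let ?I = "\<integral>x. min 1 (\<bar>(\<Sum>k. \<phi> (Suc k) x) - maxS (blk d n) (\<lambda>i. F i x)\<bar> / real n powr (1/\<alpha>)) \<partial>m"
    have "0 \<le> ?I" by (intro integral_nonneg_AE) auto
    then have "0 \<le> real n * ?I" by simp
    moreover have "real n * ?I < e" using sum_vs_max[OF elim(2) \<delta>(1)] elim(1) \<delta>(2)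
      unfolding times_divide_eq_right mult_1_right by linarith
    ultimately show ?case by (simp add: dist_real_def)
  qed
qed

end

end

subsection \<open>Comparison of step paths\<close>

lemma J1_Lip_integrable:
  assumes "prob_space M" "J1_Lip F B L" and [measurable]: "\<And>j. X j \<in> borel_measurable M"
  shows "integrable M (\<lambda>x. F (step_path n (\<lambda>j. X j x)))"
proof -
  interpret prob_space M by fact
  have [measurable]: "(\<lambda>x j. X j x) \<in> M \<rightarrow>\<^sub>M (borel :: (nat \<Rightarrow> real) measure)"
    by (rule measurable_coordinatewise_then_product) measurable
  have "(\<lambda>x. F (step_path n (\<lambda>j. X j x))) \<in> borel_measurable M"
    by (rule measurable_compose[OF _ borel_measurable_J1_step_path[OF J1_Lip_imp_bcont[OF assms(2)]]]) measurable
  then show ?thesis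
    using assms(2) cadlag_step_path by (intro integrable_const_bound[where B=B]) (auto simp: J1_Lip_def)
qed

text \<open>The coupling inequality: both increment sequences live on one space, and each block
  enters through its truncated difference only.\<close>

lemma J1_Lip_expectation_diff_le:
  assumes M: "prob_space M" and F: "J1_Lip F B L"
    and X [measurable]: "\<And>j. X j \<in> borel_measurable M" and Y [measurable]: "\<And>j. Y j \<in> borel_measurable M"
  shows "\<bar>(\<integral>x. F (step_path n (\<lambda>j. X j x)) \<partial>M) - (\<integral>x. F (step_path n (\<lambda>j. Y j x)) \<partial>M)\<bar>
    \<le> (2 * B + L) * (\<Sum>j<n. \<integral>x. min 1 \<bar>X j x - Y j x\<bar> \<partial>M)"
proof -
  interpret prob_space M by fact
  have int: "integrable M (\<lambda>x. min 1 \<bar>X j x - Y j x\<bar>)" for j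
    by (rule integrable_const_bound[where B=1]) auto
  have "(\<integral>x. F (step_path n (\<lambda>j. X j x)) \<partial>M) - (\<integral>x. F (step_path n (\<lambda>j. Y j x)) \<partial>M) =
      (\<integral>x. F (step_path n (\<lambda>j. X j x)) - F (step_path n (\<lambda>j. Y j x)) \<partial>M)"
    by (rule Bochner_Integration.integral_diff[symmetric]) (rule J1_Lip_integrable[OF M F], measurable)+
  also have "\<bar>\<dots>\<bar> \<le> (\<integral>x. \<bar>F (step_path n (\<lambda>j. X j x)) - F (step_path n (\<lambda>j. Y j x))\<bar> \<partial>M)"
    by (rule integral_abs_bound)
  also have "\<dots> \<le> (\<integral>x. (2 * B + L) * (\<Sum>j<n. min 1 \<bar>X j x - Y j x\<bar>) \<partial>M)"
  proof (rule integral_mono)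
    show "integrable M (\<lambda>x. \<bar>F (step_path n (\<lambda>j. X j x)) - F (step_path n (\<lambda>j. Y j x))\<bar>)"
      by (intro integrable_abs Bochner_Integration.integrable_diff J1_Lip_integrable[OF M F] X Y)
    show "integrable M (\<lambda>x. (2 * B + L) * (\<Sum>j<n. min 1 \<bar>X j x - Y j x\<bar>))"
      by (intro integrable_mult_right Bochner_Integration.integrable_sum int)
  qed (rule J1_Lip_step_path_le[OF F])
  also have "\<dots> = (2 * B + L) * (\<Sum>j<n. \<integral>x. min 1 \<bar>X j x - Y j x\<bar> \<partial>M)"
    using int by (simp add: Bochner_Integration.integral_sum)
  finally show ?thesis .
qed

text \<open>Change of probability space without error: the first n increments determine the value of
  F, and independence together with the marginal laws determines their joint law.\<close>

lemma J1_Lip_expectation_eq: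
  assumes M: "prob_space M" "prob_space M'" and F: "J1_Lip F B L"
    and X [measurable]: "\<And>j. X j \<in> borel_measurable M" and Y [measurable]: "\<And>j. Y j \<in> borel_measurable M'"
    and ind: "prob_space.indep_vars M (\<lambda>_. borel) X {..<n}" "prob_space.indep_vars M' (\<lambda>_. borel) Y {..<n}"
    and law: "\<And>j. j < n \<Longrightarrow> distr M borel (X j) = distr M' borel (Y j)"
  shows "(\<integral>x. F (step_path n (\<lambda>j. X j x)) \<partial>M) = (\<integral>x. F (step_path n (\<lambda>j. Y j x)) \<partial>M')"
proof -
  interpret M: prob_space M by fact
  interpret M': prob_space M' by fact
  \<comment> \<open>Points of the finite product are \<open>undefined\<close> outside the index set;
    filling in 0 there gives a measurable map to sequences, and \<open>J1_Lip_step_path_le\<close>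
    shows that F does not notice the change.\<close>
  define g where "g v = F (step_path n (\<lambda>j. if j < n then v j else 0))" for v
  have "(\<lambda>v j. if j < n then v j else 0) \<in> PiM {..<n} (\<lambda>_. borel) \<rightarrow>\<^sub>M (borel :: (nat \<Rightarrow> real) measure)"
  proof (rule measurable_coordinatewise_then_product)
    fix j show "(\<lambda>v. if j < n then v j else 0) \<in> borel_measurable (PiM {..<n} (\<lambda>_. borel))"
      by (cases "j < n") auto
  qed
  then have g [measurable]: "g \<in> borel_measurable (PiM {..<n} (\<lambda>_. borel))"
    unfolding g_def by (rule measurable_compose[OF _ borel_measurable_J1_step_path[OF J1_Lip_imp_bcont[OF F]]])
  have eq: "F (step_path n v) = g (\<lambda>i\<in>{..<n}. v i)" for v
  proof -
    have "\<bar>F (step_path n v) - g (\<lambda>i\<in>{..<n}. v i)\<bar> \<le> (2 * B + L) * (\<Sum>j<n. min 1 \<bar>v j - (if j < n then (\<lambda>i\<in>{..<n}. v i) j else 0)\<bar>)"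
      unfolding g_def by (rule J1_Lip_step_path_le[OF F])
    also have "\<dots> = 0" by simp
    finally show ?thesis by simp
  qed
  show ?thesis
  proof (cases "n = 0")
    case True
    have "F (step_path n v) = F (step_path n (\<lambda>_. 0))" for v
      using J1_Lip_step_path_le[OF F, of n v "\<lambda>_. 0"] True by simp
    then have "(\<lambda>x. F (step_path n (\<lambda>j. X j x))) = (\<lambda>_. F (step_path n (\<lambda>_. 0)))"
      "(\<lambda>x. F (step_path n (\<lambda>j. Y j x))) = (\<lambda>_. F (step_path n (\<lambda>_. 0)))" by auto
    then show ?thesis by (simp add: M.prob_space M'.prob_space)
  next
    case False
    then have ne: "{..<n} \<noteq> {}" by auto
    have "distr M (PiM {..<n} (\<lambda>_. borel)) (\<lambda>x. \<lambda>i\<in>{..<n}. X i x) = PiM {..<n} (\<lambda>i. distr M borel (X i))"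
      using ind(1) M.indep_vars_iff_distr_eq_PiM[OF ne X] by simp
    also have "\<dots> = PiM {..<n} (\<lambda>i. distr M' borel (Y i))" by (intro PiM_cong refl law) auto
    also have "\<dots> = distr M' (PiM {..<n} (\<lambda>_. borel)) (\<lambda>x. \<lambda>i\<in>{..<n}. Y i x)"
      using ind(2) M'.indep_vars_iff_distr_eq_PiM[OF ne Y] by simp
    finally have d: "distr M (PiM {..<n} (\<lambda>_. borel)) (\<lambda>x. \<lambda>i\<in>{..<n}. X i x) = distr M' (PiM {..<n} (\<lambda>_. borel)) (\<lambda>x. \<lambda>i\<in>{..<n}. Y i x)" .
    have "(\<integral>x. F (step_path n (\<lambda>j. X j x)) \<partial>M) = (\<integral>v. g v \<partial>distr M (PiM {..<n} (\<lambda>_. borel)) (\<lambda>x. \<lambda>i\<in>{..<n}. X i x))"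
      unfolding eq by (subst integral_distr) auto
    also have "\<dots> = (\<integral>x. F (step_path n (\<lambda>j. Y j x)) \<partial>M')"
      unfolding d eq by (subst integral_distr) auto
    finally show ?thesis .
  qed
qed

definition pair_law :: "real \<Rightarrow> real \<Rightarrow> real measure \<Rightarrow> real measure" where
  "pair_law a b \<rho> = distr (\<rho> \<Otimes>\<^sub>M \<rho>) borel (\<lambda>p. a * fst p - b * snd p)"

lemma (in prob_space) distr_pair_law:
  assumes "indep_var borel X borel Y" "distr M borel X = \<rho>" "distr M borel Y = \<rho>"
  shows "distr M borel (\<lambda>x. a * X x - b * Y x) = pair_law a b \<rho>"
proof -
  have [measurable]: "X \<in> borel_measurable M" "Y \<in> borel_measurable M"
    using assms(1) by (auto dest: indep_var_rv1 indep_var_rv2)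
  have s: "sets \<rho> = sets borel" using assms(2) by (metis sets_distr)
  have "\<rho> \<Otimes>\<^sub>M \<rho> = distr M (borel \<Otimes>\<^sub>M borel) (\<lambda>x. (X x, Y x))"
    using assms indep_var_distribution_eq[of borel X borel Y] by simp
  then show ?thesis unfolding pair_law_def by (simp only:) (subst distr_distr, auto simp: comp_def)
qed

lemma char_pair_law:
  assumes "real_distribution \<rho>"
  shows "char (pair_law a b \<rho>) \<theta> = char \<rho> (a * \<theta>) * char \<rho> (- (b * \<theta>))"
    and "real_distribution (pair_law a b \<rho>)"
proof -
  interpret \<rho>: real_distribution \<rho> by fact
  interpret P: pair_prob_space \<rho> \<rho> ..
  have [measurable]: "(\<lambda>p. a * fst p - b * snd p) \<in> borel_measurable (\<rho> \<Otimes>\<^sub>M \<rho>)" by measurable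
  have "char (pair_law a b \<rho>) \<theta> = (\<integral>p. iexp (\<theta> * (a * fst p - b * snd p)) \<partial>(\<rho> \<Otimes>\<^sub>M \<rho>))"
    unfolding char_def pair_law_def by (subst integral_distr) auto
  also have "\<dots> = (\<integral>x. (\<integral>y. iexp (\<theta> * (a * fst (x, y) - b * snd (x, y))) \<partial>\<rho>) \<partial>\<rho>)"
    by (intro P.integral_fst'[symmetric] P.integrable_iexp) auto
  also have "\<dots> = (\<integral>x. (\<integral>y. iexp (a * \<theta> * x) * iexp (- (b * \<theta>) * y) \<partial>\<rho>) \<partial>\<rho>)"
  proof (intro Bochner_Integration.integral_cong refl)
    fix x y
    have "\<theta> * (a * fst (x, y) - b * snd (x, y)) = a * \<theta> * x + - (b * \<theta>) * y" by (simp add: algebra_simps)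
    then show "iexp (\<theta> * (a * fst (x, y) - b * snd (x, y))) = iexp (a * \<theta> * x) * iexp (- (b * \<theta>) * y)"
      by (simp only: iexp_add)
  qed
  also have "\<dots> = char \<rho> (a * \<theta>) * char \<rho> (- (b * \<theta>))"
    by (simp only: Bochner_Integration.integral_mult_right_zero Bochner_Integration.integral_mult_left_zero char_def)
  finally show "char (pair_law a b \<rho>) \<theta> = char \<rho> (a * \<theta>) * char \<rho> (- (b * \<theta>))" .
  show "real_distribution (pair_law a b \<rho>)"
    using P.prob_space_distr[of "\<lambda>p. a * fst p - b * snd p" borel]
    by (simp add: pair_law_def real_distribution_def real_distribution_axioms_def)
qed

text \<open>The \<alpha>-th powers of the two weights have sum 1 and difference \<beta>, up to the
  factor s^\<alpha>. Hence the difference of two independent totally asymmetric copies keeps the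
  scale and acquires skewness \<beta>; this is the reason for the coefficients of f and g.\<close>

lemma stable_pair_law:
  assumes \<alpha>: "0 < \<alpha>" and \<beta>: "-1 \<le> \<beta>" "\<beta> \<le> 1" and \<rho>: "stable_law \<rho> \<alpha> \<sigma> 1 0" and s: "0 < s" and \<sigma>: "0 \<le> \<sigma>"
  shows "stable_law (pair_law (((1 + \<beta>) / 2) powr (1/\<alpha>) * s) (((1 - \<beta>) / 2) powr (1/\<alpha>) * s) \<rho>) \<alpha> (\<sigma> * s) \<beta> 0"
proof -
  define A where "A = ((1 + \<beta>) / 2) powr (1/\<alpha>) * s"
  define D where "D = ((1 - \<beta>) / 2) powr (1/\<alpha>) * s"
  have AD: "0 \<le> A" "0 \<le> D" using s by (auto simp: A_def D_def)
  have pw: "A powr \<alpha> = (1 + \<beta>) / 2 * s powr \<alpha>" "D powr \<alpha> = (1 - \<beta>) / 2 * s powr \<alpha>"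
    using \<alpha> \<beta> by (auto simp: A_def D_def powr_mult powr_powr)
  let ?t = "tan (pi * \<alpha> / 2)"
  have ch: "char \<rho> \<theta> = exp (- complex_of_real (\<sigma> powr \<alpha> * \<bar>\<theta>\<bar> powr \<alpha>) * (1 - \<i> * complex_of_real (sgn \<theta> * ?t)))" for \<theta>
    using \<rho> by (simp add: stable_law_def)
  have scaled: "char \<rho> (x * \<theta>) = exp (- complex_of_real (\<sigma> powr \<alpha> * \<bar>\<theta>\<bar> powr \<alpha>) * of_real (x powr \<alpha>) * (1 - \<i> * complex_of_real (sgn \<theta> * ?t)))" if "0 \<le> x" for x \<theta>
  proof (cases "x = 0")
    case False
    then show ?thesis using that unfolding ch by (simp add: abs_mult powr_mult sgn_mult ac_simps)
  qed (simp add: ch)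
  have scaled_neg: "char \<rho> (- (x * \<theta>)) = exp (- complex_of_real (\<sigma> powr \<alpha> * \<bar>\<theta>\<bar> powr \<alpha>) * of_real (x powr \<alpha>) * (1 + \<i> * complex_of_real (sgn \<theta> * ?t)))" if "0 \<le> x" for x \<theta>
    using scaled[OF that, of "- \<theta>"] by (simp add: sgn_minus)
  have rd: "real_distribution \<rho>" using \<rho> by (simp add: stable_law_def)
  have "char (pair_law A D \<rho>) \<theta> = exp (- complex_of_real ((\<sigma> * s) powr \<alpha> * \<bar>\<theta>\<bar> powr \<alpha>) * (1 - \<i> * complex_of_real (\<beta> * sgn \<theta> * ?t)) + \<i> * complex_of_real (0 * \<theta>))" for \<theta>
  proof -
    have alg: "- X * of_real ((1 + \<beta>) / 2 * S) * (1 - \<i> * V) + - X * of_real ((1 - \<beta>) / 2 * S) * (1 + \<i> * V) = - (of_real S * X) * (1 - \<i> * (of_real \<beta> * V))" for X V :: complex and S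
      by (simp add: field_simps)
    show ?thesis
      unfolding char_pair_law(1)[OF rd] scaled[OF AD(1)] scaled_neg[OF AD(2)] exp_add[symmetric] pw alg
      by (simp add: powr_mult ac_simps)
  qed
  then show ?thesis
    unfolding A_def[symmetric] D_def[symmetric] stable_law_def using char_pair_law(2)[OF rd] by blast
qed

lemma prod_one_minus_ge:
  fixes a :: "'i \<Rightarrow> real"
  assumes "finite A" "\<And>i. i \<in> A \<Longrightarrow> 0 \<le> a i" "\<And>i. i \<in> A \<Longrightarrow> a i \<le> 1"
  shows "1 - (\<Sum>i\<in>A. a i) \<le> (\<Prod>i\<in>A. 1 - a i)"
  using assms
proof (induction A rule: finite_induct)
  case (insert x A)
  have "(\<Prod>i\<in>A. 1 - a i) \<le> 1" using insert by (intro prod_le_1) auto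
  then have "a x * (\<Prod>i\<in>A. 1 - a i) \<le> a x * 1" using insert by (intro mult_left_mono) auto
  then show ?case using insert by (simp add: left_diff_distrib)
qed simp

text \<open>From 1 - a \<le> exp(-a) and exp(S) \<ge> 1 + S. Together with the linear lower bound
  this encloses the tail of a maximum between S/(1 + S) and S, where S is the sum of the single
  tails.\<close>

lemma prod_one_minus_le:
  fixes a :: "'i \<Rightarrow> real"
  assumes "\<And>i. i \<in> A \<Longrightarrow> 0 \<le> a i" "\<And>i. i \<in> A \<Longrightarrow> a i \<le> 1"
  shows "(\<Prod>i\<in>A. 1 - a i) \<le> 1 / (1 + (\<Sum>i\<in>A. a i))"
proof (cases "finite A")
  case True
  have s: "0 \<le> (\<Sum>i\<in>A. a i)" using assms by (intro sum_nonneg)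
  have "(\<Prod>i\<in>A. 1 - a i) \<le> (\<Prod>i\<in>A. exp (- a i))"
    using assms exp_ge_add_one_self[of "- a i" for i] by (intro prod_mono) auto
  also have "\<dots> = inverse (exp (\<Sum>i\<in>A. a i))"
    using True by (simp add: exp_sum[symmetric] sum_negf exp_minus[symmetric])
  also have "\<dots> \<le> inverse (1 + (\<Sum>i\<in>A. a i))"
    using s by (intro le_imp_inverse_le exp_ge_add_one_self) auto
  finally show ?thesis by (simp add: inverse_eq_divide)
qed simp

lemma maxS_cong: "(\<And>i. i \<in> S \<Longrightarrow> v i = w i) \<Longrightarrow> maxS S v = maxS S w"
  by (simp add: maxS_def cong: image_cong)

lemma (in stable_array) z_le_1:
  assumes "1 \<le> k"
  shows "z k t \<le> 1"
proof -
  interpret real_distribution "\<mu> k" using assms by (rule real_distribution_\<mu>)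
  show ?thesis unfolding z_eq[OF assms] by simp
qed

section \<open>Law and independence of the block maxima\<close>

context stable_system
begin

definition maxlaw :: "nat \<Rightarrow> real measure" where
  "maxlaw n = distr m borel (\<lambda>x. maxS (blk (\<lambda>_. 0) n) (\<lambda>i. F i x))"

lemma finite_blk: "finite (blk d n)"
  by (simp add: blk_def finite_active)

lemma maxS_blk_measurable [measurable]: "(\<lambda>x. maxS (blk d n) (\<lambda>i. F i x)) \<in> borel_measurable m"
  using finite_blk by measurable

lemma blk_subset_adm: "(\<And>k. k \<in> active n \<Longrightarrow> d k < 2 * dk k) \<Longrightarrow> blk d n \<subseteq> adm_index"
  by (auto simp: blk_def adm_index_def active_def)

lemma prob_max_le:
  assumes n: "0 < n" and d: "\<And>k. k \<in> active n \<Longrightarrow> d k < 2 * dk k" and y: "0 \<le> y"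
  shows "prob {x\<in>space m. maxS (blk d n) (\<lambda>i. F i x) \<le> y} = (\<Prod>k\<in>active n. 1 - z k y)"
proof -
  have "prob {x\<in>space m. maxS (blk d n) (\<lambda>i. F i x) \<le> y} = (\<Prod>i\<in>blk d n. 1 - z (fst i) y)"
    using active_nonempty[OF n] by (intro prob_maxS_le finite_blk blk_subset_adm d y) (auto simp: blk_def)
  also have "\<dots> = (\<Prod>k\<in>active n. 1 - z k y)"
    unfolding blk_def by (subst prod.reindex) (auto simp: inj_on_def)
  finally show ?thesis .
qed

lemma real_distribution_distr: "X \<in> borel_measurable m \<Longrightarrow> real_distribution (distr m borel X)"
  using prob_space_distr[of X borel] by (simp add: real_distribution_def real_distribution_axioms_def)

lemma real_distribution_maxlaw: "real_distribution (maxlaw n)"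
  unfolding maxlaw_def by (rule real_distribution_distr) simp

lemma maxlaw_neg: "measure (maxlaw n) {..<0} = 0"
proof -
  have "(\<lambda>x. maxS (blk (\<lambda>_. 0) n) (\<lambda>i. F i x)) -` {..<0} \<inter> space m = {}"
    using maxS_nonneg by (force simp: not_less[symmetric])
  then show ?thesis unfolding maxlaw_def by (subst measure_distr) auto
qed

text \<open>By independence the distribution function is a product over the active k that does not
  mention the offset, so one law serves both parts and all times.\<close>

lemma distr_max:
  assumes n: "0 < n" and d: "\<And>k. k \<in> active n \<Longrightarrow> d k < 2 * dk k"
  shows "distr m borel (\<lambda>x. maxS (blk d n) (\<lambda>i. F i x)) = maxlaw n"
proof (rule cdf_unique)
  show "real_distribution (distr m borel (\<lambda>x. maxS (blk d n) (\<lambda>i. F i x)))"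
    by (rule real_distribution_distr) simp
  show "real_distribution (maxlaw n)" by (rule real_distribution_maxlaw)
  have cdf: "cdf (distr m borel (\<lambda>x. maxS (blk e n) (\<lambda>i. F i x))) y = (if 0 \<le> y then \<Prod>k\<in>active n. 1 - z k y else 0)"
    if e: "\<And>k. k \<in> active n \<Longrightarrow> e k < 2 * dk k" for e y
  proof -
    have "cdf (distr m borel (\<lambda>x. maxS (blk e n) (\<lambda>i. F i x))) y = prob {x\<in>space m. maxS (blk e n) (\<lambda>i. F i x) \<le> y}"
      unfolding cdf_def by (subst measure_distr) (auto intro!: arg_cong2[where f=measure])
    moreover have "{x\<in>space m. maxS (blk e n) (\<lambda>i. F i x) \<le> y} = {}" if "\<not> 0 \<le> y"
      using that maxS_nonneg order_trans by blast
    ultimately show ?thesis using prob_max_le[OF n e] by (cases "0 \<le> y") simp_all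
  qed
  show "cdf (distr m borel (\<lambda>x. maxS (blk d n) (\<lambda>i. F i x))) = cdf (maxlaw n)"
    unfolding maxlaw_def by (rule ext) (simp add: cdf[OF d] cdf[of "\<lambda>_. 0"] dk_pos)
qed

lemma maxlaw_tail:
  assumes n: "0 < n" and t: "0 \<le> t"
  shows "measure (maxlaw n) {t<..} = 1 - (\<Prod>k\<in>active n. 1 - z k t)"
proof -
  have "cdf (maxlaw n) t = measure m {x\<in>space m. maxS (blk (\<lambda>_. 0) n) (\<lambda>i. F i x) \<le> t}"
    unfolding cdf_def maxlaw_def by (subst measure_distr) (auto intro!: arg_cong2[where f=measure])
  then show ?thesis using prob_max_le[OF n _ t, of "\<lambda>_. 0"]
    by (simp add: real_distribution.tail_eq_cdf[OF real_distribution_maxlaw] dk_pos)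
qed

lemma active_pos: "k \<in> active n \<Longrightarrow> 1 \<le> k"
  by (simp add: active_def)

lemma maxlaw_tail_le:
  assumes n: "0 < n" and t: "0 \<le> t"
  shows "measure (maxlaw n) {t<..} \<le> (\<Sum>k\<in>active n. z k t)"
proof -
  have "1 - (\<Sum>k\<in>active n. z k t) \<le> (\<Prod>k\<in>active n. 1 - z k t)"
    by (intro prod_one_minus_ge finite_active z_nonneg z_le_1 active_pos)
  then show ?thesis unfolding maxlaw_tail[OF assms] by linarith
qed

lemma maxlaw_bound:
  assumes n: "0 < n" and x: "0 < x"
  shows "real n * measure (maxlaw n) {real n powr (1/\<alpha>) * x<..} \<le> H * x powr (-\<alpha>)"
proof -
  let ?t = "real n powr (1/\<alpha>) * x"
  have t: "0 < ?t" using n x by simp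
  have "measure (maxlaw n) {?t<..} \<le> H * ?t powr (-\<alpha>)"
    using maxlaw_tail_le[OF n less_imp_le[OF t]] by (rule order_trans) (intro sum_z_le finite_active active_pos t)
  also have "?t powr (-\<alpha>) = x powr (-\<alpha>) / real n"
    using n x \<alpha> by (simp add: powr_mult powr_powr powr_minus_divide)
  finally show ?thesis using n by (simp add: field_simps)
qed

text \<open>Since n S(n) converges, S(n) tends to 0, so the bounds S/(1 + S) and S of the tail have
  the same limit after multiplication by n.\<close>

lemma maxlaw_limit:
  assumes x: "0 < x"
  shows "(\<lambda>n. real n * measure (maxlaw n) {real n powr (1/\<alpha>) * x<..}) \<longlonglongrightarrow> c * ln 2 * x powr (-\<alpha>)"
proof -
  define S where "S n = (\<Sum>k\<in>active n. z k (real n powr (1/\<alpha>) * x))" for n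
  have lim: "(\<lambda>n. real n * S n) \<longlonglongrightarrow> c * ln 2 * x powr (-\<alpha>)" unfolding S_def by (rule array_limit[OF x])
  have "(\<lambda>n. (real n * S n) * (1 / real n)) \<longlonglongrightarrow> (c * ln 2 * x powr (-\<alpha>)) * 0"
    by (intro tendsto_mult lim lim_1_over_n)
  moreover have "eventually (\<lambda>n. (real n * S n) * (1 / real n) = S n) sequentially"
    using eventually_gt_at_top[of 0] by eventually_elim simp
  ultimately have "S \<longlonglongrightarrow> 0" by (simp add: tendsto_cong)
  then have "(\<lambda>n. real n * S n / (1 + S n)) \<longlonglongrightarrow> c * ln 2 * x powr (-\<alpha>) / (1 + 0)"
    by (intro tendsto_divide lim tendsto_add tendsto_const) auto
  then have low: "(\<lambda>n. real n * S n / (1 + S n)) \<longlonglongrightarrow> c * ln 2 * x powr (-\<alpha>)" by simp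
  show ?thesis
  proof (rule tendsto_sandwich[OF _ _ low lim])
    show "eventually (\<lambda>n. real n * measure (maxlaw n) {real n powr (1/\<alpha>) * x<..} \<le> real n * S n) sequentially"
      using eventually_gt_at_top[of 0] by eventually_elim (use x in \<open>auto simp: S_def intro!: mult_left_mono maxlaw_tail_le\<close>)
    show "eventually (\<lambda>n. real n * S n / (1 + S n) \<le> real n * measure (maxlaw n) {real n powr (1/\<alpha>) * x<..}) sequentially"
      using eventually_gt_at_top[of 0]
    proof eventually_elim
      case (elim n)
      have S0: "0 \<le> S n" unfolding S_def by (intro sum_nonneg z_nonneg)
      have "(\<Prod>k\<in>active n. 1 - z k (real n powr (1/\<alpha>) * x)) \<le> 1 / (1 + S n)"
        unfolding S_def by (intro prod_one_minus_le z_nonneg z_le_1 active_pos)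
      moreover have "1 - 1 / (1 + S n) = S n / (1 + S n)" using S0 by (simp add: field_simps)
      ultimately have "S n / (1 + S n) \<le> measure (maxlaw n) {real n powr (1/\<alpha>) * x<..}"
        using x by (subst maxlaw_tail[OF elim]) auto
      then have "real n * (S n / (1 + S n)) \<le> real n * measure (maxlaw n) {real n powr (1/\<alpha>) * x<..}"
        by (rule mult_left_mono) simp
      then show ?case by simp
    qed
  qed
qed

lemma maxS_measurable_PiM [measurable]:
  assumes "finite S" "S \<subseteq> K"
  shows "maxS S \<in> borel_measurable (PiM K (\<lambda>_. borel))"
  by (rule maxS_measurable[of S "\<lambda>v. v"]) (use assms in \<open>auto intro!: measurable_component_singleton\<close>)

text \<open>The approximation of the increment at time j: the positive part uses f_k at time j, the
  negative part g_k, that is f_k at time j + d_k. The coefficients already include the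
  normalisation.\<close>

definition blockmax :: "real \<Rightarrow> real \<Rightarrow> nat \<Rightarrow> nat \<Rightarrow> 'a \<Rightarrow> real" where
  "blockmax A D n j x = A * maxS (blk (\<lambda>_. j) n) (\<lambda>i. F i x) - D * maxS (blk (\<lambda>k. j + dk k) n) (\<lambda>i. F i x)"

lemma blockmax_measurable [measurable]: "blockmax A D n j \<in> borel_measurable m"
  unfolding blockmax_def[abs_def] by measurable

lemma blk_adm:
  assumes "j < n"
  shows "blk (\<lambda>_. j) n \<subseteq> adm_index" "blk (\<lambda>k. j + dk k) n \<subseteq> adm_index"
  using assms by (auto intro!: blk_subset_adm simp: active_def)

lemma blockmax_law:
  assumes j: "j < n"
  shows "distr m borel (blockmax A D n j) = pair_law A D (maxlaw n)"
proof -
  have n: "0 < n" using j by simp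
  let ?S = "blk (\<lambda>_. j) n" and ?S' = "blk (\<lambda>k. j + dk k) n"
  \<comment> \<open>For a common k the times j and j + dk k differ because dk k is positive.\<close>
  have disj: "?S \<inter> ?S' = {}" by (auto simp: blk_def dk_def)
  have "indep_var borel (maxS ?S \<circ> (\<lambda>\<omega>. \<lambda>i\<in>?S. F i \<omega>)) borel (maxS ?S' \<circ> (\<lambda>\<omega>. \<lambda>i\<in>?S'. F i \<omega>))"
    by (rule indep_var_compose[OF indep_var_restrict[OF F_indep disj blk_adm[OF j]]])
      (auto intro!: maxS_measurable_PiM finite_blk)
  moreover have "maxS S \<circ> (\<lambda>\<omega>. \<lambda>i\<in>S. F i \<omega>) = (\<lambda>x. maxS S (\<lambda>i. F i x))" for S
    by (auto simp: fun_eq_iff intro!: maxS_cong)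
  ultimately have "indep_var borel (\<lambda>x. maxS ?S (\<lambda>i. F i x)) borel (\<lambda>x. maxS ?S' (\<lambda>i. F i x))" by simp
  then show ?thesis
    unfolding blockmax_def[abs_def] using j
    by (intro distr_pair_law distr_max[OF n]) (auto simp: active_def)
qed

text \<open>An active k satisfies n \<le> dk k, so the indices (k, j) and (k, j + dk k) with j < n are all distinct.\<close>
lemma blockmax_indep: "indep_vars (\<lambda>_. borel) (blockmax A D n) {..<n}"
proof -
  define K where "K j = blk (\<lambda>_. j) n \<union> blk (\<lambda>k. j + dk k) n" for j
  have K: "K j \<subseteq> adm_index" if "j \<in> {..<n}" for j using blk_adm[of j n] that by (auto simp: K_def)
  have disj: "disjoint_family_on K {..<n}"
    by (auto simp: disjoint_family_on_def K_def blk_def active_def)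
  have "indep_vars (\<lambda>_. borel) (\<lambda>j x. (\<lambda>v. A * maxS (blk (\<lambda>_. j) n) v - D * maxS (blk (\<lambda>k. j + dk k) n) v) (\<lambda>i\<in>K j. F i x)) {..<n}"
  proof (rule indep_vars_compose2[OF indep_vars_restrict[OF F_indep K disj]])
    fix j
    have [measurable]: "maxS (blk (\<lambda>_. j) n) \<in> borel_measurable (PiM (K j) (\<lambda>_. borel))"
      "maxS (blk (\<lambda>k. j + dk k) n) \<in> borel_measurable (PiM (K j) (\<lambda>_. borel))"
      by (auto intro!: maxS_measurable_PiM finite_blk simp: K_def)
    show "(\<lambda>v. A * maxS (blk (\<lambda>_. j) n) v - D * maxS (blk (\<lambda>k. j + dk k) n) v) \<in> borel_measurable (PiM (K j) (\<lambda>_. borel))"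
      by measurable
  qed
  moreover have "(\<lambda>j x. (\<lambda>v. A * maxS (blk (\<lambda>_. j) n) v - D * maxS (blk (\<lambda>k. j + dk k) n) v) (\<lambda>i\<in>K j. F i x)) = blockmax A D n"
  proof (intro ext)
    fix j x
    have "maxS (blk (\<lambda>_. j) n) (\<lambda>i\<in>K j. F i x) = maxS (blk (\<lambda>_. j) n) (\<lambda>i. F i x)"
      "maxS (blk (\<lambda>k. j + dk k) n) (\<lambda>i\<in>K j. F i x) = maxS (blk (\<lambda>k. j + dk k) n) (\<lambda>i. F i x)"
      by (auto intro!: maxS_cong simp: K_def)
    then show "(\<lambda>v. A * maxS (blk (\<lambda>_. j) n) v - D * maxS (blk (\<lambda>k. j + dk k) n) v) (\<lambda>i\<in>K j. F i x) = blockmax A D n j x"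
      by (simp only: blockmax_def)
  qed
  ultimately show ?thesis by simp
qed

end

section \<open>Common uniform variables for the two quantile representations\<close>

lemma stable_law_unique: "stable_law M \<alpha> \<sigma> \<beta> \<mu> \<Longrightarrow> stable_law M' \<alpha> \<sigma> \<beta> \<mu> \<Longrightarrow> M = M'"
  by (rule Levy_uniqueness) (auto simp: stable_law_def fun_eq_iff)

lemma quantile_pair_law:
  assumes \<rho>: "real_distribution \<rho>" "measure \<rho> {..<0} = 0"
  shows "distr (unif01 \<Otimes>\<^sub>M unif01) borel (\<lambda>p. A * upper_quantile \<rho> (fst p) - D * upper_quantile \<rho> (snd p)) = pair_law A D \<rho>"
proof -
  interpret real_distribution \<rho> by fact
  interpret U: prob_space unif01 by (rule prob_space_unif01)
  have d: "distr unif01 borel (upper_quantile \<rho>) = \<rho>" using \<rho>(2) by (rule distr_upper_quantile)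
  interpret U': prob_space "distr unif01 borel (upper_quantile \<rho>)" by (rule U.prob_space_distr) simp
  have "\<rho> \<Otimes>\<^sub>M \<rho> = distr unif01 borel (upper_quantile \<rho>) \<Otimes>\<^sub>M distr unif01 borel (upper_quantile \<rho>)" by (simp only: d)
  also have "\<dots> = distr (unif01 \<Otimes>\<^sub>M unif01) (borel \<Otimes>\<^sub>M borel) (\<lambda>(x, y). (upper_quantile \<rho> x, upper_quantile \<rho> y))"
    by (rule pair_measure_distr) (auto intro: U'.sigma_finite_measure_axioms)
  finally show ?thesis unfolding pair_law_def
    by (simp only:) (subst distr_distr, auto simp: comp_def split_beta)
qed

text \<open>The common source of randomness: one pair of uniform variables per block, one for each
  sign. Driving the maxima and the stable variables by the same pairs puts both on one space, where
  they can be compared.\<close>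

definition uniform_pairs :: "(nat \<Rightarrow> real \<times> real) measure" where
  "uniform_pairs = PiM UNIV (\<lambda>_. unif01 \<Otimes>\<^sub>M unif01)"

lemma prob_space_uniform_pair: "prob_space (unif01 \<Otimes>\<^sub>M unif01)"
  by (intro prob_space_pair prob_space_unif01)

lemma prob_space_uniform_pairs: "prob_space uniform_pairs"
  unfolding uniform_pairs_def by (intro prob_space_PiM prob_space_uniform_pair)

lemma uniform_pairs_component [measurable]: "(\<lambda>u. u j) \<in> uniform_pairs \<rightarrow>\<^sub>M unif01 \<Otimes>\<^sub>M unif01"
  unfolding uniform_pairs_def by measurable

lemma distr_uniform_pairs: "distr uniform_pairs (unif01 \<Otimes>\<^sub>M unif01) (\<lambda>u. u j) = unif01 \<Otimes>\<^sub>M unif01"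
  unfolding uniform_pairs_def
  by (rule nn_integral_PiM_component(2)[where f="\<lambda>_. 0"]) (auto intro: prob_space_uniform_pair)

lemma uniform_pairs_integral:
  fixes G :: "real \<Rightarrow> real"
  assumes [measurable]: "G \<in> borel_measurable borel"
  shows "(\<integral>u. G (fst (u j)) \<partial>uniform_pairs) = (\<integral>u. G u \<partial>unif01)"
    and "(\<integral>u. G (snd (u j)) \<partial>uniform_pairs) = (\<integral>u. G u \<partial>unif01)"
proof -
  interpret U: prob_space unif01 by (rule prob_space_unif01)
  interpret P: pair_prob_space unif01 unif01 ..
  have pr: "distr uniform_pairs unif01 (\<lambda>u. g (u j)) = distr (unif01 \<Otimes>\<^sub>M unif01) unif01 g"
    if [measurable]: "g \<in> unif01 \<Otimes>\<^sub>M unif01 \<rightarrow>\<^sub>M unif01" for g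
  proof -
    have "distr (unif01 \<Otimes>\<^sub>M unif01) unif01 g = distr (distr uniform_pairs (unif01 \<Otimes>\<^sub>M unif01) (\<lambda>u. u j)) unif01 g"
      by (simp only: distr_uniform_pairs)
    then show ?thesis by (subst (asm) distr_distr) (auto simp: comp_def)
  qed
  have 1: "distr (unif01 \<Otimes>\<^sub>M unif01) unif01 fst = unif01"
    by (rule U.distr_pair_fst)
  have 2: "distr (unif01 \<Otimes>\<^sub>M unif01) unif01 snd = unif01"
  proof -
    have "distr (unif01 \<Otimes>\<^sub>M unif01) unif01 snd = distr (distr (unif01 \<Otimes>\<^sub>M unif01) (unif01 \<Otimes>\<^sub>M unif01) (\<lambda>(x, y). (y, x))) unif01 snd"
      using P.distr_pair_swap by simp
    also have "\<dots> = distr (unif01 \<Otimes>\<^sub>M unif01) unif01 fst"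
      by (subst distr_distr) (auto simp: comp_def split_beta)
    finally show ?thesis by (simp only: 1)
  qed
  have "(\<integral>u. G u \<partial>unif01) = (\<integral>u. G u \<partial>distr uniform_pairs unif01 (\<lambda>u. fst (u j)))"
    by (simp only: pr[OF measurable_fst] 1)
  also have "\<dots> = (\<integral>u. G (fst (u j)) \<partial>uniform_pairs)"
    by (rule integral_distr) (auto intro: measurable_compose[OF uniform_pairs_component])
  finally show "(\<integral>u. G (fst (u j)) \<partial>uniform_pairs) = (\<integral>u. G u \<partial>unif01)" ..
  have "(\<integral>u. G u \<partial>unif01) = (\<integral>u. G u \<partial>distr uniform_pairs unif01 (\<lambda>u. snd (u j)))"
    by (simp only: pr[OF measurable_snd] 2)
  also have "\<dots> = (\<integral>u. G (snd (u j)) \<partial>uniform_pairs)"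
    by (rule integral_distr) (auto intro: measurable_compose[OF uniform_pairs_component])
  finally show "(\<integral>u. G (snd (u j)) \<partial>uniform_pairs) = (\<integral>u. G u \<partial>unif01)" ..
qed

definition quantile_noise :: "real measure \<Rightarrow> real \<Rightarrow> real \<Rightarrow> nat \<Rightarrow> (nat \<Rightarrow> real \<times> real) \<Rightarrow> real" where
  "quantile_noise \<rho> A D j u = A * upper_quantile \<rho> (fst (u j)) - D * upper_quantile \<rho> (snd (u j))"

context
  fixes \<rho> assumes \<rho>: "real_distribution \<rho>" and neg: "measure \<rho> {..<0} = 0"
begin

lemma quantile_pair_measurable:
  "(\<lambda>p. A * upper_quantile \<rho> (fst p) - D * upper_quantile \<rho> (snd p)) \<in> borel_measurable (unif01 \<Otimes>\<^sub>M unif01)"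
proof -
  note real_distribution.upper_quantile_measurable[OF \<rho>, measurable]
  have [measurable]: "upper_quantile \<rho> \<in> borel_measurable unif01" by measurable
  show ?thesis by measurable
qed

lemma quantile_noise_measurable: "quantile_noise \<rho> A D j \<in> borel_measurable uniform_pairs"
  unfolding quantile_noise_def by (rule measurable_compose[OF uniform_pairs_component quantile_pair_measurable])

lemma quantile_noise_law: "distr uniform_pairs borel (quantile_noise \<rho> A D j) = pair_law A D \<rho>"
proof -
  have "pair_law A D \<rho> = distr (distr uniform_pairs (unif01 \<Otimes>\<^sub>M unif01) (\<lambda>u. u j)) borel (\<lambda>p. A * upper_quantile \<rho> (fst p) - D * upper_quantile \<rho> (snd p))"
    unfolding distr_uniform_pairs using quantile_pair_law[OF \<rho> neg] by simp
  also have "\<dots> = distr uniform_pairs borel (quantile_noise \<rho> A D j)"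
    by (subst distr_distr) (auto simp: comp_def quantile_noise_def[abs_def] intro: quantile_pair_measurable)
  finally show ?thesis ..
qed

lemma quantile_noise_indep: "prob_space.indep_vars uniform_pairs (\<lambda>_. borel) (quantile_noise \<rho> A D) J"
proof -
  interpret prob_space uniform_pairs by (rule prob_space_uniform_pairs)
  have "indep_vars (\<lambda>_. unif01 \<Otimes>\<^sub>M unif01) (\<lambda>j u. u j) UNIV"
    unfolding uniform_pairs_def by (rule product_coordinates_indep) (rule prob_space_uniform_pair)
  then have "indep_vars (\<lambda>_. borel) (\<lambda>j u. (\<lambda>p. A * upper_quantile \<rho> (fst p) - D * upper_quantile \<rho> (snd p)) (u j)) UNIV"
    by (rule indep_vars_compose2) (rule quantile_pair_measurable)
  then have "indep_vars (\<lambda>_. borel) (quantile_noise \<rho> A D) UNIV" by (simp add: quantile_noise_def[abs_def])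
  then show ?thesis by (rule indep_vars_subset) simp
qed

end

text \<open>Truncation at 1 is subadditive, and weights in [0,1] only shrink the differences; so the
  two signs can be estimated separately.\<close>

lemma min_1_diff_le:
  fixes a b N x y x' y' :: real
  assumes "0 \<le> a" "a \<le> 1" "0 \<le> b" "b \<le> 1" "0 < N"
  shows "min 1 \<bar>(a / N * x - b / N * y) - (a / N * x' - b / N * y')\<bar> \<le> min 1 (\<bar>x - x'\<bar> / N) + min 1 (\<bar>y - y'\<bar> / N)"
proof -
  have "(a / N * x - b / N * y) - (a / N * x' - b / N * y') = a * ((x - x') / N) - b * ((y - y') / N)"
    using assms(5) by (simp add: field_simps)
  also have "\<bar>\<dots>\<bar> \<le> \<bar>a * ((x - x') / N)\<bar> + \<bar>b * ((y - y') / N)\<bar>" by (rule abs_triangle_ineq4)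
  also have "\<dots> = a * (\<bar>x - x'\<bar> / N) + b * (\<bar>y - y'\<bar> / N)" using assms by (simp add: abs_mult)
  also have "\<dots> \<le> 1 * (\<bar>x - x'\<bar> / N) + 1 * (\<bar>y - y'\<bar> / N)"
    using assms by (intro add_mono mult_right_mono) auto
  finally have "\<bar>(a / N * x - b / N * y) - (a / N * x' - b / N * y')\<bar> \<le> \<bar>x - x'\<bar> / N + \<bar>y - y'\<bar> / N" by simp
  moreover have "0 \<le> \<bar>x - x'\<bar> / N" "0 \<le> \<bar>y - y'\<bar> / N" using assms by auto
  ultimately show ?thesis by linarith
qed

lemma quantile_noise_diff_le:
  assumes ab: "0 \<le> a" "a \<le> 1" "0 \<le> b" "b \<le> 1" and N: "0 < N"
    and \<rho>: "real_distribution \<rho>" "real_distribution \<rho>'"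
  shows "(\<integral>u. min 1 \<bar>quantile_noise \<rho> (a / N) (b / N) j u - quantile_noise \<rho>' (a / N) (b / N) j u\<bar> \<partial>uniform_pairs) \<le>
    2 * (\<integral>u. min 1 (\<bar>upper_quantile \<rho> u - upper_quantile \<rho>' u\<bar> / N) \<partial>unif01)"
proof -
  interpret prob_space uniform_pairs by (rule prob_space_uniform_pairs)
  note real_distribution.upper_quantile_measurable[OF \<rho>(1), measurable] real_distribution.upper_quantile_measurable[OF \<rho>(2), measurable]
  have [measurable]: "(\<lambda>u. fst (u j)) \<in> borel_measurable uniform_pairs" "(\<lambda>u. snd (u j)) \<in> borel_measurable uniform_pairs"
    using measurable_compose[OF uniform_pairs_component measurable_fst] measurable_compose[OF uniform_pairs_component measurable_snd]
    by (simp_all cong: measurable_cong_sets)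
  let ?G = "\<lambda>u. min 1 (\<bar>upper_quantile \<rho> u - upper_quantile \<rho>' u\<bar> / N)"
  have G [measurable]: "?G \<in> borel_measurable borel" by measurable
  have i1: "integrable uniform_pairs (\<lambda>u. ?G (fst (u j)))" "integrable uniform_pairs (\<lambda>u. ?G (snd (u j)))"
    by (rule integrable_const_bound[where B=1]; use N in auto)+
  have "(\<integral>u. min 1 \<bar>quantile_noise \<rho> (a / N) (b / N) j u - quantile_noise \<rho>' (a / N) (b / N) j u\<bar> \<partial>uniform_pairs) \<le>
      (\<integral>u. ?G (fst (u j)) + ?G (snd (u j)) \<partial>uniform_pairs)"
  proof (rule integral_mono)
    show "integrable uniform_pairs (\<lambda>u. min 1 \<bar>quantile_noise \<rho> (a / N) (b / N) j u - quantile_noise \<rho>' (a / N) (b / N) j u\<bar>)"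
      unfolding quantile_noise_def by (rule integrable_const_bound[where B=1]) auto
    show "integrable uniform_pairs (\<lambda>u. ?G (fst (u j)) + ?G (snd (u j)))"
      by (intro Bochner_Integration.integrable_add i1)
    show "min 1 \<bar>quantile_noise \<rho> (a / N) (b / N) j u - quantile_noise \<rho>' (a / N) (b / N) j u\<bar> \<le> ?G (fst (u j)) + ?G (snd (u j))" for u
      unfolding quantile_noise_def by (rule min_1_diff_le[OF ab N])
  qed
  also have "\<dots> = (\<integral>u. ?G (fst (u j)) \<partial>uniform_pairs) + (\<integral>u. ?G (snd (u j)) \<partial>uniform_pairs)"
    by (intro Bochner_Integration.integral_add i1)
  also have "\<dots> = 2 * (\<integral>u. ?G u \<partial>unif01)" unfolding uniform_pairs_integral[OF G] by simp
  finally show ?thesis .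
qed

context stable_system
begin

text \<open>Invariance of m under T moves the comparison from time j to time 0, so every block has
  the same error bound: one comparison of sum and maximum for each sign.\<close>

lemma blockmax_diff_le:
  assumes ab: "0 \<le> a" "a \<le> 1" "0 \<le> b" "b \<le> 1" and n: "0 < n"
  defines "h \<equiv> \<lambda>x. a * (\<Sum>k. f (Suc k) x) - b * (\<Sum>k. f (Suc k) ((T ^^ dk (Suc k)) x))"
  defines "N \<equiv> real n powr (1/\<alpha>)"
  shows "(\<integral>x. min 1 \<bar>h ((T ^^ j) x) / N - blockmax (a / N) (b / N) n j x\<bar> \<partial>m) \<le>
    (\<integral>x. min 1 (\<bar>(\<Sum>k. F (Suc k, 0) x) - maxS (blk (\<lambda>_. 0) n) (\<lambda>i. F i x)\<bar> / N) \<partial>m) +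
    (\<integral>x. min 1 (\<bar>(\<Sum>k. F (Suc k, dk (Suc k)) x) - maxS (blk dk n) (\<lambda>i. F i x)\<bar> / N) \<partial>m)"
proof -
  have N: "0 < N" using n by (simp add: N_def)
  let ?g = "\<lambda>d x. min 1 (\<bar>(\<Sum>k. F (Suc k, d (Suc k)) x) - maxS (blk d n) (\<lambda>i. F i x)\<bar> / N)"
  have g [measurable]: "?g d \<in> borel_measurable m" for d by measurable
  have [measurable]: "h \<in> borel_measurable m" unfolding h_def by measurable
  have shift: "maxS (blk (\<lambda>k. j + d k) n) (\<lambda>i. F i x) = maxS (blk d n) (\<lambda>i. F i ((T ^^ j) x))" for d x
    unfolding blk_def maxS_reindex
    by (auto intro!: maxS_cong simp: F_def funpow_add add.commute[of j])
  have i: "integrable m (\<lambda>x. ?g d ((T ^^ j) x))" for d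
    by (rule integrable_const_bound[where B=1]) (use N in auto)
  have "(\<integral>x. min 1 \<bar>h ((T ^^ j) x) / N - blockmax (a / N) (b / N) n j x\<bar> \<partial>m) \<le>
      (\<integral>x. ?g (\<lambda>_. 0) ((T ^^ j) x) + ?g dk ((T ^^ j) x) \<partial>m)"
  proof (rule integral_mono)
    show "integrable m (\<lambda>x. min 1 \<bar>h ((T ^^ j) x) / N - blockmax (a / N) (b / N) n j x\<bar>)"
      by (rule integrable_const_bound[where B=1]) auto
    show "integrable m (\<lambda>x. ?g (\<lambda>_. 0) ((T ^^ j) x) + ?g dk ((T ^^ j) x))"
      by (intro Bochner_Integration.integrable_add i)
    fix x
    have h: "h y / N = a / N * (\<Sum>k. F (Suc k, 0) y) - b / N * (\<Sum>k. F (Suc k, dk (Suc k)) y)" for y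
      by (simp add: h_def F_def diff_divide_distrib)
    show "min 1 \<bar>h ((T ^^ j) x) / N - blockmax (a / N) (b / N) n j x\<bar> \<le> ?g (\<lambda>_. 0) ((T ^^ j) x) + ?g dk ((T ^^ j) x)"
      unfolding h blockmax_def shift[of dk] shift[of "\<lambda>_. 0", unfolded add_0_right] by (rule min_1_diff_le[OF ab N])
  qed
  also have "\<dots> = (\<integral>x. ?g (\<lambda>_. 0) ((T ^^ j) x) \<partial>m) + (\<integral>x. ?g dk ((T ^^ j) x) \<partial>m)"
    by (intro Bochner_Integration.integral_add i)
  also have "\<dots> = (\<integral>x. ?g (\<lambda>_. 0) x \<partial>m) + (\<integral>x. ?g dk x \<partial>m)"
    using integral_T_pow[OF g[of "\<lambda>_. 0"], of j] integral_T_pow[OF g[of dk], of j] by simp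
  finally show ?thesis .
qed

end

context stable_system
begin

text \<open>The increments of the Birkhoff sums are replaced by independent block maxima, these are coupled
  with stable variables through their quantiles, and the result has the law of the increments of W.\<close>
lemma Lipschitz_expectation_difference:
  assumes \<beta>: "-1 \<le> \<beta>" "\<beta> \<le> 1" and W: "stable_levy_motion Q W \<alpha> (ln 2 powr (1/\<alpha>)) \<beta>"
    and G: "J1_Lip G B L"
  defines "h \<equiv> \<lambda>x. ((1 + \<beta>) / 2) powr (1/\<alpha>) * (\<Sum>k. f (Suc k) x)
    - ((1 - \<beta>) / 2) powr (1/\<alpha>) * (\<Sum>k. f (Suc k) ((T ^^ dk (Suc k)) x))"
  shows "(\<lambda>n. (\<integral>x. G (step_path n (\<lambda>j. real n powr (-1/\<alpha>) * h ((T ^^ j) x))) \<partial>m) -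
    (\<integral>\<omega>. G (step_path n (grid_increments n (\<lambda>t. W t \<omega>))) \<partial>Q)) \<longlonglongrightarrow> 0"
proof -
  define a where "a = ((1 + \<beta>) / 2) powr (1/\<alpha>)"
  define b where "b = ((1 - \<beta>) / 2) powr (1/\<alpha>)"
  have ab: "0 \<le> a" "a \<le> 1" "0 \<le> b" "b \<le> 1"
    using \<alpha> \<beta> by (auto simp: a_def b_def intro!: powr_le1)
  define N where "N n = real n powr (1/\<alpha>)" for n
  have N: "0 < N n" if "0 < n" for n using that by (simp add: N_def)
  define \<sigma> where "\<sigma> = ln 2 powr (1/\<alpha>)"
  have \<sigma>: "0 < \<sigma>" "\<sigma> powr \<alpha> = ln 2" using \<alpha> by (auto simp: \<sigma>_def powr_powr)
  \<comment> \<open>The totally asymmetric law \<rho> of scale (ln 2)^(1/\<alpha>) is realised as an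
    increment over [0,1] of a Levy motion with skewness 1, whose existence is already known.\<close>
  obtain Q1 :: "(real \<Rightarrow> real) measure" and W1 where W1: "stable_levy_motion Q1 W1 \<alpha> \<sigma> 1"
    using ex_stable_levy_motion[OF \<alpha> \<sigma>(1), of 1] by auto
  define \<rho> where "\<rho> = distr Q1 borel (\<lambda>\<omega>. W1 1 \<omega> - W1 0 \<omega>)"
  have \<rho>: "stable_law \<rho> \<alpha> \<sigma> 1 0" using W1 unfolding stable_levy_motion_def \<rho>_def
    by (elim conjE allE[of _ 0] allE[of _ 1]) simp
  then have rd: "real_distribution \<rho>" by (simp add: stable_law_def)
  note one_sided = stable_law_one_sided[OF \<alpha> \<rho> \<sigma>(1)]
  \<comment> \<open>The scale is determined here: the tail constant of \<rho> has to coincide with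
    the constant c ln 2 of the block maxima.\<close>
  have c_eq: "\<sigma> powr \<alpha> / stable_const \<alpha> = c * ln 2" by (simp add: \<sigma> c_def)
  obtain C' where C': "0 < C'" "\<And>y. 0 < y \<Longrightarrow> measure \<rho> {y<..} \<le> C' * y powr (-\<alpha>)"
    using real_distribution.tail_powr_bound[OF rd \<alpha>(1) one_sided(2)] by auto
  have Npow: "(N n * x) powr (-\<alpha>) = x powr (-\<alpha>) / real n" if "0 < n" "0 < x" for n x
    using that \<alpha> by (simp add: N_def powr_mult powr_powr powr_minus_divide)
  have \<rho>_lim: "(\<lambda>n. real n * measure \<rho> {N n * x<..}) \<longlonglongrightarrow> c * ln 2 * x powr (-\<alpha>)" if x: "0 < x" for x
  proof -
    have "filterlim (\<lambda>n. N n * x) at_top sequentially" unfolding N_def using x \<alpha> by real_asymp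
    then have "(\<lambda>n. (N n * x) powr \<alpha> * measure \<rho> {N n * x<..} * x powr (-\<alpha>)) \<longlonglongrightarrow> c * ln 2 * x powr (-\<alpha>)"
      by (intro tendsto_mult tendsto_const filterlim_compose[OF one_sided(2)[unfolded c_eq]])
    moreover have "eventually (\<lambda>n. (N n * x) powr \<alpha> * measure \<rho> {N n * x<..} * x powr (-\<alpha>) = real n * measure \<rho> {N n * x<..}) sequentially"
      using eventually_gt_at_top[of 0]
      by eventually_elim (use x \<alpha> in \<open>simp add: N_def powr_mult powr_powr powr_minus_divide\<close>)
    ultimately show ?thesis by (simp add: tendsto_cong)
  qed
  have coupling: "(\<lambda>n. real n * (\<integral>u. min 1 (\<bar>upper_quantile (maxlaw n) u - upper_quantile \<rho> u\<bar> / N n) \<partial>unif01)) \<longlonglongrightarrow> 0"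
  proof (rule quantile_coupling[OF \<alpha> real_distribution_maxlaw rd N, where \<kappa>="c * ln 2" and H="max H C'"])
    show "0 < c * ln 2" using c_pos by simp
    show "0 < max H C'" using C' by simp
    show "(\<lambda>n. real n * measure (maxlaw n) {N n * x<..}) \<longlonglongrightarrow> c * ln 2 * x powr (-\<alpha>)" if "0 < x" for x
      unfolding N_def by (rule maxlaw_limit[OF that])
    fix n :: nat and x :: real assume nx: "0 < n" "0 < x"
    have "real n * measure (maxlaw n) {N n * x<..} \<le> H * x powr (-\<alpha>)"
      unfolding N_def by (rule maxlaw_bound[OF nx])
    also have "\<dots> \<le> max H C' * x powr (-\<alpha>)" by (intro mult_right_mono) auto
    finally show "real n * measure (maxlaw n) {N n * x<..} \<le> max H C' * x powr (-\<alpha>)" .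
    have "measure \<rho> {N n * x<..} \<le> C' * (N n * x) powr (-\<alpha>)" using nx N by (intro C') auto
    then have "real n * measure \<rho> {N n * x<..} \<le> real n * (C' * (x powr (-\<alpha>) / real n))"
      unfolding Npow[OF nx] by (intro mult_left_mono) auto
    also have "\<dots> = C' * x powr (-\<alpha>)" using nx by simp
    also have "\<dots> \<le> max H C' * x powr (-\<alpha>)" by (intro mult_right_mono) auto
    finally show "real n * measure \<rho> {N n * x<..} \<le> max H C' * x powr (-\<alpha>)" .
  qed (use \<rho>_lim in auto)
  define E where "E d n = (\<integral>x. min 1 (\<bar>(\<Sum>k. F (Suc k, d (Suc k)) x) - maxS (blk d n) (\<lambda>i. F i x)\<bar> / N n) \<partial>m)" for d n
  define U where "U n = (\<integral>u. min 1 (\<bar>upper_quantile (maxlaw n) u - upper_quantile \<rho> u\<bar> / N n) \<partial>unif01)" for n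
  have E_lim: "(\<lambda>n. real n * E d n) \<longlonglongrightarrow> 0" if d: "\<And>k. 1 \<le> k \<Longrightarrow> d k < 2 * dk k" for d
  proof -
    have eq: "\<phi> d k = F (k, d k)" for k by (rule \<phi>_def) (rule d)
    have "(\<lambda>n. real n * (\<integral>x. min 1 (\<bar>(\<Sum>k. \<phi> d (Suc k) x) - maxS (blk d n) (\<lambda>i. F i x)\<bar> / real n powr (1/\<alpha>)) \<partial>m)) \<longlonglongrightarrow> 0"
      by (rule sum_vs_max_tendsto) (rule d)
    then show ?thesis by (simp only: eq E_def N_def)
  qed
  have lim: "(\<lambda>n. (2 * B + L) * (real n * E (\<lambda>_. 0) n + real n * E dk n + 2 * (real n * U n))) \<longlonglongrightarrow> (2 * B + L) * (0 + 0 + 2 * 0)"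
    unfolding U_def using dk_pos by (intro tendsto_intros E_lim coupling) auto
  have BL: "0 \<le> 2 * B + L"
  proof -
    have "0 \<le> L" "\<bar>G (\<lambda>_. 0)\<bar> \<le> B" using G cadlag_const[of 0] by (auto simp: J1_Lip_def)
    then show ?thesis by linarith
  qed
  have hm [measurable]: "h \<in> borel_measurable m" unfolding h_def by measurable
  note J = prob_space_axioms
  interpret UP: prob_space uniform_pairs by (rule prob_space_uniform_pairs)
  have Q: "prob_space Q" and Wm [measurable]: "\<And>t. W t \<in> borel_measurable Q"
    using W by (auto simp: stable_levy_motion_def)
  have bound: "\<bar>(\<integral>x. G (step_path n (\<lambda>j. real n powr (-1/\<alpha>) * h ((T ^^ j) x))) \<partial>m) -
      (\<integral>\<omega>. G (step_path n (grid_increments n (\<lambda>t. W t \<omega>))) \<partial>Q)\<bar> \<le>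
      (2 * B + L) * (real n * E (\<lambda>_. 0) n + real n * E dk n + 2 * (real n * U n))" if n: "0 < n" for n
  proof -
    \<comment> \<open>Four comparisons lead from the Birkhoff increments to those of W: sum against
      maximum on m, a transfer of equal laws, the quantile coupling on the uniform pairs, and a
      second transfer of equal laws. Only the first and the third cause an error.\<close>
    let ?A = "a / N n" and ?D = "b / N n"
    let ?I1 = "\<integral>x. G (step_path n (\<lambda>j. real n powr (-1/\<alpha>) * h ((T ^^ j) x))) \<partial>m"
    let ?I2 = "\<integral>x. G (step_path n (\<lambda>j. blockmax ?A ?D n j x)) \<partial>m"
    let ?I3 = "\<integral>u. G (step_path n (\<lambda>j. quantile_noise (maxlaw n) ?A ?D j u)) \<partial>uniform_pairs"
    let ?I4 = "\<integral>u. G (step_path n (\<lambda>j. quantile_noise \<rho> ?A ?D j u)) \<partial>uniform_pairs"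
    let ?I5 = "\<integral>\<omega>. G (step_path n (grid_increments n (\<lambda>t. W t \<omega>))) \<partial>Q"
    have Ninv: "real n powr (-1/\<alpha>) * y = y / N n" for y
      by (simp add: N_def powr_minus_divide)
    have "\<bar>?I1 - ?I2\<bar> \<le> (2 * B + L) * (\<Sum>j<n. \<integral>x. min 1 \<bar>real n powr (-1/\<alpha>) * h ((T ^^ j) x) - blockmax ?A ?D n j x\<bar> \<partial>m)"
      by (rule J1_Lip_expectation_diff_le[OF J G]) measurable
    also have "\<dots> \<le> (2 * B + L) * (\<Sum>j<n. E (\<lambda>_. 0) n + E dk n)"
      using BL blockmax_diff_le[OF ab n] unfolding Ninv E_def N_def h_def a_def b_def
      by (intro mult_left_mono sum_mono) auto
    finally have 12: "\<bar>?I1 - ?I2\<bar> \<le> (2 * B + L) * (real n * E (\<lambda>_. 0) n + real n * E dk n)"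
      by (simp add: distrib_left)
    have 23: "?I2 = ?I3"
      by (rule J1_Lip_expectation_eq[OF J UP.prob_space_axioms G])
        (simp_all add: blockmax_indep blockmax_law quantile_noise_measurable[OF real_distribution_maxlaw maxlaw_neg]
          quantile_noise_indep[OF real_distribution_maxlaw maxlaw_neg] quantile_noise_law[OF real_distribution_maxlaw maxlaw_neg])
    have "\<bar>?I3 - ?I4\<bar> \<le> (2 * B + L) * (\<Sum>j<n. \<integral>u. min 1 \<bar>quantile_noise (maxlaw n) ?A ?D j u - quantile_noise \<rho> ?A ?D j u\<bar> \<partial>uniform_pairs)"
      by (intro J1_Lip_expectation_diff_le[OF UP.prob_space_axioms G] quantile_noise_measurable real_distribution_maxlaw maxlaw_neg rd one_sided)
    also have "\<dots> \<le> (2 * B + L) * (\<Sum>j<n. 2 * U n)"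
      unfolding U_def by (intro mult_left_mono BL sum_mono quantile_noise_diff_le[OF ab N[OF n] real_distribution_maxlaw rd])
    finally have 34: "\<bar>?I3 - ?I4\<bar> \<le> (2 * B + L) * (2 * (real n * U n))" by (simp add: ac_simps)
    have 45: "?I4 = ?I5"
    proof (rule J1_Lip_expectation_eq[OF UP.prob_space_axioms Q G])
      show "quantile_noise \<rho> ?A ?D j \<in> borel_measurable uniform_pairs" for j
        by (rule quantile_noise_measurable[OF rd one_sided(1)])
      show "(\<lambda>\<omega>. grid_increments n (\<lambda>t. W t \<omega>) j) \<in> borel_measurable Q" for j
        unfolding grid_increments_def by measurable
      show "UP.indep_vars (\<lambda>_. borel) (quantile_noise \<rho> ?A ?D) {..<n}"
        by (rule quantile_noise_indep[OF rd one_sided(1)])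
      have "0 \<le> real 0 / real n \<and> real n / real n \<le> 1 \<and> (\<forall>i<n. real i / real n < real (Suc i) / real n)"
        using n by (auto simp: divide_strict_right_mono)
      then have "prob_space.indep_vars Q (\<lambda>_. borel) (\<lambda>i \<omega>. W (real (Suc i) / real n) \<omega> - W (real i / real n) \<omega>) {..<n}"
        by (rule W[unfolded stable_levy_motion_def, THEN conjunct2, THEN conjunct2, THEN conjunct2, THEN conjunct1,
              THEN spec, THEN spec, THEN mp, of "\<lambda>i. real i / real n" n])
      then show "prob_space.indep_vars Q (\<lambda>_. borel) (\<lambda>j \<omega>. grid_increments n (\<lambda>t. W t \<omega>) j) {..<n}"
        by (simp add: grid_increments_def add.commute)
      fix j assume j: "j < n"
      \<comment> \<open>Self-similarity: division by n^(1/\<alpha>) gives exactly the scale of an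
        increment of W over a time step 1/n, so this last transfer is free of error.\<close>
      have "stable_law (pair_law (a * (1 / N n)) (b * (1 / N n)) \<rho>) \<alpha> (\<sigma> * (1 / N n)) \<beta> 0"
        unfolding a_def b_def using N[OF n] \<sigma> by (intro stable_pair_law \<alpha> \<beta> \<rho>) auto
      moreover have "stable_law (distr Q borel (\<lambda>\<omega>. W (real (Suc j) / real n) \<omega> - W (real j / real n) \<omega>)) \<alpha>
          (\<sigma> * (real (Suc j) / real n - real j / real n) powr (1/\<alpha>)) \<beta> 0"
      proof -
        have "0 \<le> real j / real n \<and> real j / real n < real (Suc j) / real n \<and> real (Suc j) / real n \<le> 1"
          using j n by (auto simp: divide_strict_right_mono divide_le_eq_1)
        then show ?thesis using W unfolding stable_levy_motion_def \<sigma>_def by blast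
      qed
      moreover have "(real (Suc j) / real n - real j / real n) powr (1/\<alpha>) = 1 / N n"
        using n by (simp add: diff_divide_distrib[symmetric] N_def powr_divide)
      ultimately have "pair_law ?A ?D \<rho> = distr Q borel (\<lambda>\<omega>. W (real (Suc j) / real n) \<omega> - W (real j / real n) \<omega>)"
        by (auto intro: stable_law_unique)
      then show "distr uniform_pairs borel (quantile_noise \<rho> ?A ?D j) = distr Q borel (\<lambda>\<omega>. grid_increments n (\<lambda>t. W t \<omega>) j)"
        by (simp add: quantile_noise_law[OF rd one_sided(1)] grid_increments_def add.commute)
    qed
    show ?thesis using 12 34 unfolding 23 45 by (simp add: distrib_left)
  qed
  show ?thesis
  proof (rule tendsto_rabs_zero_cancel, rule tendsto_sandwich[OF _ _ tendsto_const])
    show "(\<lambda>n. (2 * B + L) * (real n * E (\<lambda>_. 0) n + real n * E dk n + 2 * (real n * U n))) \<longlonglongrightarrow> 0" using lim by simp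
    show "eventually (\<lambda>n. \<bar>(\<integral>x. G (step_path n (\<lambda>j. real n powr (-1/\<alpha>) * h ((T ^^ j) x))) \<partial>m) -
      (\<integral>\<omega>. G (step_path n (grid_increments n (\<lambda>t. W t \<omega>))) \<partial>Q)\<bar> \<le>
      (2 * B + L) * (real n * E (\<lambda>_. 0) n + real n * E dk n + 2 * (real n * U n))) sequentially"
      using eventually_gt_at_top[of 0] by eventually_elim (rule bound)
  qed simp
qed

end

theorem theorem2p4:
  fixes m :: "'a measure" and T :: "'a \<Rightarrow> 'a" and \<alpha> \<beta> :: real
    and f :: "nat \<Rightarrow> 'a \<Rightarrow> real"
  assumes "prob_preserving m T" and "ergodic m T" and "aperiodic m T"
    and "0 < \<alpha>" and "\<alpha> < 1" and "-1 \<le> \<beta>" and "\<beta> \<le> 1"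
    and "admissible m T \<alpha> f"
  shows "converges_to_stable_levy m
           (Wn T \<alpha> (\<lambda>x. ((1 + \<beta>) / 2) powr (1/\<alpha>) * (\<Sum>k. f (Suc k) x)
                       - ((1 - \<beta>) / 2) powr (1/\<alpha>) * (\<Sum>k. f (Suc k) ((T ^^ dk (Suc k)) x))))
           \<alpha> (ln 2 powr (1/\<alpha>)) \<beta>"
proof -
  define h where "h = (\<lambda>x. ((1 + \<beta>) / 2) powr (1/\<alpha>) * (\<Sum>k. f (Suc k) x)
    - ((1 - \<beta>) / 2) powr (1/\<alpha>) * (\<Sum>k. f (Suc k) ((T ^^ dk (Suc k)) x)))"
  obtain \<mu> where "\<forall>k\<ge>1. stable_law (\<mu> k) \<alpha> (real k powr (-1/\<alpha>)) 1 0"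
    and "distr m (PiM adm_index (\<lambda>_. borel)) (\<lambda>x. \<lambda>i\<in>adm_index. f (fst i) ((T ^^ snd i) x))
      = PiM adm_index (\<lambda>i. distr (\<mu> (fst i)) borel (Zmap (fst i)))"
    using assms(8) unfolding admissible_def by blast
  then interpret S: stable_system \<alpha> \<mu> m T f
    using assms by (auto simp: stable_system_def stable_system_axioms_def stable_array_def prob_preserving_def admissible_def)
  obtain Q :: "(real \<Rightarrow> real) measure" and W where W: "stable_levy_motion Q W \<alpha> (ln 2 powr (1/\<alpha>)) \<beta>"
    using ex_stable_levy_motion[OF assms(4,5) _ assms(6,7), of "ln 2 powr (1/\<alpha>)"] by auto
  interpret W: cadlag_process Q W
    using W by (auto simp: cadlag_process_def cadlag_process_axioms_def stable_levy_motion_def)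
  have [measurable]: "h \<in> borel_measurable m" unfolding h_def by measurable
  have "(\<lambda>x j. real n powr (-1/\<alpha>) * h ((T ^^ j) x)) \<in> m \<rightarrow>\<^sub>M borel" for n
    by (rule measurable_coordinatewise_then_product) measurable
  then have "(\<lambda>n. \<integral>x. G (Wn T \<alpha> h n x) \<partial>m) \<longlonglongrightarrow> (\<integral>\<omega>. G (\<lambda>t. W t \<omega>) \<partial>Q)" if "J1_bcont G" for G
    unfolding Wn_eq_step_path
    by (rule W.J1_convergence_Lipschitz[OF S.prob_space_axioms _ _ that])
      (unfold h_def, rule S.Lipschitz_expectation_difference[OF assms(6,7) W])
  then show ?thesis unfolding converges_to_stable_levy_def h_def[symmetric] using W by blast
qed

end
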